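(* If one uses the Borel--Serre complex to define the functor ${}'D_A^{\tilde G}$, then $${}'D_A^{\tilde G}=D_A^{\tilde G}\otimes\epsilon_{\tilde G}$$ (equality meaning canonical functorial isomorphism).
   Context: **Setting.** $F$ is a non-archimedean local field and $\tilde G$ is an affine algebraic $F$-group whose identity component $G$ is reductive (no assumption on the finite component group). $\mathcal R(\tilde G)$ is the category of smooth finite-length complex representations of $\tilde G(F)$ (likewise $\mathcal R(G)$, etc.); $V_\pi$ is the space of $\pi$; $\mathrm{Res}:\mathcal R(\tilde G)\to\mathcal R(G)$ is restriction to $G(F)$. Fix a minimal parabolic pair $(M_0,P_0)$ of $G$ over $F$, let $A_0$ be the maximal split central torus of $M_0$, $S\subset X^*(A_0)$ the set of simple relative roots, $r=|S|$. For $J\subset S$ let $P_J=M_JU_J\supset P_0$ be the standard parabolic whose Lie algebra is the sum of the $A_0$-weight spaces for weights that are integral combinations of $S$ with non-negative coefficients on $S\smallsetminus J$ (so $P_S=G$, $P_\varnothing=P_0$). Let $i_P^G$, $r_P^G$ denote normalized parabolic induction and restriction (Jacquet module). **The categories $\mathcal R_t$.** $\mathcal R_t(G)\subset\mathcal R(G)$ is the full subcategory of those $\pi$ such that every irreducible subquotient of $\pi$ is a subquotient of $i_{P_I}^G(\tau)$ for some $I\subset S$ with $|I|=t$ and some irreducible supercuspidal representation $\tau$ of $M_I(F)$. $\mathcal R_t(\tilde G)$ is the preimage of $\mathcal R_t(G)$ under $\mathrm{Res}$. One has $\mathcal R(\tilde G)=\prod_{t=0}^r\mathcal R_t(\tilde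 G)$. **The functor $D_A^{\tilde G}$.** Let $\tilde N$ be the normalizer of $(M_0,P_0)$ in $\tilde G$. Then $\tilde G(F)=G(F)\tilde N(F)$, $\tilde N(F)\cap G(F)=M_0(F)$, and $\tilde N(F)$ acts on $S$ with $M_0(F)$ acting trivially, so $\tilde G(F)$ acts on $S$ through $\tilde G(F)/G(F)=\tilde N(F)/M_0(F)$. For $\tilde\pi\in\mathcal R(\tilde G)$ and $\pi=\mathrm{Res}(\tilde\pi)$ put $$X_J(\pi)=i_{P_J}^Gr_{P_J}^G\pi=\{f:G(F)\to (V_\pi)_{U_J(F)}\text{ smooth}\mid f(pg)=\pi(p)f(g),\ p\in P_J(F)\},$$ with $G(F)$ acting by right translation; $\Lambda_J=\bigwedge^{|S\smallsetminus J|}\mathbb C^{S\smallsetminus J}$; $Y_J=X_J\otimes_{\mathbb C}\Lambda_J$; $Y_t=\bigoplus_{|J|=t}Y_J$. For $I\subset J$ with $|J|=|I|+1$ let $\varphi^J_I:X_J\to X_I$ be composition with the projection $(V_\pi)_{U_J(F)}\to(V_\pi)_{U_I(F)}$; with $J\smallsetminus I=\{i\}$ let $\psi^J_I:Y_J\to Y_I$ be the tensor product of $\varphi_I^J$ and the map $\Lambda_J\to\Lambda_I$, $\omega\mapsto\omega\wedge e_i$; let $d_t:Y_t\to Y_{t-1}$ be the sum of all $\psi_I^J$ with $I\subset J$, $|J|=t$, $|I|=t-1$. The group $\tilde G(F)$ acts on $Y_t(\pi)$: $g\in G(F)$ acts by right translation on $X_J(\pi)$ and trivially on $\Lambda_J$;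 $n\in\tilde N(F)$, inducing the permutation $a$ of $S$, sends $x\otimes z\in X_J(\pi)\otimes\Lambda_J$ to $X_J(n)(x)\otimes\lambda_J(a)(z)\in X_{aJ}(\pi)\otimes\Lambda_{aJ}$, where $X_J(n)(x)(h)=\tilde\pi(n)x(n^{-1}hn)$ and $\lambda_J(a):\Lambda_J\to\Lambda_{aJ}$ is induced by the bijection $a:S\smallsetminus J\to S\smallsetminus aJ$. This is a well-defined action commuting with the $d_t$, giving functors $Y_t^{\tilde G}$. On $\mathcal R_t(\tilde G)$ define $D_A^{\tilde G}=\mathrm{cok}(d_{t+1}:Y_{t+1}^{\tilde G}\to Y_t^{\tilde G})$ (with $Y_{r+1}=0$), and take the product over $t$. **The functor ${}'D_A^{\tilde G}$ (Borel--Serre complex).** Fix a bijection $S\cong\{1,\dots,r\}$, hence a total order on $S$. For $J=I\cup\{j\}$, $j\notin I$, put $n(I,J)=\#\{i\in J\mid i\le j\}$ and $\epsilon(I,J)=(-1)^{n(I,J)}$. Let $X_t=\bigoplus_{|J|=t}X_J$ and ${}'d_t=\sum\epsilon(I,J)\varphi_I^J:X_t\to X_{t-1}$, summed over $I\subset J$ with $t=|J|=|I|+1$. For a permutation $\sigma$ of $S$ and $I\subset S$ let $\epsilon(\sigma,I)\in\{\pm1\}$ be the sign of the permutation sorting $\sigma|_I$, i.e. $(-1)$ to the number of pairs $i<i'$ in $I$ with $\sigma(i)>\sigma(i')$. Let $\tilde G(F)$ act on $X_t(\pi)$ by letting $G(F)$ act by right translation and letting $n\in\tilde N(F)$, inducing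 the permutation $a$ of $S$, map $X_I(\pi)\to X_{aI}(\pi)$ by $\epsilon(a,I)\cdot X_I(n)$; this action commutes with ${}'d_t$. On $\mathcal R_t(\tilde G)$ put ${}'D_A^{\tilde G}=\mathrm{cok}({}'d_{t+1}:X_{t+1}\to X_t)$ with this action, and take the product over $t$. **The sign character.** $\epsilon_{\tilde G}:\tilde G(F)/G(F)\to\{\pm1\}$ is $\epsilon_{\tilde G}(\tilde g)=\mathrm{sgn}(a|S)$, the sign of the permutation $a$ of $S$ induced by $\tilde g$. *)

theory Defs
  imports
    "HOL-Analysis.Analysis"
    "HOL-Algebra.Module"
    "HOL-Algebra.AbelCoset"
    "HOL-Algebra.Solvable_Groups"
    "HOL-Algebra.Algebraic_Closure_Type"
    "HOL-Combinatorics.Permutations"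
begin

section \<open>Complex vector spaces\<close>

text \<open>
  Complex vector spaces are modules, in the sense of HOL-Algebra, over the following ring; the
  multiplicative fields of the module record carry no meaning.
\<close>

abbreviation CC :: "complex ring" where
  "CC \<equiv> ring_of_type_algebra"

definition linear_map :: "(complex, 'a) module \<Rightarrow> (complex, 'b) module \<Rightarrow> ('a \<Rightarrow> 'b) \<Rightarrow> bool" where
  "linear_map V W f \<longleftrightarrow> f \<in> carrier V \<rightarrow> carrier W \<and>
     (\<forall>x\<in>carrier V. \<forall>y\<in>carrier V. f (x \<oplus>\<^bsub>V\<^esub> y) = f x \<oplus>\<^bsub>W\<^esub> f y) \<and>
     (\<forall>c. \<forall>x\<in>carrier V. f (c \<odot>\<^bsub>V\<^esub> x) = c \<odot>\<^bsub>W\<^esub> f x)"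

definition span_in :: "(complex, 'a) module \<Rightarrow> 'a set \<Rightarrow> 'a set" where
  "span_in V B = \<Inter>{W. submodule W CC V \<and> B \<subseteq> W}"

definition quot :: "(complex, 'a) module \<Rightarrow> 'a set \<Rightarrow> (complex, 'a set) module" where
  "quot V W = \<lparr>carrier = a_rcosets\<^bsub>V\<^esub> W, mult = undefined, one = undefined,
     zero = W, add = set_add V, smult = (\<lambda>c C. \<Union>x\<in>C. W +>\<^bsub>V\<^esub> (c \<odot>\<^bsub>V\<^esub> x))\<rparr>"

text \<open>The map into the quotient of \<open>V\<close> by \<open>W\<close> which a linear map \<open>f\<close> into \<open>V\<close> induces on cosets.\<close>

definition quot_map :: "(complex, 'b) module \<Rightarrow> 'b set \<Rightarrow> ('a \<Rightarrow> 'b) \<Rightarrow> 'a set \<Rightarrow> 'b set" where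
  "quot_map V W f C = (\<Union>x\<in>C. W +>\<^bsub>V\<^esub> f x)"

text \<open>Direct sums; they are only used for finite index sets.\<close>

definition dsum :: "'i set \<Rightarrow> ('i \<Rightarrow> (complex, 'a) module) \<Rightarrow> (complex, 'i \<Rightarrow> 'a) module" where
  "dsum I M = \<lparr>carrier = (\<Pi>\<^sub>E i\<in>I. carrier (M i)), mult = undefined, one = undefined,
     zero = (\<lambda>i\<in>I. \<zero>\<^bsub>M i\<^esub>), add = (\<lambda>x y. \<lambda>i\<in>I. x i \<oplus>\<^bsub>M i\<^esub> y i),
     smult = (\<lambda>c x. \<lambda>i\<in>I. c \<odot>\<^bsub>M i\<^esub> x i)\<rparr>"

definition free :: "'a set \<Rightarrow> (complex, 'a \<Rightarrow> complex) module" where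
  "free A = \<lparr>carrier = {c. finite {a. c a \<noteq> 0} \<and> {a. c a \<noteq> 0} \<subseteq> A}, mult = undefined, one = undefined,
     zero = (\<lambda>_. 0), add = (\<lambda>c d a. c a + d a), smult = (\<lambda>z c a. z * c a)\<rparr>"

definition delta :: "'a \<Rightarrow> 'a \<Rightarrow> complex" where
  "delta a x = (if x = a then 1 else 0)"

text \<open>The linear extension of a map between bases.\<close>

definition push :: "('a \<Rightarrow> 'b) \<Rightarrow> ('a \<Rightarrow> complex) \<Rightarrow> 'b \<Rightarrow> complex" where
  "push h c b = (\<Sum>a | c a \<noteq> 0 \<and> h a = b. c a)"

definition tensor_rel :: "(complex, 'a) module \<Rightarrow> (complex, 'b) module \<Rightarrow> ('a \<times> 'b \<Rightarrow> complex) set" where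
  "tensor_rel V W = span_in (free (carrier V \<times> carrier W))
     ({(\<lambda>p. delta (x \<oplus>\<^bsub>V\<^esub> x', y) p - delta (x, y) p - delta (x', y) p) | x x' y.
         x \<in> carrier V \<and> x' \<in> carrier V \<and> y \<in> carrier W} \<union>
      {(\<lambda>p. delta (x, y \<oplus>\<^bsub>W\<^esub> y') p - delta (x, y) p - delta (x, y') p) | x y y'.
         x \<in> carrier V \<and> y \<in> carrier W \<and> y' \<in> carrier W} \<union>
      {(\<lambda>p. delta (c \<odot>\<^bsub>V\<^esub> x, y) p - c * delta (x, y) p) | c x y.
         x \<in> carrier V \<and> y \<in> carrier W} \<union>
      {(\<lambda>p. delta (x, c \<odot>\<^bsub>W\<^esub> y) p - c * delta (x, y) p) | c x y.
         x \<in> carrier V \<and> y \<in> carrier W})"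

definition tensor :: "(complex, 'a) module \<Rightarrow> (complex, 'b) module \<Rightarrow>
    (complex, ('a \<times> 'b \<Rightarrow> complex) set) module" where
  "tensor V W = quot (free (carrier V \<times> carrier W)) (tensor_rel V W)"

text \<open>The map into \<open>tensor V W\<close> induced by linear maps \<open>f\<close> into \<open>V\<close> and \<open>g\<close> into \<open>W\<close>.\<close>

definition tensor_map :: "(complex, 'a) module \<Rightarrow> (complex, 'b) module \<Rightarrow> ('c \<Rightarrow> 'a) \<Rightarrow> ('d \<Rightarrow> 'b) \<Rightarrow>
    ('c \<times> 'd \<Rightarrow> complex) set \<Rightarrow> ('a \<times> 'b \<Rightarrow> complex) set" where
  "tensor_map V W f g =
     quot_map (free (carrier V \<times> carrier W)) (tensor_rel V W) (push (map_prod f g))"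

text \<open>
  The exterior power of degree \<open>k\<close>: the free vector space on \<open>k\<close>-tuples of vectors modulo
  multilinearity and modulo the tuples with a repeated entry.
\<close>

definition tuples :: "(complex, 'a) module \<Rightarrow> nat \<Rightarrow> 'a list set" where
  "tuples W k = {ws. length ws = k \<and> set ws \<subseteq> carrier W}"

definition ext_rel :: "(complex, 'a) module \<Rightarrow> nat \<Rightarrow> ('a list \<Rightarrow> complex) set" where
  "ext_rel W k = span_in (free (tuples W k))
     ({(\<lambda>p. delta (us @ [w \<oplus>\<^bsub>W\<^esub> w'] @ vs) p - delta (us @ [w] @ vs) p - delta (us @ [w'] @ vs) p) |
         us w w' vs. us @ [w] @ vs \<in> tuples W k \<and> us @ [w'] @ vs \<in> tuples W k} \<union>
      {(\<lambda>p. delta (us @ [c \<odot>\<^bsub>W\<^esub> w] @ vs) p - c * delta (us @ [w] @ vs) p) |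
         us c w vs. us @ [w] @ vs \<in> tuples W k} \<union>
      {delta ws | ws. ws \<in> tuples W k \<and> \<not> distinct ws})"

definition ext_power :: "(complex, 'a) module \<Rightarrow> nat \<Rightarrow> (complex, ('a list \<Rightarrow> complex) set) module" where
  "ext_power W k = quot (free (tuples W k)) (ext_rel W k)"

text \<open>The map into the exterior power of \<open>W\<close> induced by a linear map \<open>f\<close> into \<open>W\<close>.\<close>

definition ext_map :: "(complex, 'b) module \<Rightarrow> nat \<Rightarrow> ('a \<Rightarrow> 'b) \<Rightarrow>
    ('a list \<Rightarrow> complex) set \<Rightarrow> ('b list \<Rightarrow> complex) set" where
  "ext_map W k f = quot_map (free (tuples W k)) (ext_rel W k) (push (map f))"

text \<open>The map \<open>\<omega> \<mapsto> \<omega> \<and> e\<close> from degree \<open>k\<close> (of any subspace of \<open>W\<close>) to degree \<open>k + 1\<close>.\<close>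

definition ext_wedge :: "(complex, 'a) module \<Rightarrow> nat \<Rightarrow> 'a \<Rightarrow>
    ('a list \<Rightarrow> complex) set \<Rightarrow> ('a list \<Rightarrow> complex) set" where
  "ext_wedge W k e = quot_map (free (tuples W (Suc k))) (ext_rel W (Suc k)) (push (\<lambda>ws. ws @ [e]))"


section \<open>Linear algebraic groups over a local field\<close>

text \<open>
  A non-archimedean local field is given by a non-trivial ultrametric absolute value whose metric
  topology is locally compact.
\<close>

definition nonarch_local_field :: "('f::field \<Rightarrow> real) \<Rightarrow> bool" where
  "nonarch_local_field v \<longleftrightarrow>
     (\<forall>x. v x \<ge> 0) \<and> (\<forall>x. v x = 0 \<longleftrightarrow> x = 0) \<and> (\<forall>x y. v (x * y) = v x * v y) \<and>
     (\<forall>x y. v (x + y) \<le> max (v x) (v y)) \<and> (\<exists>x. x \<noteq> 0 \<and> v x \<noteq> 1) \<and>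
     locally_compact_space (Metric_space.mtopology UNIV (\<lambda>x y. v (x - y)))"

definition mat_top :: "('f::field \<Rightarrow> real) \<Rightarrow> ('f ^ 'n ^ 'n) topology" where
  "mat_top v = Metric_space.mtopology UNIV (\<lambda>A B. Max (range (\<lambda>(i, j). v (A $ i $ j - B $ i $ j))))"

definition GL :: "('k::field ^ 'n ^ 'n) monoid" where
  "GL = \<lparr>carrier = {g. invertible g}, mult = (**), one = mat 1\<rparr>"

definition conj_by :: "'k::field ^ 'n ^ 'n \<Rightarrow> 'k ^ 'n ^ 'n \<Rightarrow> 'k ^ 'n ^ 'n" where
  "conj_by g x = g ** x ** matrix_inv g"

inductive_set poly_fun :: "'k::field set \<Rightarrow> ('k ^ 'n ^ 'n \<Rightarrow> 'k) set" for R where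
  const: "c \<in> R \<Longrightarrow> (\<lambda>_. c) \<in> poly_fun R"
| coord: "(\<lambda>x. x $ i $ j) \<in> poly_fun R"
| add: "p \<in> poly_fun R \<Longrightarrow> q \<in> poly_fun R \<Longrightarrow> (\<lambda>x. p x + q x) \<in> poly_fun R"
| mult: "p \<in> poly_fun R \<Longrightarrow> q \<in> poly_fun R \<Longrightarrow> (\<lambda>x. p x * q x) \<in> poly_fun R"

definition reg_fun :: "'k::field set \<Rightarrow> ('k ^ 'n ^ 'n \<Rightarrow> 'k) set" where
  "reg_fun R = {(\<lambda>x. p x / det x ^ k) | p k. p \<in> poly_fun R}"

definition zariski :: "('k::field ^ 'n ^ 'n) topology" where
  "zariski = topology_generated_by {{g. invertible g \<and> p g \<noteq> 0} | p. p \<in> poly_fun UNIV}"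

definition closed_subgroup :: "('k::field ^ 'n ^ 'n) set \<Rightarrow> bool" where
  "closed_subgroup H \<longleftrightarrow> subgroup H GL \<and> closedin zariski H"

text \<open>
  Affine algebraic groups over a field \<open>F\<close> (type \<open>'f\<close>) are represented by their points over the
  algebraic closure, as closed subgroups of a general linear group defined over \<open>F\<close>: the vanishing
  ideal is spanned by polynomials with coefficients in \<open>F\<close>. A group with reductive identity
  component is smooth, so no information is lost.
\<close>

definition base_field :: "'f::field alg_closure set" where
  "base_field = range to_ac"

definition defined_over_base :: "('f::field alg_closure ^ 'n ^ 'n) set \<Rightarrow> bool" where
  "defined_over_base H \<longleftrightarrow>
     (\<forall>p \<in> poly_fun UNIV. (\<forall>h\<in>H. p h = 0) \<longrightarrow>
        (\<exists>Q c. finite Q \<and> Q \<subseteq> {q \<in> poly_fun base_field. \<forall>h\<in>H. q h = 0} \<and>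
               p = (\<lambda>x. \<Sum>q\<in>Q. c q * q x)))"

definition algebraic_group :: "('f::field alg_closure ^ 'n ^ 'n) set \<Rightarrow> bool" where
  "algebraic_group H \<longleftrightarrow> closed_subgroup H \<and> defined_over_base H"

definition rat_pts :: "('f::field alg_closure ^ 'n ^ 'n) set \<Rightarrow> ('f ^ 'n ^ 'n) set" where
  "rat_pts H = {g. map_matrix to_ac g \<in> H}"

definition identity_component :: "('k::field ^ 'n ^ 'n) set \<Rightarrow> ('k ^ 'n ^ 'n) set" where
  "identity_component H = connected_component_of_set (subtopology zariski H) (mat 1)"

definition normal_in :: "('k::field ^ 'n ^ 'n) set \<Rightarrow> ('k ^ 'n ^ 'n) set \<Rightarrow> bool" where
  "normal_in N H \<longleftrightarrow> N \<lhd> (GL\<lparr>carrier := H\<rparr>)"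

definition connected_solvable :: "('k::field ^ 'n ^ 'n) set \<Rightarrow> bool" where
  "connected_solvable H \<longleftrightarrow>
     closed_subgroup H \<and> connectedin zariski H \<and> solvable (GL\<lparr>carrier := H\<rparr>)"

definition radical :: "('k::field ^ 'n ^ 'n) set \<Rightarrow> ('k ^ 'n ^ 'n) set" where
  "radical H = \<Union>{N. connected_solvable N \<and> normal_in N H}"

definition unipotent :: "'k::field ^ 'n ^ 'n \<Rightarrow> bool" where
  "unipotent g \<longleftrightarrow> (\<exists>k. (((**) (g - mat 1)) ^^ k) (mat 1) = 0)"

definition unip_radical :: "('k::field ^ 'n ^ 'n) set \<Rightarrow> ('k ^ 'n ^ 'n) set" where
  "unip_radical H = {g \<in> radical H. unipotent g}"

definition reductive :: "('k::field ^ 'n ^ 'n) set \<Rightarrow> bool" where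
  "reductive H \<longleftrightarrow> closed_subgroup H \<and> connectedin zariski H \<and> unip_radical H = {mat 1}"

definition borel_subgroup :: "('k::field ^ 'n ^ 'n) set \<Rightarrow> ('k ^ 'n ^ 'n) set \<Rightarrow> bool" where
  "borel_subgroup H B \<longleftrightarrow> connected_solvable B \<and> B \<subseteq> H \<and>
     (\<forall>B'. connected_solvable B' \<and> B \<subseteq> B' \<and> B' \<subseteq> H \<longrightarrow> B' = B)"

text \<open>Parabolic and Levi subgroups are always understood to be defined over the base field.\<close>

definition parabolic :: "('f::field alg_closure ^ 'n ^ 'n) set \<Rightarrow> ('f alg_closure ^ 'n ^ 'n) set \<Rightarrow> bool" where
  "parabolic H P \<longleftrightarrow> algebraic_group P \<and> P \<subseteq> H \<and> (\<exists>B. borel_subgroup H B \<and> B \<subseteq> P)"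

text \<open>
  \<open>P\<close> is the semidirect product of \<open>M\<close> and the unipotent radical as an algebraic group:
  the projection to \<open>M\<close> is required to be a morphism of varieties.
\<close>

definition levi :: "('f::field alg_closure ^ 'n ^ 'n) set \<Rightarrow> ('f alg_closure ^ 'n ^ 'n) set \<Rightarrow> bool" where
  "levi P M \<longleftrightarrow> algebraic_group M \<and>
     P = {m ** u | m u. m \<in> M \<and> u \<in> unip_radical P} \<and> M \<inter> unip_radical P = {mat 1} \<and>
     (\<forall>i j. \<exists>f \<in> reg_fun UNIV. \<forall>m\<in>M. \<forall>u \<in> unip_radical P. f (m ** u) = m $ i $ j)"

definition minimal_parabolic_pair ::
    "('f::field alg_closure ^ 'n ^ 'n) set \<Rightarrow> ('f alg_closure ^ 'n ^ 'n) set \<Rightarrow>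
     ('f alg_closure ^ 'n ^ 'n) set \<Rightarrow> bool" where
  "minimal_parabolic_pair G M0 P0 \<longleftrightarrow>
     parabolic G P0 \<and> (\<forall>P. parabolic G P \<and> P \<subseteq> P0 \<longrightarrow> P = P0) \<and> levi P0 M0"

text \<open>The \<open>F\<close>-rational characters of \<open>T\<close>, made extensional.\<close>

definition characters ::
    "('f::field alg_closure ^ 'n ^ 'n) set \<Rightarrow> ('f alg_closure ^ 'n ^ 'n \<Rightarrow> 'f alg_closure) set" where
  "characters T = {\<eta> \<in> extensional T.
     (\<forall>a\<in>T. \<eta> a \<noteq> 0) \<and> (\<forall>a\<in>T. \<forall>b\<in>T. \<eta> (a ** b) = \<eta> a * \<eta> b) \<and>
     (\<exists>f \<in> reg_fun base_field. \<forall>a\<in>T. \<eta> a = f a)}"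

text \<open>A torus is split if its coordinate ring is spanned by \<open>F\<close>-rational characters.\<close>

definition split_torus :: "('f::field alg_closure ^ 'n ^ 'n) set \<Rightarrow> bool" where
  "split_torus T \<longleftrightarrow> algebraic_group T \<and> connectedin zariski T \<and>
     (\<forall>f \<in> reg_fun UNIV. \<exists>Q c. finite Q \<and> Q \<subseteq> characters T \<and>
        (\<forall>a\<in>T. f a = (\<Sum>\<eta>\<in>Q. c \<eta> * \<eta> a)))"

text \<open>Among the split central tori of \<open>M\<close> there is a largest one.\<close>

definition max_split_central_torus ::
    "('f::field alg_closure ^ 'n ^ 'n) set \<Rightarrow> ('f alg_closure ^ 'n ^ 'n) set" where
  "max_split_central_torus M =
     \<Union>{T. split_torus T \<and> T \<subseteq> {z \<in> M. \<forall>m\<in>M. z ** m = m ** z}}"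

text \<open>
  The tangent space at the identity: the differentials of the equations of \<open>H\<close> vanish; \<open>q\<close> is
  the polynomial \<open>p (1 + t x)\<close> in \<open>t\<close>.
\<close>

definition lie :: "('k::field ^ 'n ^ 'n) set \<Rightarrow> ('k ^ 'n ^ 'n) set" where
  "lie H = {x. \<forall>p \<in> poly_fun UNIV. (\<forall>h\<in>H. p h = 0) \<longrightarrow>
     (\<forall>q. (\<forall>t. poly q t = p (mat 1 + map_matrix ((*) t) x)) \<longrightarrow> poly (pderiv q) 0 = 0)}"

definition weight_space :: "('k::field ^ 'n ^ 'n) set \<Rightarrow> ('k ^ 'n ^ 'n) set \<Rightarrow>
    ('k ^ 'n ^ 'n \<Rightarrow> 'k) \<Rightarrow> ('k ^ 'n ^ 'n) set" where
  "weight_space A L \<eta> = {x \<in> L. \<forall>a\<in>A. conj_by a x = map_matrix ((*) (\<eta> a)) x}"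

definition roots :: "('f::field alg_closure ^ 'n ^ 'n) set \<Rightarrow> ('f alg_closure ^ 'n ^ 'n) set \<Rightarrow>
    ('f alg_closure ^ 'n ^ 'n \<Rightarrow> 'f alg_closure) set" where
  "roots A L = {\<eta> \<in> characters A. (\<exists>a\<in>A. \<eta> a \<noteq> 1) \<and> weight_space A L \<eta> \<noteq> {0}}"


section \<open>Smooth representations\<close>

type_synonym ('g, 'v) action = "'g \<Rightarrow> 'v \<Rightarrow> 'v"

definition representation ::
    "('f::field ^ 'n ^ 'n) set \<Rightarrow> (complex, 'v) module \<Rightarrow> ('f ^ 'n ^ 'n, 'v) action \<Rightarrow> bool" where
  "representation H V \<pi> \<longleftrightarrow> module CC V \<and> (\<forall>g\<in>H. linear_map V V (\<pi> g)) \<and>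
     (\<forall>x\<in>carrier V. \<pi> (mat 1) x = x) \<and>
     (\<forall>g\<in>H. \<forall>h\<in>H. \<forall>x\<in>carrier V. \<pi> (g ** h) x = \<pi> g (\<pi> h x))"

definition smooth ::
    "('f::field \<Rightarrow> real) \<Rightarrow> ('f ^ 'n ^ 'n) set \<Rightarrow> (complex, 'v) module \<Rightarrow> ('f ^ 'n ^ 'n, 'v) action \<Rightarrow> bool" where
  "smooth v H V \<pi> \<longleftrightarrow> (\<forall>x\<in>carrier V. openin (subtopology (mat_top v) H) {g\<in>H. \<pi> g x = x})"

definition subrep ::
    "('f::field ^ 'n ^ 'n) set \<Rightarrow> (complex, 'v) module \<Rightarrow> ('f ^ 'n ^ 'n, 'v) action \<Rightarrow> 'v set \<Rightarrow> bool" where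
  "subrep H V \<pi> W \<longleftrightarrow> submodule W CC V \<and> (\<forall>g\<in>H. \<forall>x\<in>W. \<pi> g x \<in> W)"

definition irreducible_rep ::
    "('f::field ^ 'n ^ 'n) set \<Rightarrow> (complex, 'v) module \<Rightarrow> ('f ^ 'n ^ 'n, 'v) action \<Rightarrow> bool" where
  "irreducible_rep H V \<pi> \<longleftrightarrow> carrier V \<noteq> {\<zero>\<^bsub>V\<^esub>} \<and>
     (\<forall>W. subrep H V \<pi> W \<longrightarrow> W = {\<zero>\<^bsub>V\<^esub>} \<or> W = carrier V)"

definition finite_length ::
    "('f::field ^ 'n ^ 'n) set \<Rightarrow> (complex, 'v) module \<Rightarrow> ('f ^ 'n ^ 'n, 'v) action \<Rightarrow> bool" where
  "finite_length H V \<pi> \<longleftrightarrow> (\<exists>N. \<forall>\<C>. (\<forall>W\<in>\<C>. subrep H V \<pi> W) \<and>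
     (\<forall>W\<in>\<C>. \<forall>W'\<in>\<C>. W \<subseteq> W' \<or> W' \<subseteq> W) \<longrightarrow> finite \<C> \<and> card \<C> \<le> N)"

text \<open>The objects of the category of smooth representations of finite length.\<close>

definition fl_smooth_rep ::
    "('f::field \<Rightarrow> real) \<Rightarrow> ('f ^ 'n ^ 'n) set \<Rightarrow> (complex, 'v) module \<Rightarrow> ('f ^ 'n ^ 'n, 'v) action \<Rightarrow> bool" where
  "fl_smooth_rep v H V \<pi> \<longleftrightarrow> representation H V \<pi> \<and> smooth v H V \<pi> \<and> finite_length H V \<pi>"

definition rep_hom :: "('f::field ^ 'n ^ 'n) set \<Rightarrow>
    (complex, 'v) module \<Rightarrow> ('f ^ 'n ^ 'n, 'v) action \<Rightarrow>
    (complex, 'w) module \<Rightarrow> ('f ^ 'n ^ 'n, 'w) action \<Rightarrow> ('v \<Rightarrow> 'w) \<Rightarrow> bool" where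
  "rep_hom H V \<pi> W \<rho> f \<longleftrightarrow> linear_map V W f \<and> (\<forall>g\<in>H. \<forall>x\<in>carrier V. f (\<pi> g x) = \<rho> g (f x))"

definition rep_iso :: "('f::field ^ 'n ^ 'n) set \<Rightarrow>
    (complex, 'v) module \<Rightarrow> ('f ^ 'n ^ 'n, 'v) action \<Rightarrow>
    (complex, 'w) module \<Rightarrow> ('f ^ 'n ^ 'n, 'w) action \<Rightarrow> ('v \<Rightarrow> 'w) \<Rightarrow> bool" where
  "rep_iso H V \<pi> W \<rho> f \<longleftrightarrow> rep_hom H V \<pi> W \<rho> f \<and> bij_betw f (carrier V) (carrier W)"

definition sub_mod :: "(complex, 'v) module \<Rightarrow> 'v set \<Rightarrow> (complex, 'v) module" where
  "sub_mod V W = V\<lparr>carrier := W\<rparr>"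

text \<open>Twist by a character with values in \<open>\<plusminus>1\<close>.\<close>

definition twist :: "(complex, 'v) module \<Rightarrow> ('g, 'v) action \<Rightarrow> ('g \<Rightarrow> int) \<Rightarrow> ('g, 'v) action" where
  "twist V \<pi> \<epsilon> g x = of_int (\<epsilon> g) \<odot>\<^bsub>V\<^esub> \<pi> g x"

text \<open>The kernel of the projection to the coinvariants of \<open>U\<close>.\<close>

definition coinv_ker :: "(complex, 'v) module \<Rightarrow> ('g, 'v) action \<Rightarrow> 'g set \<Rightarrow> 'v set" where
  "coinv_ker V \<pi> U = span_in V {\<pi> u x \<ominus>\<^bsub>V\<^esub> x | u x. u \<in> U \<and> x \<in> carrier V}"

text \<open>
  Smooth (unnormalized) induction from \<open>P\<close> to \<open>H\<close>; a function is smooth if it is invariant under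
  right translation by an open subgroup.
\<close>

definition ind :: "('f::field \<Rightarrow> real) \<Rightarrow> ('f ^ 'n ^ 'n) set \<Rightarrow> ('f ^ 'n ^ 'n) set \<Rightarrow>
    (complex, 'v) module \<Rightarrow> ('f ^ 'n ^ 'n, 'v) action \<Rightarrow> (complex, 'f ^ 'n ^ 'n \<Rightarrow> 'v) module" where
  "ind v H P E \<sigma> = \<lparr>carrier = {f \<in> H \<rightarrow>\<^sub>E carrier E.
       (\<forall>p\<in>P. \<forall>g\<in>H. f (p ** g) = \<sigma> p (f g)) \<and>
       (\<exists>K. subgroup K GL \<and> openin (subtopology (mat_top v) H) K \<and> (\<forall>g\<in>H. \<forall>k\<in>K. f (g ** k) = f g))},
     mult = undefined, one = undefined, zero = (\<lambda>g\<in>H. \<zero>\<^bsub>E\<^esub>),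
     add = (\<lambda>f f'. \<lambda>g\<in>H. f g \<oplus>\<^bsub>E\<^esub> f' g), smult = (\<lambda>c f. \<lambda>g\<in>H. c \<odot>\<^bsub>E\<^esub> f g)\<rparr>"

definition right_transl :: "('f::field ^ 'n ^ 'n) set \<Rightarrow> ('f ^ 'n ^ 'n, 'f ^ 'n ^ 'n \<Rightarrow> 'v) action" where
  "right_transl H h f = (\<lambda>g\<in>H. f (g ** h))"

text \<open>
  The modulus of \<open>p\<close> acting on \<open>U\<close> by conjugation, i.e. \<open>vol (p C p\<^sup>-\<^sup>1) / vol C\<close>, computed as a
  generalized index for an arbitrary compact open subgroup \<open>C\<close> of \<open>U\<close>.
\<close>

definition modulus :: "('f::field \<Rightarrow> real) \<Rightarrow> ('f ^ 'n ^ 'n) set \<Rightarrow> 'f ^ 'n ^ 'n \<Rightarrow> real" where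
  "modulus v U p =
     (let C = (SOME C. subgroup C GL \<and> openin (subtopology (mat_top v) U) C \<and> compactin (mat_top v) C);
          C' = conj_by p ` C
      in real (card (rcosets\<^bsub>GL\<lparr>carrier := C'\<rparr>\<^esub> (C \<inter> C'))) / real (card (rcosets\<^bsub>GL\<lparr>carrier := C\<rparr>\<^esub> (C \<inter> C'))))"

text \<open>
  Normalized parabolic induction from the Levi subgroup \<open>M\<close> of \<open>P\<close>: \<open>\<tau>\<close> is inflated to the
  rational points of \<open>P\<close> and multiplied by the square root of the modulus.
\<close>

definition inflate :: "('f::field \<Rightarrow> real) \<Rightarrow> ('f alg_closure ^ 'n ^ 'n) set \<Rightarrow> ('f alg_closure ^ 'n ^ 'n) set \<Rightarrow>
    (complex, 'v) module \<Rightarrow> ('f ^ 'n ^ 'n, 'v) action \<Rightarrow> ('f ^ 'n ^ 'n, 'v) action" where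
  "inflate v P M E \<tau> p x =
     complex_of_real (sqrt (modulus v (rat_pts (unip_radical P)) p)) \<odot>\<^bsub>E\<^esub>
       \<tau> (THE m. m \<in> rat_pts M \<and> (\<exists>u \<in> rat_pts (unip_radical P). p = m ** u)) x"

definition parabolic_ind :: "('f::field \<Rightarrow> real) \<Rightarrow> ('f alg_closure ^ 'n ^ 'n) set \<Rightarrow>
    ('f alg_closure ^ 'n ^ 'n) set \<Rightarrow> ('f alg_closure ^ 'n ^ 'n) set \<Rightarrow>
    (complex, 'v) module \<Rightarrow> ('f ^ 'n ^ 'n, 'v) action \<Rightarrow> (complex, 'f ^ 'n ^ 'n \<Rightarrow> 'v) module" where
  "parabolic_ind v G P M E \<tau> = ind v (rat_pts G) (rat_pts P) E (inflate v P M E \<tau>)"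

definition irreducible_supercuspidal :: "('f::field \<Rightarrow> real) \<Rightarrow> ('f alg_closure ^ 'n ^ 'n) set \<Rightarrow>
    (complex, 'v) module \<Rightarrow> ('f ^ 'n ^ 'n, 'v) action \<Rightarrow> bool" where
  "irreducible_supercuspidal v M E \<tau> \<longleftrightarrow>
     representation (rat_pts M) E \<tau> \<and> smooth v (rat_pts M) E \<tau> \<and> irreducible_rep (rat_pts M) E \<tau> \<and>
     (\<forall>Q. parabolic M Q \<and> Q \<noteq> M \<longrightarrow> coinv_ker E \<tau> (rat_pts (unip_radical Q)) = carrier E)"


section \<open>The functors\<close>

text \<open>
  \<open>v\<close> is the absolute value of the base field, \<open>Gt\<close> the given (possibly disconnected) group, and
  \<open>ord\<close> the chosen numbering of the simple roots, which only enters the Borel--Serre functor.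
\<close>

locale nonconnected_group =
  fixes v :: "'f::field \<Rightarrow> real"
    and Gt M0 P0 :: "('f alg_closure ^ 'n ^ 'n) set"
    and ord :: "('f alg_closure ^ 'n ^ 'n \<Rightarrow> 'f alg_closure) \<Rightarrow> nat"
begin

definition G where "G = identity_component Gt"

abbreviation GtF where "GtF \<equiv> rat_pts Gt"
abbreviation GF where "GF \<equiv> rat_pts G"

definition A0 where "A0 = max_split_central_torus M0"

text \<open>The simple roots: the positive roots (those of \<open>P0\<close>) which are not sums of two positive roots.\<close>

definition S where
  "S = {\<alpha> \<in> roots A0 (lie P0).
     \<not> (\<exists>\<beta> \<in> roots A0 (lie P0). \<exists>\<gamma> \<in> roots A0 (lie P0). \<forall>a\<in>A0. \<alpha> a = \<beta> a * \<gamma> a)}"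

abbreviation r where "r \<equiv> card S"

definition parabolic_lie where
  "parabolic_lie J = Modules.module.span (\<lambda>c. map_matrix ((*) c))
     (\<Union>{weight_space A0 (lie G) \<eta> | \<eta>. \<eta> \<in> characters A0 \<and>
        (\<exists>m :: _ \<Rightarrow> int. (\<forall>\<alpha>\<in>S - J. m \<alpha> \<ge> 0) \<and> (\<forall>a\<in>A0. \<eta> a = (\<Prod>\<alpha>\<in>S. \<alpha> a powi m \<alpha>)))})"

definition standard_parabolic where
  "standard_parabolic J P \<longleftrightarrow> parabolic G P \<and> P0 \<subseteq> P \<and> lie P = parabolic_lie J"

text \<open>
  For each \<open>K \<subseteq> S\<close> there is exactly one standard parabolic subgroup, and it contains those for the
  subsets of \<open>K\<close>. Hence the following intersection is the one for \<open>J\<close>.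
\<close>

definition PJ where
  "PJ J = G \<inter> \<Inter>{P. \<exists>K. J \<subseteq> K \<and> K \<subseteq> S \<and> standard_parabolic K P}"

abbreviation UJ where "UJ J \<equiv> unip_radical (PJ J)"

text \<open>
  The category of index \<open>t\<close> for \<open>G\<close>. The existentially quantified \<open>M\<close> is the standard Levi
  subgroup. An irreducible smooth representation has countable dimension, so it has a model whose
  space consists of sequences of complex numbers.
\<close>

definition in_RtG :: "nat \<Rightarrow> (complex, 'v) module \<Rightarrow> ('f ^ 'n ^ 'n, 'v) action \<Rightarrow> bool" where
  "in_RtG t V \<pi> \<longleftrightarrow> fl_smooth_rep v GF V \<pi> \<and>
     (\<forall>W1 W2. subrep GF V \<pi> W1 \<and> subrep GF V \<pi> W2 \<and> W1 \<subseteq> W2 \<and>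
        irreducible_rep GF (quot (sub_mod V W2) W1) (\<lambda>g. quot_map (sub_mod V W2) W1 (\<pi> g)) \<longrightarrow>
        (\<exists>I M (E :: (complex, nat \<Rightarrow> complex) module) \<tau> N1 N2 f.
           I \<subseteq> S \<and> card I = t \<and> levi (PJ I) M \<and> M0 \<subseteq> M \<and> irreducible_supercuspidal v M E \<tau> \<and>
           subrep GF (parabolic_ind v G (PJ I) M E \<tau>) (right_transl GF) N1 \<and>
           subrep GF (parabolic_ind v G (PJ I) M E \<tau>) (right_transl GF) N2 \<and> N1 \<subseteq> N2 \<and>
           rep_iso GF (quot (sub_mod V W2) W1) (\<lambda>g. quot_map (sub_mod V W2) W1 (\<pi> g))
             (quot (sub_mod (parabolic_ind v G (PJ I) M E \<tau>) N2) N1)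
             (\<lambda>g. quot_map (sub_mod (parabolic_ind v G (PJ I) M E \<tau>) N2) N1 (right_transl GF g)) f))"

definition in_Rt :: "nat \<Rightarrow> (complex, 'v) module \<Rightarrow> ('f ^ 'n ^ 'n, 'v) action \<Rightarrow> bool" where
  "in_Rt t V \<pi> \<longleftrightarrow> fl_smooth_rep v GtF V \<pi> \<and> in_RtG t V \<pi>"

text \<open>
  The component of index \<open>t\<close> of a representation with respect to the decomposition of the category
  as a product: its largest subrepresentation lying in the category of index \<open>t\<close>.
\<close>

definition component :: "(complex, 'v) module \<Rightarrow> ('f ^ 'n ^ 'n, 'v) action \<Rightarrow> nat \<Rightarrow> (complex, 'v) module" where
  "component V \<pi> t = sub_mod V (span_in V (\<Union>{W. subrep GtF V \<pi> W \<and> in_Rt t (sub_mod V W) \<pi>}))"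

definition NF where
  "NF = rat_pts {n \<in> Gt. conj_by n ` M0 = M0 \<and> conj_by n ` P0 = P0}"

text \<open>The action of the normalizer on \<open>S\<close>, by transport of characters along conjugation.\<close>

definition perm where
  "perm n \<alpha> = (\<lambda>x\<in>A0. \<alpha> (conj_by (matrix_inv (map_matrix to_ac n)) x))"

definition perm_preimage where
  "perm_preimage n J = {\<alpha>\<in>S. perm n \<alpha> \<in> J}"

text \<open>
  A decomposition of \<open>g\<close> as a product of rational points of \<open>G\<close> and of the normalizer. It always
  exists; the second alternative only makes the function total.
\<close>

definition decomp where
  "decomp g = (if \<exists>h\<in>GF. \<exists>n\<in>NF. g = h ** n
     then (SOME (h, n). h \<in> GF \<and> n \<in> NF \<and> g = h ** n) else (mat 1, mat 1))"

definition sgn_char :: "'f ^ 'n ^ 'n \<Rightarrow> int" where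
  "sgn_char g = sign_on S (perm (snd (decomp g)))"

subsection \<open>The spaces \<open>X\<^sub>J\<close>\<close>

definition ker_U :: "(complex, 'v) module \<Rightarrow> ('f ^ 'n ^ 'n, 'v) action \<Rightarrow> _ set \<Rightarrow> 'v set" where
  "ker_U V \<pi> J = coinv_ker V \<pi> (rat_pts (UJ J))"

definition XJ :: "(complex, 'v) module \<Rightarrow> ('f ^ 'n ^ 'n, 'v) action \<Rightarrow> _ set \<Rightarrow>
    (complex, 'f ^ 'n ^ 'n \<Rightarrow> 'v set) module" where
  "XJ V \<pi> J = ind v GF (rat_pts (PJ J)) (quot V (ker_U V \<pi> J)) (\<lambda>p. quot_map V (ker_U V \<pi> J) (\<pi> p))"

definition \<phi> :: "(complex, 'v) module \<Rightarrow> ('f ^ 'n ^ 'n, 'v) action \<Rightarrow> _ set \<Rightarrow>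
    ('f ^ 'n ^ 'n \<Rightarrow> 'v set) \<Rightarrow> 'f ^ 'n ^ 'n \<Rightarrow> 'v set" where
  "\<phi> V \<pi> I x = (\<lambda>h\<in>GF. quot_map V (ker_U V \<pi> I) id (x h))"

text \<open>The map \<open>X\<^sub>K(n)\<close> to \<open>X\<^sub>J\<close>, where \<open>n\<close> maps \<open>K\<close> to \<open>J\<close>.\<close>

definition Xn :: "(complex, 'v) module \<Rightarrow> ('f ^ 'n ^ 'n, 'v) action \<Rightarrow> 'f ^ 'n ^ 'n \<Rightarrow> _ set \<Rightarrow>
    ('f ^ 'n ^ 'n \<Rightarrow> 'v set) \<Rightarrow> 'f ^ 'n ^ 'n \<Rightarrow> 'v set" where
  "Xn V \<pi> n J x = (\<lambda>h\<in>GF. quot_map V (ker_U V \<pi> J) (\<pi> n) (x (conj_by (matrix_inv n) h)))"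

text \<open>Functoriality: \<open>f\<close> is a morphism from some representation to \<open>(V, \<pi>)\<close>.\<close>

definition Xf :: "(complex, 'v) module \<Rightarrow> ('f ^ 'n ^ 'n, 'v) action \<Rightarrow> ('w \<Rightarrow> 'v) \<Rightarrow> _ set \<Rightarrow>
    ('f ^ 'n ^ 'n \<Rightarrow> 'w set) \<Rightarrow> 'f ^ 'n ^ 'n \<Rightarrow> 'v set" where
  "Xf V \<pi> f J x = (\<lambda>h\<in>GF. quot_map V (ker_U V \<pi> J) f (x h))"

definition subsets where "subsets t = {J. J \<subseteq> S \<and> card J = t}"

subsection \<open>The functor \<open>D\<^sub>A\<close>\<close>

definition \<Lambda> where "\<Lambda> J = ext_power (free (S - J)) (card (S - J))"

definition YJ where "YJ V \<pi> J = tensor (XJ V \<pi> J) (\<Lambda> J)"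

definition Yt where "Yt V \<pi> t = dsum (subsets t) (YJ V \<pi>)"

definition \<psi> where
  "\<psi> V \<pi> I i = tensor_map (XJ V \<pi> I) (\<Lambda> I) (\<phi> V \<pi> I)
     (ext_wedge (free (S - I)) (card (S - insert i I)) (delta i))"

text \<open>The differential from degree \<open>t + 1\<close> to degree \<open>t\<close>.\<close>

definition dY where
  "dY V \<pi> t y = (\<lambda>I\<in>subsets t. \<Oplus>\<^bsub>YJ V \<pi> I\<^esub>i\<in>S - I. \<psi> V \<pi> I i (y (insert i I)))"

definition actY where
  "actY V \<pi> t g y = (case decomp g of (h, n) \<Rightarrow> (\<lambda>J\<in>subsets t.
     tensor_map (XJ V \<pi> J) (\<Lambda> J) (right_transl GF h) id
       (tensor_map (XJ V \<pi> J) (\<Lambda> J) (Xn V \<pi> n J)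
         (ext_map (free (S - J)) (card (S - J)) (push (perm n)))
         (y (perm_preimage n J)))))"

definition mapY where
  "mapY V \<pi> f t y = (\<lambda>J\<in>subsets t. tensor_map (XJ V \<pi> J) (\<Lambda> J) (Xf V \<pi> f J) id (y J))"

definition imY where "imY V \<pi> t = dY V \<pi> t ` carrier (Yt V \<pi> (Suc t))"

definition DA where
  "DA V \<pi> = dsum {..r}
     (\<lambda>t. quot (Yt (component V \<pi> t) \<pi> t) (imY (component V \<pi> t) \<pi> t))"

definition DA_act where
  "DA_act V \<pi> g z = (\<lambda>t\<in>{..r}.
     quot_map (Yt (component V \<pi> t) \<pi> t) (imY (component V \<pi> t) \<pi> t) (actY (component V \<pi> t) \<pi> t g) (z t))"

definition DA_map where
  "DA_map V \<pi> f z = (\<lambda>t\<in>{..r}.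
     quot_map (Yt (component V \<pi> t) \<pi> t) (imY (component V \<pi> t) \<pi> t) (mapY (component V \<pi> t) \<pi> f t) (z t))"

subsection \<open>The functor defined by the Borel--Serre complex\<close>

definition Xt where "Xt V \<pi> t = dsum (subsets t) (XJ V \<pi>)"

text \<open>\<open>\<epsilon> I j\<close> is the sign attached to the pair of subsets \<open>I\<close> and \<open>I \<union> {j}\<close>.\<close>

definition \<epsilon> :: "_ set \<Rightarrow> _ \<Rightarrow> int" where
  "\<epsilon> I j = (-1) ^ card {i \<in> insert j I. ord i \<le> ord j}"

definition \<epsilon>_perm :: "_ \<Rightarrow> _ set \<Rightarrow> int" where
  "\<epsilon>_perm \<sigma> I = (-1) ^ card {(i, i'). i \<in> I \<and> i' \<in> I \<and> ord i < ord i' \<and> ord (\<sigma> i) > ord (\<sigma> i')}"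

definition dX where
  "dX V \<pi> t x = (\<lambda>I\<in>subsets t.
     \<Oplus>\<^bsub>XJ V \<pi> I\<^esub>j\<in>S - I. of_int (\<epsilon> I j) \<odot>\<^bsub>XJ V \<pi> I\<^esub> \<phi> V \<pi> I (x (insert j I)))"

definition actX where
  "actX V \<pi> t g x = (case decomp g of (h, n) \<Rightarrow> (\<lambda>J\<in>subsets t.
     right_transl GF h
       (of_int (\<epsilon>_perm (perm n) (perm_preimage n J)) \<odot>\<^bsub>XJ V \<pi> J\<^esub> Xn V \<pi> n J (x (perm_preimage n J)))))"

definition mapX where
  "mapX V \<pi> f t x = (\<lambda>J\<in>subsets t. Xf V \<pi> f J (x J))"

definition imX where "imX V \<pi> t = dX V \<pi> t ` carrier (Xt V \<pi> (Suc t))"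

definition BS where
  "BS V \<pi> = dsum {..r}
     (\<lambda>t. quot (Xt (component V \<pi> t) \<pi> t) (imX (component V \<pi> t) \<pi> t))"

definition BS_act where
  "BS_act V \<pi> g z = (\<lambda>t\<in>{..r}.
     quot_map (Xt (component V \<pi> t) \<pi> t) (imX (component V \<pi> t) \<pi> t) (actX (component V \<pi> t) \<pi> t g) (z t))"

definition BS_map where
  "BS_map V \<pi> f z = (\<lambda>t\<in>{..r}.
     quot_map (Xt (component V \<pi> t) \<pi> t) (imX (component V \<pi> t) \<pi> t) (mapX (component V \<pi> t) \<pi> f t) (z t))"

end

end

theory Submission
  imports Defs
begin

text \<open>
  Both functors are cokernels of complexes built from the same spaces \<open>X\<^sub>J\<close>. In one complex the signs
  come from tensoring with the top exterior power \<open>\<Lambda>\<^sub>J\<close> of the space with basis \<open>S - J\<close>, in the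
  other they come from counting with respect to a total order on \<open>S\<close>. Since \<open>\<Lambda>\<^sub>J\<close> is a line, each
  choice of a non-zero vector of \<open>\<Lambda>\<^sub>J\<close> identifies \<open>X\<^sub>J\<close> with \<open>Y\<^sub>J = X\<^sub>J \<otimes> \<Lambda>\<^sub>J\<close>, and the point is to choose
  these vectors for all \<open>J\<close> in such a way that the two sign conventions match.

  The choice made here is \<open>orientation J\<close>: the wedge product, in increasing order, of the basis
  vectors in \<open>S - J\<close>, multiplied by \<open>shuffle_sign J\<close>, the product over \<open>i \<in> J\<close> and \<open>k \<in> S - J\<close> of
  the sign of \<open>ord i - ord k\<close>. Two properties of it carry the proof.

  First, wedging \<open>orientation (I \<union> {i})\<close> with \<open>e\<^sub>i\<close> on the right gives \<open>- \<epsilon>(I, I \<union> {i})\<close> times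
  \<open>orientation I\<close>. Sorting \<open>e\<^sub>i\<close> into its place passes the \<open>k\<close> outside \<open>I \<union> {i}\<close> that are larger than
  \<open>i\<close>; these same \<open>k\<close> contribute the factors that disappear from the shuffle sign, and the factors that
  appear in their place count the \<open>j \<in> I\<close> that are smaller than \<open>i\<close>. The Borel--Serre sign counts \<open>i\<close>
  as well, whence the extra minus sign. It does not depend on \<open>I\<close> or \<open>i\<close>, so the image of the
  differential, hence the cokernel, is the same (lemmas \<open>ext_wedge_orientation\<close>, \<open>imY_eq\<close>).

  Second, a permutation \<open>a\<close> of \<open>S\<close> carries \<open>orientation K\<close> to \<open>sgn a \<cdot> \<epsilon>(a, K)\<close> times
  \<open>orientation (a K)\<close>. The inversions of \<open>a\<close> on \<open>S\<close> split into those within \<open>K\<close>, those within \<open>S - K\<close>,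
  and the mixed ones. The first kind gives \<open>\<epsilon>(a, K)\<close>, the second is what sorting the image of the
  wedge product costs, and the third is the quotient of the two shuffle signs (lemma
  \<open>shuffle_sign_permutation\<close>). Thus \<open>x \<mapsto> x \<otimes> orientation J\<close> intertwines the two actions up to the sign
  character (lemma \<open>actY_theta\<close>).

  For this to be an argument about representations, the maps between the spaces \<open>X\<^sub>J\<close> have to be well
  defined. The projections \<open>X\<^sub>J \<rightarrow> X\<^sub>I\<close> need \<open>U\<^sub>J \<subseteq> U\<^sub>I\<close> for \<open>I \<subseteq> J\<close>: a connected solvable normal subgroup
  of \<open>P\<^sub>J\<close> lies in every Borel subgroup that \<open>P\<^sub>J\<close> contains, hence in \<open>P\<^sub>I\<close> (lemma
  \<open>connected_solvable_normal_subset_borel\<close>). The action of the normalizer needs that conjugation by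
  \<open>n\<close> carries \<open>P\<^sub>J\<close> to \<open>P\<^bsub>n J\<^esub>\<close>, which holds because everything that enters the definition of
  \<open>P\<^sub>J\<close> is transported by rational conjugations. Finally, naturality on all
  finite-length representations needs that a morphism respects the components, because the
  image of an object of one of the categories \<open>R\<^sub>t\<close> is again an object of it (lemma \<open>in_Rt_image\<close>).
\<close>

section \<open>Complex vector spaces\<close>

lemma CC_simps [simp]:
  "carrier CC = UNIV" "a \<oplus>\<^bsub>CC\<^esub> b = a + b" "a \<otimes>\<^bsub>CC\<^esub> b = a * b"
  "\<zero>\<^bsub>CC\<^esub> = 0" "\<one>\<^bsub>CC\<^esub> = 1"
  by (simp_all add: ring_of_type_algebra_def)

lemma cring_CC: "cring CC"
  by (rule cring_from_type_algebra)

lemma CC_minus [simp]: "\<ominus>\<^bsub>CC\<^esub> a = - a"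
proof -
  interpret cring CC by (rule cring_CC)
  show ?thesis by (rule minus_equality) simp_all
qed

locale vspace = module CC V for V :: "(complex, 'a) module" (structure)
begin

lemma scale_closed [simp]: "x \<in> carrier V \<Longrightarrow> c \<odot> x \<in> carrier V"
  and scale_add_left: "x \<in> carrier V \<Longrightarrow> (c + d) \<odot> x = c \<odot> x \<oplus> d \<odot> x"
  and scale_add_right: "x \<in> carrier V \<Longrightarrow> y \<in> carrier V \<Longrightarrow> c \<odot> (x \<oplus> y) = c \<odot> x \<oplus> c \<odot> y"
  and scale_scale: "x \<in> carrier V \<Longrightarrow> c \<odot> (d \<odot> x) = (c * d) \<odot> x"
  and scale_one [simp]: "x \<in> carrier V \<Longrightarrow> 1 \<odot> x = x"
  and scale_zero [simp]: "x \<in> carrier V \<Longrightarrow> 0 \<odot> x = \<zero>"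
  and scale_null [simp]: "c \<odot> \<zero> = \<zero>"
  and neg_scale: "x \<in> carrier V \<Longrightarrow> \<ominus> x = (- 1) \<odot> x"
  using smult_l_distr[of c d x] smult_r_distr[of c x y] smult_assoc1[of c d x] smult_one[of x]
    smult_l_null[of x] smult_r_null[of c] smult_l_minus[of 1 x]
  by simp_all

lemma eq_if_minus_zero:
  assumes "x \<ominus> y = \<zero>" "x \<in> carrier V" "y \<in> carrier V"
  shows "x = y"
proof -
  have "x = (x \<ominus> y) \<oplus> y" using assms(2,3) by (simp add: a_minus_def M.a_assoc M.l_neg)
  also have "\<dots> = y" using assms by simp
  finally show ?thesis .
qed

end

abbreviation subspace_of :: "'a set \<Rightarrow> (complex, 'a) module \<Rightarrow> bool" where
  "subspace_of W V \<equiv> submodule W CC V"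

lemma vspaceI:
  fixes V :: "(complex, 'a) module" (structure)
  assumes "\<And>x y. x \<in> carrier V \<Longrightarrow> y \<in> carrier V \<Longrightarrow> x \<oplus> y \<in> carrier V"
    and "\<zero> \<in> carrier V"
    and "\<And>x y z. x \<in> carrier V \<Longrightarrow> y \<in> carrier V \<Longrightarrow> z \<in> carrier V \<Longrightarrow> (x \<oplus> y) \<oplus> z = x \<oplus> (y \<oplus> z)"
    and "\<And>x y. x \<in> carrier V \<Longrightarrow> y \<in> carrier V \<Longrightarrow> x \<oplus> y = y \<oplus> x"
    and "\<And>x. x \<in> carrier V \<Longrightarrow> \<zero> \<oplus> x = x"
    and "\<And>x. x \<in> carrier V \<Longrightarrow> 0 \<odot> x = \<zero>"
    and "\<And>c x. x \<in> carrier V \<Longrightarrow> c \<odot> x \<in> carrier V"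
    and "\<And>c d x. x \<in> carrier V \<Longrightarrow> (c + d) \<odot> x = c \<odot> x \<oplus> d \<odot> x"
    and "\<And>c x y. x \<in> carrier V \<Longrightarrow> y \<in> carrier V \<Longrightarrow> c \<odot> (x \<oplus> y) = c \<odot> x \<oplus> c \<odot> y"
    and "\<And>c d x. x \<in> carrier V \<Longrightarrow> (c * d) \<odot> x = c \<odot> (d \<odot> x)"
    and "\<And>x. x \<in> carrier V \<Longrightarrow> 1 \<odot> x = x"
  shows "vspace V"
proof (intro vspace.intro moduleI[OF cring_CC])
  show "abelian_group V"
  proof (rule abelian_groupI)
    fix x assume x: "x \<in> carrier V"
    have "(- 1) \<odot> x \<oplus> x = (- 1 + 1) \<odot> x" using assms(8)[OF x, of "-1" 1] assms(11)[OF x] by simp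
    then show "\<exists>y\<in>carrier V. y \<oplus> x = \<zero>" using assms(6)[OF x] assms(7)[OF x] by auto
  qed (use assms in auto)
qed (use assms in auto)

lemma subspaceI:
  assumes "vspace V" "W \<subseteq> carrier V" "\<zero>\<^bsub>V\<^esub> \<in> W"
    and "\<And>x y. x \<in> W \<Longrightarrow> y \<in> W \<Longrightarrow> x \<oplus>\<^bsub>V\<^esub> y \<in> W"
    and "\<And>c x. x \<in> W \<Longrightarrow> c \<odot>\<^bsub>V\<^esub> x \<in> W"
  shows "subspace_of W V"
proof -
  interpret vspace V by fact
  show ?thesis
    by (rule submoduleI) (use assms in \<open>auto simp: neg_scale subset_iff\<close>)
qed

lemma subspaceD:
  assumes "vspace V" "subspace_of W V"
  shows "W \<subseteq> carrier V" "\<zero>\<^bsub>V\<^esub> \<in> W"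
    and "\<And>x y. x \<in> W \<Longrightarrow> y \<in> W \<Longrightarrow> x \<oplus>\<^bsub>V\<^esub> y \<in> W"
    and "\<And>c x. x \<in> W \<Longrightarrow> c \<odot>\<^bsub>V\<^esub> x \<in> W"
    and "\<And>x y. x \<in> W \<Longrightarrow> y \<in> W \<Longrightarrow> x \<ominus>\<^bsub>V\<^esub> y \<in> W"
proof -
  interpret vspace V by fact
  interpret W: submodule W CC V by fact
  show "W \<subseteq> carrier V" "\<zero>\<^bsub>V\<^esub> \<in> W"
    and "\<And>x y. x \<in> W \<Longrightarrow> y \<in> W \<Longrightarrow> x \<oplus>\<^bsub>V\<^esub> y \<in> W"
    and "\<And>c x. x \<in> W \<Longrightarrow> c \<odot>\<^bsub>V\<^esub> x \<in> W"
    and "\<And>x y. x \<in> W \<Longrightarrow> y \<in> W \<Longrightarrow> x \<ominus>\<^bsub>V\<^esub> y \<in> W"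
    using submoduleE[OF assms(2)] W.one_closed by (auto simp: a_minus_def)
qed

lemma subspace_span_in:
  assumes "vspace V" "B \<subseteq> carrier V"
  shows "subspace_of (span_in V B) V"
proof (rule subspaceI[OF assms(1)])
  interpret vspace V by fact
  show "span_in V B \<subseteq> carrier V"
    using carrier_is_submodule assms(2) by (auto simp: span_in_def)
qed (use subspaceD[OF assms(1)] in \<open>auto simp: span_in_def\<close>)

lemma span_in_superset: "B \<subseteq> span_in V B"
  by (auto simp: span_in_def)

lemma span_in_least: "subspace_of W V \<Longrightarrow> B \<subseteq> W \<Longrightarrow> span_in V B \<subseteq> W"
  by (auto simp: span_in_def)

lemma linear_mapI:
  assumes "\<And>x. x \<in> carrier V \<Longrightarrow> f x \<in> carrier W"
    and "\<And>x y. x \<in> carrier V \<Longrightarrow> y \<in> carrier V \<Longrightarrow> f (x \<oplus>\<^bsub>V\<^esub> y) = f x \<oplus>\<^bsub>W\<^esub> f y"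
    and "\<And>c x. x \<in> carrier V \<Longrightarrow> f (c \<odot>\<^bsub>V\<^esub> x) = c \<odot>\<^bsub>W\<^esub> f x"
  shows "linear_map V W f"
  using assms by (auto simp: linear_map_def)

lemma linear_mapD:
  assumes "linear_map V W f"
  shows "x \<in> carrier V \<Longrightarrow> f x \<in> carrier W"
    and "x \<in> carrier V \<Longrightarrow> y \<in> carrier V \<Longrightarrow> f (x \<oplus>\<^bsub>V\<^esub> y) = f x \<oplus>\<^bsub>W\<^esub> f y"
    and "x \<in> carrier V \<Longrightarrow> f (c \<odot>\<^bsub>V\<^esub> x) = c \<odot>\<^bsub>W\<^esub> f x"
  using assms by (auto simp: linear_map_def)

lemma linear_map_zero:
  assumes "vspace V" "vspace W" "linear_map V W f"
  shows "f \<zero>\<^bsub>V\<^esub> = \<zero>\<^bsub>W\<^esub>"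
proof -
  interpret V: vspace V by fact
  interpret W: vspace W by fact
  show ?thesis
    using linear_mapD(3)[OF assms(3), of "\<zero>\<^bsub>V\<^esub>" 0] linear_mapD(1)[OF assms(3), of "\<zero>\<^bsub>V\<^esub>"] by simp
qed

lemma linear_map_minus:
  assumes "vspace V" "vspace W" "linear_map V W f" "x \<in> carrier V" "y \<in> carrier V"
  shows "f (x \<ominus>\<^bsub>V\<^esub> y) = f x \<ominus>\<^bsub>W\<^esub> f y"
proof -
  interpret V: vspace V by fact
  interpret W: vspace W by fact
  show ?thesis
    using assms(4,5) linear_mapD[OF assms(3)] by (simp add: a_minus_def V.neg_scale W.neg_scale)
qed

lemma linear_map_comp:
  "linear_map U V f \<Longrightarrow> linear_map V W g \<Longrightarrow> linear_map U W (\<lambda>x. g (f x))"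
  by (rule linear_mapI) (simp_all add: linear_mapD)

lemma linear_map_smult:
  assumes "vspace W" "linear_map V W f"
  shows "linear_map V W (\<lambda>x. c \<odot>\<^bsub>W\<^esub> f x)"
proof -
  interpret W: vspace W by fact
  show ?thesis
    using linear_mapD[OF assms(2)]
    by (intro linear_mapI) (simp_all add: W.scale_add_right W.scale_scale mult.commute)
qed

lemma linear_map_finsum:
  assumes "vspace V" "vspace W" "linear_map V W f" "finite A" "\<And>a. a \<in> A \<Longrightarrow> h a \<in> carrier V"
  shows "f (\<Oplus>\<^bsub>V\<^esub>a\<in>A. h a) = (\<Oplus>\<^bsub>W\<^esub>a\<in>A. f (h a))"
proof -
  interpret V: vspace V by fact
  interpret W: vspace W by fact
  show ?thesis using assms(4,5)
    by (induction A rule: finite_induct)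
       (auto simp: linear_map_zero[OF assms(1-3)] linear_mapD[OF assms(3)] Pi_def
          V.finsum_insert W.finsum_insert V.finsum_closed)
qed

lemma linear_map_sum:
  assumes "vspace V" "vspace W" "finite A" "\<And>a. a \<in> A \<Longrightarrow> linear_map V W (f a)"
  shows "linear_map V W (\<lambda>x. \<Oplus>\<^bsub>W\<^esub>a\<in>A. f a x)"
proof -
  interpret V: vspace V by fact
  interpret W: vspace W by fact
  have cl: "f a x \<in> carrier W" if "a \<in> A" "x \<in> carrier V" for a x
    using linear_mapD(1)[OF assms(4)] that by auto
  show ?thesis
  proof (rule linear_mapI)
    fix x y c assume x: "x \<in> carrier V"
    show "(\<Oplus>\<^bsub>W\<^esub>a\<in>A. f a x) \<in> carrier W" using cl x by (intro W.finsum_closed) auto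
    have "(\<Oplus>\<^bsub>W\<^esub>a\<in>A. f a (c \<odot>\<^bsub>V\<^esub> x)) = (\<Oplus>\<^bsub>W\<^esub>a\<in>A. c \<odot>\<^bsub>W\<^esub> f a x)"
      using cl x linear_mapD(3)[OF assms(4)] by (intro W.finsum_cong') auto
    then show "(\<Oplus>\<^bsub>W\<^esub>a\<in>A. f a (c \<odot>\<^bsub>V\<^esub> x)) = c \<odot>\<^bsub>W\<^esub> (\<Oplus>\<^bsub>W\<^esub>a\<in>A. f a x)"
      using W.finsum_smult_ldistr[OF assms(3), of c "\<lambda>a. f a x"] cl x by auto
    assume y: "y \<in> carrier V"
    have "(\<Oplus>\<^bsub>W\<^esub>a\<in>A. f a (x \<oplus>\<^bsub>V\<^esub> y)) = (\<Oplus>\<^bsub>W\<^esub>a\<in>A. f a x \<oplus>\<^bsub>W\<^esub> f a y)"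
      using cl x y linear_mapD(2)[OF assms(4)] by (intro W.finsum_cong') auto
    then show "(\<Oplus>\<^bsub>W\<^esub>a\<in>A. f a (x \<oplus>\<^bsub>V\<^esub> y)) = (\<Oplus>\<^bsub>W\<^esub>a\<in>A. f a x) \<oplus>\<^bsub>W\<^esub> (\<Oplus>\<^bsub>W\<^esub>a\<in>A. f a y)"
      using W.finsum_addf[of "\<lambda>a. f a x" A "\<lambda>a. f a y"] cl x y by auto
  qed
qed

lemma subspace_vimage:
  assumes "vspace V" "vspace W" "linear_map V W f" "subspace_of Z W"
  shows "subspace_of {x \<in> carrier V. f x \<in> Z} V"
proof -
  interpret V: vspace V by fact
  show ?thesis
    by (rule subspaceI[OF assms(1)])
       (use subspaceD[OF assms(2,4)] linear_mapD[OF assms(3)] linear_map_zero[OF assms(1-3)] in auto)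
qed

lemma subspace_image:
  assumes "vspace V" "vspace W" "linear_map V W f" "subspace_of Z V"
  shows "subspace_of (f ` Z) W"
proof (rule subspaceI[OF assms(2)])
  note Z = subspaceD[OF assms(1,4)] and f = linear_mapD[OF assms(3)]
  show "f ` Z \<subseteq> carrier W" using Z(1) f(1) by auto
  show "\<zero>\<^bsub>W\<^esub> \<in> f ` Z" using linear_map_zero[OF assms(1-3)] Z(2) by force
  fix x y c assume x: "x \<in> f ` Z"
  then obtain x' where x': "x' \<in> Z" "x = f x'" by auto
  show "c \<odot>\<^bsub>W\<^esub> x \<in> f ` Z" using x' Z(1,4) f(3) by (auto intro!: image_eqI[of _ _ "c \<odot>\<^bsub>V\<^esub> x'"])
  assume y: "y \<in> f ` Z"
  then obtain y' where y': "y' \<in> Z" "y = f y'" by auto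
  show "x \<oplus>\<^bsub>W\<^esub> y \<in> f ` Z"
    using x' y' Z(3) f(2)[of x' y'] Z(1)[THEN subsetD] by (intro image_eqI[of _ _ "x' \<oplus>\<^bsub>V\<^esub> y'"]) auto
qed

lemma span_in_map:
  assumes "vspace V" "vspace W" "linear_map V W f" "B \<subseteq> carrier V" "subspace_of Z W"
    and "\<And>x. x \<in> B \<Longrightarrow> f x \<in> Z" "x \<in> span_in V B"
  shows "f x \<in> Z"
  using span_in_least[OF subspace_vimage[OF assms(1-3,5)], of B] assms by auto

subsection \<open>Quotients\<close>

abbreviation cls :: "(complex, 'a) module \<Rightarrow> 'a set \<Rightarrow> 'a \<Rightarrow> 'a set" where
  "cls V W x \<equiv> W +>\<^bsub>V\<^esub> x"

lemma abelian_subgroup_subspace: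
  assumes "vspace V" "subspace_of W V"
  shows "abelian_subgroup W V"
proof -
  interpret vspace V by fact
  show ?thesis
    using assms(2) by (intro abelian_subgroupI3 additive_subgroup.intro M.abelian_group_axioms)
      (simp add: submodule_def)
qed

lemma carrier_quot: "carrier (quot V W) = {cls V W x | x. x \<in> carrier V}"
  by (auto simp: quot_def A_RCOSETS_def')

lemma cls_in_quot: "x \<in> carrier V \<Longrightarrow> cls V W x \<in> carrier (quot V W)"
  by (auto simp: carrier_quot)

lemma quot_cases:
  assumes "C \<in> carrier (quot V W)" obtains x where "x \<in> carrier V" "C = cls V W x"
  using assms by (auto simp: carrier_quot)

lemma cls_mem:
  assumes "vspace V" "subspace_of W V" "x \<in> carrier V"
  shows "y \<in> cls V W x \<longleftrightarrow> y \<in> carrier V \<and> y \<ominus>\<^bsub>V\<^esub> x \<in> W"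
proof -
  interpret vspace V by fact
  interpret W: abelian_subgroup W V by (rule abelian_subgroup_subspace[OF assms(1,2)])
  show ?thesis
    using W.a_rcos_module[of x y] W.a_elemrcos_carrier[of x y] assms(3) by (auto simp: a_minus_def)
qed

lemma cls_eq_iff:
  assumes "vspace V" "subspace_of W V" "x \<in> carrier V" "y \<in> carrier V"
  shows "cls V W x = cls V W y \<longleftrightarrow> x \<ominus>\<^bsub>V\<^esub> y \<in> W"
proof -
  interpret vspace V by fact
  interpret W: abelian_subgroup W V by (rule abelian_subgroup_subspace[OF assms(1,2)])
  show ?thesis
    using cls_mem[OF assms(1,2,4), of x] W.a_repr_independence'[of x y] W.a_rcos_self[of x] assms(3,4)
    by auto
qed

lemma cls_self: "vspace V \<Longrightarrow> subspace_of W V \<Longrightarrow> x \<in> carrier V \<Longrightarrow> x \<in> cls V W x"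
  by (rule abelian_subgroup.a_rcos_self[OF abelian_subgroup_subspace])

lemma cls_zero:
  assumes "vspace V" "subspace_of W V" shows "cls V W \<zero>\<^bsub>V\<^esub> = W"
  using abelian_subgroup.a_rcos_const[OF abelian_subgroup_subspace[OF assms]] subspaceD(2)[OF assms] by auto

text \<open>
  Maps out of a quotient are unions over the elements of a coset; such a union is evaluated at any
  representative once the terms are known to agree.
\<close>

lemma UN_cls:
  assumes "vspace V" "subspace_of W V" "x \<in> carrier V"
    and "\<And>y. y \<in> carrier V \<Longrightarrow> y \<ominus>\<^bsub>V\<^esub> x \<in> W \<Longrightarrow> h y = h x"
  shows "(\<Union>y\<in>cls V W x. h y) = h x"
  using cls_mem[OF assms(1-3)] cls_self[OF assms(1-3)] assms(4) by blast

lemma quot_add: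
  assumes "vspace V" "subspace_of W V" "x \<in> carrier V" "y \<in> carrier V"
  shows "cls V W x \<oplus>\<^bsub>quot V W\<^esub> cls V W y = cls V W (x \<oplus>\<^bsub>V\<^esub> y)"
  using abelian_subgroup.a_rcos_sum[OF abelian_subgroup_subspace[OF assms(1,2)] assms(3,4)] by (simp add: quot_def)

lemma quot_map_cls:
  assumes "vspace V" "subspace_of W V" "vspace V'" "subspace_of W' V'" "linear_map V V' f"
    and "\<And>y. y \<in> W \<Longrightarrow> f y \<in> W'" "x \<in> carrier V"
  shows "quot_map V' W' f (cls V W x) = cls V' W' (f x)"
  unfolding quot_map_def
proof (rule UN_cls[OF assms(1,2,7)])
  fix y assume "y \<in> carrier V" "y \<ominus>\<^bsub>V\<^esub> x \<in> W"
  then show "cls V' W' (f y) = cls V' W' (f x)"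
    using cls_eq_iff[OF assms(3,4)] linear_map_minus[OF assms(1,3,5), of y x] assms(6)[of "y \<ominus>\<^bsub>V\<^esub> x"]
      linear_mapD(1)[OF assms(5)] assms(7) by auto
qed

lemma quot_smult:
  assumes "vspace V" "subspace_of W V" "x \<in> carrier V"
  shows "c \<odot>\<^bsub>quot V W\<^esub> cls V W x = cls V W (c \<odot>\<^bsub>V\<^esub> x)"
proof -
  interpret vspace V by fact
  have "linear_map V V (\<lambda>x. c \<odot>\<^bsub>V\<^esub> x)"
    by (rule linear_map_smult[OF assms(1)]) (auto simp: linear_map_def)
  then show ?thesis
    using quot_map_cls[OF assms(1,2,1,2) _ _ assms(3), of "\<lambda>x. c \<odot>\<^bsub>V\<^esub> x"] subspaceD(4)[OF assms(1,2)]
    by (simp add: quot_def quot_map_def)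
qed

lemma quot_zero: "\<zero>\<^bsub>quot V W\<^esub> = W"
  by (simp add: quot_def)

lemma vspace_quot:
  assumes V: "vspace V" and W: "subspace_of W V"
  shows "vspace (quot V W)"
proof -
  interpret vspace V by fact
  note [simp] = quot_add[OF V W] quot_smult[OF V W]
  have z: "\<zero>\<^bsub>quot V W\<^esub> = cls V W \<zero>\<^bsub>V\<^esub>" by (simp add: quot_zero cls_zero[OF V W])
  show ?thesis
    by (rule vspaceI; (elim quot_cases)?)
       (auto simp: z cls_in_quot M.a_ac scale_add_left scale_add_right scale_scale)
qed

lemma linear_map_quot_map:
  assumes "vspace V" "subspace_of W V" "vspace V'" "subspace_of W' V'" "linear_map V V' f"
    and "\<And>y. y \<in> W \<Longrightarrow> f y \<in> W'"
  shows "linear_map (quot V W) (quot V' W') (quot_map V' W' f)"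
proof -
  interpret V: vspace V by fact
  note [simp] = quot_map_cls[OF assms(1-6)] quot_add[OF assms(1,2)] quot_smult[OF assms(1,2)]
     quot_add[OF assms(3,4)] quot_smult[OF assms(3,4)]
  show ?thesis
    by (rule linear_mapI; elim quot_cases) (simp_all add: cls_in_quot linear_mapD[OF assms(5)])
qed

lemma linear_map_cls:
  assumes "vspace V" "subspace_of W V"
  shows "linear_map V (quot V W) (cls V W)"
  using assms by (auto intro!: linear_mapI simp: cls_in_quot quot_add quot_smult)

lemma quot_lift:
  assumes "vspace V" "subspace_of W V" "vspace V'" "linear_map V V' f"
    and "\<And>y. y \<in> W \<Longrightarrow> f y = \<zero>\<^bsub>V'\<^esub>"
  obtains g where "linear_map (quot V W) V' g" "\<And>x. x \<in> carrier V \<Longrightarrow> g (cls V W x) = f x"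
proof -
  interpret V: vspace V by fact
  interpret V': vspace V' by fact
  define g where "g C = f (SOME x. x \<in> C)" for C
  have g: "g (cls V W x) = f x" if x: "x \<in> carrier V" for x
  proof -
    have "(SOME y. y \<in> cls V W x) \<in> cls V W x" (is "?y \<in> _")
      using cls_self[OF assms(1,2) x] by (rule someI)
    then have y: "?y \<in> carrier V" "?y \<ominus>\<^bsub>V\<^esub> x \<in> W" using cls_mem[OF assms(1,2) x] by auto
    then have "f ?y \<ominus>\<^bsub>V'\<^esub> f x = \<zero>\<^bsub>V'\<^esub>"
      using assms(5) linear_map_minus[OF assms(1,3,4) _ x, of ?y] by metis
    then show ?thesis using linear_mapD(1)[OF assms(4)] x y(1) by (simp add: g_def V'.eq_if_minus_zero)
  qed
  note [simp] = g quot_add[OF assms(1,2)] quot_smult[OF assms(1,2)]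
  have "linear_map (quot V W) V' g"
    by (rule linear_mapI; elim quot_cases) (simp_all add: cls_in_quot linear_mapD[OF assms(4)])
  then show thesis using that g by blast
qed

subsection \<open>Direct sums and free vector spaces\<close>

lemma vspace_dsum:
  fixes M :: "'i \<Rightarrow> (complex, 'a) module"
  assumes "\<And>i. i \<in> I \<Longrightarrow> vspace (M i)"
  shows "vspace (dsum I M)"
proof (rule vspaceI)
  fix x y z :: "'i \<Rightarrow> 'a" and c d
  assume x: "x \<in> carrier (dsum I M)"
  have 1: "x i \<in> carrier (M i) \<and> \<zero>\<^bsub>M i\<^esub> \<oplus>\<^bsub>M i\<^esub> x i = x i \<and> 0 \<odot>\<^bsub>M i\<^esub> x i = \<zero>\<^bsub>M i\<^esub> \<and>
      c \<odot>\<^bsub>M i\<^esub> x i \<in> carrier (M i) \<and> (c + d) \<odot>\<^bsub>M i\<^esub> x i = c \<odot>\<^bsub>M i\<^esub> x i \<oplus>\<^bsub>M i\<^esub> d \<odot>\<^bsub>M i\<^esub> x i \<and>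
      (c * d) \<odot>\<^bsub>M i\<^esub> x i = c \<odot>\<^bsub>M i\<^esub> (d \<odot>\<^bsub>M i\<^esub> x i) \<and> 1 \<odot>\<^bsub>M i\<^esub> x i = x i" if "i \<in> I" for i
  proof -
    interpret vspace "M i" using assms that .
    have "x i \<in> carrier (M i)" using x that by (auto simp: dsum_def)
    then show ?thesis by (simp add: scale_add_left scale_scale)
  qed
  then show "\<zero>\<^bsub>dsum I M\<^esub> \<oplus>\<^bsub>dsum I M\<^esub> x = x" "0 \<odot>\<^bsub>dsum I M\<^esub> x = \<zero>\<^bsub>dsum I M\<^esub>"
    "c \<odot>\<^bsub>dsum I M\<^esub> x \<in> carrier (dsum I M)"
    "(c + d) \<odot>\<^bsub>dsum I M\<^esub> x = c \<odot>\<^bsub>dsum I M\<^esub> x \<oplus>\<^bsub>dsum I M\<^esub> d \<odot>\<^bsub>dsum I M\<^esub> x"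
    "(c * d) \<odot>\<^bsub>dsum I M\<^esub> x = c \<odot>\<^bsub>dsum I M\<^esub> (d \<odot>\<^bsub>dsum I M\<^esub> x)" "1 \<odot>\<^bsub>dsum I M\<^esub> x = x"
    using x by (auto simp: dsum_def fun_eq_iff restrict_def dest: PiE_arb)
  assume y: "y \<in> carrier (dsum I M)"
  have 2: "x i \<oplus>\<^bsub>M i\<^esub> y i \<in> carrier (M i) \<and>
      c \<odot>\<^bsub>M i\<^esub> (x i \<oplus>\<^bsub>M i\<^esub> y i) = c \<odot>\<^bsub>M i\<^esub> x i \<oplus>\<^bsub>M i\<^esub> c \<odot>\<^bsub>M i\<^esub> y i" if "i \<in> I" for i
  proof -
    interpret vspace "M i" using assms that .
    have "x i \<in> carrier (M i)" "y i \<in> carrier (M i)" using x y that by (auto simp: dsum_def)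
    then show ?thesis by (auto simp: scale_add_right)
  qed
  then show "x \<oplus>\<^bsub>dsum I M\<^esub> y \<in> carrier (dsum I M)"
    "c \<odot>\<^bsub>dsum I M\<^esub> (x \<oplus>\<^bsub>dsum I M\<^esub> y) = c \<odot>\<^bsub>dsum I M\<^esub> x \<oplus>\<^bsub>dsum I M\<^esub> c \<odot>\<^bsub>dsum I M\<^esub> y"
    by (auto simp: dsum_def intro!: restrict_ext)
  have "x i \<oplus>\<^bsub>M i\<^esub> y i = y i \<oplus>\<^bsub>M i\<^esub> x i" if "i \<in> I" for i
  proof -
    interpret vspace "M i" using assms that .
    show ?thesis using x y that by (auto simp: dsum_def intro!: M.a_comm)
  qed
  then show "x \<oplus>\<^bsub>dsum I M\<^esub> y = y \<oplus>\<^bsub>dsum I M\<^esub> x"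
    unfolding dsum_def by (auto intro!: restrict_ext)
  assume z: "z \<in> carrier (dsum I M)"
  have "(x i \<oplus>\<^bsub>M i\<^esub> y i) \<oplus>\<^bsub>M i\<^esub> z i = x i \<oplus>\<^bsub>M i\<^esub> (y i \<oplus>\<^bsub>M i\<^esub> z i)" if "i \<in> I" for i
  proof -
    interpret vspace "M i" using assms that .
    show ?thesis using x y z that by (auto simp: dsum_def intro!: M.a_assoc)
  qed
  then show "(x \<oplus>\<^bsub>dsum I M\<^esub> y) \<oplus>\<^bsub>dsum I M\<^esub> z = x \<oplus>\<^bsub>dsum I M\<^esub> (y \<oplus>\<^bsub>dsum I M\<^esub> z)"
    by (auto simp: dsum_def intro!: restrict_ext)
next
  have "\<zero>\<^bsub>M i\<^esub> \<in> carrier (M i)" if "i \<in> I" for i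
  proof -
    interpret vspace "M i" using assms that .
    show ?thesis by simp
  qed
  then show "\<zero>\<^bsub>dsum I M\<^esub> \<in> carrier (dsum I M)" by (auto simp: dsum_def)
qed

lemma dsum_simps:
  "carrier (dsum I M) = (\<Pi>\<^sub>E i\<in>I. carrier (M i))"
  "x \<oplus>\<^bsub>dsum I M\<^esub> y = (\<lambda>i\<in>I. x i \<oplus>\<^bsub>M i\<^esub> y i)"
  "c \<odot>\<^bsub>dsum I M\<^esub> x = (\<lambda>i\<in>I. c \<odot>\<^bsub>M i\<^esub> x i)"
  "\<zero>\<^bsub>dsum I M\<^esub> = (\<lambda>i\<in>I. \<zero>\<^bsub>M i\<^esub>)"
  by (simp_all add: dsum_def)

lemma linear_map_dsum_proj: "i \<in> I \<Longrightarrow> linear_map (dsum I M) (M i) (\<lambda>x. x i)"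
  by (auto intro!: linear_mapI simp: dsum_simps)

lemma linear_map_to_dsum:
  assumes "\<And>i. i \<in> I \<Longrightarrow> linear_map V (M i) (f i)"
  shows "linear_map V (dsum I M) (\<lambda>x. \<lambda>i\<in>I. f i x)"
  using linear_mapD[OF assms] by (auto intro!: linear_mapI restrict_ext simp: dsum_simps)

lemma free_simps:
  "carrier (free A) = {c. finite {a. c a \<noteq> 0} \<and> {a. c a \<noteq> 0} \<subseteq> A}"
  "c \<oplus>\<^bsub>free A\<^esub> d = (\<lambda>a. c a + d a)" "z \<odot>\<^bsub>free A\<^esub> c = (\<lambda>a. z * c a)" "\<zero>\<^bsub>free A\<^esub> = (\<lambda>_. 0)"
  by (simp_all add: free_def)

lemma free_addI:
  assumes "c \<in> carrier (free A)" "d \<in> carrier (free A)"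
  shows "(\<lambda>a. c a + d a) \<in> carrier (free A)"
proof -
  have "{a. c a + d a \<noteq> 0} \<subseteq> {a. c a \<noteq> 0} \<union> {a. d a \<noteq> 0}" by auto
  then show ?thesis using assms finite_subset[of "{a. c a + d a \<noteq> 0}"] by (auto simp: free_simps)
qed

lemma vspace_free: "vspace (free A)"
proof (rule vspaceI)
  show "z \<odot>\<^bsub>free A\<^esub> c \<in> carrier (free A)" if "c \<in> carrier (free A)" for z c
    using that finite_subset[of "{a. z * c a \<noteq> 0}" "{a. c a \<noteq> 0}"] by (auto simp: free_simps)
  show "c \<oplus>\<^bsub>free A\<^esub> d \<in> carrier (free A)" if "c \<in> carrier (free A)" "d \<in> carrier (free A)" for c d
    using free_addI[OF that] by (simp add: free_simps)
qed (auto simp: free_simps algebra_simps)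

lemma free_minus:
  assumes "c \<in> carrier (free A)" "d \<in> carrier (free A)"
  shows "c \<ominus>\<^bsub>free A\<^esub> d = (\<lambda>a. c a - d a)"
  using vspace.neg_scale[OF vspace_free assms(2)] by (simp add: a_minus_def free_simps)

lemma free_smultI: "c \<in> carrier (free A) \<Longrightarrow> (\<lambda>a. z * c a) \<in> carrier (free A)"
  using vspace.scale_closed[OF vspace_free, of c A z] by (simp add: free_simps)

lemma free_diffI:
  assumes "c \<in> carrier (free A)" "d \<in> carrier (free A)"
  shows "(\<lambda>a. c a - d a) \<in> carrier (free A)"
  using free_addI[OF assms(1) free_smultI[OF assms(2), of "-1"]] by simp

lemma delta_in_free: "delta a \<in> carrier (free A) \<longleftrightarrow> a \<in> A"
proof -
  have "{x. delta a x \<noteq> 0} = {a}" by (auto simp: delta_def)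
  then show ?thesis by (simp add: free_simps)
qed

lemma free_mono: "A \<subseteq> B \<Longrightarrow> c \<in> carrier (free A) \<Longrightarrow> c \<in> carrier (free B)"
  by (auto simp: free_simps)

lemma free_induct:
  assumes "c \<in> carrier (free A)" and Z: "subspace_of Z (free A)" and d: "\<And>a. a \<in> A \<Longrightarrow> delta a \<in> Z"
  shows "c \<in> Z"
proof -
  have "finite T \<Longrightarrow> T \<subseteq> A \<Longrightarrow> {a. c a \<noteq> 0} \<subseteq> T \<Longrightarrow> c \<in> Z" for T c
  proof (induction T arbitrary: c rule: finite_induct)
    case empty
    then have "c = \<zero>\<^bsub>free A\<^esub>" by (auto simp: free_simps)
    then show ?case using subspaceD(2)[OF vspace_free Z] by simp
  next
    case (insert b T)
    have "c = (\<lambda>a. (c(b := 0)) a) \<oplus>\<^bsub>free A\<^esub> (c b \<odot>\<^bsub>free A\<^esub> delta b)" by (auto simp: free_simps delta_def)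
    moreover have "c(b := 0) \<in> Z" using insert by (intro insert.IH) auto
    ultimately show ?case using subspaceD(3,4)[OF vspace_free Z] d insert.prems by (metis insert_subset)
  qed
  then show ?thesis using assms(1) by (auto simp: free_simps)
qed

definition lin_ext :: "(complex, 'b) module \<Rightarrow> ('a \<Rightarrow> 'b) \<Rightarrow> ('a \<Rightarrow> complex) \<Rightarrow> 'b" where
  "lin_ext V h c = (\<Oplus>\<^bsub>V\<^esub>a\<in>{a. c a \<noteq> 0}. c a \<odot>\<^bsub>V\<^esub> h a)"

text \<open>
  Linearity compares vectors with different supports, so the defining sums are first brought to a
  common finite index set.
\<close>

lemma lin_ext_superset:
  assumes "vspace V" "\<And>a. a \<in> A \<Longrightarrow> h a \<in> carrier V" "finite T" "{a. c a \<noteq> 0} \<subseteq> T" "T \<subseteq> A"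
  shows "lin_ext V h c = (\<Oplus>\<^bsub>V\<^esub>a\<in>T. c a \<odot>\<^bsub>V\<^esub> h a)"
proof -
  interpret V: vspace V by fact
  show ?thesis unfolding lin_ext_def
    using assms by (intro V.add.finprod_mono_neutral_cong_left) auto
qed

lemma linear_map_lin_ext:
  fixes A :: "'a set"
  assumes V: "vspace V" and h: "\<And>a. a \<in> A \<Longrightarrow> h a \<in> carrier V"
  shows "linear_map (free A) V (lin_ext V h)"
proof (rule linear_mapI)
  interpret V: vspace V by fact
  fix c d :: "'a \<Rightarrow> complex" and z
  assume c: "c \<in> carrier (free A)"
  let ?T = "{a. c a \<noteq> 0}"
  have T: "finite ?T" "?T \<subseteq> A" using c by (auto simp: free_simps)
  show "lin_ext V h c \<in> carrier V"
    unfolding lin_ext_def using T h by (intro V.finsum_closed) auto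
  have "lin_ext V h (\<lambda>a. z * c a) = (\<Oplus>\<^bsub>V\<^esub>a\<in>?T. (z * c a) \<odot>\<^bsub>V\<^esub> h a)"
    using T by (intro lin_ext_superset[where A = A] V h) auto
  also have "\<dots> = (\<Oplus>\<^bsub>V\<^esub>a\<in>?T. z \<odot>\<^bsub>V\<^esub> (c a \<odot>\<^bsub>V\<^esub> h a))"
    using T h by (intro V.finsum_cong') (auto simp: V.scale_scale)
  also have "\<dots> = z \<odot>\<^bsub>V\<^esub> lin_ext V h c"
    unfolding lin_ext_def using T h by (subst V.finsum_smult_ldistr) auto
  finally show "lin_ext V h (z \<odot>\<^bsub>free A\<^esub> c) = z \<odot>\<^bsub>V\<^esub> lin_ext V h c" by (simp add: free_simps)
  assume d: "d \<in> carrier (free A)"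
  let ?U = "{a. c a \<noteq> 0} \<union> {a. d a \<noteq> 0}"
  have U: "finite ?U" "?U \<subseteq> A" using c d by (auto simp: free_simps)
  have "lin_ext V h (\<lambda>a. c a + d a) = (\<Oplus>\<^bsub>V\<^esub>a\<in>?U. (c a + d a) \<odot>\<^bsub>V\<^esub> h a)"
    using U by (intro lin_ext_superset[where A = A] V h) auto
  also have "\<dots> = (\<Oplus>\<^bsub>V\<^esub>a\<in>?U. c a \<odot>\<^bsub>V\<^esub> h a \<oplus>\<^bsub>V\<^esub> d a \<odot>\<^bsub>V\<^esub> h a)"
    using U h by (intro V.finsum_cong') (auto simp: V.scale_add_left)
  also have "\<dots> = (\<Oplus>\<^bsub>V\<^esub>a\<in>?U. c a \<odot>\<^bsub>V\<^esub> h a) \<oplus>\<^bsub>V\<^esub> (\<Oplus>\<^bsub>V\<^esub>a\<in>?U. d a \<odot>\<^bsub>V\<^esub> h a)"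
    using U h by (intro V.finsum_addf) auto
  also have "\<dots> = lin_ext V h c \<oplus>\<^bsub>V\<^esub> lin_ext V h d"
    using U by (subst (1 2) lin_ext_superset[where A = A and T = ?U, OF V h]) auto
  finally show "lin_ext V h (c \<oplus>\<^bsub>free A\<^esub> d) = lin_ext V h c \<oplus>\<^bsub>V\<^esub> lin_ext V h d" by (simp add: free_simps)
qed

lemma lin_ext_delta:
  assumes "vspace V" "h a \<in> carrier V"
  shows "lin_ext V h (delta a) = h a"
proof -
  interpret V: vspace V by fact
  have "{x. delta a x \<noteq> 0} = {a}" by (auto simp: delta_def)
  then show ?thesis using assms(2) by (simp add: lin_ext_def delta_def)
qed

lemma push_superset:
  assumes "finite T" "{a. c a \<noteq> 0} \<subseteq> T"
  shows "push h c b = (\<Sum>a\<in>T. if h a = b then c a else 0)"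
proof -
  have "push h c b = (\<Sum>a\<in>{a\<in>T. h a = b}. c a)"
    unfolding push_def using assms by (intro sum.mono_neutral_left) auto
  then show ?thesis using assms(1) by (simp add: sum.inter_filter)
qed

lemma linear_map_push:
  fixes A :: "'a set"
  assumes h: "\<And>a. a \<in> A \<Longrightarrow> h a \<in> B"
  shows "linear_map (free A) (free B) (push h)"
proof (rule linear_mapI)
  fix c d :: "'a \<Rightarrow> complex" and z
  assume c: "c \<in> carrier (free A)"
  let ?T = "{a. c a \<noteq> 0}"
  have T: "finite ?T" "?T \<subseteq> A" using c by (auto simp: free_simps)
  have sub: "{b. push h c b \<noteq> 0} \<subseteq> h ` ?T"
  proof
    fix b assume "b \<in> {b. push h c b \<noteq> 0}"
    then have ne: "push h c b \<noteq> 0" by simp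
    have "{a. c a \<noteq> 0 \<and> h a = b} \<noteq> {}"
    proof
      assume e: "{a. c a \<noteq> 0 \<and> h a = b} = {}"
      have "push h c b = 0" unfolding push_def e by simp
      then show False using ne by simp
    qed
    then show "b \<in> h ` ?T" by auto
  qed
  have "finite {b. push h c b \<noteq> 0}" by (rule finite_subset[OF sub]) (use T(1) in simp)
  moreover have "h ` ?T \<subseteq> B" using T(2) h by auto
  ultimately show "push h c \<in> carrier (free B)" using sub unfolding free_simps by simp
  show "push h (z \<odot>\<^bsub>free A\<^esub> c) = z \<odot>\<^bsub>free B\<^esub> push h c"
  proof
    fix b
    have "push h (\<lambda>a. z * c a) b = (\<Sum>a\<in>?T. if h a = b then z * c a else 0)"
      by (rule push_superset[OF T(1)]) auto
    also have "\<dots> = z * push h c b"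
      by (subst push_superset[OF T(1) order_refl]) (simp add: sum_distrib_left if_distrib cong: if_cong)
    finally show "push h (z \<odot>\<^bsub>free A\<^esub> c) b = (z \<odot>\<^bsub>free B\<^esub> push h c) b" by (simp add: free_simps)
  qed
  assume d: "d \<in> carrier (free A)"
  let ?U = "{a. c a \<noteq> 0} \<union> {a. d a \<noteq> 0}"
  have U: "finite ?U" "?U \<subseteq> A" using c d by (auto simp: free_simps)
  show "push h (c \<oplus>\<^bsub>free A\<^esub> d) = push h c \<oplus>\<^bsub>free B\<^esub> push h d"
  proof
    fix b
    have "push h (\<lambda>a. c a + d a) b = (\<Sum>a\<in>?U. if h a = b then c a + d a else 0)"
      by (rule push_superset[OF U(1)]) auto
    also have "\<dots> = (\<Sum>a\<in>?U. if h a = b then c a else 0) + (\<Sum>a\<in>?U. if h a = b then d a else 0)"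
      unfolding sum.distrib[symmetric] by (rule sum.cong) simp_all
    also have "\<dots> = push h c b + push h d b"
      by (subst (1 2) push_superset[OF U(1)]) auto
    finally show "push h (c \<oplus>\<^bsub>free A\<^esub> d) b = (push h c \<oplus>\<^bsub>free B\<^esub> push h d) b" by (simp add: free_simps)
  qed
qed

lemma push_delta [simp]: "push h (delta a) = delta (h a)"
proof
  fix b
  have "push h (delta a) b = (\<Sum>x\<in>{a}. if h x = b then delta a x else 0)"
    by (rule push_superset) (auto simp: delta_def)
  then show "push h (delta a) b = delta (h a) b" by (auto simp: delta_def)
qed

subsection \<open>Tensor products\<close>

lemma free_cls:
  assumes "subspace_of Z (free A)" "c \<in> carrier (free A)" "d \<in> carrier (free A)"
  shows "(\<lambda>a. c a - d a) \<in> Z \<Longrightarrow> cls (free A) Z c = cls (free A) Z d"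
    and "cls (free A) Z c \<oplus>\<^bsub>quot (free A) Z\<^esub> cls (free A) Z d = cls (free A) Z (\<lambda>a. c a + d a)"
    and "z \<odot>\<^bsub>quot (free A) Z\<^esub> cls (free A) Z c = cls (free A) Z (\<lambda>a. z * c a)"
  using cls_eq_iff[OF vspace_free assms] quot_add[OF vspace_free assms] quot_smult[OF vspace_free assms(1,2)]
  by (simp_all add: free_minus[OF assms(2,3)]) (simp_all add: free_simps)

abbreviation tens :: "(complex, 'a) module \<Rightarrow> (complex, 'b) module \<Rightarrow> 'a \<Rightarrow> 'b \<Rightarrow> ('a \<times> 'b \<Rightarrow> complex) set" where
  "tens V W x y \<equiv> cls (free (carrier V \<times> carrier W)) (tensor_rel V W) (delta (x, y))"

context
  fixes V :: "(complex, 'a) module" and W :: "(complex, 'b) module"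
  assumes V: "vspace V" and W: "vspace W"
begin

interpretation V: vspace V by (rule V)
interpretation W: vspace W by (rule W)

private abbreviation F where "F \<equiv> free (carrier V \<times> carrier W)"

lemma tensor_rel_gens:
  shows "x \<in> carrier V \<Longrightarrow> x' \<in> carrier V \<Longrightarrow> y \<in> carrier W \<Longrightarrow>
      (\<lambda>p. delta (x \<oplus>\<^bsub>V\<^esub> x', y) p - delta (x, y) p - delta (x', y) p) \<in> tensor_rel V W"
    "x \<in> carrier V \<Longrightarrow> y \<in> carrier W \<Longrightarrow> y' \<in> carrier W \<Longrightarrow>
      (\<lambda>p. delta (x, y \<oplus>\<^bsub>W\<^esub> y') p - delta (x, y) p - delta (x, y') p) \<in> tensor_rel V W"
    "x \<in> carrier V \<Longrightarrow> y \<in> carrier W \<Longrightarrow>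
      (\<lambda>p. delta (c \<odot>\<^bsub>V\<^esub> x, y) p - c * delta (x, y) p) \<in> tensor_rel V W"
    "x \<in> carrier V \<Longrightarrow> y \<in> carrier W \<Longrightarrow>
      (\<lambda>p. delta (x, c \<odot>\<^bsub>W\<^esub> y) p - c * delta (x, y) p) \<in> tensor_rel V W"
  unfolding tensor_rel_def by (blast intro: span_in_superset[THEN subsetD])+

lemma subspace_tensor_rel: "subspace_of (tensor_rel V W) F"
  unfolding tensor_rel_def
  by (rule subspace_span_in[OF vspace_free])
     (auto intro!: free_diffI free_smultI simp: delta_in_free)

lemma vspace_tensor: "vspace (tensor V W)"
  unfolding tensor_def by (rule vspace_quot[OF vspace_free subspace_tensor_rel])

lemma tens_closed: "x \<in> carrier V \<Longrightarrow> y \<in> carrier W \<Longrightarrow> tens V W x y \<in> carrier (tensor V W)"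
  unfolding tensor_def by (auto intro!: cls_in_quot simp: delta_in_free)

text \<open>
  The universal property of the relations: a linear map that sends the four kinds of generators into
  a subspace sends all relations there.
\<close>

lemma tensor_rel_least:
  assumes "vspace U" "linear_map F U f" "subspace_of Z U"
    and "\<And>x x' y. x \<in> carrier V \<Longrightarrow> x' \<in> carrier V \<Longrightarrow> y \<in> carrier W \<Longrightarrow>
      f (\<lambda>p. delta (x \<oplus>\<^bsub>V\<^esub> x', y) p - delta (x, y) p - delta (x', y) p) \<in> Z"
    and "\<And>x y y'. x \<in> carrier V \<Longrightarrow> y \<in> carrier W \<Longrightarrow> y' \<in> carrier W \<Longrightarrow>
      f (\<lambda>p. delta (x, y \<oplus>\<^bsub>W\<^esub> y') p - delta (x, y) p - delta (x, y') p) \<in> Z"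
    and "\<And>c x y. x \<in> carrier V \<Longrightarrow> y \<in> carrier W \<Longrightarrow>
      f (\<lambda>p. delta (c \<odot>\<^bsub>V\<^esub> x, y) p - c * delta (x, y) p) \<in> Z"
    and "\<And>c x y. x \<in> carrier V \<Longrightarrow> y \<in> carrier W \<Longrightarrow>
      f (\<lambda>p. delta (x, c \<odot>\<^bsub>W\<^esub> y) p - c * delta (x, y) p) \<in> Z"
    and "c \<in> tensor_rel V W"
  shows "f c \<in> Z"
  using assms(8) unfolding tensor_rel_def
  by (rule span_in_map[OF vspace_free assms(1,2) _ assms(3), rotated 2])
     (use assms(4-7) in \<open>auto intro!: free_diffI free_smultI simp: delta_in_free\<close>)

lemma tens_scale:
  assumes "x \<in> carrier V" "y \<in> carrier W"
  shows "tens V W (c \<odot>\<^bsub>V\<^esub> x) y = c \<odot>\<^bsub>tensor V W\<^esub> tens V W x y"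
    and "tens V W x (c \<odot>\<^bsub>W\<^esub> y) = c \<odot>\<^bsub>tensor V W\<^esub> tens V W x y"
proof -
  have d: "delta (x, y) \<in> carrier F" "delta (c \<odot>\<^bsub>V\<^esub> x, y) \<in> carrier F" "delta (x, c \<odot>\<^bsub>W\<^esub> y) \<in> carrier F"
    using assms by (auto simp: delta_in_free)
  show "tens V W (c \<odot>\<^bsub>V\<^esub> x) y = c \<odot>\<^bsub>tensor V W\<^esub> tens V W x y"
    "tens V W x (c \<odot>\<^bsub>W\<^esub> y) = c \<odot>\<^bsub>tensor V W\<^esub> tens V W x y"
    unfolding tensor_def free_cls(3)[OF subspace_tensor_rel d(1) d(1)]
    by (rule free_cls(1)[OF subspace_tensor_rel d(2) free_smultI[OF d(1)] tensor_rel_gens(3)]; use assms in simp)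
       (rule free_cls(1)[OF subspace_tensor_rel d(3) free_smultI[OF d(1)] tensor_rel_gens(4)]; use assms in simp)
qed

lemma tens_add:
  assumes "x \<in> carrier V" "x' \<in> carrier V" "y \<in> carrier W"
  shows "tens V W (x \<oplus>\<^bsub>V\<^esub> x') y = tens V W x y \<oplus>\<^bsub>tensor V W\<^esub> tens V W x' y"
proof -
  have d: "delta (x, y) \<in> carrier F" "delta (x', y) \<in> carrier F" "delta (x \<oplus>\<^bsub>V\<^esub> x', y) \<in> carrier F"
    using assms by (auto simp: delta_in_free)
  show ?thesis
    unfolding tensor_def free_cls(2)[OF subspace_tensor_rel d(1,2)]
    by (rule free_cls(1)[OF subspace_tensor_rel d(3) free_addI[OF d(1,2)]])
       (use tensor_rel_gens(1)[OF assms] in \<open>simp add: diff_diff_eq\<close>)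
qed

text \<open>
  The hypotheses say that \<open>W\<close> is a line with basis vector \<open>e\<close> and coordinate \<open>D\<close>; the inverse of
  \<open>x \<mapsto> x \<otimes> e\<close> is then \<open>x \<otimes> y \<mapsto> D y \<cdot> x\<close>. The functional guarantees that the line does not collapse.
\<close>

lemma bij_tens:
  assumes e: "e \<in> carrier W"
    and D: "\<And>y y'. y \<in> carrier W \<Longrightarrow> y' \<in> carrier W \<Longrightarrow> D (y \<oplus>\<^bsub>W\<^esub> y') = D y + (D y' :: complex)"
      "\<And>c y. y \<in> carrier W \<Longrightarrow> D (c \<odot>\<^bsub>W\<^esub> y) = c * D y" "D e = 1"
    and gen: "\<And>y. y \<in> carrier W \<Longrightarrow> \<exists>c. y = c \<odot>\<^bsub>W\<^esub> e"
  shows "bij_betw (\<lambda>x. tens V W x e) (carrier V) (carrier (tensor V W))"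
proof -
  interpret T: vspace "tensor V W" by (rule vspace_tensor)
  interpret F: vspace F by (rule vspace_free)
  define L where "L = lin_ext V (\<lambda>(x, y). D y \<odot>\<^bsub>V\<^esub> x)"
  have L: "linear_map F V L" unfolding L_def by (rule linear_map_lin_ext[OF V]) auto
  have Ld: "L (delta (x, y)) = D y \<odot>\<^bsub>V\<^esub> x" if "x \<in> carrier V" for x y
    unfolding L_def using that by (subst lin_ext_delta[OF V]) auto
  have Lsub: "L (\<lambda>p. c p - d p) = L c \<ominus>\<^bsub>V\<^esub> L d" if "c \<in> carrier F" "d \<in> carrier F" for c d
    using linear_map_minus[OF vspace_free V L that] by (simp add: free_minus[OF that])
  have Lscale: "L (\<lambda>p. z * c p) = z \<odot>\<^bsub>V\<^esub> L c" if "c \<in> carrier F" for c z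
    using linear_mapD(3)[OF L that, of z] by (simp add: free_simps)
  have vm: "a \<oplus>\<^bsub>V\<^esub> b \<ominus>\<^bsub>V\<^esub> a \<ominus>\<^bsub>V\<^esub> b = \<zero>\<^bsub>V\<^esub>" "a \<ominus>\<^bsub>V\<^esub> a = \<zero>\<^bsub>V\<^esub>" if "a \<in> carrier V" "b \<in> carrier V" for a b
  proof -
    have "a \<oplus>\<^bsub>V\<^esub> b \<ominus>\<^bsub>V\<^esub> a \<ominus>\<^bsub>V\<^esub> b = (a \<oplus>\<^bsub>V\<^esub> \<ominus>\<^bsub>V\<^esub> a) \<oplus>\<^bsub>V\<^esub> (b \<oplus>\<^bsub>V\<^esub> \<ominus>\<^bsub>V\<^esub> b)"
      using that by (simp add: a_minus_def V.M.a_ac)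
    then show "a \<oplus>\<^bsub>V\<^esub> b \<ominus>\<^bsub>V\<^esub> a \<ominus>\<^bsub>V\<^esub> b = \<zero>\<^bsub>V\<^esub>" using that by (simp add: V.M.r_neg)
    show "a \<ominus>\<^bsub>V\<^esub> a = \<zero>\<^bsub>V\<^esub>" using that by (simp add: a_minus_def V.M.r_neg)
  qed
  have z: "subspace_of {\<zero>\<^bsub>V\<^esub>} V" by (rule subspaceI[OF V]) auto
  have L0: "L c = \<zero>\<^bsub>V\<^esub>" if c: "c \<in> tensor_rel V W" for c
  proof -
    have "L c \<in> {\<zero>\<^bsub>V\<^esub>}"
      by (rule tensor_rel_least[OF V L z _ _ _ _ c])
         (simp_all add: Lsub Lscale Ld free_diffI free_smultI delta_in_free D vm V.scale_add_right V.scale_add_left V.scale_scale mult.commute)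
    then show ?thesis by simp
  qed
  show ?thesis
  proof (rule bij_betwI')
    fix x x' assume x: "x \<in> carrier V" "x' \<in> carrier V"
    show "tens V W x e = tens V W x' e \<longleftrightarrow> x = x'"
    proof
      assume "tens V W x e = tens V W x' e"
      then have "delta (x, e) \<ominus>\<^bsub>F\<^esub> delta (x', e) \<in> tensor_rel V W"
        using x e by (subst (asm) cls_eq_iff[OF vspace_free subspace_tensor_rel]) (auto simp: delta_in_free)
      then have "L (delta (x, e) \<ominus>\<^bsub>F\<^esub> delta (x', e)) = \<zero>\<^bsub>V\<^esub>" by (rule L0)
      then have "L (delta (x, e)) \<ominus>\<^bsub>V\<^esub> L (delta (x', e)) = \<zero>\<^bsub>V\<^esub>"
        using linear_map_minus[OF vspace_free V L, of "delta (x, e)" "delta (x', e)"] x e by (simp add: delta_in_free)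
      then show "x = x'" using x by (auto simp: Ld D(3) intro: V.eq_if_minus_zero)
    qed simp
  next
    fix x assume "x \<in> carrier V"
    then show "tens V W x e \<in> carrier (tensor V W)" using e by (rule tens_closed)
  next
    fix C assume "C \<in> carrier (tensor V W)"
    then obtain c where c: "c \<in> carrier F" "C = cls F (tensor_rel V W) c" unfolding tensor_def by (elim quot_cases)
    have T: "linear_map V (tensor V W) (\<lambda>x. tens V W x e)"
      by (rule linear_mapI) (use e in \<open>simp_all add: tens_closed tens_add tens_scale\<close>)
    have R: "subspace_of ((\<lambda>x. tens V W x e) ` carrier V) (tensor V W)"
      by (rule subspace_image[OF V vspace_tensor T V.carrier_is_submodule])
    have cl: "linear_map F (tensor V W) (cls F (tensor_rel V W))"
      unfolding tensor_def by (rule linear_map_cls[OF vspace_free subspace_tensor_rel])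
    have "c \<in> {c \<in> carrier F. cls F (tensor_rel V W) c \<in> (\<lambda>x. tens V W x e) ` carrier V}"
    proof (rule free_induct[OF c(1) subspace_vimage[OF vspace_free vspace_tensor cl R]])
      fix p assume p: "p \<in> carrier V \<times> carrier W"
      then obtain x y where xy: "p = (x, y)" "x \<in> carrier V" "y \<in> carrier W" by auto
      obtain s where "y = s \<odot>\<^bsub>W\<^esub> e" using gen xy(3) by blast
      then have "tens V W x y = tens V W (s \<odot>\<^bsub>V\<^esub> x) e" using xy e by (simp add: tens_scale)
      then show "delta p \<in> {c \<in> carrier F. cls F (tensor_rel V W) c \<in> (\<lambda>x. tens V W x e) ` carrier V}"
        using xy p by (auto simp: delta_in_free)
    qed
    then show "\<exists>x\<in>carrier V. C = tens V W x e" using c by auto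
  qed
qed

end

lemma tensor_map_tens:
  assumes V: "vspace V" and W: "vspace W" and V': "vspace V'" and W': "vspace W'"
    and f: "linear_map V V' f" and g: "linear_map W W' g" and x: "x \<in> carrier V" and y: "y \<in> carrier W"
  shows "tensor_map V' W' f g (tens V W x y) = tens V' W' (f x) (g y)"
proof -
  let ?F = "free (carrier V \<times> carrier W)" and ?F' = "free (carrier V' \<times> carrier W')"
  interpret V: vspace V by fact
  interpret W: vspace W by fact
  let ?p = "push (map_prod f g)"
  have p: "linear_map ?F ?F' ?p"
    by (rule linear_map_push) (use linear_mapD(1)[OF f] linear_mapD(1)[OF g] in auto)
  have sub: "?p (\<lambda>q. c q - d q) = (\<lambda>q. ?p c q - ?p d q)" if "c \<in> carrier ?F" "d \<in> carrier ?F" for c d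
    using linear_map_minus[OF vspace_free vspace_free p that] linear_mapD(1)[OF p that(1)] linear_mapD(1)[OF p that(2)]
    by (simp add: free_minus[OF that] free_minus)
  have sc: "?p (\<lambda>q. z * c q) = (\<lambda>q. z * ?p c q)" if "c \<in> carrier ?F" for c z
    using linear_mapD(3)[OF p that, of z] by (simp add: free_simps)
  have "?p c \<in> tensor_rel V' W'" if "c \<in> tensor_rel V W" for c
    by (rule tensor_rel_least[OF V W vspace_free p subspace_tensor_rel[OF V' W'] _ _ _ _ that])
       (simp_all add: sub sc free_diffI free_smultI delta_in_free linear_mapD[OF f] linear_mapD[OF g] tensor_rel_gens[OF V' W'])
  then show ?thesis
    unfolding tensor_map_def using x y
    by (subst quot_map_cls[OF vspace_free subspace_tensor_rel[OF V W] vspace_free subspace_tensor_rel[OF V' W'] p])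
       (auto simp: delta_in_free)
qed

subsection \<open>Exterior powers\<close>

abbreviation wdg :: "(complex, 'a) module \<Rightarrow> nat \<Rightarrow> 'a list \<Rightarrow> ('a list \<Rightarrow> complex) set" where
  "wdg W k ws \<equiv> cls (free (tuples W k)) (ext_rel W k) (delta ws)"

lemma tuples_simps [simp]:
  "us @ w # vs \<in> tuples W k \<longleftrightarrow>
     length us + Suc (length vs) = k \<and> set us \<subseteq> carrier W \<and> w \<in> carrier W \<and> set vs \<subseteq> carrier W"
  by (auto simp: tuples_def)

context
  fixes W :: "(complex, 'b) module"
  assumes W: "vspace W"
begin

interpretation W: vspace W by (rule W)

lemma ext_rel_gens:
  shows "us @ w # vs \<in> tuples W k \<Longrightarrow> us @ w' # vs \<in> tuples W k \<Longrightarrow>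
      (\<lambda>p. delta (us @ (w \<oplus>\<^bsub>W\<^esub> w') # vs) p - delta (us @ w # vs) p - delta (us @ w' # vs) p) \<in> ext_rel W k"
    "us @ w # vs \<in> tuples W k \<Longrightarrow>
      (\<lambda>p. delta (us @ (c \<odot>\<^bsub>W\<^esub> w) # vs) p - c * delta (us @ w # vs) p) \<in> ext_rel W k"
    "ws \<in> tuples W k \<Longrightarrow> \<not> distinct ws \<Longrightarrow> delta ws \<in> ext_rel W k"
  unfolding ext_rel_def
  by (rule span_in_superset[THEN subsetD], simp del: tuples_simps, blast)+

lemma ext_gens_in_free:
  "{(\<lambda>p. delta (us @ [w \<oplus>\<^bsub>W\<^esub> w'] @ vs) p - delta (us @ [w] @ vs) p - delta (us @ [w'] @ vs) p) |
         us w w' vs. us @ [w] @ vs \<in> tuples W k \<and> us @ [w'] @ vs \<in> tuples W k} \<union>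
      {(\<lambda>p. delta (us @ [c \<odot>\<^bsub>W\<^esub> w] @ vs) p - c * delta (us @ [w] @ vs) p) |
         us c w vs. us @ [w] @ vs \<in> tuples W k} \<union>
      {delta ws | ws. ws \<in> tuples W k \<and> \<not> distinct ws} \<subseteq> carrier (free (tuples W k))"
  by (auto intro!: free_diffI free_smultI simp: delta_in_free)

lemma subspace_ext_rel: "subspace_of (ext_rel W k) (free (tuples W k))"
  unfolding ext_rel_def by (rule subspace_span_in[OF vspace_free ext_gens_in_free])

lemma vspace_ext: "vspace (ext_power W k)"
  unfolding ext_power_def by (rule vspace_quot[OF vspace_free subspace_ext_rel])

lemma wdg_closed: "ws \<in> tuples W k \<Longrightarrow> wdg W k ws \<in> carrier (ext_power W k)"
  unfolding ext_power_def by (auto intro!: cls_in_quot simp: delta_in_free)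

lemma ext_rel_least:
  assumes "vspace U" "linear_map (free (tuples W k)) U f" "subspace_of Z U"
    and "\<And>us w w' vs. us @ w # vs \<in> tuples W k \<Longrightarrow> us @ w' # vs \<in> tuples W k \<Longrightarrow>
      f (\<lambda>p. delta (us @ (w \<oplus>\<^bsub>W\<^esub> w') # vs) p - delta (us @ w # vs) p - delta (us @ w' # vs) p) \<in> Z"
    and "\<And>us c w vs. us @ w # vs \<in> tuples W k \<Longrightarrow>
      f (\<lambda>p. delta (us @ (c \<odot>\<^bsub>W\<^esub> w) # vs) p - c * delta (us @ w # vs) p) \<in> Z"
    and "\<And>ws. ws \<in> tuples W k \<Longrightarrow> \<not> distinct ws \<Longrightarrow> f (delta ws) \<in> Z"
    and "c \<in> ext_rel W k"
  shows "f c \<in> Z"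
  using assms(7) unfolding ext_rel_def
  by (rule span_in_map[OF vspace_free assms(1,2) ext_gens_in_free assms(3), rotated])
     (use assms(4-6) in \<open>auto simp del: tuples_simps\<close>)

lemma linear_wdg_slot:
  assumes "length us + Suc (length vs) = k" "set us \<subseteq> carrier W" "set vs \<subseteq> carrier W"
  shows "linear_map W (ext_power W k) (\<lambda>w. wdg W k (us @ w # vs))"
proof (rule linear_mapI)
  fix w w' c assume w: "w \<in> carrier W"
  have d: "delta (us @ w # vs) \<in> carrier (free (tuples W k))" if "w \<in> carrier W" for w
    using that assms by (simp add: delta_in_free)
  show "wdg W k (us @ w # vs) \<in> carrier (ext_power W k)" using w assms by (intro wdg_closed) simp
  show "wdg W k (us @ (c \<odot>\<^bsub>W\<^esub> w) # vs) = c \<odot>\<^bsub>ext_power W k\<^esub> wdg W k (us @ w # vs)"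
    unfolding ext_power_def free_cls(3)[OF subspace_ext_rel d[OF w] d[OF w]]
    by (rule free_cls(1)[OF subspace_ext_rel d free_smultI[OF d[OF w]]])
       (use w assms in \<open>simp_all add: ext_rel_gens\<close>)
  assume w': "w' \<in> carrier W"
  show "wdg W k (us @ (w \<oplus>\<^bsub>W\<^esub> w') # vs) =
      wdg W k (us @ w # vs) \<oplus>\<^bsub>ext_power W k\<^esub> wdg W k (us @ w' # vs)"
    unfolding ext_power_def free_cls(2)[OF subspace_ext_rel d[OF w] d[OF w']]
    by (rule free_cls(1)[OF subspace_ext_rel d free_addI[OF d[OF w] d[OF w']]])
       (use w w' assms ext_rel_gens(1)[of us w vs k w'] in \<open>simp_all add: diff_diff_eq\<close>)
qed

lemma wdg_nondistinct:
  assumes "ws \<in> tuples W k" "\<not> distinct ws"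
  shows "wdg W k ws = \<zero>\<^bsub>ext_power W k\<^esub>"
proof -
  interpret F: vspace "free (tuples W k)" by (rule vspace_free)
  have "wdg W k ws = cls (free (tuples W k)) (ext_rel W k) \<zero>\<^bsub>free (tuples W k)\<^esub>"
    using assms ext_rel_gens(3)[OF assms]
    by (subst cls_eq_iff[OF vspace_free subspace_ext_rel]) (simp_all add: delta_in_free a_minus_def F.neg_scale)
  then show ?thesis by (simp add: cls_zero[OF vspace_free subspace_ext_rel] ext_power_def quot_zero)
qed

text \<open>
  The relations only kill tuples with a repeated entry; expanding the tuple with \<open>x + y\<close> in both
  places turns this into antisymmetry.
\<close>

lemma wdg_swap:
  assumes "us @ x # y # vs \<in> tuples W k"
  shows "wdg W k (us @ x # y # vs) = (- 1) \<odot>\<^bsub>ext_power W k\<^esub> wdg W k (us @ y # x # vs)"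
proof -
  interpret L: vspace "ext_power W k" by (rule vspace_ext)
  let ?t = "\<lambda>x y. wdg W k (us @ x # y # vs)"
  have a: "length us + Suc (Suc (length vs)) = k" "set us \<subseteq> carrier W" "set vs \<subseteq> carrier W"
    "x \<in> carrier W" "y \<in> carrier W"
    using assms by (auto simp: tuples_def)
  have 1: "linear_map W (ext_power W k) (\<lambda>w. ?t w z)" if "z \<in> carrier W" for z
    using linear_wdg_slot[of us "z # vs" k] a that by simp
  have 2: "linear_map W (ext_power W k) (?t z)" if "z \<in> carrier W" for z
    using linear_wdg_slot[of "us @ [z]" vs k] a that by simp
  have 0: "?t z z = \<zero>\<^bsub>ext_power W k\<^esub>" if "z \<in> carrier W" for z
    using wdg_nondistinct[of "us @ z # z # vs" k] a that by simp
  have c: "?t z z' \<in> carrier (ext_power W k)" if "z \<in> carrier W" "z' \<in> carrier W" for z z'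
    using linear_mapD(1)[OF 2 that(2)] that by simp
  have "?t (x \<oplus>\<^bsub>W\<^esub> y) (x \<oplus>\<^bsub>W\<^esub> y) = (?t x x \<oplus>\<^bsub>ext_power W k\<^esub> ?t y x) \<oplus>\<^bsub>ext_power W k\<^esub> (?t x y \<oplus>\<^bsub>ext_power W k\<^esub> ?t y y)"
    using a by (simp add: linear_mapD(2)[OF 1] linear_mapD(2)[OF 2])
  then have "?t x y \<oplus>\<^bsub>ext_power W k\<^esub> ?t y x = \<zero>\<^bsub>ext_power W k\<^esub>"
    using a 0 c by (simp add: L.M.a_comm)
  then have "?t x y = \<ominus>\<^bsub>ext_power W k\<^esub> ?t y x"
    using a c by (intro L.M.minus_equality[symmetric]) auto
  then show ?thesis using a c by (simp add: L.neg_scale)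
qed

text \<open>
  Both operations on exterior powers, functoriality and multiplication by a vector, are induced by an
  operation \<open>h\<close> on tuples; they descend to the quotient because \<open>h\<close> respects the three kinds of
  relations.
\<close>

lemma push_ext_rel:
  assumes U: "vspace U" and f: "linear_map (free (tuples W k)) (free (tuples U m)) (push h)"
    and "\<And>us w w' vs. us @ w # vs \<in> tuples W k \<Longrightarrow> us @ w' # vs \<in> tuples W k \<Longrightarrow>
      (\<lambda>p. delta (h (us @ (w \<oplus>\<^bsub>W\<^esub> w') # vs)) p - delta (h (us @ w # vs)) p - delta (h (us @ w' # vs)) p) \<in> ext_rel U m"
    and "\<And>us c w vs. us @ w # vs \<in> tuples W k \<Longrightarrow>
      (\<lambda>p. delta (h (us @ (c \<odot>\<^bsub>W\<^esub> w) # vs)) p - c * delta (h (us @ w # vs)) p) \<in> ext_rel U m"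
    and "\<And>ws. ws \<in> tuples W k \<Longrightarrow> \<not> distinct ws \<Longrightarrow> delta (h ws) \<in> ext_rel U m"
    and Z: "subspace_of (ext_rel U m) (free (tuples U m))"
  shows "ws \<in> tuples W k \<Longrightarrow> quot_map (free (tuples U m)) (ext_rel U m) (push h) (wdg W k ws) = wdg U m (h ws)"
    and "linear_map (ext_power W k) (ext_power U m) (quot_map (free (tuples U m)) (ext_rel U m) (push h))"
proof -
  let ?F = "free (tuples W k)"
  have sub: "push h (\<lambda>q. c q - d q) = (\<lambda>q. push h c q - push h d q)" if "c \<in> carrier ?F" "d \<in> carrier ?F" for c d
    using linear_map_minus[OF vspace_free vspace_free f that] linear_mapD(1)[OF f that(1)] linear_mapD(1)[OF f that(2)]
    by (simp add: free_minus[OF that] free_minus)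
  have sc: "push h (\<lambda>q. z * c q) = (\<lambda>q. z * push h c q)" if "c \<in> carrier ?F" for c z
    using linear_mapD(3)[OF f that, of z] by (simp add: free_simps)
  have *: "push h c \<in> ext_rel U m" if "c \<in> ext_rel W k" for c
    by (rule ext_rel_least[OF vspace_free f Z _ _ _ that])
       (use assms(3-5) in \<open>simp_all add: sub sc free_diffI free_smultI delta_in_free\<close>)
  show "ws \<in> tuples W k \<Longrightarrow> quot_map (free (tuples U m)) (ext_rel U m) (push h) (wdg W k ws) = wdg U m (h ws)"
    by (subst quot_map_cls[OF vspace_free subspace_ext_rel vspace_free Z f *]) (simp_all add: delta_in_free)
  show "linear_map (ext_power W k) (ext_power U m) (quot_map (free (tuples U m)) (ext_rel U m) (push h))"
    unfolding ext_power_def by (rule linear_map_quot_map[OF vspace_free subspace_ext_rel vspace_free Z f *])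
qed

end

lemma ext_map:
  assumes W: "vspace W" and U: "vspace U" and f: "linear_map W U f"
  shows ext_map_wdg: "ws \<in> tuples W k \<Longrightarrow> ext_map U k f (wdg W k ws) = wdg U k (map f ws)"
    and linear_map_ext_map: "linear_map (ext_power W k) (ext_power U k) (ext_map U k f)"
proof -
  have s: "f ` A \<subseteq> carrier U" if "A \<subseteq> carrier W" for A using linear_mapD(1)[OF f] that by auto
  have t: "map f ws \<in> tuples U k" if "ws \<in> tuples W k" for ws using s that by (simp add: tuples_def)
  have p: "linear_map (free (tuples W k)) (free (tuples U k)) (push (map f))" by (rule linear_map_push) (rule t)
  have g3: "delta (map f ws) \<in> ext_rel U k" if "ws \<in> tuples W k" "\<not> distinct ws" for ws
    using ext_rel_gens(3)[OF U t[OF that(1)]] that(2) by (simp add: distinct_map)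
  have g1: "(\<lambda>p. delta (map f (us @ (w \<oplus>\<^bsub>W\<^esub> w') # vs)) p - delta (map f (us @ w # vs)) p -
      delta (map f (us @ w' # vs)) p) \<in> ext_rel U k"
    if "us @ w # vs \<in> tuples W k" "us @ w' # vs \<in> tuples W k" for us w w' vs
    using ext_rel_gens(1)[OF U, of "map f us" "f w" "map f vs" k "f w'"] t[OF that(1)] t[OF that(2)] that
    by (simp add: linear_mapD[OF f])
  have g2: "(\<lambda>p. delta (map f (us @ (c \<odot>\<^bsub>W\<^esub> w) # vs)) p - c * delta (map f (us @ w # vs)) p) \<in> ext_rel U k"
    if "us @ w # vs \<in> tuples W k" for us c w vs
    using ext_rel_gens(2)[OF U, of "map f us" "f w" "map f vs" k c] t[OF that] that
    by (simp add: linear_mapD[OF f])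
  show "ws \<in> tuples W k \<Longrightarrow> ext_map U k f (wdg W k ws) = wdg U k (map f ws)"
    unfolding ext_map_def by (rule push_ext_rel(1)[OF W U p g1 g2 g3 subspace_ext_rel[OF U]])
  show "linear_map (ext_power W k) (ext_power U k) (ext_map U k f)"
    unfolding ext_map_def by (rule push_ext_rel(2)[OF W U p g1 g2 g3 subspace_ext_rel[OF U]])
qed

text \<open>
  The vector is appended on the right, so that \<open>\<omega>\<close> is sent to \<open>\<omega> \<and> e\<close>.
\<close>

lemma ext_wedge:
  assumes W: "vspace W" and U: "vspace U" and e: "e \<in> carrier U"
    and sub: "carrier W \<subseteq> carrier U" "\<And>x y. x \<oplus>\<^bsub>W\<^esub> y = x \<oplus>\<^bsub>U\<^esub> y" "\<And>c x. c \<odot>\<^bsub>W\<^esub> x = c \<odot>\<^bsub>U\<^esub> x"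
  shows ext_wedge_wdg: "ws \<in> tuples W k \<Longrightarrow> ext_wedge U k e (wdg W k ws) = wdg U (Suc k) (ws @ [e])"
    and linear_map_ext_wedge: "linear_map (ext_power W k) (ext_power U (Suc k)) (ext_wedge U k e)"
proof -
  have t: "ws @ [e] \<in> tuples U (Suc k)" if "ws \<in> tuples W k" for ws using sub(1) e that by (auto simp: tuples_def)
  have p: "linear_map (free (tuples W k)) (free (tuples U (Suc k))) (push (\<lambda>ws. ws @ [e]))"
    by (rule linear_map_push) (rule t)
  have g3: "delta (ws @ [e]) \<in> ext_rel U (Suc k)" if "ws \<in> tuples W k" "\<not> distinct ws" for ws
    using ext_rel_gens(3)[OF U t[OF that(1)]] that(2) by simp
  have g1: "(\<lambda>p. delta ((us @ (w \<oplus>\<^bsub>W\<^esub> w') # vs) @ [e]) p - delta ((us @ w # vs) @ [e]) p -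
      delta ((us @ w' # vs) @ [e]) p) \<in> ext_rel U (Suc k)"
    if "us @ w # vs \<in> tuples W k" "us @ w' # vs \<in> tuples W k" for us w w' vs
    using ext_rel_gens(1)[OF U, of us w "vs @ [e]" "Suc k" w'] t[OF that(1)] t[OF that(2)] by (simp add: sub(2))
  have g2: "(\<lambda>p. delta ((us @ (c \<odot>\<^bsub>W\<^esub> w) # vs) @ [e]) p - c * delta ((us @ w # vs) @ [e]) p) \<in> ext_rel U (Suc k)"
    if "us @ w # vs \<in> tuples W k" for us c w vs
    using ext_rel_gens(2)[OF U, of us w "vs @ [e]" "Suc k" c] t[OF that] by (simp add: sub(3))
  show "ws \<in> tuples W k \<Longrightarrow> ext_wedge U k e (wdg W k ws) = wdg U (Suc k) (ws @ [e])"
    unfolding ext_wedge_def by (rule push_ext_rel(1)[OF W U p g1 g2 g3 subspace_ext_rel[OF U]])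
  show "linear_map (ext_power W k) (ext_power U (Suc k)) (ext_wedge U k e)"
    unfolding ext_wedge_def by (rule push_ext_rel(2)[OF W U p g1 g2 g3 subspace_ext_rel[OF U]])
qed

subsection \<open>Sorting signs\<close>

fun inversions :: "('a \<Rightarrow> nat) \<Rightarrow> 'a list \<Rightarrow> nat" where
  "inversions ord [] = 0"
| "inversions ord (x # xs) = card {y \<in> set xs. ord y < ord x} + inversions ord xs"

text \<open>
  Sorting by the keys and reading the elements off the sorted keys gives the increasing enumeration
  when \<open>ord\<close> is injective on \<open>B\<close>; there is no linear order on the elements themselves.
\<close>

definition sorted_enum :: "('a \<Rightarrow> nat) \<Rightarrow> 'a set \<Rightarrow> 'a list" where
  "sorted_enum ord B = map (inv_into B ord) (sorted_list_of_set (ord ` B))"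

context
  fixes ord :: "'a \<Rightarrow> nat" and B :: "'a set"
  assumes fin: "finite B" and inj: "inj_on ord B"
begin

lemma map_ord_sorted_enum: "map ord (sorted_enum ord B) = sorted_list_of_set (ord ` B)"
  unfolding sorted_enum_def map_map
  by (rule map_idI) (use fin in \<open>auto simp: f_inv_into_f\<close>)

lemma sorted_enum:
  "set (sorted_enum ord B) = B" "distinct (sorted_enum ord B)" "sorted (map ord (sorted_enum ord B))"
proof -
  show "set (sorted_enum ord B) = B"
    using fin inj by (auto simp: sorted_enum_def image_image)
  show "distinct (sorted_enum ord B)"
    using map_ord_sorted_enum fin by (metis distinct_map sorted_list_of_set.distinct_sorted_key_list_of_set)
  show "sorted (map ord (sorted_enum ord B))" by (simp add: map_ord_sorted_enum)
qed

lemma sort_key_eq_sorted_enum: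
  assumes "distinct l" "set l = B"
  shows "sort_key ord l = sorted_enum ord B"
proof (rule map_sorted_distinct_set_unique[where f = ord])
  show "distinct (map ord (sort_key ord l))" "distinct (map ord (sorted_enum ord B))"
    using assms sorted_enum inj by (auto simp: distinct_map)
qed (use assms sorted_enum inj in auto)

text \<open>
  Each step of insertion sort past a smaller element is a transposition of neighbours and costs a
  sign, so an alternating function of lists is determined by its value at the sorted list.
\<close>

lemma alternating_insort:
  assumes M: "vspace M"
    and F: "\<And>l. distinct l \<Longrightarrow> set l = B \<Longrightarrow> F l \<in> carrier M"
    and swap: "\<And>us x y vs. distinct (us @ x # y # vs) \<Longrightarrow> set (us @ x # y # vs) = B \<Longrightarrow>
      F (us @ x # y # vs) = (- 1) \<odot>\<^bsub>M\<^esub> F (us @ y # x # vs)"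
    and "sorted (map ord l)" "distinct (us @ x # l)" "set (us @ x # l) = B"
  shows "F (us @ x # l) = (- 1) ^ card {y \<in> set l. ord y < ord x} \<odot>\<^bsub>M\<^esub> F (us @ insort_key ord x l)"
  using assms(4-6)
proof (induction l arbitrary: us)
  case Nil
  interpret vspace M by fact
  show ?case using F[OF Nil(2,3)] by simp
next
  case (Cons y l)
  interpret vspace M by fact
  show ?case
  proof (cases "ord x \<le> ord y")
    case True
    then have e: "{z \<in> set (y # l). ord z < ord x} = {}" using Cons.prems(1) by auto
    show ?thesis unfolding e using True F[OF Cons.prems(2,3)] by simp
  next
    case False
    have e: "{z \<in> set (y # l). ord z < ord x} = insert y {z \<in> set l. ord z < ord x}" using False by auto
    have c: "card {z \<in> set (y # l). ord z < ord x} = Suc (card {z \<in> set l. ord z < ord x})"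
      unfolding e using Cons.prems(2) by (subst card_insert_disjoint) auto
    have IH: "F ((us @ [y]) @ x # l) =
        (- 1) ^ card {y \<in> set l. ord y < ord x} \<odot>\<^bsub>M\<^esub> F ((us @ [y]) @ insort_key ord x l)"
      by (rule Cons.IH) (use Cons.prems in auto)
    have cl: "F (us @ y # insort_key ord x l) \<in> carrier M"
      using Cons.prems by (intro F) (auto simp: set_insort_key distinct_insort)
    show ?thesis unfolding c using False IH swap[OF Cons.prems(2,3)] cl by (simp add: scale_scale)
  qed
qed

lemma alternating_sort:
  assumes M: "vspace M"
    and F: "\<And>l. distinct l \<Longrightarrow> set l = B \<Longrightarrow> F l \<in> carrier M"
    and swap: "\<And>us x y vs. distinct (us @ x # y # vs) \<Longrightarrow> set (us @ x # y # vs) = B \<Longrightarrow>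
      F (us @ x # y # vs) = (- 1) \<odot>\<^bsub>M\<^esub> F (us @ y # x # vs)"
    and "distinct l" "set l = B"
  shows "F l = (- 1) ^ inversions ord l \<odot>\<^bsub>M\<^esub> F (sorted_enum ord B)"
proof -
  interpret vspace M by fact
  have "F (us @ l) = (- 1) ^ inversions ord l \<odot>\<^bsub>M\<^esub> F (us @ sort_key ord l)"
    if "distinct (us @ l)" "set (us @ l) = B" for us l
    using that
  proof (induction l arbitrary: us)
    case Nil
    then show ?case using F[of us] by simp
  next
    case (Cons x l)
    have IH: "F ((us @ [x]) @ l) = (- 1) ^ inversions ord l \<odot>\<^bsub>M\<^esub> F ((us @ [x]) @ sort_key ord l)"
      by (rule Cons.IH) (use Cons.prems in auto)
    have "F (us @ x # sort_key ord l) = (- 1) ^ card {y \<in> set (sort_key ord l). ord y < ord x} \<odot>\<^bsub>M\<^esub>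
        F (us @ insort_key ord x (sort_key ord l))"
      by (rule alternating_insort[where F = F, OF M F swap]) (use Cons.prems in auto)
    moreover have "F (us @ insort_key ord x (sort_key ord l)) \<in> carrier M"
      using Cons.prems by (intro F) (auto simp: set_insort_key distinct_insort)
    ultimately show ?case using IH by (simp add: scale_scale power_add mult.commute)
  qed
  from this[of "[]" l] show ?thesis using assms(4,5) by (simp add: sort_key_eq_sorted_enum)
qed

end

text \<open>
  For an increasing list, the inversions of its image under \<open>a\<close> are the pairs whose order \<open>a\<close> reverses.
  This is the form in which the Borel--Serre sign \<open>\<epsilon>(a, K)\<close> is defined.
\<close>

lemma inversions_map:
  assumes "sorted (map ord l)" "distinct (map ord l)" "inj_on a (set l)"
  shows "inversions ord (map a l) =
    card {(i, i'). i \<in> set l \<and> i' \<in> set l \<and> ord i < ord i' \<and> ord (a i) > ord (a i')}"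
  using assms
proof (induction l)
  case (Cons x l)
  let ?P = "\<lambda>A. {(i, i'). i \<in> A \<and> i' \<in> A \<and> ord i < ord i' \<and> ord (a i) > ord (a i')}"
  let ?Q = "{i' \<in> set l. ord (a i') < ord (a x)}"
  have lt: "ord x < ord y" if "y \<in> set l" for y
    using Cons.prems(1,2) that by (auto simp: less_le)
  have "?P (set (x # l)) = Pair x ` ?Q \<union> ?P (set l)" using lt by (auto dest: less_asym)
  moreover have "finite (?P (set l))" by (rule finite_subset[of _ "set l \<times> set l"]) auto
  moreover have "Pair x ` ?Q \<inter> ?P (set l) = {}" using lt by auto
  ultimately have "card (?P (set (x # l))) = card (Pair x ` ?Q) + card (?P (set l))"
    by (simp add: card_Un_disjoint)
  also have "card (Pair x ` ?Q) = card ?Q" by (rule card_image) (auto simp: inj_on_def)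
  also have "card ?Q = card {y \<in> set (map a l). ord y < ord (a x)}"
  proof -
    have "{y \<in> set (map a l). ord y < ord (a x)} = a ` ?Q" by auto
    moreover have "inj_on a ?Q" using Cons.prems(3) by (auto simp: inj_on_def)
    ultimately show ?thesis by (simp add: card_image)
  qed
  finally show ?case using Cons by simp
qed simp

lemma inversions_snoc:
  assumes "sorted (map ord l)" "distinct l"
  shows "inversions ord (l @ [i]) = card {k \<in> set l. ord i < ord k}"
  using assms
proof (induction l)
  case (Cons x l)
  have e: "{y \<in> set (l @ [i]). ord y < ord x} = (if ord i < ord x then {i} else {})"
    using Cons.prems(1) by (auto simp: not_less)
  have "{k \<in> set (x # l). ord i < ord k} = (if ord i < ord x then {x} else {}) \<union> {k \<in> set l. ord i < ord k}"
    by auto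
  then have "card {k \<in> set (x # l). ord i < ord k} = (if ord i < ord x then 1 else 0) + card {k \<in> set l. ord i < ord k}"
    using Cons.prems(2) by (auto simp: card_insert_if)
  then show ?case using Cons e by (simp only: append_Cons inversions.simps) auto
qed simp

subsection \<open>The top exterior power\<close>

text \<open>
  The ground field as a vector space over itself, the target of linear functionals.
\<close>

definition complex_line :: "(complex, complex) module" where
  "complex_line = \<lparr>carrier = UNIV, mult = undefined, one = undefined, zero = 0, add = (+), smult = (*)\<rparr>"

lemma complex_line_simps [simp]:
  "carrier complex_line = UNIV" "x \<oplus>\<^bsub>complex_line\<^esub> y = x + y" "c \<odot>\<^bsub>complex_line\<^esub> x = c * x"
  "\<zero>\<^bsub>complex_line\<^esub> = 0"
  by (simp_all add: complex_line_def)

lemma vspace_complex_line: "vspace complex_line"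
  by (rule vspaceI) (simp_all add: algebra_simps)

lemma complex_line_minus [simp]: "x \<ominus>\<^bsub>complex_line\<^esub> y = x - y"
  using vspace.neg_scale[OF vspace_complex_line, of y] by (simp add: a_minus_def)

context
  fixes ord :: "'a \<Rightarrow> nat" and B :: "'a set"
  assumes fin: "finite B" and inj: "inj_on ord B"
begin

private abbreviation k where "k \<equiv> card B"
private abbreviation W where "W \<equiv> free B"
private abbreviation es where "es \<equiv> sorted_enum ord B"

text \<open>
  The determinant of the coordinates of a list of vectors, by the Leibniz formula. The permutations act
  on the basis itself; position \<open>i\<close> of the list is matched with the \<open>i\<close>-th basis vector in increasing order.
\<close>

private definition leibniz :: "('a \<Rightarrow> complex) list \<Rightarrow> complex" where
  "leibniz ws = (\<Sum>p | p permutes B. of_int (sign p) * (\<Prod>i<k. (ws ! i) (p (es ! i))))"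

lemma length_es: "length es = k"
  using sorted_enum(1,2)[OF fin inj] distinct_card by fastforce

lemma es_in: "i < k \<Longrightarrow> es ! i \<in> B"
  using sorted_enum(1)[OF fin inj] length_es nth_mem by metis

lemma nth_slot:
  assumes "i \<noteq> length us" shows "(us @ w # vs) ! i = (us @ w' # vs) ! i"
  using assms by (auto simp: nth_append nth_Cons' )

lemma leibniz_slot:
  assumes "length us < k"
  shows "leibniz (us @ w # vs) = (\<Sum>p | p permutes B. of_int (sign p) * (w (p (es ! length us)) *
      (\<Prod>i\<in>{..<k} - {length us}. ((us @ z # vs) ! i) (p (es ! i)))))"
  unfolding leibniz_def
proof (rule sum.cong[OF refl], rule arg_cong2[where f = "(*)", OF refl])
  fix p
  have "(\<Prod>i<k. ((us @ w # vs) ! i) (p (es ! i))) = ((us @ w # vs) ! length us) (p (es ! length us)) *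
      (\<Prod>i\<in>{..<k} - {length us}. ((us @ w # vs) ! i) (p (es ! i)))"
    using assms by (intro prod.remove) auto
  also have "(\<Prod>i\<in>{..<k} - {length us}. ((us @ w # vs) ! i) (p (es ! i))) =
      (\<Prod>i\<in>{..<k} - {length us}. ((us @ z # vs) ! i) (p (es ! i)))"
    by (rule prod.cong[OF refl]) (metis DiffD2 nth_slot singletonI)
  finally show "(\<Prod>i<k. ((us @ w # vs) ! i) (p (es ! i))) = w (p (es ! length us)) *
      (\<Prod>i\<in>{..<k} - {length us}. ((us @ z # vs) ! i) (p (es ! i)))" by simp
qed

lemma leibniz_repeated:
  assumes "length ws = k" "\<not> distinct ws"
  shows "leibniz ws = 0"
proof -
  obtain a b where ab: "a < k" "b < k" "a \<noteq> b" "ws ! a = ws ! b"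
    using assms by (auto simp: distinct_conv_nth)
  let ?\<tau> = "Transposition.transpose (es ! a) (es ! b)" and ?t = "Transposition.transpose a b"
  let ?P = "\<lambda>p. (\<Prod>i<k. (ws ! i) (p (es ! i)))"
  have ne: "es ! a \<noteq> es ! b"
    using ab sorted_enum(2)[OF fin inj] length_es by (simp add: nth_eq_iff_index_eq)
  have \<tau>: "?\<tau> permutes B" using ab es_in by (intro permutes_swap_id) auto
  have t: "?t permutes {..<k}" using ab by (intro permutes_swap_id) auto
  have e\<tau>: "?\<tau> (es ! i) = es ! ?t i" if "i < k" for i
    using that ab sorted_enum(2)[OF fin inj] length_es by (auto simp: Transposition.transpose_def nth_eq_iff_index_eq)
  have "leibniz ws = (\<Sum>p | p permutes B. of_int (sign (p \<circ> ?\<tau>)) * ?P (p \<circ> ?\<tau>))"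
    unfolding leibniz_def by (rule sum_permutations_compose_right[OF \<tau>])
  also have "\<dots> = (\<Sum>p | p permutes B. - (of_int (sign p) * ?P p))"
  proof (rule sum.cong[OF refl])
    fix p assume "p \<in> {p. p permutes B}"
    then have p: "permutation p" using fin by (auto intro: permutation_permutes[THEN iffD2])
    have "sign (p \<circ> ?\<tau>) = - sign p"
      using sign_compose[OF p permutation_swap_id] ne by (simp add: sign_swap_id)
    moreover have "?P (p \<circ> ?\<tau>) = (\<Prod>i<k. (ws ! ?t i) (p (es ! ?t i)))"
      using e\<tau> ab by (intro prod.cong) (auto simp: Transposition.transpose_def)
    moreover have "\<dots> = ?P p" using prod.permute[OF t, of "\<lambda>i. (ws ! i) (p (es ! i))"] by (simp add: o_def)
    ultimately show "of_int (sign (p \<circ> ?\<tau>)) * ?P (p \<circ> ?\<tau>) = - (of_int (sign p) * ?P p)" by simp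
  qed
  also have "\<dots> = - leibniz ws" by (simp add: leibniz_def sum_negf)
  finally show ?thesis by simp
qed

lemma leibniz_basis:
  assumes "a permutes B"
  shows "leibniz (map delta (map a es)) = of_int (sign a)"
proof -
  have "(\<Prod>i<k. (map delta (map a es) ! i) (p (es ! i))) = (if p = a then 1 else 0)" if p: "p permutes B" for p
  proof (cases "p = a")
    case True
    then show ?thesis by (simp add: length_es delta_def)
  next
    case False
    then obtain b where b: "p b \<noteq> a b" by auto
    then have "b \<in> B" using p assms by (metis permutes_not_in)
    then obtain i where "i < k" "es ! i = b"
      using sorted_enum(1)[OF fin inj] length_es by (metis in_set_conv_nth)
    then show ?thesis using b False by (auto simp: length_es delta_def intro!: bexI[of _ i])
  qed
  then have "leibniz (map delta (map a es)) = (\<Sum>p | p permutes B. if p = a then of_int (sign p) else 0)"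
    unfolding leibniz_def by (intro sum.cong) auto
  also have "\<dots> = of_int (sign a)" using assms finite_permutations[OF fin] by simp
  finally show ?thesis .
qed

text \<open>
  The determinant is multilinear and vanishes on repeated entries, so it factors through the top
  exterior power. It shows that the wedge product of the basis vectors is not zero.
\<close>

lemma top_functional:
  obtains D where "linear_map (ext_power W k) complex_line D"
    "\<forall>a. a permutes B \<longrightarrow> D (wdg W k (map delta (map a es))) = of_int (sign a)"
proof -
  let ?F = "free (tuples W k)"
  let ?L = "lin_ext complex_line leibniz"
  have L: "linear_map ?F complex_line ?L"
    by (rule linear_map_lin_ext[OF vspace_complex_line]) simp
  have Ld: "?L (delta ws) = leibniz ws" for ws by (rule lin_ext_delta[OF vspace_complex_line]) simp
  have sub: "?L (\<lambda>p. c p - d p) = ?L c - ?L d" if "c \<in> carrier ?F" "d \<in> carrier ?F" for c d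
    using linear_map_minus[OF vspace_free vspace_complex_line L that] by (simp add: free_minus[OF that])
  have sc: "?L (\<lambda>p. z * c p) = z * ?L c" if "c \<in> carrier ?F" for c z
    using linear_mapD(3)[OF L that, of z] by (simp add: free_simps)
  have Z: "subspace_of {0} complex_line" by (rule subspaceI[OF vspace_complex_line]) auto
  have "?L c = \<zero>\<^bsub>complex_line\<^esub>" if "c \<in> ext_rel W k" for c
  proof -
    have "?L c \<in> {0}"
    proof (rule ext_rel_least[OF vspace_free vspace_complex_line L Z _ _ _ that])
      show "?L (delta ws) \<in> {0}" if "ws \<in> tuples W k" "\<not> distinct ws" for ws
        using leibniz_repeated[of ws] that by (simp add: Ld tuples_def)
      fix us w vs c assume "us @ w # vs \<in> tuples W k"
      then have a: "length us + Suc (length vs) = k" "set us \<subseteq> carrier W" "w \<in> carrier W" "set vs \<subseteq> carrier W" by simp_all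
      have d: "delta (us @ w # vs) \<in> carrier ?F" if "w \<in> carrier W" for w using a that by (simp add: delta_in_free)
      have cl: "c \<odot>\<^bsub>W\<^esub> w \<in> carrier W" using vspace.scale_closed[OF vspace_free a(3)] .
      show "?L (\<lambda>p. delta (us @ (c \<odot>\<^bsub>W\<^esub> w) # vs) p - c * delta (us @ w # vs) p) \<in> {0}"
        unfolding sub[OF d[OF cl] free_smultI[OF d[OF a(3)]]] sc[OF d[OF a(3)]] Ld
        using a by (subst (1 2) leibniz_slot[where z = w]) (auto simp: free_simps sum_distrib_left mult.left_commute mult.assoc)
      fix w' assume "us @ w' # vs \<in> tuples W k"
      then have w': "w' \<in> carrier W" by simp
      have cl: "w \<oplus>\<^bsub>W\<^esub> w' \<in> carrier W" using free_addI[OF a(3) w'] by (simp add: free_simps)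
      show "?L (\<lambda>p. delta (us @ (w \<oplus>\<^bsub>W\<^esub> w') # vs) p - delta (us @ w # vs) p - delta (us @ w' # vs) p) \<in> {0}"
        unfolding sub[OF free_diffI[OF d[OF cl] d[OF a(3)]] d[OF w']] sub[OF d[OF cl] d[OF a(3)]] Ld
        using a by (subst (1 2 3) leibniz_slot[where z = w]) (auto simp: free_simps sum.distrib algebra_simps)
    qed
    then show ?thesis by simp
  qed
  from quot_lift[OF vspace_free subspace_ext_rel[OF vspace_free] vspace_complex_line L this]
  obtain D where D: "linear_map (ext_power W k) complex_line D"
    "\<And>x. x \<in> carrier ?F \<Longrightarrow> D (cls ?F (ext_rel W k) x) = ?L x"
    unfolding ext_power_def by blast
  have "D (wdg W k (map delta (map a es))) = of_int (sign a)" if a: "a permutes B" for a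
  proof -
    have "map delta (map a es) \<in> tuples W k"
      using a sorted_enum(1)[OF fin inj] permutes_in_image[OF a] by (auto simp: tuples_def length_es delta_in_free)
    then show ?thesis using leibniz_basis[OF a] D(2)[of "delta (map delta (map a es))"] by (simp add: Ld delta_in_free)
  qed
  then show thesis using that D(1) by blast
qed

lemma basis_tuple: "set l \<subseteq> B \<Longrightarrow> length l = k \<Longrightarrow> map delta l \<in> tuples W k"
  by (auto simp: tuples_def delta_in_free)

text \<open>
  Wedge products of basis vectors are alternating by antisymmetry, so sorting them costs the parity
  of the number of inversions.
\<close>

lemma wdg_basis_sort:
  assumes "distinct l" "set l = B"
  shows "wdg W k (map delta l) = (- 1) ^ inversions ord l \<odot>\<^bsub>ext_power W k\<^esub> wdg W k (map delta es)"
proof (rule alternating_sort[where F = "\<lambda>l. wdg W k (map delta l)", OF fin inj vspace_ext[OF vspace_free] _ _ assms])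
  have len: "length l = k" if "distinct l" "set l = B" for l :: "'a list" using that distinct_card by metis
  show "wdg W k (map delta l) \<in> carrier (ext_power W k)" if "distinct l" "set l = B" for l
    using that len by (intro wdg_closed[OF vspace_free] basis_tuple) auto
  show "wdg W k (map delta (us @ x # y # vs)) = (- 1) \<odot>\<^bsub>ext_power W k\<^esub> wdg W k (map delta (us @ y # x # vs))"
    if "distinct (us @ x # y # vs)" "set (us @ x # y # vs) = B" for us x y vs
  proof -
    have "map delta (us @ x # y # vs) \<in> tuples W k" using len[OF that] that by (intro basis_tuple) auto
    then have "map delta us @ delta x # delta y # map delta vs \<in> tuples W k" by (simp only: map_append list.map)
    from wdg_swap[OF vspace_free this] show ?thesis by simp
  qed
qed

text \<open>
  Both sides are the factor by which a permutation of the basis multiplies the top wedge product: the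
  determinant computes it as the sign, sorting as the parity of the number of inversions.
\<close>

lemma sign_eq_inversions:
  assumes a: "a permutes B"
  shows "sign a = (- 1) ^ inversions ord (map a es)"
proof -
  obtain D where D: "linear_map (ext_power W k) complex_line D"
    "\<forall>a. a permutes B \<longrightarrow> D (wdg W k (map delta (map a es))) = of_int (sign a)"
    by (rule top_functional)
  have es: "set es = B" "distinct es" using sorted_enum[OF fin inj] by auto
  have "distinct (map a es)" "set (map a es) = B"
    using es permutes_inj_on[OF a] permutes_image[OF a] by (auto simp: distinct_map)
  then have "D (wdg W k (map delta (map a es))) = D ((- 1) ^ inversions ord (map a es) \<odot>\<^bsub>ext_power W k\<^esub> wdg W k (map delta es))"
    by (simp only: wdg_basis_sort)
  also have "\<dots> = (- 1) ^ inversions ord (map a es) * D (wdg W k (map delta (map id es)))"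
    using linear_mapD(3)[OF D(1) wdg_closed[OF vspace_free basis_tuple]] es(1) length_es by simp
  also have "\<dots> = (- 1) ^ inversions ord (map a es)" by (simp only: D(2)[rule_format, OF permutes_id]) simp
  finally have "(of_int (sign a) :: complex) = of_int ((- 1) ^ inversions ord (map a es))"
    by (simp only: D(2)[rule_format, OF a]) simp
  then show ?thesis by (simp only: of_int_eq_iff)
qed

text \<open>
  By multilinearity every wedge product is a combination of wedge products of basis vectors; as many
  vectors as the dimension leave only rearrangements of the whole basis.
\<close>

lemma wdg_generates:
  assumes "y \<in> carrier (ext_power W k)"
  shows "\<exists>c. y = c \<odot>\<^bsub>ext_power W k\<^esub> wdg W k (map delta es)"
proof -
  let ?e = "wdg W k (map delta es)" and ?L = "ext_power W k"
  interpret L: vspace ?L by (rule vspace_ext[OF vspace_free])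
  have e: "?e \<in> carrier ?L"
    using sorted_enum(1)[OF fin inj] length_es by (intro wdg_closed[OF vspace_free] basis_tuple) auto
  define Z where "Z = range (\<lambda>c. c \<odot>\<^bsub>?L\<^esub> ?e)"
  have Z: "subspace_of Z ?L"
  proof (rule subspaceI[OF L.vspace_axioms])
    have "\<zero>\<^bsub>?L\<^esub> = 0 \<odot>\<^bsub>?L\<^esub> ?e" using e by simp
    then show "\<zero>\<^bsub>?L\<^esub> \<in> Z" unfolding Z_def by (rule range_eqI)
  qed (use e in \<open>auto simp: Z_def L.scale_scale simp flip: L.scale_add_left\<close>)
  have 1: "wdg W k (map delta us @ vs) \<in> Z"
    if "set us \<subseteq> B" "set vs \<subseteq> carrier W" "length us + length vs = k" for us vs
    using that
  proof (induction vs arbitrary: us)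
    case Nil
    show ?case
    proof (cases "distinct us")
      case True
      then have "set us = B" using Nil by (intro card_subset_eq[OF fin]) (auto simp: distinct_card)
      then show ?thesis using wdg_basis_sort[OF True] by (simp add: Z_def)
    next
      case False
      then have "wdg W k (map delta us) = \<zero>\<^bsub>?L\<^esub>"
        using Nil by (intro wdg_nondistinct[OF vspace_free] basis_tuple) (auto simp: distinct_map)
      then show ?thesis using subspaceD(2)[OF L.vspace_axioms Z] by simp
    qed
  next
    case (Cons w vs)
    let ?f = "\<lambda>w. wdg W k (map delta us @ w # vs)"
    have f: "linear_map W ?L ?f"
      using Cons.prems by (intro linear_wdg_slot[OF vspace_free]) (auto simp: delta_in_free)
    have "w \<in> {w \<in> carrier W. ?f w \<in> Z}"
    proof (rule free_induct[OF _ subspace_vimage[OF vspace_free L.vspace_axioms f Z]])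
      show "w \<in> carrier W" using Cons.prems by simp
      fix b assume b: "b \<in> B"
      have "wdg W k (map delta (us @ [b]) @ vs) \<in> Z" using Cons.prems b by (intro Cons.IH) auto
      then show "delta b \<in> {w \<in> carrier W. ?f w \<in> Z}" using b by (simp add: delta_in_free)
    qed
    then show ?case by simp
  qed
  obtain c where c: "c \<in> carrier (free (tuples W k))" "y = cls (free (tuples W k)) (ext_rel W k) c"
    using assms unfolding ext_power_def by (elim quot_cases)
  have cl: "linear_map (free (tuples W k)) ?L (cls (free (tuples W k)) (ext_rel W k))"
    unfolding ext_power_def by (rule linear_map_cls[OF vspace_free subspace_ext_rel[OF vspace_free]])
  have "c \<in> {c \<in> carrier (free (tuples W k)). cls (free (tuples W k)) (ext_rel W k) c \<in> Z}"
  proof (rule free_induct[OF c(1) subspace_vimage[OF vspace_free L.vspace_axioms cl Z]])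
    fix ws assume "ws \<in> tuples W k"
    then show "delta ws \<in> {c \<in> carrier (free (tuples W k)). cls (free (tuples W k)) (ext_rel W k) c \<in> Z}"
      using 1[of "[]" ws] by (simp add: delta_in_free) (simp add: tuples_def)
  qed
  then show ?thesis using c(2) by (auto simp: Z_def)
qed

text \<open>
  The top exterior power is a line: the wedge product of the basis generates it and the determinant
  takes the value 1 there. A non-zero multiple \<open>z\<close> of it serves equally well.
\<close>

lemma bij_tens_top:
  assumes V: "vspace V" and z: "z \<noteq> 0"
  shows "bij_betw (\<lambda>x. tens V (ext_power W k) x (z \<odot>\<^bsub>ext_power W k\<^esub> wdg W k (map delta es)))
    (carrier V) (carrier (tensor V (ext_power W k)))"
proof -
  let ?e = "wdg W k (map delta es)" and ?L = "ext_power W k"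
  interpret L: vspace ?L by (rule vspace_ext[OF vspace_free])
  have e: "?e \<in> carrier ?L"
    using sorted_enum(1)[OF fin inj] length_es by (intro wdg_closed[OF vspace_free] basis_tuple) auto
  obtain D where D: "linear_map ?L complex_line D"
    "\<forall>a. a permutes B \<longrightarrow> D (wdg W k (map delta (map a es))) = of_int (sign a)"
    by (rule top_functional)
  have De: "D ?e = 1" using D(2)[rule_format, OF permutes_id] by simp
  show ?thesis
  proof (rule bij_tens[OF V L.vspace_axioms, where D = "\<lambda>y. D y / z"])
    fix y assume "y \<in> carrier ?L"
    then obtain c where "y = c \<odot>\<^bsub>?L\<^esub> ?e" using wdg_generates by blast
    then have "y = (c / z) \<odot>\<^bsub>?L\<^esub> (z \<odot>\<^bsub>?L\<^esub> ?e)" using e z by (simp add: L.scale_scale)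
    then show "\<exists>c. y = c \<odot>\<^bsub>?L\<^esub> (z \<odot>\<^bsub>?L\<^esub> ?e)" by blast
  qed (use linear_mapD[OF D(1)] e z De in \<open>simp_all add: add_divide_distrib\<close>)
qed

end

subsection \<open>Shuffle signs\<close>

text \<open>
  Up to a factor depending only on the size of \<open>J\<close>, this is the sign of the shuffle that lists \<open>J\<close>
  before \<open>S - J\<close>. It mediates between signs that are counted inside \<open>J\<close> and signs that are counted
  inside \<open>S - J\<close>.
\<close>

definition shuffle_sign :: "('a \<Rightarrow> nat) \<Rightarrow> 'a set \<Rightarrow> 'a set \<Rightarrow> int" where
  "shuffle_sign ord S J = (\<Prod>i\<in>J. \<Prod>k\<in>S - J. sgn (int (ord i) - int (ord k)))"

lemma prod_sign_eq_power:
  assumes "finite T"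
  shows "(\<Prod>x\<in>T. if P x then - 1 else 1 :: int) = (- 1) ^ card {x \<in> T. P x}"
  using assms by (simp add: prod.inter_filter[symmetric])

text \<open>
  Passing from \<open>I\<close> to \<open>I \<union> {i}\<close> replaces the factors for \<open>(j, i)\<close>, \<open>j \<in> I\<close>, by the factors for \<open>(i, k)\<close>,
  \<open>k\<close> outside. The former count the \<open>j < i\<close> in \<open>I\<close>, the latter the \<open>k > i\<close> outside. The count on the
  right also includes \<open>i\<close> itself, which accounts for the minus sign.
\<close>

lemma shuffle_sign_insert:
  assumes S: "finite S" "inj_on ord S" and i: "i \<in> S - I" "I \<subseteq> S"
  shows "shuffle_sign ord S (insert i I) * (- 1) ^ card {k \<in> S - insert i I. ord i < ord k} =
    - ((- 1) ^ card {k \<in> insert i I. ord k \<le> ord i}) * shuffle_sign ord S I"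
proof -
  let ?K = "S - insert i I"
  define C where "C = (\<Prod>j\<in>I. \<Prod>k\<in>?K. sgn (int (ord j) - int (ord k)))"
  have fin: "finite I" "finite ?K" using S(1) i(2) by (auto intro: finite_subset)
  have ne: "ord i \<noteq> ord k" if "k \<in> ?K" for k using that inj_onD[OF S(2), of i k] i(1) by auto
  have ne': "ord i \<noteq> ord j" if "j \<in> I" for j using that inj_onD[OF S(2), of i j] i by auto
  have "shuffle_sign ord S (insert i I) = (\<Prod>k\<in>?K. sgn (int (ord i) - int (ord k))) * C"
    unfolding shuffle_sign_def C_def using i fin by (subst prod.insert) auto
  also have "(\<Prod>k\<in>?K. sgn (int (ord i) - int (ord k))) = (\<Prod>k\<in>?K. if ord i < ord k then - 1 else 1)"
    using ne by (intro prod.cong) (auto simp: sgn_if)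
  finally have 1: "shuffle_sign ord S (insert i I) = (- 1) ^ card {k \<in> ?K. ord i < ord k} * C"
    using prod_sign_eq_power[OF fin(2)] by simp
  have SI: "S - I = insert i ?K" using i by auto
  have "shuffle_sign ord S I = (\<Prod>j\<in>I. sgn (int (ord j) - int (ord i))) * C"
    unfolding shuffle_sign_def C_def SI using fin by (simp add: prod.distrib)
  also have "(\<Prod>j\<in>I. sgn (int (ord j) - int (ord i))) = (\<Prod>j\<in>I. if ord j < ord i then - 1 else 1)"
    using ne'[THEN not_sym] by (intro prod.cong) (auto simp: sgn_if)
  finally have 2: "shuffle_sign ord S I = (- 1) ^ card {j \<in> I. ord j < ord i} * C"
    using prod_sign_eq_power[OF fin(1)] by simp
  have "{k \<in> insert i I. ord k \<le> ord i} = insert i {j \<in> I. ord j < ord i}"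
  proof -
    have "ord k \<le> ord i \<longleftrightarrow> ord k < ord i" if "k \<in> I" for k using ne'[OF that] by linarith
    then show ?thesis by auto
  qed
  then have 3: "card {k \<in> insert i I. ord k \<le> ord i} = Suc (card {j \<in> I. ord j < ord i})"
    using i fin by simp
  show ?thesis unfolding 1 2 3 by (simp flip: power_add mult_2 add: mult.assoc[symmetric] mult.commute[of _ C] mult.assoc)
qed

text \<open>
  A pair with one element in \<open>K\<close> and one in \<open>S - K\<close> is inverted by \<open>a\<close> exactly when its factors in the
  shuffle signs of \<open>K\<close> and of \<open>a K\<close> differ. Hence the mixed inversions account for the quotient of these
  two signs, and the remaining inversions lie within \<open>K\<close> or within \<open>S - K\<close>.
\<close>

lemma shuffle_sign_permutation:
  fixes a :: "'a \<Rightarrow> 'a"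
  assumes S: "finite S" "inj_on ord S" and a: "a permutes S" and K: "K \<subseteq> S"
  defines "Inv A \<equiv> {(i, i'). i \<in> A \<and> i' \<in> A \<and> ord i < ord i' \<and> ord (a i) > ord (a i')}"
  shows "shuffle_sign ord S K * (- 1) ^ card (Inv (S - K)) =
    sign a * (- 1) ^ card (Inv K) * shuffle_sign ord S (a ` K)"
proof -
  have "sign a = (- 1) ^ card (Inv S)"
    using sign_eq_inversions[OF S a] inversions_map[of ord "sorted_enum ord S" a]
      sorted_enum[OF S] map_ord_sorted_enum[OF S] permutes_inj_on[OF a] S(1) unfolding Inv_def by simp
  \<comment> \<open>The mixed inversions, according to whether the smaller element lies in \<open>K\<close> or outside.\<close>
  moreover define M1 where "M1 = {(i, k). i \<in> K \<and> k \<in> S - K \<and> ord i < ord k \<and> ord (a i) > ord (a k)}"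
  moreover define M2 where "M2 = {(k, i). i \<in> K \<and> k \<in> S - K \<and> ord k < ord i \<and> ord (a k) > ord (a i)}"
  moreover have "card (Inv S) = card (Inv K) + card (Inv (S - K)) + card M1 + card M2"
  proof -
    have f: "finite (S \<times> S)" using S by simp
    have fin: "finite (Inv K)" "finite (Inv (S - K))" "finite M1" "finite M2"
      by (rule finite_subset[OF _ f]; use K in \<open>auto simp: Inv_def M1_def M2_def\<close>)+
    have "Inv S = ((Inv K \<union> Inv (S - K)) \<union> M1) \<union> M2"
      using K by (auto simp: Inv_def M1_def M2_def)
    moreover have "Inv K \<inter> Inv (S - K) = {}" "(Inv K \<union> Inv (S - K)) \<inter> M1 = {}"
      "((Inv K \<union> Inv (S - K)) \<union> M1) \<inter> M2 = {}"
      by (auto simp: Inv_def M1_def M2_def)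
    ultimately show ?thesis using fin by (simp add: card_Un_disjoint)
  qed
  moreover have "(- 1) ^ card M1 * (- 1) ^ card M2 = shuffle_sign ord S K * shuffle_sign ord S (a ` K)"
  proof -
    have fin: "finite (K \<times> (S - K))" using S K by (auto intro: finite_subset)
    have "M1 = {x \<in> K \<times> (S - K). ord (fst x) < ord (snd x) \<and> ord (a (fst x)) > ord (a (snd x))}"
      by (auto simp: M1_def)
    then have 1: "(- 1) ^ card M1 = (\<Prod>x\<in>K \<times> (S - K).
        if ord (fst x) < ord (snd x) \<and> ord (a (fst x)) > ord (a (snd x)) then - 1 else 1 :: int)"
      using prod_sign_eq_power[OF fin] by simp
    have "M2 = prod.swap ` {x \<in> K \<times> (S - K). ord (snd x) < ord (fst x) \<and> ord (a (snd x)) > ord (a (fst x))}"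
      by (auto simp: M2_def)
    then have "card M2 = card {x \<in> K \<times> (S - K). ord (snd x) < ord (fst x) \<and> ord (a (snd x)) > ord (a (fst x))}"
      by (simp add: card_image)
    then have 2: "(- 1) ^ card M2 = (\<Prod>x\<in>K \<times> (S - K).
        if ord (snd x) < ord (fst x) \<and> ord (a (snd x)) > ord (a (fst x)) then - 1 else 1 :: int)"
      using prod_sign_eq_power[OF fin] by simp
    have ne: "ord (fst x) \<noteq> ord (snd x)" "ord (a (fst x)) \<noteq> ord (a (snd x))" if "x \<in> K \<times> (S - K)" for x
    proof -
      have x: "fst x \<in> S" "snd x \<in> S" "fst x \<noteq> snd x" using that K by auto
      then show "ord (fst x) \<noteq> ord (snd x)" using inj_onD[OF S(2)] by blast
      have "a (fst x) \<in> S" "a (snd x) \<in> S" "a (fst x) \<noteq> a (snd x)"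
        using x permutes_in_image[OF a] permutes_inj[OF a] by (auto dest: injD)
      then show "ord (a (fst x)) \<noteq> ord (a (snd x))" using inj_onD[OF S(2)] by blast
    qed
    have "(- 1) ^ card M1 * (- 1) ^ card M2 = (\<Prod>x\<in>K \<times> (S - K).
        sgn (int (ord (fst x)) - int (ord (snd x))) * sgn (int (ord (a (fst x))) - int (ord (a (snd x)))))"
      unfolding 1 2 prod.distrib[symmetric] 
    proof (rule prod.cong[OF refl])
      fix x assume "x \<in> K \<times> (S - K)"
      from ne[OF this] show "(if ord (fst x) < ord (snd x) \<and> ord (a (snd x)) < ord (a (fst x)) then - 1 else 1) *
          (if ord (snd x) < ord (fst x) \<and> ord (a (fst x)) < ord (a (snd x)) then - 1 else 1) =
          sgn (int (ord (fst x)) - int (ord (snd x))) * sgn (int (ord (a (fst x))) - int (ord (a (snd x))))"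
        by (simp add: sgn_if)
    qed
    also have "\<dots> = (\<Prod>i\<in>K. \<Prod>k\<in>S - K. sgn (int (ord i) - int (ord k))) *
        (\<Prod>i\<in>K. \<Prod>k\<in>S - K. sgn (int (ord (a i)) - int (ord (a k))))"
      unfolding prod.distrib prod.cartesian_product by (simp add: case_prod_unfold)
    also have "(\<Prod>i\<in>K. \<Prod>k\<in>S - K. sgn (int (ord (a i)) - int (ord (a k)))) = shuffle_sign ord S (a ` K)"
    proof -
      have e: "S - a ` K = a ` (S - K)"
        using permutes_image[OF a] permutes_inj[OF a] by (simp add: image_set_diff)
      have "inj_on a A" for A using permutes_inj[OF a] by (rule inj_on_subset) simp
      then show ?thesis unfolding shuffle_sign_def e by (simp add: prod.reindex)
    qed
    finally show ?thesis by (simp add: shuffle_sign_def)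
  qed
  moreover have "shuffle_sign ord S (a ` K) * shuffle_sign ord S (a ` K) = 1"
  proof -
    have sq: "shuffle_sign ord S J * shuffle_sign ord S J = 1" if J: "J \<subseteq> S" for J
      unfolding shuffle_sign_def prod.distrib[symmetric]
    proof (intro prod.neutral ballI)
      fix i k assume "i \<in> J" "k \<in> S - J"
      then have "ord i \<noteq> ord k" using inj_onD[OF S(2), of i k] J by auto
      then show "sgn (int (ord i) - int (ord k)) * sgn (int (ord i) - int (ord k)) = 1" by (auto simp: sgn_if)
    qed
    show ?thesis by (rule sq) (use K permutes_image[OF a] in auto)
  qed
  ultimately have *: "sign a * (- 1) ^ card (Inv K) * shuffle_sign ord S (a ` K) =
      ((- 1) ^ card (Inv K) * (- 1) ^ card (Inv K)) * (- 1) ^ card (Inv (S - K)) *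
      (shuffle_sign ord S K * (shuffle_sign ord S (a ` K) * shuffle_sign ord S (a ` K)))"
    by (simp add: power_add algebra_simps)
  show ?thesis
    unfolding * \<open>shuffle_sign ord S (a ` K) * shuffle_sign ord S (a ` K) = 1\<close> by (simp flip: power_add mult_2)
qed

lemma shuffle_sign_neq_0:
  assumes "finite S" "inj_on ord S" "J \<subseteq> S"
  shows "shuffle_sign ord S J \<noteq> 0"
proof -
  have "finite J" using assms(1,3) by (rule finite_subset[rotated])
  moreover have "sgn (int (ord i) - int (ord k)) \<noteq> 0" if "i \<in> J" "k \<in> S - J" for i k
    using inj_onD[OF assms(2), of i k] that assms(3) by (auto simp: sgn_if)
  ultimately show ?thesis using assms(1) by (auto simp: shuffle_sign_def)
qed

section \<open>Linear algebraic groups\<close>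

no_notation fps_nth (infixl \<open>$\<close> 75)

lemma matrix_inv_both:
  fixes g :: "'k::semiring_1 ^ 'n ^ 'n"
  assumes "invertible g"
  shows "g ** matrix_inv g = mat 1" "matrix_inv g ** g = mat 1"
  using someI_ex[OF assms[unfolded invertible_def]] by (simp_all add: matrix_inv_def)

lemma invertible_mult_iff:
  fixes g h :: "'k::field ^ 'n ^ 'n"
  shows "invertible (g ** h) \<longleftrightarrow> invertible g \<and> invertible h"
  by (simp add: invertible_det_nz det_mul)

lemma invertible_one: "invertible (mat 1 :: 'k::field ^ 'n ^ 'n)"
  by (simp add: invertible_det_nz)

lemma invertible_matrix_inv:
  fixes g :: "'k::field ^ 'n ^ 'n"
  shows "invertible g \<Longrightarrow> invertible (matrix_inv g)"
  using matrix_inv_both[of g] unfolding invertible_def by blast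

lemma matrix_inv_unique:
  fixes g h :: "'k::field ^ 'n ^ 'n"
  assumes "g ** h = mat 1"
  shows "matrix_inv g = h"
proof -
  have g: "invertible g" using assms invertible_mult_iff[of g h] invertible_one by metis
  have "matrix_inv g = matrix_inv g ** (g ** h)" by (simp add: assms)
  also have "\<dots> = h" by (simp add: matrix_mul_assoc matrix_inv_both[OF g])
  finally show ?thesis .
qed

lemma matrix_inv_inv: "invertible g \<Longrightarrow> matrix_inv (matrix_inv g) = (g :: 'k::field ^ 'n ^ 'n)"
  by (rule matrix_inv_unique) (simp add: matrix_inv_both)

lemma matrix_inv_mult:
  fixes g h :: "'k::field ^ 'n ^ 'n"
  assumes "invertible g" "invertible h"
  shows "matrix_inv (g ** h) = matrix_inv h ** matrix_inv g"
proof (rule matrix_inv_unique)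
  have "g ** h ** (matrix_inv h ** matrix_inv g) = g ** (h ** matrix_inv h) ** matrix_inv g"
    by (simp only: matrix_mul_assoc)
  then show "g ** h ** (matrix_inv h ** matrix_inv g) = mat 1" by (simp add: matrix_inv_both assms)
qed

lemma matrix_inv_one: "matrix_inv (mat 1) = (mat 1 :: 'k::field ^ 'n ^ 'n)"
  by (rule matrix_inv_unique) simp

lemma mult_inv_cancel:
  fixes g x :: "'k::field ^ 'n ^ 'n"
  assumes "invertible g"
  shows "g ** (matrix_inv g ** x) = x" "matrix_inv g ** (g ** x) = x"
    "x ** g ** matrix_inv g = x" "x ** matrix_inv g ** g = x"
proof -
  show "g ** (matrix_inv g ** x) = x" "matrix_inv g ** (g ** x) = x"
    by (simp_all add: matrix_mul_assoc matrix_inv_both[OF assms])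
  show "x ** g ** matrix_inv g = x" "x ** matrix_inv g ** g = x"
    by (simp_all add: matrix_mul_assoc[symmetric] matrix_inv_both[OF assms])
qed

lemma GL_simps [simp]:
  "carrier GL = {g. invertible g}" "x \<otimes>\<^bsub>GL\<^esub> y = x ** y" "\<one>\<^bsub>GL\<^esub> = mat 1"
  by (simp_all add: GL_def)

lemma group_GL: "group (GL :: ('k::field ^ 'n ^ 'n) monoid)"
proof (rule groupI)
  fix x :: "'k ^ 'n ^ 'n" assume "x \<in> carrier GL"
  then have x: "invertible x" by simp
  then show "\<exists>y\<in>carrier GL. y \<otimes>\<^bsub>GL\<^esub> x = \<one>\<^bsub>GL\<^esub>"
    by (intro bexI[of _ "matrix_inv x"]) (simp_all add: matrix_inv_both invertible_matrix_inv)
qed (simp_all add: invertible_mult_iff invertible_one matrix_mul_assoc)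

lemma GL_inv [simp]:
  assumes "invertible (g :: 'k::field ^ 'n ^ 'n)" shows "inv\<^bsub>GL\<^esub> g = matrix_inv g"
  by (rule group.inv_equality[OF group_GL]) (use assms in \<open>simp_all add: matrix_inv_both invertible_matrix_inv\<close>)

lemma subgroup_GL_iff:
  fixes H :: "('k::field ^ 'n ^ 'n) set"
  shows "subgroup H GL \<longleftrightarrow> (\<forall>h\<in>H. invertible h) \<and> mat 1 \<in> H \<and> (\<forall>g\<in>H. \<forall>h\<in>H. g ** h \<in> H) \<and>
     (\<forall>h\<in>H. matrix_inv h \<in> H)"
proof
  assume H: "subgroup H GL"
  have i: "invertible h" if "h \<in> H" for h using subgroup.subset[OF H] that by auto
  have "matrix_inv h \<in> H" if "h \<in> H" for h using subgroup.m_inv_closed[OF H that] GL_inv[OF i[OF that]] by simp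
  then show "(\<forall>h\<in>H. invertible h) \<and> mat 1 \<in> H \<and> (\<forall>g\<in>H. \<forall>h\<in>H. g ** h \<in> H) \<and> (\<forall>h\<in>H. matrix_inv h \<in> H)"
    using i subgroup.one_closed[OF H] subgroup.m_closed[OF H] by simp
next
  assume H: "(\<forall>h\<in>H. invertible h) \<and> mat 1 \<in> H \<and> (\<forall>g\<in>H. \<forall>h\<in>H. g ** h \<in> H) \<and> (\<forall>h\<in>H. matrix_inv h \<in> H)"
  show "subgroup H GL" by (rule subgroup.intro) (use H in \<open>simp_all add: subset_iff\<close>)
qed

lemma normal_in_iff:
  assumes H: "subgroup H GL"
  shows "normal_in N H \<longleftrightarrow> subgroup N GL \<and> N \<subseteq> H \<and> (\<forall>h\<in>H. \<forall>n\<in>N. conj_by h n \<in> N)"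
proof -
  interpret GL: group "GL :: ('a ^ 'b ^ 'b) monoid" by (rule group_GL)
  interpret H: group "GL\<lparr>carrier := H\<rparr>" using H by (rule GL.subgroup_imp_group)
  have i: "inv\<^bsub>GL\<lparr>carrier := H\<rparr>\<^esub> h = matrix_inv h" if "h \<in> H" for h
    using GL.m_inv_consistent[OF H that] H that by (auto simp: subgroup_GL_iff)
  have "subgroup N (GL\<lparr>carrier := H\<rparr>) \<longleftrightarrow> subgroup N GL \<and> N \<subseteq> H"
  proof
    assume N: "subgroup N (GL\<lparr>carrier := H\<rparr>)"
    then show "subgroup N GL \<and> N \<subseteq> H"
      using GL.incl_subgroup[OF H N] subgroup.subset[OF N] by simp
  next
    assume "subgroup N GL \<and> N \<subseteq> H"
    then show "subgroup N (GL\<lparr>carrier := H\<rparr>)" using GL.subgroup_incl H by blast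
  qed
  then show ?thesis by (auto simp: normal_in_def H.normal_inv_iff conj_by_def i)
qed

subsection \<open>Conjugation\<close>

lemma conj_by_mult:
  assumes "invertible g"
  shows "conj_by g (x ** y) = conj_by g x ** conj_by g y"
proof -
  have "conj_by g x ** conj_by g y = g ** x ** (matrix_inv g ** g) ** y ** matrix_inv g"
    by (simp only: conj_by_def matrix_mul_assoc)
  then show ?thesis using assms by (simp add: matrix_inv_both conj_by_def matrix_mul_assoc)
qed

lemma conj_by_one: "invertible g \<Longrightarrow> conj_by g (mat 1) = mat 1"
  by (simp add: conj_by_def matrix_inv_both)

lemma conj_by_conj_by:
  assumes "invertible g" "invertible h"
  shows "conj_by g (conj_by h x) = conj_by (g ** h) x"
  using assms by (simp add: conj_by_def matrix_inv_mult matrix_mul_assoc)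

lemma conj_by_cancel:
  assumes "invertible g"
  shows "conj_by g (conj_by (matrix_inv g) x) = x" "conj_by (matrix_inv g) (conj_by g x) = x"
  using assms by (simp_all add: conj_by_conj_by invertible_matrix_inv matrix_inv_both)
    (simp_all add: conj_by_def matrix_inv_one)

lemma conj_by_invertible: "invertible g \<Longrightarrow> invertible (conj_by g x) \<longleftrightarrow> invertible x"
  by (simp add: conj_by_def invertible_mult_iff invertible_matrix_inv)

lemma conj_by_matrix_inv:
  assumes "invertible g" "invertible x"
  shows "conj_by g (matrix_inv x) = matrix_inv (conj_by g x)"
  by (rule matrix_inv_unique[symmetric]) (simp add: assms conj_by_mult[symmetric] matrix_inv_both conj_by_one)

lemma conj_by_add: "conj_by g (x + y) = conj_by g x + conj_by g y"
  for g x :: "'k::field ^ 'n ^ 'n"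
  by (simp add: vec_eq_iff conj_by_def matrix_matrix_mult_def sum.distrib distrib_left distrib_right)

lemma conj_by_scale: "conj_by g (map_matrix ((*) t) x) = map_matrix ((*) t) (conj_by g x)"
  for g x :: "'k::field ^ 'n ^ 'n"
  by (simp add: vec_eq_iff conj_by_def matrix_matrix_mult_def sum_distrib_left sum_distrib_right mult.assoc mult.left_commute)

lemma conj_by_diff: "conj_by g (x - y) = conj_by g x - conj_by g y"
  for g x :: "'k::field ^ 'n ^ 'n"
  by (metis conj_by_add add_diff_cancel_right' diff_add_cancel)

lemma conj_by_zero: "conj_by g 0 = (0 :: 'k::field ^ 'n ^ 'n)"
  using conj_by_diff[of g 0 0] by simp

lemma inj_conj_by: "invertible g \<Longrightarrow> inj (conj_by g)"
  by (rule inj_on_inverseI[where g = "conj_by (matrix_inv g)"]) (rule conj_by_cancel(2))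

lemma det_conj_by: "invertible g \<Longrightarrow> det (conj_by g x) = det (x :: 'k::field ^ 'n ^ 'n)"
proof -
  assume g: "invertible g"
  have "det g * det (matrix_inv g) = 1" using matrix_inv_both(1)[OF g] det_mul[of g "matrix_inv g"] by simp
  then have "det x = (det g * det (matrix_inv g)) * det x" by simp
  then show ?thesis by (simp only: conj_by_def det_mul) (simp add: mult_ac)
qed

lemma conj_by_image_cancel:
  assumes "invertible g"
  shows "conj_by g ` (conj_by (matrix_inv g) ` A) = A" "conj_by (matrix_inv g) ` (conj_by g ` A) = A"
  using assms by (simp_all add: image_image conj_by_cancel)

lemma in_conj_by_image_iff:
  assumes "invertible g"
  shows "y \<in> conj_by g ` A \<longleftrightarrow> conj_by (matrix_inv g) y \<in> A"
  using conj_by_cancel[OF assms] by (metis image_iff)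

text \<open>
  Conjugating back by the inverse gives the other inclusion. So for every construction \<open>F\<close> transported
  below only one inclusion has to be proved, provided it is proved for all admissible \<open>g\<close> at once.
\<close>

lemma conj_by_image_eqI:
  assumes R: "R g" "\<And>g. R g \<Longrightarrow> invertible g \<and> R (matrix_inv g)"
    and sub: "\<And>g A. R g \<Longrightarrow> Q A \<Longrightarrow> conj_by g ` F A \<subseteq> F (conj_by g ` A)"
    and "Q A" "Q (conj_by g ` A)"
  shows "F (conj_by g ` A) = conj_by g ` F A"
proof
  have g: "invertible g" "R (matrix_inv g)" using R by auto
  have "conj_by (matrix_inv g) ` F (conj_by g ` A) \<subseteq> F A"
    using sub[OF g(2) assms(5)] by (simp add: conj_by_image_cancel[OF g(1)])
  then have "conj_by g ` (conj_by (matrix_inv g) ` F (conj_by g ` A)) \<subseteq> conj_by g ` F A" by (rule image_mono)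
  then show "F (conj_by g ` A) \<subseteq> conj_by g ` F A" by (simp only: conj_by_image_cancel[OF g(1)])
qed (rule sub[OF R(1) assms(4)])

lemma subgroup_conj_by:
  assumes g: "invertible g" and H: "subgroup H GL"
  shows "subgroup (conj_by g ` H) GL"
proof -
  have "mat 1 \<in> conj_by g ` H"
    using imageI[of "mat 1" H "conj_by g"] H by (simp add: subgroup_GL_iff conj_by_one[OF g])
  then show ?thesis
    using H unfolding subgroup_GL_iff
    by (auto simp: conj_by_invertible[OF g] conj_by_mult[OF g, symmetric] conj_by_matrix_inv[OF g, symmetric])
qed

lemma normal_in_conj_by:
  assumes g: "invertible g" and H: "subgroup H GL" and N: "normal_in N H"
  shows "normal_in (conj_by g ` N) (conj_by g ` H)"
proof -
  have "conj_by (conj_by g h) (conj_by g n) = conj_by g (conj_by h n)" if "h \<in> H" for h n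
    using that H g unfolding subgroup_GL_iff conj_by_def[of h] conj_by_def[of "conj_by g h"]
    by (simp add: conj_by_mult conj_by_matrix_inv)
  then show ?thesis
    using N H subgroup_conj_by[OF g, of N] subgroup_conj_by[OF g H] by (auto simp: normal_in_iff)
qed

subsection \<open>Polynomial and regular functions, the Zariski topology\<close>

text \<open>
  What is used of a ring of coefficients; it is instantiated with the base field and with its
  algebraic closure, so that polynomials over both are treated together.
\<close>

definition coeff_ring :: "'k::field set \<Rightarrow> bool" where
  "coeff_ring R \<longleftrightarrow> 0 \<in> R \<and> 1 \<in> R \<and> -1 \<in> R \<and> (\<forall>x\<in>R. \<forall>y\<in>R. x + y \<in> R \<and> x * y \<in> R)"

lemma coeff_ring_UNIV: "coeff_ring UNIV" by (simp add: coeff_ring_def)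

lemma coeff_ring_base_field: "coeff_ring base_field"
proof -
  have "-1 \<in> range (to_ac :: 'a \<Rightarrow> _)" using to_ac_minus[of 1] by (metis rangeI to_ac_1)
  then show ?thesis
    by (auto simp: coeff_ring_def base_field_def simp flip: to_ac_add to_ac_mult intro: range_eqI[of _ _ 0] range_eqI[of _ _ 1])
qed

lemma poly_fun_sum:
  assumes "coeff_ring R" "\<And>a. a \<in> A \<Longrightarrow> f a \<in> poly_fun R"
  shows "(\<lambda>x. \<Sum>a\<in>A. f a x) \<in> poly_fun R"
  using assms by (induction A rule: infinite_finite_induct) (auto intro: poly_fun.intros simp: coeff_ring_def)

lemma poly_fun_prod:
  assumes "coeff_ring R" "\<And>a. a \<in> A \<Longrightarrow> f a \<in> poly_fun R"
  shows "(\<lambda>x. \<Prod>a\<in>A. f a x) \<in> poly_fun R"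
  using assms by (induction A rule: infinite_finite_induct) (auto intro: poly_fun.intros simp: coeff_ring_def)

lemma poly_fun_power:
  assumes "coeff_ring R" "p \<in> poly_fun R"
  shows "(\<lambda>x. p x ^ m) \<in> poly_fun R"
  using poly_fun_prod[OF assms(1), of "{..<m}" "\<lambda>_. p"] assms(2) by simp

lemma poly_fun_compose:
  fixes T :: "'k::field ^ 'n ^ 'n \<Rightarrow> 'k ^ 'n ^ 'n"
  assumes "p \<in> poly_fun R" "\<And>i j. (\<lambda>x. T x $ i $ j) \<in> poly_fun R"
  shows "(\<lambda>x. p (T x)) \<in> poly_fun R"
  using assms by (induction rule: poly_fun.induct) (auto intro: poly_fun.intros)

lemma poly_fun_det:
  fixes T :: "'k::field ^ 'n ^ 'n \<Rightarrow> 'k ^ 'n ^ 'n"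
  assumes R: "coeff_ring R" and T: "\<And>i j. (\<lambda>x. T x $ i $ j) \<in> poly_fun R"
  shows "(\<lambda>x. det (T x)) \<in> poly_fun R"
  unfolding det_def
proof (rule poly_fun_sum[OF R])
  fix p :: "'n \<Rightarrow> 'n"
  have "of_int (sign p) \<in> R" using R by (auto simp: sign_def coeff_ring_def)
  then show "(\<lambda>x. of_int (sign p) * (\<Prod>i\<in>UNIV. T x $ i $ p i)) \<in> poly_fun R"
    by (intro poly_fun.mult poly_fun.const poly_fun_prod[OF R] T)
qed

lemma poly_fun_conj_by:
  fixes g :: "'k::field ^ 'n ^ 'n"
  assumes R: "coeff_ring R" and g: "\<And>i j. g $ i $ j \<in> R" "\<And>i j. matrix_inv g $ i $ j \<in> R"
    and p: "p \<in> poly_fun R"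
  shows "(\<lambda>x. p (conj_by g x)) \<in> poly_fun R"
  by (rule poly_fun_compose[OF p])
     (auto simp: conj_by_def matrix_matrix_mult_def intro!: poly_fun_sum[OF R] poly_fun.mult poly_fun.coord poly_fun.const g)

text \<open>
  Only the values at invertible matrices matter, so that the composite of regular maps is again
  regular without any normal form away from the group.
\<close>

definition regular :: "('k::field ^ 'n ^ 'n \<Rightarrow> 'k) \<Rightarrow> bool" where
  "regular f \<longleftrightarrow> (\<exists>q\<in>poly_fun UNIV. \<exists>m. \<forall>x. invertible x \<longrightarrow> f x = q x / det x ^ m)"

lemma regular_poly_fun: "p \<in> poly_fun UNIV \<Longrightarrow> regular p"
  unfolding regular_def by (rule bexI[of _ p], rule exI[of _ 0]) auto

lemma regular_add:
  assumes "regular f" "regular g" shows "regular (\<lambda>x. f x + g x)"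
proof -
  obtain p k q m where p: "p \<in> poly_fun UNIV" "\<And>x. invertible x \<Longrightarrow> f x = p x / det x ^ k"
    and q: "q \<in> poly_fun UNIV" "\<And>x. invertible x \<Longrightarrow> g x = q x / det x ^ m"
    using assms unfolding regular_def by metis
  have d: "(\<lambda>x. det x ^ m) \<in> poly_fun UNIV" for m
    by (intro poly_fun_power poly_fun_det coeff_ring_UNIV poly_fun.coord)
  have "f x + g x = (p x * det x ^ m + q x * det x ^ k) / det x ^ (k + m)" if "invertible x" for x
    using that p(2) q(2) by (simp add: invertible_det_nz power_add add_frac_eq)
  then show ?thesis unfolding regular_def
    by (intro bexI[of _ "\<lambda>x. p x * det x ^ m + q x * det x ^ k"] exI[of _ "k + m"] poly_fun.add poly_fun.mult p q d) auto
qed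

lemma regular_mult:
  assumes "regular f" "regular g" shows "regular (\<lambda>x. f x * g x)"
proof -
  obtain p k q m where p: "p \<in> poly_fun UNIV" "\<And>x. invertible x \<Longrightarrow> f x = p x / det x ^ k"
    and q: "q \<in> poly_fun UNIV" "\<And>x. invertible x \<Longrightarrow> g x = q x / det x ^ m"
    using assms unfolding regular_def by metis
  show ?thesis unfolding regular_def
    by (intro bexI[of _ "\<lambda>x. p x * q x"] exI[of _ "k + m"] poly_fun.mult p q) (simp add: p(2) q(2) power_add)
qed

lemma regular_const: "regular (\<lambda>_. c)" and regular_coord: "regular (\<lambda>x. x $ i $ j)"
  by (intro regular_poly_fun poly_fun.intros UNIV_I)+

lemma regular_sum: "(\<And>a. a \<in> A \<Longrightarrow> regular (f a)) \<Longrightarrow> regular (\<lambda>x. \<Sum>a\<in>A. f a x)"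
  by (induction A rule: infinite_finite_induct) (auto intro: regular_const regular_add)

definition regular_map :: "('k::field ^ 'n ^ 'n \<Rightarrow> 'k ^ 'n ^ 'n) \<Rightarrow> bool" where
  "regular_map T \<longleftrightarrow> (\<forall>i j. regular (\<lambda>x. T x $ i $ j)) \<and> (\<forall>x. invertible x \<longrightarrow> invertible (T x))"

lemma regular_map_mult: "regular_map S \<Longrightarrow> regular_map T \<Longrightarrow> regular_map (\<lambda>x. S x ** T x)"
  by (auto simp: regular_map_def matrix_matrix_mult_def invertible_mult_iff[unfolded matrix_matrix_mult_def]
      intro!: regular_sum regular_mult)

lemma regular_map_id: "regular_map (\<lambda>x. x)"
  by (simp add: regular_map_def regular_coord)

lemma regular_map_const: "invertible g \<Longrightarrow> regular_map (\<lambda>_. g)"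
  by (simp add: regular_map_def regular_const)

lemma regularI:
  "q \<in> poly_fun UNIV \<Longrightarrow> (\<And>x. invertible x \<Longrightarrow> f x = q x / det x ^ m) \<Longrightarrow> regular f"
  unfolding regular_def by blast

text \<open>
  Cramer's rule.
\<close>

lemma regular_map_inv: "regular_map (matrix_inv :: 'k::field ^ 'n ^ 'n \<Rightarrow> 'k ^ 'n ^ 'n)"
  unfolding regular_map_def
proof (intro conjI allI impI invertible_matrix_inv)
  fix i j :: 'n
  define q where "q x = det (\<chi> a b. if b = i then axis j 1 $ a else x $ a $ b)" for x :: "'k ^ 'n ^ 'n"
  have "(\<lambda>x. (\<chi> a b. if b = i then axis j 1 $ a else x $ a $ b) $ a $ b) \<in> poly_fun UNIV"
    for a b :: 'n
    by (cases "b = i") (simp_all add: poly_fun.intros)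
  then have "q \<in> poly_fun UNIV"
    unfolding q_def by (rule poly_fun_det[OF coeff_ring_UNIV])
  then show "regular (\<lambda>x :: 'k ^ 'n ^ 'n. matrix_inv x $ i $ j)"
  proof (rule regularI[where m = 1])
    fix x :: "'k ^ 'n ^ 'n" assume x: "invertible x"
    have "x *v (column j (matrix_inv x)) = column j (x ** matrix_inv x)"
      by (simp add: vec_eq_iff column_def matrix_vector_mult_def matrix_matrix_mult_def)
    also have "\<dots> = axis j 1" by (simp add: matrix_inv_both[OF x] vec_eq_iff column_def mat_def axis_def)
    finally have "column j (matrix_inv x) = (\<chi> k. det (\<chi> a b. if b = k then axis j 1 $ a else x $ a $ b) / det x)"
      using cramer[of x "column j (matrix_inv x)" "axis j 1"] x by (simp add: invertible_det_nz)
    then have "column j (matrix_inv x) $ i = q x / det x" by (simp add: q_def)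
    then show "matrix_inv x $ i $ j = q x / det x ^ 1" by (simp add: column_def)
  qed
qed

lemma regular_compose:
  assumes p: "p \<in> poly_fun UNIV" and T: "regular_map T"
  shows "regular (\<lambda>x. p (T x))"
  using p
proof (induction rule: poly_fun.induct)
  case (coord i j)
  then show ?case using T by (simp add: regular_map_def)
qed (simp_all add: regular_const regular_add regular_mult)

definition basic_opens :: "('k::field ^ 'n ^ 'n) set set" where
  "basic_opens = {{g. invertible g \<and> p g \<noteq> 0} | p. p \<in> poly_fun UNIV}"

lemma basic_opensI: "p \<in> poly_fun UNIV \<Longrightarrow> {g. invertible g \<and> p g \<noteq> 0} \<in> basic_opens"
  unfolding basic_opens_def by blast

lemma zariski_eq: "zariski = topology_generated_by basic_opens"
  by (simp add: zariski_def basic_opens_def)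

lemma topspace_zariski: "topspace (zariski :: ('k::field ^ 'n ^ 'n) topology) = {g. invertible g}"
proof
  have "{g :: 'k ^ 'n ^ 'n. invertible g \<and> (1::'k) \<noteq> 0} \<in> basic_opens"
    by (rule basic_opensI[OF poly_fun.const[OF UNIV_I]])
  then have "{g :: 'k ^ 'n ^ 'n. invertible g} \<in> basic_opens" by simp
  then show "{g :: 'k ^ 'n ^ 'n. invertible g} \<subseteq> topspace zariski"
    unfolding zariski_eq topology_generated_by_topspace by (rule Union_upper)
  show "topspace zariski \<subseteq> {g :: 'k ^ 'n ^ 'n. invertible g}"
    unfolding zariski_eq topology_generated_by_topspace by (rule Union_least) (auto simp: basic_opens_def)
qed

lemma openin_zariski_basic: "p \<in> poly_fun UNIV \<Longrightarrow> openin zariski {g. invertible g \<and> p g \<noteq> 0}"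
  unfolding zariski_eq by (intro topology_generated_by_Basis basic_opensI)

lemma regular_map_continuous:
  fixes T :: "'k::field ^ 'n ^ 'n \<Rightarrow> 'k ^ 'n ^ 'n"
  assumes T: "regular_map T"
  shows "continuous_map zariski zariski T"
proof -
  have inv: "invertible (T x)" if "invertible x" for x using T that by (simp add: regular_map_def)
  have "continuous_map zariski (topology_generated_by basic_opens) T"
  proof (rule continuous_on_generated_topo)
    fix U :: "('k ^ 'n ^ 'n) set" assume "U \<in> basic_opens"
    then obtain p where p: "p \<in> poly_fun UNIV" "U = {g. invertible g \<and> p g \<noteq> 0}"
      unfolding basic_opens_def by blast
    obtain q m where q: "q \<in> poly_fun UNIV" "\<And>x. invertible x \<Longrightarrow> p (T x) = q x / det x ^ m"
      using regular_compose[OF p(1) T] unfolding regular_def by blast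
    have "T -` U \<inter> topspace zariski = {g. invertible g \<and> q g \<noteq> 0}"
      unfolding p(2) topspace_zariski using inv q(2) by (auto simp: invertible_det_nz)
    then show "openin zariski (T -` U \<inter> topspace zariski)" using openin_zariski_basic[OF q(1)] by simp
  next
    have "T ` topspace zariski \<subseteq> topspace zariski" using inv by (auto simp: topspace_zariski)
    then show "T ` topspace zariski \<subseteq> \<Union> basic_opens"
      unfolding zariski_eq topology_generated_by_topspace by auto
  qed
  then show ?thesis by (simp add: zariski_eq)
qed

lemma closedin_one: "closedin zariski {mat 1 :: 'k::field ^ 'n ^ 'n}"
proof -
  let ?U = "\<Union>(i, j)\<in>UNIV. {g :: 'k ^ 'n ^ 'n. invertible g \<and> g $ i $ j + (- (mat 1 $ i $ j)) \<noteq> 0}"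
  have "openin zariski {g :: 'k ^ 'n ^ 'n. invertible g \<and> g $ i $ j + (- (mat 1 $ i $ j)) \<noteq> 0}" for i j
    by (rule openin_zariski_basic) (intro poly_fun.intros UNIV_I)
  then have "openin zariski ?U" by (intro openin_Union) auto
  moreover have "topspace zariski - {mat 1} = ?U" unfolding topspace_zariski by (auto simp: vec_eq_iff)
  ultimately show ?thesis by (simp add: closedin_def topspace_zariski invertible_one)
qed

subsection \<open>Closures of solvable groups\<close>

lemma regular_map_mult_const: "invertible g \<Longrightarrow> regular_map (\<lambda>x. g ** x)" "invertible g \<Longrightarrow> regular_map (\<lambda>x. x ** g)"
  by (rule regular_map_mult[OF regular_map_const regular_map_id], assumption)
     (rule regular_map_mult[OF regular_map_id regular_map_const], assumption)

lemma regular_map_closure: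
  assumes T: "regular_map T" and "\<And>h. h \<in> H \<Longrightarrow> T h \<in> zariski closure_of K" and "x \<in> zariski closure_of H"
  shows "T x \<in> zariski closure_of K"
proof -
  have "T ` (zariski closure_of H) \<subseteq> zariski closure_of (T ` H)"
    by (rule continuous_map_image_closure_subset[OF regular_map_continuous[OF T]])
  also have "\<dots> \<subseteq> zariski closure_of (zariski closure_of K)" by (rule closure_of_mono) (use assms(2) in auto)
  finally show ?thesis using assms(3) by auto
qed

lemma subgroup_closure:
  fixes H :: "('k::field ^ 'n ^ 'n) set"
  assumes H: "subgroup H GL"
  shows "subgroup (zariski closure_of H) GL"
proof -
  note H' = H[unfolded subgroup_GL_iff]
  have sub: "H \<subseteq> zariski closure_of H"
    by (rule closure_of_subset) (use H' in \<open>auto simp: topspace_zariski\<close>)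
  have inv: "invertible x" if "x \<in> zariski closure_of H" for x
    using that closure_of_subset_topspace[of zariski H] by (auto simp: topspace_zariski)
  have 1: "h ** x \<in> zariski closure_of H" if h: "h \<in> H" "x \<in> zariski closure_of H" for h x
    by (rule regular_map_closure[OF regular_map_mult_const(1) _ h(2)]) (use H' h sub in auto)
  have 2: "x ** y \<in> zariski closure_of H" if "x \<in> zariski closure_of H" "y \<in> zariski closure_of H" for x y
    by (rule regular_map_closure[OF regular_map_mult_const(2) _ that(1)]) (use 1 inv that in auto)
  have 3: "matrix_inv x \<in> zariski closure_of H" if "x \<in> zariski closure_of H" for x
    by (rule regular_map_closure[OF regular_map_inv _ that]) (use H' sub in auto)
  show ?thesis unfolding subgroup_GL_iff using inv 2 3 sub H' by auto
qed

text \<open>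
  The commutator is a regular map in each variable separately; fixing first an element of \<open>H\<close> and then
  an element of the closure extends the inclusion of the commutators to the closure in two steps.
\<close>

lemma derived_closure:
  fixes H :: "('k::field ^ 'n ^ 'n) set"
  assumes H: "subgroup H GL"
  shows "derived GL (zariski closure_of H) \<subseteq> zariski closure_of (derived GL H)"
proof -
  interpret GL: group "GL :: ('k ^ 'n ^ 'n) monoid" by (rule group_GL)
  let ?C = "zariski closure_of H" and ?D = "zariski closure_of (derived GL H)"
  have inv: "invertible h" if "h \<in> H" for h using H that by (auto simp: subgroup_GL_iff)
  have inv': "invertible h" if "h \<in> ?C" for h
    using that closure_of_subset_topspace[of zariski H] by (auto simp: topspace_zariski)
  have sD: "subgroup (derived GL H) GL" using inv by (intro GL.derived_is_subgroup) auto
  have D: "derived GL H \<subseteq> ?D"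
    by (rule closure_of_subset) (use sD in \<open>auto simp: topspace_zariski subgroup_GL_iff\<close>)
  have r: "regular_map (\<lambda>x. x ** g ** matrix_inv x ** matrix_inv g)" "regular_map (\<lambda>x. g ** x ** matrix_inv g ** matrix_inv x)"
    if "invertible g" for g :: "'k ^ 'n ^ 'n"
    using that invertible_matrix_inv[OF that]
    by (simp_all add: regular_map_mult regular_map_id regular_map_const regular_map_inv)
  have 0: "x ** h ** matrix_inv x ** matrix_inv h \<in> ?D" if "x \<in> H" "h \<in> H" for x h
  proof -
    have "x ** h ** matrix_inv x ** matrix_inv h \<in> derived_set GL H"
      by (rule UN_I[OF that(1)], rule UN_I[OF that(2)]) (simp add: inv that)
    then have "x ** h ** matrix_inv x ** matrix_inv h \<in> derived GL H"
      unfolding derived_def by (rule generate.incl)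
    then show ?thesis using D by blast
  qed
  have 1: "x ** h ** matrix_inv x ** matrix_inv h \<in> ?D" if "x \<in> ?C" "h \<in> H" for x h
    by (rule regular_map_closure[OF r(1)[OF inv[OF that(2)]] _ that(1)]) (rule 0[OF _ that(2)])
  have 2: "x ** h ** matrix_inv x ** matrix_inv h \<in> ?D" if "x \<in> ?C" "h \<in> ?C" for x h
    by (rule regular_map_closure[OF r(2)[OF inv'[OF that(1)]] _ that(2)]) (rule 1[OF that(1)])
  have "derived_set GL ?C \<subseteq> ?D" using 2 inv' by auto
  then show ?thesis unfolding derived_def
    by (intro GL.generate_subgroup_incl subgroup_closure sD[unfolded derived_def])
qed

lemma solvable_iff_derived:
  fixes H :: "('k::field ^ 'n ^ 'n) set"
  assumes H: "subgroup H GL"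
  shows "solvable (GL\<lparr>carrier := H\<rparr>) \<longleftrightarrow> (\<exists>m. (derived GL ^^ m) H = {mat 1})"
proof -
  interpret GL: group "GL :: ('k ^ 'n ^ 'n) monoid" by (rule group_GL)
  interpret H: group "GL\<lparr>carrier := H\<rparr>" by (rule GL.subgroup_imp_group[OF H])
  have "(derived (GL\<lparr>carrier := H\<rparr>) ^^ m) H = (derived GL ^^ m) H \<and> (derived GL ^^ m) H \<subseteq> H" for m
    by (induction m) (use GL.derived_consistent[OF _ H] GL.derived_incl[OF _ H] in auto)
  then show ?thesis unfolding H.solvable_iff_trivial_derived_seq by simp
qed

text \<open>
  The derived series of the closure stays inside the closures of the derived series of \<open>H\<close>, and points
  are closed.
\<close>

lemma solvable_closure:
  fixes H :: "('k::field ^ 'n ^ 'n) set"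
  assumes H: "subgroup H GL" and s: "solvable (GL\<lparr>carrier := H\<rparr>)"
  shows "solvable (GL\<lparr>carrier := zariski closure_of H\<rparr>)"
proof -
  interpret GL: group "GL :: ('k ^ 'n ^ 'n) monoid" by (rule group_GL)
  have m: "(derived GL ^^ m) (zariski closure_of H) \<subseteq> zariski closure_of ((derived GL ^^ m) H)" for m
  proof (induction m)
    case (Suc m)
    have "derived GL ((derived GL ^^ m) (zariski closure_of H)) \<subseteq> derived GL (zariski closure_of ((derived GL ^^ m) H))"
      by (rule GL.mono_derived[OF Suc])
    also have "\<dots> \<subseteq> zariski closure_of (derived GL ((derived GL ^^ m) H))"
      by (rule derived_closure[OF GL.exp_of_derived_is_subgroup[OF H]])
    finally show ?case by simp
  qed simp
  obtain m' where "(derived GL ^^ m') H = {mat 1}" using s solvable_iff_derived[OF H] by blast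
  with m[of m'] have "(derived GL ^^ m') (zariski closure_of H) \<subseteq> {mat 1}"
    using closure_of_closedin[OF closedin_one] by metis
  moreover have "mat 1 \<in> (derived GL ^^ m') (zariski closure_of H)"
    using GL.exp_of_derived_is_subgroup[OF subgroup_closure[OF H], of m'] by (simp add: subgroup_GL_iff)
  ultimately show ?thesis using solvable_iff_derived[OF subgroup_closure[OF H]] by blast
qed

text \<open>
  The group \<open>N B\<close> is an extension: modulo \<open>N\<close> it has the same image as \<open>B\<close>.
\<close>

lemma solvable_product:
  fixes P :: "('k::field ^ 'n ^ 'n) set"
  assumes P: "subgroup P GL" and N: "normal_in N P" and B: "subgroup B GL" "B \<subseteq> P"
    and sN: "solvable (GL\<lparr>carrier := N\<rparr>)" and sB: "solvable (GL\<lparr>carrier := B\<rparr>)"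
  shows "subgroup {n ** b | n b. n \<in> N \<and> b \<in> B} GL"
    and "solvable (GL\<lparr>carrier := {n ** b | n b. n \<in> N \<and> b \<in> B}\<rparr>)"
proof -
  interpret GL: group "GL :: ('k ^ 'n ^ 'n) monoid" by (rule group_GL)
  define H where "H = GL\<lparr>carrier := P\<rparr>"
  interpret H: group H unfolding H_def by (rule GL.subgroup_imp_group[OF P])
  have NH: "N \<lhd> H" using N by (simp add: normal_in_def H_def)
  interpret N: normal N H by (rule NH)
  have NGL: "subgroup N GL" "N \<subseteq> P" using N normal_in_iff[OF P] by auto
  have BH: "subgroup B H" unfolding H_def using GL.subgroup_incl[OF B(1) P B(2)] .
  let ?J = "{n ** b | n b. n \<in> N \<and> b \<in> B}"
  have cN: "conj_by b n \<in> N" if "n \<in> N" "b \<in> B" for n b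
    using that N B(2) normal_in_iff[OF P] by blast
  note BG = B(1)[unfolded subgroup_GL_iff] and NG = NGL(1)[unfolded subgroup_GL_iff]
  show JGL: "subgroup ?J GL"
    unfolding subgroup_GL_iff
  proof (intro conjI ballI)
    show "mat 1 \<in> ?J" using BG NG by (intro CollectI exI[of _ "mat 1"]) simp
    fix x assume "x \<in> ?J"
    then obtain n b where x: "x = n ** b" "n \<in> N" "b \<in> B" by blast
    have inv: "invertible n" "invertible b" using x(2,3) BG NG by simp_all
    then show "invertible x" by (simp add: x invertible_mult_iff)
    have "matrix_inv x = conj_by (matrix_inv b) (matrix_inv n) ** matrix_inv b"
      using inv by (simp add: x matrix_inv_mult conj_by_def matrix_inv_inv mult_inv_cancel)
    moreover have "matrix_inv n \<in> N" and b: "matrix_inv b \<in> B" using x(2,3) BG NG by simp_all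
    moreover from cN[OF this] have "conj_by (matrix_inv b) (matrix_inv n) \<in> N" .
    ultimately show "matrix_inv x \<in> ?J" by (intro CollectI exI conjI)
    fix y assume "y \<in> ?J"
    then obtain n' b' where y: "y = n' ** b'" "n' \<in> N" "b' \<in> B" by blast
    have "x ** y = (n ** conj_by b n') ** (b ** b')"
      using inv by (simp add: x y conj_by_def matrix_mul_assoc mult_inv_cancel)
    moreover have "n ** conj_by b n' \<in> N" "b ** b' \<in> B" using cN x(2,3) y(2,3) BG NG by simp_all
    ultimately show "x ** y \<in> ?J" by (intro CollectI exI conjI)
  qed
  have JP: "?J \<subseteq> P"
  proof
    fix x assume "x \<in> ?J"
    then obtain n b where x: "x = n ** b" "n \<in> N" "b \<in> B" by blast
    then have "n \<in> P" "b \<in> P" using NGL(2) B(2) by auto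
    then show "x \<in> P" using P unfolding x(1) subgroup_GL_iff by simp
  qed
  have JH: "subgroup ?J H" unfolding H_def by (rule GL.subgroup_incl[OF JGL P JP])
  have seq: "solvable_seq H A" if "subgroup A GL" "A \<subseteq> P" "solvable (GL\<lparr>carrier := A\<rparr>)" for A
  proof -
    have "\<exists>m. (derived H ^^ m) A = {\<one>\<^bsub>H\<^esub>}"
    proof -
      have "(derived H ^^ m) A = (derived GL ^^ m) A \<and> (derived GL ^^ m) A \<subseteq> P" for m
        unfolding H_def by (induction m) (use GL.derived_consistent[OF _ P] GL.derived_incl[OF _ P] that(2) in auto)
      then show ?thesis using that(3) solvable_iff_derived[OF that(1)] by (simp add: H_def)
    qed
    then show ?thesis using H.trivial_derived_seq_imp_solvable GL.subgroup_incl[OF that(1) P that(2)] unfolding H_def by blast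
  qed
  define f where "f a = N #>\<^bsub>H\<^esub> a" for a
  interpret Q: group "H Mod N" by (rule N.factorgroup_is_group)
  have f: "group_hom H (H Mod N) f"
    unfolding f_def by (intro group_hom.intro group_hom_axioms.intro N.r_coset_hom_Mod H.is_group Q.is_group)
  have id: "group_hom H H (\<lambda>x. x)"
    by (intro group_hom.intro group_hom_axioms.intro H.is_group) (auto simp: hom_def)
  have fN: "f n = \<one>\<^bsub>H Mod N\<^esub>" if "n \<in> N" for n
    using that N.subset N.rcos_const[OF H.is_group] by (auto simp: f_def FactGroup_def)
  have cl: "n \<in> carrier H" if "n \<in> N" for n using that N.subset by auto
  have cl': "b \<in> carrier H" if "b \<in> B" for b using that subgroup.subset[OF BH] by auto
  have "f ` ?J = f ` B"
  proof
    show "f ` ?J \<subseteq> f ` B"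
    proof
      fix y assume "y \<in> f ` ?J"
      then obtain n b where nb: "n \<in> N" "b \<in> B" "y = f (n ** b)" by blast
      have "f (n ** b) = f (n \<otimes>\<^bsub>H\<^esub> b)" by (simp add: H_def)
      also have "\<dots> = f n \<otimes>\<^bsub>H Mod N\<^esub> f b"
        using group_hom.hom_mult[OF f cl cl'] nb by blast
      also have "\<dots> = f b"
        by (simp only: fN[OF nb(1)] Q.l_one[OF group_hom.hom_closed[OF f cl'[OF nb(2)]]])
      finally show "y \<in> f ` B" using nb by blast
    qed
    have "B \<subseteq> ?J"
    proof
      fix b assume "b \<in> B"
      then show "b \<in> ?J" using NG by (intro CollectI exI[of _ "mat 1"] exI[of _ b]) simp
    qed
    then show "f ` B \<subseteq> f ` ?J" by (rule image_mono)
  qed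
  then have sJ: "solvable_seq (H Mod N) (f ` ?J)"
    using group_hom.solvable_imp_solvable_img[OF f seq[OF B sB]] by simp
  have "kernel H (H Mod N) f \<subseteq> N"
  proof
    fix x assume "x \<in> kernel H (H Mod N) f"
    then have "x \<in> carrier H" "N #>\<^bsub>H\<^esub> x = N" by (auto simp: kernel_def f_def FactGroup_def)
    then show "x \<in> N" using H.coset_join1[of N x] N.subgroup_axioms N.subset by blast
  qed
  then have ker: "kernel H (H Mod N) f \<subseteq> (\<lambda>x. x) ` N" by simp
  have NJ: "(\<lambda>x. x) ` N \<subseteq> ?J"
  proof
    fix n assume "n \<in> (\<lambda>x. x) ` N"
    then show "n \<in> ?J" using BG by (intro CollectI exI[of _ n] exI[of _ "mat 1"]) simp
  qed
  have "solvable_seq H ?J"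
    by (rule solvable_seq_condition[OF id f NJ ker JH seq[OF NGL sN] sJ])
  then obtain m where m: "(derived H ^^ m) ?J = {\<one>\<^bsub>H\<^esub>}" using H.solvable_imp_trivial_derived_seq by blast
  have "(derived H ^^ m) ?J = (derived GL ^^ m) ?J \<and> (derived GL ^^ m) ?J \<subseteq> P" for m
    unfolding H_def by (induction m) (use GL.derived_consistent[OF _ P] GL.derived_incl[OF _ P] JP in auto)
  then show "solvable (GL\<lparr>carrier := ?J\<rparr>)" using m solvable_iff_derived[OF JGL] by (auto simp: H_def)
qed

text \<open>
  The closure of \<open>N B\<close> is again closed, connected and solvable, so by maximality of \<open>B\<close> it equals \<open>B\<close>.
  Taking the closure avoids having to know that the product set is closed.
\<close>

lemma connected_solvable_normal_subset_borel:
  fixes P :: "('k::field ^ 'n ^ 'n) set"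
  assumes H: "closed_subgroup H" and P: "subgroup P GL" "P \<subseteq> H" and B: "borel_subgroup H B" "B \<subseteq> P"
    and N: "connected_solvable N" "normal_in N P"
  shows "N \<subseteq> B"
proof -
  have cB: "connected_solvable B" and Bmax: "\<And>B'. connected_solvable B' \<Longrightarrow> B \<subseteq> B' \<Longrightarrow> B' \<subseteq> H \<Longrightarrow> B' = B"
    using B(1) by (auto simp: borel_subgroup_def)
  have sN: "subgroup N GL" and sB: "subgroup B GL"
    using N(1) cB by (auto simp: connected_solvable_def closed_subgroup_def)
  let ?J = "{n ** b | n b. n \<in> N \<and> b \<in> B}"
  have J: "subgroup ?J GL" "solvable (GL\<lparr>carrier := ?J\<rparr>)"
    using solvable_product[OF P(1) N(2) sB B(2)] N(1) cB by (auto simp: connected_solvable_def)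
  have NJ: "N \<subseteq> ?J"
  proof
    fix n assume "n \<in> N"
    then show "n \<in> ?J" using subgroup.one_closed[OF sB] by (intro CollectI exI[of _ n] exI[of _ "mat 1"]) simp
  qed
  have BJ: "B \<subseteq> ?J"
  proof
    fix b assume "b \<in> B"
    then show "b \<in> ?J" using subgroup.one_closed[OF sN] by (intro CollectI exI[of _ "mat 1"] exI[of _ b]) simp
  qed
  have conJ: "connectedin zariski ?J"
  proof -
    \<comment> \<open>Each translate \<open>n B\<close> meets \<open>N\<close> in \<open>n\<close>, and all the unions share the identity.\<close>
    have "?J = (\<Union>n\<in>N. N \<union> (\<lambda>b. n ** b) ` B)" using NJ by auto
    moreover have "connectedin zariski (\<Union>((\<lambda>n. N \<union> (\<lambda>b. n ** b) ` B) ` N))"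
    proof (rule connectedin_Union)
      have "mat 1 \<in> N" using subgroup.one_closed[OF sN] by simp
      then show "\<Inter>((\<lambda>n. N \<union> (\<lambda>b. n ** b) ` B) ` N) \<noteq> {}" by auto
      fix S assume "S \<in> (\<lambda>n. N \<union> (\<lambda>b. n ** b) ` B) ` N"
      then obtain n where n: "n \<in> N" "S = N \<union> (\<lambda>b. n ** b) ` B" by auto
      have "invertible n" using n sN by (simp add: subgroup_GL_iff)
      then have "connectedin zariski ((\<lambda>b. n ** b) ` B)"
        using cB by (intro connectedin_continuous_map_image[OF regular_map_continuous[OF regular_map_mult_const(1)]])
          (auto simp: connected_solvable_def)
      moreover have "n \<in> (\<lambda>b. n ** b) ` B" using subgroup.one_closed[OF sB] by (intro image_eqI[of _ _ "mat 1"]) simp_all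
      ultimately show "connectedin zariski S"
        unfolding n(2) using N(1) n(1) by (intro connectedin_Un) (auto simp: connected_solvable_def)
    qed
    ultimately show ?thesis by simp
  qed
  let ?C = "zariski closure_of ?J"
  have JC: "?J \<subseteq> ?C"
    by (rule closure_of_subset) (use J(1) in \<open>auto simp: topspace_zariski subgroup_GL_iff\<close>)
  have "connected_solvable ?C"
    unfolding connected_solvable_def closed_subgroup_def
    by (intro conjI subgroup_closure J(1) solvable_closure J connectedin_closure_of conJ closedin_closure_of)
  moreover have "?C \<subseteq> H"
  proof (rule closure_of_minimal)
    show "closedin zariski H" using H by (simp add: closed_subgroup_def)
    have "N \<subseteq> P" using N(2) normal_in_iff[OF P(1)] by auto
    then show "?J \<subseteq> H" using P B(2) unfolding subgroup_GL_iff by blast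
  qed
  ultimately have "?C = B" using Bmax BJ JC by blast
  then show ?thesis using NJ JC by blast
qed

text \<open>
  The larger the parabolic, the smaller its unipotent radical: a connected solvable normal subgroup of
  \<open>P\<close> is contained in \<open>B\<close>, hence in \<open>Q\<close>, and remains normal there.
\<close>

lemma unip_radical_antimono:
  fixes P :: "('k::field ^ 'n ^ 'n) set"
  assumes H: "closed_subgroup H" and P: "subgroup P GL" "P \<subseteq> H" and Q: "subgroup Q GL" "Q \<subseteq> P"
    and B: "borel_subgroup H B" "B \<subseteq> Q"
  shows "unip_radical P \<subseteq> unip_radical Q"
proof
  fix g assume "g \<in> unip_radical P"
  then obtain N where N: "connected_solvable N" "normal_in N P" "g \<in> N" and g: "unipotent g"
    by (auto simp: unip_radical_def radical_def)
  have "N \<subseteq> Q" using connected_solvable_normal_subset_borel[OF H P B(1) _ N(1,2)] B(2) Q(2) by blast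
  then have "normal_in N Q" using N(2) Q(2) normal_in_iff[OF P(1)] normal_in_iff[OF Q(1)] by auto
  then show "g \<in> unip_radical Q" using N g by (auto simp: unip_radical_def radical_def)
qed

lemma unipotent_conj_by:
  assumes g: "invertible g" and x: "unipotent x"
  shows "unipotent (conj_by g x)"
proof -
  obtain m where m: "(((**) (x - mat 1)) ^^ m) (mat 1) = 0" using x by (auto simp: unipotent_def)
  have "(((**) (conj_by g x - mat 1)) ^^ m) (mat 1) = conj_by g ((((**) (x - mat 1)) ^^ m) (mat 1))" for m
  proof (induction m)
    case 0
    then show ?case using g by (simp add: conj_by_one)
  next
    case (Suc m)
    then show ?case using g by (simp add: conj_by_mult conj_by_diff conj_by_one)
  qed
  then show ?thesis unfolding unipotent_def using m conj_by_zero[of g] by metis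
qed

lemma unip_radical_subset:
  assumes "subgroup P GL" shows "unip_radical P \<subseteq> P"
  using normal_in_iff[OF assms] by (auto simp: unip_radical_def radical_def)

lemma unip_radical_normal:
  assumes P: "subgroup P GL" and p: "p \<in> P" and u: "u \<in> unip_radical P"
  shows "conj_by p u \<in> unip_radical P"
proof -
  obtain N where N: "connected_solvable N" "normal_in N P" "u \<in> N" and un: "unipotent u"
    using u by (auto simp: unip_radical_def radical_def)
  have "conj_by p u \<in> N" using N p normal_in_iff[OF P] by auto
  moreover have "unipotent (conj_by p u)" using unipotent_conj_by[OF _ un] p P by (auto simp: subgroup_GL_iff)
  ultimately show ?thesis using N by (auto simp: unip_radical_def radical_def)
qed

subsection \<open>Transport of structure along conjugation\<close>

lemma regular_map_conj_by: "invertible g \<Longrightarrow> regular_map (conj_by g)"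
  unfolding conj_by_def by (simp add: regular_map_mult regular_map_id regular_map_const invertible_matrix_inv)

lemma closed_subgroup_conj_by:
  fixes H :: "('k::field ^ 'n ^ 'n) set"
  assumes g: "invertible g" and H: "closed_subgroup H"
  shows "closed_subgroup (conj_by g ` H)"
proof -
  have sH: "subgroup H GL" and cH: "closedin zariski H" using H by (auto simp: closed_subgroup_def)
  have "closedin zariski {x \<in> topspace zariski. conj_by (matrix_inv g) x \<in> H}"
    by (rule closedin_continuous_map_preimage[OF regular_map_continuous[OF regular_map_conj_by[OF invertible_matrix_inv[OF g]]] cH])
  moreover have "{x \<in> topspace zariski. conj_by (matrix_inv g) x \<in> H} = conj_by g ` H"
    using sH unfolding subgroup_GL_iff topspace_zariski
    by (auto simp: in_conj_by_image_iff[OF g] conj_by_cancel[OF g] conj_by_invertible[OF g])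
  ultimately show ?thesis using subgroup_conj_by[OF g sH] by (simp add: closed_subgroup_def)
qed

lemma connectedin_conj_by:
  assumes "invertible g" "connectedin zariski H"
  shows "connectedin zariski (conj_by g ` H)"
  by (rule connectedin_continuous_map_image[OF regular_map_continuous[OF regular_map_conj_by]]) fact+

lemma solvable_conj_by:
  fixes H :: "('k::field ^ 'n ^ 'n) set"
  assumes g: "invertible g" and H: "subgroup H GL" "solvable (GL\<lparr>carrier := H\<rparr>)"
  shows "solvable (GL\<lparr>carrier := conj_by g ` H\<rparr>)"
proof -
  interpret GL: group "GL :: ('k ^ 'n ^ 'n) monoid" by (rule group_GL)
  have h: "group_hom GL GL (conj_by g)"
    by (intro group_hom.intro group_hom_axioms.intro GL.is_group)
       (auto simp: hom_def conj_by_invertible[OF g] conj_by_mult[OF g])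
  have "solvable_seq GL H"
    using GL.trivial_derived_seq_imp_solvable[OF H(1)] H(2) solvable_iff_derived[OF H(1)] by auto
  then have "solvable_seq GL (conj_by g ` H)" by (rule group_hom.solvable_imp_solvable_img[OF h])
  then show ?thesis
    using GL.solvable_imp_trivial_derived_seq solvable_iff_derived[OF subgroup_conj_by[OF g H(1)]] by simp
qed

lemma connected_solvable_conj_by:
  "invertible g \<Longrightarrow> connected_solvable H \<Longrightarrow> connected_solvable (conj_by g ` H)"
  using closed_subgroup_conj_by connectedin_conj_by solvable_conj_by
  by (auto simp: connected_solvable_def closed_subgroup_def)

lemma unip_radical_conj_by:
  assumes g: "invertible g" and H: "subgroup H GL"
  shows "unip_radical (conj_by g ` H) = conj_by g ` unip_radical H"
proof (rule conj_by_image_eqI[where R = invertible and Q = "\<lambda>H. subgroup H GL", OF g _ _ H subgroup_conj_by[OF g H]])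
  show "conj_by g ` unip_radical H \<subseteq> unip_radical (conj_by g ` H)" if "invertible g" "subgroup H GL" for g :: "'a ^ 'b ^ 'b" and H
  proof
    fix y assume "y \<in> conj_by g ` unip_radical H"
    then obtain N x where x: "connected_solvable N" "normal_in N H" "x \<in> N" "unipotent x" "y = conj_by g x"
      by (auto simp: unip_radical_def radical_def)
    then have "connected_solvable (conj_by g ` N)" "normal_in (conj_by g ` N) (conj_by g ` H)"
      "y \<in> conj_by g ` N" "unipotent y"
      using connected_solvable_conj_by normal_in_conj_by unipotent_conj_by that by auto
    then show "y \<in> unip_radical (conj_by g ` H)" unfolding unip_radical_def radical_def by blast
  qed
qed (simp add: invertible_matrix_inv)

lemma borel_subgroup_conj_by:
  assumes g: "invertible g" and B: "borel_subgroup H B"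
  shows "borel_subgroup (conj_by g ` H) (conj_by g ` B)"
  unfolding borel_subgroup_def
proof (intro conjI allI impI)
  show "connected_solvable (conj_by g ` B)" "conj_by g ` B \<subseteq> conj_by g ` H"
    using B connected_solvable_conj_by[OF g] by (auto simp: borel_subgroup_def)
  fix B' assume B': "connected_solvable B' \<and> conj_by g ` B \<subseteq> B' \<and> B' \<subseteq> conj_by g ` H"
  let ?B = "conj_by (matrix_inv g) ` B'"
  have "connected_solvable ?B" using B' connected_solvable_conj_by[OF invertible_matrix_inv[OF g]] by blast
  moreover have "conj_by (matrix_inv g) ` conj_by g ` B \<subseteq> ?B" "?B \<subseteq> conj_by (matrix_inv g) ` conj_by g ` H"
    using B' by (auto intro!: image_mono)
  ultimately have "?B = B" using B by (simp add: conj_by_image_cancel[OF g] borel_subgroup_def)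
  then show "B' = conj_by g ` B" using conj_by_image_cancel(1)[OF g, of B'] by simp
qed

lemma identity_component_subset: "identity_component H \<subseteq> H"
  using connected_component_of_subset_topspace[of "subtopology zariski H"]
  by (auto simp: identity_component_def)

lemma identity_component_conj_by:
  fixes H :: "('k::field ^ 'n ^ 'n) set"
  assumes g: "invertible g" and H: "subgroup H GL"
  shows "identity_component (conj_by g ` H) = conj_by g ` identity_component H"
proof (rule conj_by_image_eqI[where R = invertible and Q = "\<lambda>H. subgroup H GL", OF g _ _ H subgroup_conj_by[OF g H]])
  fix g :: "'k ^ 'n ^ 'n" and H :: "('k ^ 'n ^ 'n) set"
  assume g: "invertible g" and H: "subgroup H GL"
  let ?C = "identity_component H"
  have "connectedin (subtopology zariski H) ?C"
    unfolding identity_component_def by (rule connectedin_connected_component_of)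
  then have "connectedin zariski ?C" by (simp add: connectedin_subtopology)
  then have "connectedin (subtopology zariski (conj_by g ` H)) (conj_by g ` ?C)"
    using connectedin_conj_by[OF g] identity_component_subset[of H] by (auto simp: connectedin_subtopology)
  moreover have "mat 1 \<in> ?C"
    using H by (simp add: identity_component_def connected_component_of_refl topspace_zariski subgroup_GL_iff)
  then have "mat 1 \<in> conj_by g ` ?C" using imageI[of "mat 1" ?C "conj_by g"] by (simp add: conj_by_one[OF g])
  ultimately show "conj_by g ` ?C \<subseteq> identity_component (conj_by g ` H)"
    unfolding identity_component_def by (rule connected_component_of_maximal)
qed (simp add: invertible_matrix_inv)

text \<open>
  The conjugations that preserve everything defined over the base field. The entries of the inverse are
  included in the definition, which makes it symmetric under inversion.
\<close>

definition base_rational :: "'f::field alg_closure ^ 'n ^ 'n \<Rightarrow> bool" where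
  "base_rational g \<longleftrightarrow> invertible g \<and> (\<forall>i j. g $ i $ j \<in> base_field \<and> matrix_inv g $ i $ j \<in> base_field)"

lemma base_rational_inv: "base_rational g \<Longrightarrow> invertible g \<and> base_rational (matrix_inv g)"
  by (simp add: base_rational_def matrix_inv_inv invertible_matrix_inv)

lemma poly_fun_base_conj_by:
  "base_rational g \<Longrightarrow> p \<in> poly_fun base_field \<Longrightarrow> (\<lambda>x. p (conj_by g x)) \<in> poly_fun base_field"
  by (rule poly_fun_conj_by[OF coeff_ring_base_field]) (simp_all add: base_rational_def)

lemma poly_fun_UNIV_conj_by: "p \<in> poly_fun UNIV \<Longrightarrow> (\<lambda>x. p (conj_by g x)) \<in> poly_fun UNIV"
  by (rule poly_fun_conj_by[OF coeff_ring_UNIV]) simp_all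

lemma reg_fun_base_conj_by:
  assumes "base_rational g" "f \<in> reg_fun base_field"
  shows "(\<lambda>x. f (conj_by g x)) \<in> reg_fun base_field"
proof -
  obtain p k where p: "p \<in> poly_fun base_field" "f = (\<lambda>x. p x / det x ^ k)" using assms(2) by (auto simp: reg_fun_def)
  have "(\<lambda>x. f (conj_by g x)) = (\<lambda>x. p (conj_by g x) / det x ^ k)"
    using assms(1) by (simp add: p(2) det_conj_by base_rational_def)
  then show ?thesis using poly_fun_base_conj_by[OF assms(1) p(1)] by (auto simp: reg_fun_def)
qed

lemma reg_fun_UNIV_conj_by:
  assumes "invertible g" "f \<in> reg_fun UNIV"
  shows "(\<lambda>x. f (conj_by g x)) \<in> reg_fun UNIV"
proof -
  obtain p k where p: "p \<in> poly_fun UNIV" "f = (\<lambda>x. p x / det x ^ k)" using assms(2) by (auto simp: reg_fun_def)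
  have "(\<lambda>x. f (conj_by g x)) = (\<lambda>x. p (conj_by g x) / det x ^ k)"
    using assms(1) by (simp add: p(2) det_conj_by)
  then show ?thesis using poly_fun_UNIV_conj_by[OF p(1)] by (auto simp: reg_fun_def)
qed

text \<open>
  Substituting the conjugation turns an equation of the conjugate into one of \<open>H\<close>; this is expressed by
  equations over the base field, and the inverse substitution keeps those over the base field.
\<close>

lemma defined_over_base_conj_by:
  fixes H :: "('f::field alg_closure ^ 'n ^ 'n) set"
  assumes g: "base_rational g" and H: "defined_over_base H"
  shows "defined_over_base (conj_by g ` H)"
  unfolding defined_over_base_def
proof (intro ballI impI)
  fix p :: "'f alg_closure ^ 'n ^ 'n \<Rightarrow> 'f alg_closure"
  assume p: "p \<in> poly_fun UNIV" "\<forall>h\<in>conj_by g ` H. p h = 0"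
  have inv: "invertible g" and g': "base_rational (matrix_inv g)" using g base_rational_inv by auto
  have "(\<lambda>x. p (conj_by g x)) \<in> poly_fun UNIV" by (rule poly_fun_UNIV_conj_by[OF p(1)])
  moreover have "\<forall>h\<in>H. p (conj_by g h) = 0" using p(2) by simp
  ultimately have "\<exists>Q c. finite Q \<and> Q \<subseteq> {q \<in> poly_fun base_field. \<forall>h\<in>H. q h = 0} \<and>
      (\<lambda>x. p (conj_by g x)) = (\<lambda>x. \<Sum>q\<in>Q. c q * q x)"
    using H unfolding defined_over_base_def by (elim ballE[of _ _ "\<lambda>x. p (conj_by g x)"]) simp_all
  then obtain Q c where Q: "finite Q" "Q \<subseteq> {q \<in> poly_fun base_field. \<forall>h\<in>H. q h = 0}"
    "(\<lambda>x. p (conj_by g x)) = (\<lambda>x. \<Sum>q\<in>Q. c q * q x)" by (elim exE conjE)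
  let ?t = "\<lambda>q x. q (conj_by (matrix_inv g) x)" and ?t' = "\<lambda>q x. q (conj_by g x)"
  have tt: "?t' (?t q) = q" for q by (simp add: conj_by_cancel[OF inv])
  have inj: "inj_on ?t Q" by (rule inj_on_inverseI[where g = ?t']) (rule tt)
  show "\<exists>Q c. finite Q \<and> Q \<subseteq> {q \<in> poly_fun base_field. \<forall>h\<in>conj_by g ` H. q h = 0} \<and> p = (\<lambda>x. \<Sum>q\<in>Q. c q * q x)"
  proof (intro exI conjI)
    show "finite (?t ` Q)" using Q(1) by simp
    show "?t ` Q \<subseteq> {q \<in> poly_fun base_field. \<forall>h\<in>conj_by g ` H. q h = 0}"
    proof
      fix q' assume "q' \<in> ?t ` Q"
      then obtain q where q: "q \<in> Q" "q' = ?t q" by auto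
      then have "q \<in> poly_fun base_field" "\<forall>h\<in>H. q h = 0" using Q(2) by auto
      then show "q' \<in> {q \<in> poly_fun base_field. \<forall>h\<in>conj_by g ` H. q h = 0}"
        using poly_fun_base_conj_by[OF g'] by (simp add: q(2) conj_by_cancel[OF inv])
    qed
    show "p = (\<lambda>x. \<Sum>q\<in>?t ` Q. c (?t' q) * q x)"
    proof
      fix x
      have "p x = p (conj_by g (conj_by (matrix_inv g) x))" by (simp add: conj_by_cancel[OF inv])
      also have "\<dots> = (\<Sum>q\<in>Q. c q * q (conj_by (matrix_inv g) x))" using fun_cong[OF Q(3)] by simp
      also have "\<dots> = (\<Sum>q\<in>?t ` Q. c (?t' q) * q x)" by (simp add: sum.reindex[OF inj] tt)
      finally show "p x = (\<Sum>q\<in>?t ` Q. c (?t' q) * q x)" .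
    qed
  qed
qed

lemma algebraic_group_conj_by:
  "base_rational g \<Longrightarrow> algebraic_group H \<Longrightarrow> algebraic_group (conj_by g ` H)"
  using closed_subgroup_conj_by[of g H] defined_over_base_conj_by[of g H] base_rational_inv[of g]
  unfolding algebraic_group_def by simp

lemma parabolic_conj_by:
  assumes g: "base_rational g" and P: "parabolic H P"
  shows "parabolic (conj_by g ` H) (conj_by g ` P)"
proof -
  obtain B where "borel_subgroup H B" "B \<subseteq> P" using P by (auto simp: parabolic_def)
  then have "borel_subgroup (conj_by g ` H) (conj_by g ` B)" "conj_by g ` B \<subseteq> conj_by g ` P"
    using borel_subgroup_conj_by base_rational_inv[OF g] by auto
  then show ?thesis using P algebraic_group_conj_by[OF g] unfolding parabolic_def by blast
qed

text \<open>
  Characters are functions on \<open>T\<close> extended by a default value, so the transported function has to be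
  restricted to the conjugate of \<open>T\<close>.
\<close>

definition transport_char where
  "transport_char g T \<eta> = (\<lambda>x\<in>conj_by g ` T. \<eta> (conj_by (matrix_inv g) x))"

lemma transport_char_apply: "invertible g \<Longrightarrow> a \<in> T \<Longrightarrow> transport_char g T \<eta> (conj_by g a) = \<eta> a"
  by (simp add: transport_char_def conj_by_cancel)

lemma characters_conj_by:
  assumes g: "base_rational g" and \<eta>: "\<eta> \<in> characters T"
  shows "transport_char g T \<eta> \<in> characters (conj_by g ` T)"
proof -
  have inv: "invertible g" "base_rational (matrix_inv g)" using base_rational_inv[OF g] by auto
  obtain f where f: "f \<in> reg_fun base_field" "\<And>a. a \<in> T \<Longrightarrow> \<eta> a = f a" using \<eta> by (auto simp: characters_def)
  have "\<exists>f\<in>reg_fun base_field. \<forall>a\<in>conj_by g ` T. transport_char g T \<eta> a = f a"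
    by (rule bexI[OF _ reg_fun_base_conj_by[OF inv(2) f(1)]])
       (auto simp: f(2) transport_char_def conj_by_cancel[OF inv(1)])
  moreover have "transport_char g T \<eta> (conj_by g a ** conj_by g b) = transport_char g T \<eta> (conj_by g a) * transport_char g T \<eta> (conj_by g b)"
    if ab: "a \<in> T" "b \<in> T" for a b
  proof -
    have "transport_char g T \<eta> (conj_by g (a ** b)) = \<eta> (a ** b)"
    proof (cases "a ** b \<in> T")
      case False
      then have "conj_by g (a ** b) \<notin> conj_by g ` T" by (auto dest: injD[OF inj_conj_by[OF inv(1)]])
      then show ?thesis using \<eta> False by (simp add: characters_def extensional_def transport_char_def)
    qed (rule transport_char_apply[OF inv(1)])
    moreover have "transport_char g T \<eta> (conj_by g a) = \<eta> a" "transport_char g T \<eta> (conj_by g b) = \<eta> b"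
      using transport_char_apply[OF inv(1)] ab by blast+
    ultimately show ?thesis using \<eta> ab
      by (simp add: conj_by_mult[OF inv(1), symmetric] characters_def)
  qed
  moreover have "transport_char g T \<eta> (conj_by g a) \<noteq> 0" if "a \<in> T" for a
    using \<eta> that unfolding transport_char_apply[OF inv(1) that] by (simp add: characters_def)
  moreover have "transport_char g T \<eta> \<in> extensional (conj_by g ` T)"
    unfolding transport_char_def by (rule restrict_extensional)
  ultimately show ?thesis unfolding characters_def by blast
qed

lemma transport_char_inverse:
  assumes g: "invertible g" and \<eta>: "\<eta> \<in> extensional T"
  shows "transport_char (matrix_inv g) (conj_by g ` T) (transport_char g T \<eta>) = \<eta>"
  using \<eta> by (auto simp: transport_char_def fun_eq_iff conj_by_image_cancel[OF g] conj_by_cancel[OF g]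
      matrix_inv_inv[OF g] extensional_def)

lemma split_torus_conj_by:
  fixes T :: "('f::field alg_closure ^ 'n ^ 'n) set"
  assumes g: "base_rational g" and T: "split_torus T"
  shows "split_torus (conj_by g ` T)"
  unfolding split_torus_def
proof (intro conjI ballI)
  have inv: "invertible g" using base_rational_inv[OF g] by simp
  show "algebraic_group (conj_by g ` T)" "connectedin zariski (conj_by g ` T)"
    using T algebraic_group_conj_by[OF g] connectedin_conj_by[OF inv] by (simp_all add: split_torus_def)
  fix f :: "'f alg_closure ^ 'n ^ 'n \<Rightarrow> 'f alg_closure" assume f: "f \<in> reg_fun UNIV"
  have "(\<lambda>x. f (conj_by g x)) \<in> reg_fun UNIV" by (rule reg_fun_UNIV_conj_by[OF inv f])
  then have "\<exists>Q c. finite Q \<and> Q \<subseteq> characters T \<and> (\<forall>a\<in>T. f (conj_by g a) = (\<Sum>\<eta>\<in>Q. c \<eta> * \<eta> a))"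
    using T unfolding split_torus_def by (elim conjE ballE[of _ _ "\<lambda>x. f (conj_by g x)"]) simp_all
  then obtain Q c where Q: "finite Q" "Q \<subseteq> characters T" "\<And>a. a \<in> T \<Longrightarrow> f (conj_by g a) = (\<Sum>\<eta>\<in>Q. c \<eta> * \<eta> a)"
    by blast
  let ?t = "transport_char g T" and ?t' = "transport_char (matrix_inv g) (conj_by g ` T)"
  have tt: "?t' (?t \<eta>) = \<eta>" if "\<eta> \<in> Q" for \<eta>
    using Q(2) that by (intro transport_char_inverse[OF inv]) (auto simp: characters_def)
  have inj: "inj_on ?t Q" by (rule inj_on_inverseI[where g = ?t']) (rule tt)
  have "f x = (\<Sum>\<eta>\<in>?t ` Q. c (?t' \<eta>) * \<eta> x)" if x: "x \<in> conj_by g ` T" for x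
  proof -
    obtain a where a: "a \<in> T" "x = conj_by g a" using x by blast
    have "(\<Sum>\<eta>\<in>?t ` Q. c (?t' \<eta>) * \<eta> x) = (\<Sum>\<eta>\<in>Q. c \<eta> * \<eta> a)"
      unfolding sum.reindex[OF inj] o_def
      by (rule sum.cong[OF refl]) (simp add: tt a(2) transport_char_apply[OF inv a(1)])
    then show ?thesis using Q(3)[OF a(1)] a(2) by simp
  qed
  moreover have "?t ` Q \<subseteq> characters (conj_by g ` T)" using Q(2) characters_conj_by[OF g] by blast
  ultimately show "\<exists>Q c. finite Q \<and> Q \<subseteq> characters (conj_by g ` T) \<and> (\<forall>a\<in>conj_by g ` T. f a = (\<Sum>\<eta>\<in>Q. c \<eta> * \<eta> a))"
    using Q(1) by (intro exI[of _ "?t ` Q"] exI[of _ "\<lambda>\<eta>. c (?t' \<eta>)"]) simp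
qed

lemma max_split_central_torus_conj_by:
  fixes M :: "('f::field alg_closure ^ 'n ^ 'n) set"
  assumes g: "base_rational g"
  shows "max_split_central_torus (conj_by g ` M) = conj_by g ` max_split_central_torus M"
proof (rule conj_by_image_eqI[where R = base_rational and Q = "\<lambda>_. True", OF g base_rational_inv])
  fix g :: "'f alg_closure ^ 'n ^ 'n" and M :: "('f alg_closure ^ 'n ^ 'n) set"
  assume g: "base_rational g"
  then have inv: "invertible g" using base_rational_inv by blast
  show "conj_by g ` max_split_central_torus M \<subseteq> max_split_central_torus (conj_by g ` M)"
  proof
    fix y assume "y \<in> conj_by g ` max_split_central_torus M"
    then obtain T x where T: "split_torus T" "T \<subseteq> {z \<in> M. \<forall>m\<in>M. z ** m = m ** z}" "x \<in> T" "y = conj_by g x"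
      by (auto simp: max_split_central_torus_def)
    have "conj_by g ` T \<subseteq> {z \<in> conj_by g ` M. \<forall>m\<in>conj_by g ` M. z ** m = m ** z}"
      using T(2) by (auto simp: conj_by_mult[OF inv, symmetric])
    then show "y \<in> max_split_central_torus (conj_by g ` M)"
      using split_torus_conj_by[OF g T(1)] T(3,4) unfolding max_split_central_torus_def by blast
  qed
qed simp_all

lemma lie_conj_by:
  fixes H :: "('k::field ^ 'n ^ 'n) set"
  assumes g: "invertible g"
  shows "lie (conj_by g ` H) = conj_by g ` lie H"
proof (rule conj_by_image_eqI[where R = invertible and Q = "\<lambda>_. True", OF g])
  fix g :: "'k ^ 'n ^ 'n" and H :: "('k ^ 'n ^ 'n) set"
  assume g: "invertible g"
  show "conj_by g ` lie H \<subseteq> lie (conj_by g ` H)"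
  proof
    fix y assume "y \<in> conj_by g ` lie H"
    then obtain x where x: "x \<in> lie H" "y = conj_by g x" by auto
    show "y \<in> lie (conj_by g ` H)"
      unfolding lie_def
    proof (intro CollectI ballI impI allI)
      fix p :: "'k ^ 'n ^ 'n \<Rightarrow> 'k" and q
      assume p: "p \<in> poly_fun UNIV" "\<forall>h\<in>conj_by g ` H. p h = 0"
        and q: "\<forall>t. poly q t = p (mat 1 + map_matrix ((*) t) y)"
      have p': "(\<lambda>x. p (conj_by g x)) \<in> poly_fun UNIV" by (rule poly_fun_UNIV_conj_by[OF p(1)])
      have "\<forall>t. poly q t = p (conj_by g (mat 1 + map_matrix ((*) t) x))"
        using q by (simp add: x(2) conj_by_add conj_by_scale conj_by_one[OF g])
      then show "poly (pderiv q) 0 = 0"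
        using x(1)[unfolded lie_def, THEN CollectD, rule_format, OF p'] p(2) by simp
    qed
  qed
qed (simp_all add: invertible_matrix_inv)

lemma weight_space_conj_by:
  assumes g: "invertible g" and A: "\<And>a. a \<in> A \<Longrightarrow> invertible a" and x: "x \<in> weight_space A L \<eta>"
  shows "conj_by g x \<in> weight_space (conj_by g ` A) (conj_by g ` L) (transport_char g A \<eta>)"
proof -
  have "conj_by (conj_by g a) (conj_by g x) = map_matrix ((*) (\<eta> a)) (conj_by g x)" if a: "a \<in> A" for a
  proof -
    have "conj_by (conj_by g a) (conj_by g x) = conj_by g (conj_by a x)"
      using A[OF a] unfolding conj_by_def[of a x] conj_by_def[of "conj_by g a"]
      by (simp add: conj_by_mult[OF g] conj_by_matrix_inv[OF g])
    then show ?thesis using x a by (simp add: weight_space_def conj_by_scale)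
  qed
  then show ?thesis using x by (auto simp: weight_space_def transport_char_apply[OF g])
qed

subsection \<open>Rational points\<close>

abbreviation ac_matrix :: "'f::field ^ 'n ^ 'n \<Rightarrow> 'f alg_closure ^ 'n ^ 'n" where
  "ac_matrix \<equiv> map_matrix to_ac"

lemma ac_matrix_mult: "ac_matrix (g ** h) = ac_matrix g ** ac_matrix h"
  by (simp add: vec_eq_iff matrix_matrix_mult_def to_ac_sum)

lemma ac_matrix_one: "ac_matrix (mat 1) = mat 1"
  by (simp add: vec_eq_iff mat_def)

lemma det_ac_matrix: "det (ac_matrix g) = to_ac (det g)"
proof -
  have "to_ac (of_int (sign p) :: 'a) = of_int (sign p)" for p :: "'b \<Rightarrow> 'b" by (rule to_ac_of_int)
  then show ?thesis by (simp add: det_def to_ac_sum to_ac_prod)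
qed

lemma invertible_ac_matrix: "invertible (ac_matrix g) \<longleftrightarrow> invertible g"
  by (simp add: invertible_det_nz det_ac_matrix)

lemma ac_matrix_inv: "invertible g \<Longrightarrow> ac_matrix (matrix_inv g) = matrix_inv (ac_matrix g)"
  by (rule matrix_inv_unique[symmetric]) (simp add: ac_matrix_mult[symmetric] matrix_inv_both ac_matrix_one)

lemma base_rational_ac_matrix: "invertible g \<Longrightarrow> base_rational (ac_matrix g)"
  by (simp add: base_rational_def invertible_ac_matrix ac_matrix_inv[symmetric] base_field_def)

lemma ac_matrix_conj_by: "invertible g \<Longrightarrow> ac_matrix (conj_by g x) = conj_by (ac_matrix g) (ac_matrix x)"
  by (simp add: conj_by_def ac_matrix_mult ac_matrix_inv)

lemma rat_pts_mono: "A \<subseteq> B \<Longrightarrow> rat_pts A \<subseteq> rat_pts B"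
  by (auto simp: rat_pts_def)

lemma subgroup_rat_pts:
  assumes "subgroup H GL"
  shows "subgroup (rat_pts H) GL"
  using assms unfolding subgroup_GL_iff rat_pts_def
  by (auto simp: ac_matrix_mult ac_matrix_one invertible_ac_matrix ac_matrix_inv)

lemma rat_pts_conj_by:
  assumes g: "invertible g"
  shows "rat_pts (conj_by (ac_matrix g) ` H) = conj_by g ` rat_pts H"
  using g invertible_matrix_inv[OF g]
  by (auto simp: rat_pts_def in_conj_by_image_iff[OF g] in_conj_by_image_iff[OF invertible_ac_matrix[THEN iffD2, OF g]]
      ac_matrix_conj_by ac_matrix_inv conj_by_cancel[OF invertible_ac_matrix[THEN iffD2, OF g]])

subsection \<open>The metric topology\<close>

text \<open>
  The maximum metric on matrices, whose topology is that of the rational points.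
\<close>

definition mat_dist :: "('f::field \<Rightarrow> real) \<Rightarrow> 'f ^ 'n ^ 'n \<Rightarrow> 'f ^ 'n ^ 'n \<Rightarrow> real" where
  "mat_dist v A B = Max (range (\<lambda>(i, j). v (A $ i $ j - B $ i $ j)))"

context
  fixes v :: "'f::field \<Rightarrow> real"
  assumes v: "nonarch_local_field v"
begin

lemma v_rules:
  "v x \<ge> 0" "v x = 0 \<longleftrightarrow> x = 0" "v (x * y) = v x * v y" "v (x + y) \<le> v x + v y" "v (- x) = v x"
proof -
  have n: "v x \<ge> 0" "v x = 0 \<longleftrightarrow> x = 0" "v (x * y) = v x * v y" "v (x + y) \<le> max (v x) (v y)" for x y
    using v unfolding nonarch_local_field_def by blast+
  show "v x \<ge> 0" "v x = 0 \<longleftrightarrow> x = 0" "v (x * y) = v x * v y" by (rule n)+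
  show "v (x + y) \<le> v x + v y" using n(4)[of x y] n(1)[of x] n(1)[of y] by linarith
  have "v 1 * v 1 = v 1" using n(3)[of 1 1] by simp
  moreover have "v 1 \<noteq> 0" using n(2)[of 1] by simp
  ultimately have "v 1 = 1" by simp
  then have "v (-1) * v (-1) = 1" using n(3)[of "-1" "-1"] by simp
  then have "(v (-1))\<^sup>2 = 1" by (simp add: power2_eq_square)
  then have "v (-1) = 1 \<or> v (-1) = -1" by (rule power2_eq_1_iff[THEN iffD1])
  then have "v (-1) = 1" using n(1)[of "-1"] by auto
  then show "v (- x) = v x" using n(3)[of "-1" x] by simp
qed

lemma v_sum: "v (\<Sum>a\<in>A. f a) \<le> (\<Sum>a\<in>A. v (f a))"
proof (induction A rule: infinite_finite_induct)
  case (insert a A)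
  then show ?case using v_rules(4)[of "f a" "sum f A"] by simp
qed (use v_rules(2)[of 0] in simp_all)

lemma entry_le_mat_dist: "v (A $ i $ j - B $ i $ j) \<le> mat_dist v A B"
  unfolding mat_dist_def by (rule Max_ge) (auto intro: range_eqI[of _ _ "(i, j)"])

lemma mat_dist_le_iff: "mat_dist v A B \<le> c \<longleftrightarrow> (\<forall>i j. v (A $ i $ j - B $ i $ j) \<le> c)"
  unfolding mat_dist_def by (subst Max_le_iff) auto

lemma Metric_space_mat_dist: "Metric_space UNIV (mat_dist v :: 'f ^ 'n ^ 'n \<Rightarrow> _)"
proof
  fix A B C :: "'f ^ 'n ^ 'n"
  have "0 \<le> v (A $ i $ i - B $ i $ i)" for i by (rule v_rules)
  then show "0 \<le> mat_dist v A B" using entry_le_mat_dist order_trans by blast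
  have "v (A $ i $ j - B $ i $ j) = v (B $ i $ j - A $ i $ j)" for i j
    using v_rules(5)[of "A $ i $ j - B $ i $ j"] by simp
  then show "mat_dist v A B = mat_dist v B A" by (simp add: mat_dist_def)
  show "(mat_dist v A B = 0) = (A = B)"
  proof
    assume "mat_dist v A B = 0"
    then have "v (A $ i $ j - B $ i $ j) \<le> 0" for i j using entry_le_mat_dist[of A i j B] by simp
    then have "v (A $ i $ j - B $ i $ j) = 0" for i j using v_rules(1) order_antisym by blast
    then show "A = B" by (simp add: v_rules(2) vec_eq_iff)
  next
    assume "A = B"
    then show "mat_dist v A B = 0"
      using v_rules(2)[of 0] unfolding mat_dist_def by (simp add: case_prod_unfold image_constant_conv)
  qed
  show "mat_dist v A C \<le> mat_dist v A B + mat_dist v B C"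
    unfolding mat_dist_le_iff[of A C]
  proof (intro allI)
    fix i j
    have "v ((A $ i $ j - B $ i $ j) + (B $ i $ j - C $ i $ j)) \<le> v (A $ i $ j - B $ i $ j) + v (B $ i $ j - C $ i $ j)"
      by (rule v_rules)
    then show "v (A $ i $ j - C $ i $ j) \<le> mat_dist v A B + mat_dist v B C"
      using entry_le_mat_dist[of A i j B] entry_le_mat_dist[of B i j C] by simp
  qed
qed

lemma mat_top_eq: "mat_top v = Metric_space.mtopology UNIV (mat_dist v)"
  by (simp add: mat_top_def mat_dist_def[abs_def])

text \<open>
  Conjugation is linear in the entries, so it is Lipschitz for the maximum metric.
\<close>

lemma openin_mat_top_conj_by_vimage:
  fixes U :: "('f ^ 'n ^ 'n) set"
  assumes U: "openin (mat_top v) U"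
  shows "openin (mat_top v) {x. conj_by g x \<in> U}"
proof -
  interpret M: Metric_space UNIV "mat_dist v :: 'f ^ 'n ^ 'n \<Rightarrow> _" by (rule Metric_space_mat_dist)
  let ?h = "matrix_inv g"
  \<comment> \<open>A Lipschitz constant that serves all entries at once; the summand 1 makes it positive.\<close>
  define c where "c = (\<Sum>i\<in>UNIV. \<Sum>j\<in>UNIV. \<Sum>l\<in>UNIV. \<Sum>k\<in>UNIV. v (g $ i $ k) * v (?h $ l $ j)) + 1"
  have nn: "0 \<le> v (g $ i $ k) * v (?h $ l $ j)" for i j k l by (simp add: v_rules(1))
  have c: "c > 0" unfolding c_def by (intro add_nonneg_pos sum_nonneg nn) simp
  have le: "mat_dist v (conj_by g x) (conj_by g y) \<le> c * mat_dist v x y" for x y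
    unfolding mat_dist_le_iff
  proof (intro allI)
    fix i j
    have d: "0 \<le> mat_dist v x y" by (rule M.nonneg)
    have "conj_by g x $ i $ j - conj_by g y $ i $ j = conj_by g (x - y) $ i $ j" by (simp add: conj_by_diff)
    also have "\<dots> = (\<Sum>l\<in>UNIV. \<Sum>k\<in>UNIV. g $ i $ k * (x - y) $ k $ l * ?h $ l $ j)"
      by (simp add: conj_by_def matrix_matrix_mult_def sum_distrib_right)
    finally have "v (conj_by g x $ i $ j - conj_by g y $ i $ j) =
        v (\<Sum>l\<in>UNIV. \<Sum>k\<in>UNIV. g $ i $ k * (x - y) $ k $ l * ?h $ l $ j)" by simp
    also have "\<dots> \<le> (\<Sum>l\<in>UNIV. v (\<Sum>k\<in>UNIV. g $ i $ k * (x - y) $ k $ l * ?h $ l $ j))" by (rule v_sum)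
    also have "\<dots> \<le> (\<Sum>l\<in>UNIV. \<Sum>k\<in>UNIV. v (g $ i $ k * (x - y) $ k $ l * ?h $ l $ j))"
      by (intro sum_mono v_sum)
    also have "\<dots> \<le> (\<Sum>l\<in>UNIV. \<Sum>k\<in>UNIV. v (g $ i $ k) * v (?h $ l $ j) * mat_dist v x y)"
    proof (intro sum_mono)
      fix k l
      have "v (g $ i $ k * (x - y) $ k $ l * ?h $ l $ j) = v (g $ i $ k) * v (?h $ l $ j) * v (x $ k $ l - y $ k $ l)"
        by (simp add: v_rules(3) mult_ac)
      also have "\<dots> \<le> v (g $ i $ k) * v (?h $ l $ j) * mat_dist v x y"
        by (intro mult_left_mono entry_le_mat_dist nn)
      finally show "v (g $ i $ k * (x - y) $ k $ l * ?h $ l $ j) \<le> v (g $ i $ k) * v (?h $ l $ j) * mat_dist v x y" .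
    qed
    also have "\<dots> = (\<Sum>l\<in>UNIV. \<Sum>k\<in>UNIV. v (g $ i $ k) * v (?h $ l $ j)) * mat_dist v x y"
      by (simp add: sum_distrib_right)
    also have "\<dots> \<le> c * mat_dist v x y"
    proof (rule mult_right_mono[OF _ d])
      let ?s = "\<lambda>i j. (\<Sum>l\<in>UNIV. \<Sum>k\<in>UNIV. v (g $ i $ k) * v (?h $ l $ j))"
      have s: "0 \<le> ?s i j" for i j by (intro sum_nonneg nn)
      have "?s i j \<le> (\<Sum>j\<in>UNIV. ?s i j)" by (rule member_le_sum) (use s in auto)
      also have "\<dots> \<le> (\<Sum>i\<in>UNIV. \<Sum>j\<in>UNIV. ?s i j)"
        by (rule member_le_sum[where f = "\<lambda>i. \<Sum>j\<in>UNIV. ?s i j"]) (use s in \<open>auto intro: sum_nonneg\<close>)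
      finally show "?s i j \<le> c" by (simp add: c_def)
    qed
    finally show "v (conj_by g x $ i $ j - conj_by g y $ i $ j) \<le> c * mat_dist v x y" .
  qed
  show ?thesis
    unfolding mat_top_eq M.openin_mtopology
  proof (intro conjI allI impI)
    fix x assume "x \<in> {x. conj_by g x \<in> U}"
    then obtain r where r: "r > 0" "M.mball (conj_by g x) r \<subseteq> U"
      using U unfolding mat_top_eq M.openin_mtopology by blast
    have "M.mball x (r / c) \<subseteq> {x. conj_by g x \<in> U}"
    proof
      fix y assume "y \<in> M.mball x (r / c)"
      then have "mat_dist v x y < r / c" by simp
      then have "c * mat_dist v x y < r" using c by (simp add: field_simps)
      then have "mat_dist v (conj_by g x) (conj_by g y) < r" using le[of x y] by simp
      then show "y \<in> {x. conj_by g x \<in> U}" using r(2) by auto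
    qed
    then show "\<exists>r>0. M.mball x r \<subseteq> {x. conj_by g x \<in> U}" using r(1) c by (intro exI[of _ "r / c"]) simp
  qed simp
qed

lemma openin_subtopology_conj_by:
  fixes H :: "('f ^ 'n ^ 'n) set"
  assumes g: "invertible g" and H: "conj_by g ` H = H" and K: "openin (subtopology (mat_top v) H) K"
  shows "openin (subtopology (mat_top v) H) (conj_by g ` K)"
proof -
  obtain U where U: "openin (mat_top v) U" "K = U \<inter> H" using K by (auto simp: openin_subtopology)
  have "conj_by g ` K = {x. conj_by (matrix_inv g) x \<in> U} \<inter> conj_by g ` H"
    by (auto simp: U(2) in_conj_by_image_iff[OF g] conj_by_cancel[OF g])
  then show ?thesis
    using openin_mat_top_conj_by_vimage[OF U(1), of "matrix_inv g"] H by (auto simp: openin_subtopology)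
qed

end

section \<open>Standard parabolic subgroups and the normalizer\<close>

locale nonconnected_reductive = nonconnected_group v Gt M0 P0 ord
  for v :: "'f::field \<Rightarrow> real"
    and Gt M0 P0 :: "('f alg_closure ^ 'n ^ 'n) set"
    and ord :: "('f alg_closure ^ 'n ^ 'n \<Rightarrow> 'f alg_closure) \<Rightarrow> nat" +
  assumes local_field: "nonarch_local_field v"
    and algebraic_Gt: "algebraic_group Gt"
    and reductive_G: "reductive (identity_component Gt)"
    and minimal_pair: "minimal_parabolic_pair (identity_component Gt) M0 P0"
    and bij_ord: "bij_betw ord S {1..card S}"
begin

lemma finite_S: "finite S"
proof (rule ccontr)
  assume "infinite S"
  then have "card S = 0" by simp
  then have "bij_betw ord S {}" using bij_ord by simp
  then have "S = {}" by (auto simp: bij_betw_def)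
  then show False using \<open>infinite S\<close> by simp
qed

lemma inj_ord: "inj_on ord S"
  using bij_ord by (rule bij_betw_imp_inj_on)

lemma subgroup_Gt: "subgroup Gt GL"
  using algebraic_Gt by (simp add: algebraic_group_def closed_subgroup_def)

lemma closed_G: "closed_subgroup G"
  using reductive_G by (simp add: reductive_def G_def)

lemma subgroup_G: "subgroup G GL"
  using closed_G by (simp add: closed_subgroup_def)

lemma G_subset: "G \<subseteq> Gt"
  unfolding G_def by (rule identity_component_subset)

lemma parabolic_P0: "parabolic G P0"
  using minimal_pair by (simp add: minimal_parabolic_pair_def G_def)

lemma subgroup_parabolic: "parabolic H P \<Longrightarrow> subgroup P GL"
  by (simp add: parabolic_def algebraic_group_def closed_subgroup_def)

lemma subgroup_PJ: "subgroup (PJ J) GL"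
proof -
  have "subgroup (\<Inter>(insert G {P. \<exists>K. J \<subseteq> K \<and> K \<subseteq> S \<and> standard_parabolic K P})) GL"
    using subgroup_G subgroup_parabolic
    by (intro group.subgroups_Inter[OF group_GL]) (auto simp: standard_parabolic_def)
  then show ?thesis by (simp add: PJ_def)
qed

lemma PJ_subset: "PJ J \<subseteq> G"
  by (auto simp: PJ_def)

lemma PJ_mono: "J \<subseteq> K \<Longrightarrow> PJ J \<subseteq> PJ K"
  unfolding PJ_def by blast

lemma P0_subset_PJ: "P0 \<subseteq> PJ J"
  using parabolic_P0 by (auto simp: PJ_def standard_parabolic_def parabolic_def)

text \<open>
  \<open>P\<^sub>0\<close> contains a Borel subgroup of \<open>G\<close>, and it lies in both \<open>P\<^sub>I\<close> and \<open>P\<^sub>J\<close>.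
\<close>

lemma UJ_antimono:
  assumes "I \<subseteq> J"
  shows "UJ J \<subseteq> UJ I"
proof -
  obtain B where "borel_subgroup G B" "B \<subseteq> P0" using parabolic_P0 by (auto simp: parabolic_def)
  then show ?thesis
    using unip_radical_antimono[OF closed_G subgroup_PJ PJ_subset subgroup_PJ PJ_mono[OF assms]] P0_subset_PJ by blast
qed

lemma subgroup_GF: "subgroup GF GL"
  by (rule subgroup_rat_pts[OF subgroup_G])

lemma GF_subset: "GF \<subseteq> GtF"
  by (rule rat_pts_mono[OF G_subset])

lemma subgroup_PJF: "subgroup (rat_pts (PJ J)) GL"
  by (rule subgroup_rat_pts[OF subgroup_PJ])

lemma PJF_subset: "rat_pts (PJ J) \<subseteq> GF"
  by (rule rat_pts_mono[OF PJ_subset])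

lemma UJF_normal:
  assumes "p \<in> rat_pts (PJ J)" "u \<in> rat_pts (UJ J)"
  shows "conj_by p u \<in> rat_pts (UJ J)"
proof -
  have "invertible p" using assms(1) subgroup_PJF by (auto simp: subgroup_GL_iff)
  then show ?thesis
    using unip_radical_normal[OF subgroup_PJ, of "ac_matrix p" J "ac_matrix u"] assms
    by (simp add: rat_pts_def ac_matrix_conj_by)
qed

lemma UJF_subset: "rat_pts (UJ J) \<subseteq> rat_pts (PJ J)"
  by (rule rat_pts_mono[OF unip_radical_subset[OF subgroup_PJ]])

lemma NF_simps:
  assumes n: "n \<in> NF"
  shows "n \<in> GtF" "invertible n" "base_rational (ac_matrix n)" "ac_matrix n \<in> Gt"
    "conj_by (ac_matrix n) ` M0 = M0" "conj_by (ac_matrix n) ` P0 = P0"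
proof -
  show "ac_matrix n \<in> Gt" "conj_by (ac_matrix n) ` M0 = M0" "conj_by (ac_matrix n) ` P0 = P0"
    using n by (auto simp: NF_def rat_pts_def)
  then show "n \<in> GtF" by (simp add: rat_pts_def)
  then show "invertible n" using subgroup_rat_pts[OF subgroup_Gt] by (auto simp: subgroup_GL_iff)
  then show "base_rational (ac_matrix n)" by (rule base_rational_ac_matrix)
qed

lemma NF_inv:
  assumes n: "n \<in> NF"
  shows "matrix_inv n \<in> NF"
proof -
  note n' = NF_simps[OF n]
  have i: "invertible (ac_matrix n)" using n' by (simp add: invertible_ac_matrix)
  have "conj_by (matrix_inv (ac_matrix n)) ` M0 = M0" "conj_by (matrix_inv (ac_matrix n)) ` P0 = P0"
    using conj_by_image_cancel(2)[OF i, of M0] conj_by_image_cancel(2)[OF i, of P0] n'(5,6) by simp_all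
  then show ?thesis
    using subgroup_Gt n' by (simp add: NF_def rat_pts_def ac_matrix_inv subgroup_GL_iff)
qed

lemma one_NF: "mat 1 \<in> NF"
  using subgroup_Gt by (simp add: NF_def rat_pts_def ac_matrix_one subgroup_GL_iff conj_by_def matrix_inv_one)

lemma NF_conj_Gt: "n \<in> NF \<Longrightarrow> conj_by (ac_matrix n) ` Gt = Gt"
proof -
  have sub: "conj_by g ` Gt \<subseteq> Gt" if "g \<in> Gt" for g
    using that subgroup_Gt by (auto simp: conj_by_def subgroup_GL_iff)
  assume n: "n \<in> NF"
  have i: "invertible (ac_matrix n)" using NF_simps[OF n] by (simp add: invertible_ac_matrix)
  have "matrix_inv (ac_matrix n) \<in> Gt" using NF_simps(4)[OF n] subgroup_Gt by (simp add: subgroup_GL_iff)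
  then have "conj_by (ac_matrix n) ` conj_by (matrix_inv (ac_matrix n)) ` Gt \<subseteq> conj_by (ac_matrix n) ` Gt"
    by (intro image_mono sub)
  then show ?thesis using sub[OF NF_simps(4)[OF n]] by (simp add: conj_by_image_cancel[OF i])
qed

lemma NF_conj_G: "n \<in> NF \<Longrightarrow> conj_by (ac_matrix n) ` G = G"
  using identity_component_conj_by[OF _ subgroup_Gt, of "ac_matrix n"] NF_conj_Gt[of n] NF_simps(2)[of n]
  by (simp add: G_def invertible_ac_matrix)

lemma NF_conj_A0: "n \<in> NF \<Longrightarrow> conj_by (ac_matrix n) ` A0 = A0"
  using max_split_central_torus_conj_by[of "ac_matrix n" M0] NF_simps(3,5)[of n] by (simp add: A0_def)

lemma A0_invertible: "a \<in> A0 \<Longrightarrow> invertible a"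
  by (auto simp: A0_def max_split_central_torus_def split_torus_def algebraic_group_def closed_subgroup_def subgroup_GL_iff)

lemma perm_eq_transport:
  assumes n: "n \<in> NF" shows "perm n = transport_char (ac_matrix n) A0"
  by (simp add: fun_eq_iff perm_def transport_char_def NF_conj_A0[OF n])

lemma perm_inv:
  fixes \<eta> :: "'f alg_closure ^ 'n ^ 'n \<Rightarrow> 'f alg_closure"
  assumes n: "n \<in> NF" and \<eta>: "\<eta> \<in> extensional A0"
  shows "perm (matrix_inv n) (perm n \<eta>) = \<eta>"
proof -
  have "invertible (ac_matrix n)" using NF_simps(2)[OF n] by (simp add: invertible_ac_matrix)
  then show ?thesis
    using transport_char_inverse[OF _ \<eta>, of "ac_matrix n"] NF_conj_A0[OF n] NF_simps(2)[OF n]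
    by (simp add: perm_eq_transport[OF n] perm_eq_transport[OF NF_inv[OF n]] ac_matrix_inv)
qed

lemma perm_characters: "n \<in> NF \<Longrightarrow> \<eta> \<in> characters A0 \<Longrightarrow> perm n \<eta> \<in> characters A0"
  using characters_conj_by[of "ac_matrix n" \<eta> A0] NF_simps(3)[of n] NF_conj_A0[of n] by (simp add: perm_eq_transport)

lemma perm_apply:
  fixes \<eta> :: "'f alg_closure ^ 'n ^ 'n \<Rightarrow> 'f alg_closure"
  assumes "n \<in> NF" "a \<in> A0"
  shows "perm n \<eta> (conj_by (ac_matrix n) a) = \<eta> a"
  using transport_char_apply[of "ac_matrix n" a A0 \<eta>] assms NF_simps(2)[of n]
  by (simp add: perm_eq_transport invertible_ac_matrix)

lemma perm_weight_space:
  fixes \<eta> :: "'f alg_closure ^ 'n ^ 'n \<Rightarrow> 'f alg_closure"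
  assumes n: "n \<in> NF" and L: "conj_by (ac_matrix n) ` L = L" and x: "x \<in> weight_space A0 L \<eta>"
  shows "conj_by (ac_matrix n) x \<in> weight_space A0 L (perm n \<eta>)"
  using weight_space_conj_by[OF _ A0_invertible x, of "ac_matrix n"] L NF_conj_A0[OF n] NF_simps(2)[OF n]
  by (simp add: perm_eq_transport[OF n] invertible_ac_matrix)

lemma NF_conj_lie: "n \<in> NF \<Longrightarrow> conj_by (ac_matrix n) ` H = H \<Longrightarrow> conj_by (ac_matrix n) ` lie H = lie H"
  using lie_conj_by[of "ac_matrix n" H] NF_simps(2)[of n] by (simp add: invertible_ac_matrix)

lemma perm_roots:
  assumes n: "n \<in> NF" and \<eta>: "\<eta> \<in> roots A0 (lie P0)"
  shows "perm n \<eta> \<in> roots A0 (lie P0)"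
proof -
  have i: "invertible (ac_matrix n)" using NF_simps(2)[OF n] by (simp add: invertible_ac_matrix)
  have L: "conj_by (ac_matrix n) ` lie P0 = lie P0" by (rule NF_conj_lie[OF n NF_simps(6)[OF n]])
  obtain a where a: "a \<in> A0" "\<eta> a \<noteq> 1" using \<eta> by (auto simp: roots_def)
  have "\<exists>a\<in>A0. perm n \<eta> a \<noteq> 1"
  proof
    show "conj_by (ac_matrix n) a \<in> A0" using a(1) NF_conj_A0[OF n] by blast
    show "perm n \<eta> (conj_by (ac_matrix n) a) \<noteq> 1" using a by (simp add: perm_apply[OF n])
  qed
  moreover have "weight_space A0 (lie P0) (perm n \<eta>) \<noteq> {0}"
  proof
    assume *: "weight_space A0 (lie P0) (perm n \<eta>) = {0}"
    have n': "matrix_inv n \<in> NF" by (rule NF_inv[OF n])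
    have L': "conj_by (ac_matrix (matrix_inv n)) ` lie P0 = lie P0" by (rule NF_conj_lie[OF n' NF_simps(6)[OF n']])
    have "\<eta> \<in> extensional A0" using \<eta> by (simp add: roots_def characters_def)
    then have "conj_by (ac_matrix (matrix_inv n)) 0 \<in> weight_space A0 (lie P0) \<eta>"
      using perm_weight_space[OF n' L', of 0 "perm n \<eta>"] * perm_inv[OF n] by simp
    moreover have "x = 0" if x: "x \<in> weight_space A0 (lie P0) \<eta>" for x
    proof -
      have "conj_by (ac_matrix n) x = 0" using perm_weight_space[OF n L x] * by simp
      then have "conj_by (matrix_inv (ac_matrix n)) (conj_by (ac_matrix n) x) = 0" by (simp add: conj_by_zero)
      then show "x = 0" by (simp only: conj_by_cancel(2)[OF i])
    qed
    ultimately have "weight_space A0 (lie P0) \<eta> = {0}" by (auto simp: conj_by_zero)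
    then show False using \<eta> by (simp add: roots_def)
  qed
  ultimately show ?thesis using perm_characters[OF n] \<eta> by (simp add: roots_def)
qed

lemma S_extensional: "\<alpha> \<in> S \<Longrightarrow> \<alpha> \<in> extensional A0"
  by (simp add: S_def roots_def characters_def)

text \<open>
  Simple roots are the indecomposable ones, and a decomposition of the image would pull back to one of
  \<open>\<alpha>\<close>.
\<close>

lemma perm_S:
  assumes n: "n \<in> NF" and \<alpha>: "\<alpha> \<in> S"
  shows "perm n \<alpha> \<in> S"
proof -
  have n': "matrix_inv n \<in> NF" by (rule NF_inv[OF n])
  have i: "invertible (ac_matrix n)" using NF_simps(2)[OF n] by (simp add: invertible_ac_matrix)
  have "\<not> (\<forall>a\<in>A0. perm n \<alpha> a = \<beta> a * \<gamma> a)" if "\<beta> \<in> roots A0 (lie P0)" "\<gamma> \<in> roots A0 (lie P0)" for \<beta> \<gamma>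
  proof
    assume *: "\<forall>a\<in>A0. perm n \<alpha> a = \<beta> a * \<gamma> a"
    have "\<alpha> a = perm (matrix_inv n) \<beta> a * perm (matrix_inv n) \<gamma> a" if a: "a \<in> A0" for a
    proof -
      have ca: "conj_by (ac_matrix n) a \<in> A0" using a NF_conj_A0[OF n] by blast
      have "\<alpha> a = \<beta> (conj_by (ac_matrix n) a) * \<gamma> (conj_by (ac_matrix n) a)"
        using *[rule_format, OF ca] by (simp add: perm_apply[OF n a])
      then show ?thesis
        using a NF_simps(2)[OF n] by (simp add: perm_def ac_matrix_inv matrix_inv_inv[OF i])
    qed
    then show False using \<alpha> perm_roots[OF n'] that unfolding S_def by blast
  qed
  then show ?thesis using \<alpha> perm_roots[OF n] by (simp add: S_def)
qed

lemma bij_perm: assumes n: "n \<in> NF" shows "bij_betw (perm n) S S"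
proof (rule bij_betw_byWitness[where f' = "perm (matrix_inv n)"])
  have n': "matrix_inv n \<in> NF" by (rule NF_inv[OF n])
  show "\<forall>a\<in>S. perm (matrix_inv n) (perm n a) = a" using perm_inv[OF n] S_extensional by blast
  have "matrix_inv (matrix_inv n) = n" using NF_simps(2)[OF n] by (rule matrix_inv_inv)
  then show "\<forall>a\<in>S. perm n (perm (matrix_inv n) a) = a" using perm_inv[OF n'] S_extensional by auto
qed (use perm_S n NF_inv[OF n] in auto)

lemma perm_preimage_image:
  assumes n: "n \<in> NF" and J: "J \<subseteq> S"
  shows "perm_preimage n J \<subseteq> S" "perm n ` perm_preimage n J = J" "card (perm_preimage n J) = card J"
proof -
  show 1: "perm_preimage n J \<subseteq> S" by (auto simp: perm_preimage_def)
  have "perm n ` S = S" using bij_perm[OF n] by (rule bij_betw_imp_surj_on)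
  then show 2: "perm n ` perm_preimage n J = J"
  proof (intro equalityI subsetI)
    fix \<beta> assume \<beta>: "\<beta> \<in> J"
    then have "\<beta> \<in> perm n ` S" using J \<open>perm n ` S = S\<close> by auto
    then show "\<beta> \<in> perm n ` perm_preimage n J" using \<beta> by (auto simp: perm_preimage_def)
  qed (auto simp: perm_preimage_def)
  have "inj_on (perm n) (perm_preimage n J)" using bij_betw_imp_inj_on[OF bij_perm[OF n]] 1 by (rule inj_on_subset)
  then show "card (perm_preimage n J) = card J" using card_image[of "perm n" "perm_preimage n J"] 2 by simp
qed

text \<open>
  Conjugation by \<open>n\<close> carries the weight space of \<open>\<eta>\<close> to that of the permuted weight, and a weight that
  is an integral combination of \<open>S\<close> with coefficients \<open>m\<close> goes to the combination whose coefficients are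
  permuted accordingly.
\<close>

lemma parabolic_lie_conj_by_subset:
  assumes n: "n \<in> NF" and J: "J \<subseteq> S"
  shows "conj_by (ac_matrix n) ` parabolic_lie J \<subseteq> parabolic_lie (perm n ` J)"
proof -
  let ?scale = "\<lambda>(c :: 'f alg_closure) (x :: 'f alg_closure ^ 'n ^ 'n). map_matrix ((*) c) x"
  let ?c = "conj_by (ac_matrix n)"
  have n': "matrix_inv n \<in> NF" by (rule NF_inv[OF n])
  have i: "invertible (ac_matrix n)" using NF_simps(2)[OF n] by (simp add: invertible_ac_matrix)
  have m: "Modules.module ?scale"
    by standard (simp_all add: vec_eq_iff algebra_simps)
  have hom: "module_hom ?scale ?scale ?c"
    unfolding module_hom_def module_hom_axioms_def by (simp add: m conj_by_add conj_by_scale)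
  let ?P = "\<lambda>J \<eta>. \<eta> \<in> characters A0 \<and>
        (\<exists>m :: _ \<Rightarrow> int. (\<forall>\<alpha>\<in>S - J. m \<alpha> \<ge> 0) \<and> (\<forall>a\<in>A0. \<eta> a = (\<Prod>\<alpha>\<in>S. \<alpha> a powi m \<alpha>)))"
  let ?W = "\<lambda>J. \<Union>{weight_space A0 (lie G) \<eta> | \<eta>. ?P J \<eta>}"
  have "?c ` ?W J \<subseteq> ?W (perm n ` J)"
  proof
    fix y assume "y \<in> ?c ` ?W J"
    then obtain x Z where xZ: "y = ?c x" "x \<in> Z" "Z \<in> {weight_space A0 (lie G) \<eta> | \<eta>. ?P J \<eta>}"
      by (elim imageE UnionE)
    obtain \<eta> where \<eta>: "Z = weight_space A0 (lie G) \<eta> \<and> ?P J \<eta>"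
      using xZ(3) unfolding mem_Collect_eq by (rule exE)
    from \<eta>[THEN conjunct2, THEN conjunct2] obtain m :: "_ \<Rightarrow> int" where "\<forall>\<alpha>\<in>S - J. m \<alpha> \<ge> 0" "\<forall>a\<in>A0. \<eta> a = (\<Prod>\<alpha>\<in>S. \<alpha> a powi m \<alpha>)"
      by (elim exE conjE)
    then have x: "y = ?c x" "x \<in> weight_space A0 (lie G) \<eta>"
      "\<eta> \<in> characters A0" "\<forall>\<alpha>\<in>S - J. m \<alpha> \<ge> 0" "\<forall>a\<in>A0. \<eta> a = (\<Prod>\<alpha>\<in>S. \<alpha> a powi m \<alpha>)"
      using xZ \<eta> by simp_all
    let ?m = "\<lambda>\<beta>. m (perm (matrix_inv n) \<beta>)"
    have 1: "y \<in> weight_space A0 (lie G) (perm n \<eta>)"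
      unfolding x(1) by (rule perm_weight_space[OF n NF_conj_lie[OF n NF_conj_G[OF n]] x(2)])
    have 2: "\<forall>\<beta>\<in>S - perm n ` J. ?m \<beta> \<ge> 0"
    proof
      fix \<beta> assume \<beta>: "\<beta> \<in> S - perm n ` J"
      have "perm n (perm (matrix_inv n) \<beta>) = \<beta>"
        using perm_inv[OF n' S_extensional] \<beta> matrix_inv_inv[OF NF_simps(2)[OF n]] by simp
      then have "perm (matrix_inv n) \<beta> \<notin> J" using \<beta> imageI[of "perm (matrix_inv n) \<beta>" J "perm n"] by auto
      then have "perm (matrix_inv n) \<beta> \<in> S - J" using \<beta> perm_S[OF n'] by simp
      then show "?m \<beta> \<ge> 0" using x(4) by blast
    qed
    have 3: "\<forall>a\<in>A0. perm n \<eta> a = (\<Prod>\<beta>\<in>S. \<beta> a powi ?m \<beta>)"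
    proof
      fix a assume "a \<in> A0"
      then obtain b where b: "b \<in> A0" "a = ?c b" using NF_conj_A0[OF n] by blast
      have "(\<Prod>\<beta>\<in>S. \<beta> a powi ?m \<beta>) = (\<Prod>\<alpha>\<in>S. perm n \<alpha> a powi ?m (perm n \<alpha>))"
        by (rule prod.reindex_bij_betw[OF bij_perm[OF n], symmetric])
      also have "\<dots> = (\<Prod>\<alpha>\<in>S. \<alpha> b powi m \<alpha>)"
        by (rule prod.cong[OF refl]) (simp add: b(2) perm_apply[OF n b(1)] perm_inv[OF n S_extensional])
      finally show "perm n \<eta> a = (\<Prod>\<beta>\<in>S. \<beta> a powi ?m \<beta>)" using x(5) b by (simp add: perm_apply[OF n])
    qed
    have "?P (perm n ` J) (perm n \<eta>)"
      using perm_characters[OF n x(3)] by (intro conjI exI[of _ ?m] 2 3)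
    then have "weight_space A0 (lie G) (perm n \<eta>) \<in> {weight_space A0 (lie G) \<eta> | \<eta>. ?P (perm n ` J) \<eta>}"
      by (intro CollectI exI[of _ "perm n \<eta>"] conjI refl) simp_all
    then show "y \<in> ?W (perm n ` J)" using 1 by (rule UnionI)
  qed
  then show ?thesis
    unfolding parabolic_lie_def module_hom.span_image[OF hom, symmetric] by (rule Modules.module.span_mono[OF m])
qed

lemma perm_perm_inv_image:
  assumes n: "n \<in> NF" and J: "J \<subseteq> S"
  shows "perm (matrix_inv n) ` perm n ` J = J"
  using perm_inv[OF n S_extensional] J by (force simp: image_image)

lemma parabolic_lie_conj_by:
  assumes n: "n \<in> NF" and J: "J \<subseteq> S"
  shows "parabolic_lie (perm n ` J) = conj_by (ac_matrix n) ` parabolic_lie J"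
proof
  have n': "matrix_inv n \<in> NF" by (rule NF_inv[OF n])
  have i: "invertible (ac_matrix n)" using NF_simps(2)[OF n] by (simp add: invertible_ac_matrix)
  have "perm n ` J \<subseteq> S" using J perm_S[OF n] by blast
  then have "conj_by (matrix_inv (ac_matrix n)) ` parabolic_lie (perm n ` J) \<subseteq> parabolic_lie J"
    using parabolic_lie_conj_by_subset[OF n', of "perm n ` J"] perm_perm_inv_image[OF n J] NF_simps(2)[OF n]
    by (simp add: ac_matrix_inv)
  then have "conj_by (ac_matrix n) ` conj_by (matrix_inv (ac_matrix n)) ` parabolic_lie (perm n ` J) \<subseteq>
      conj_by (ac_matrix n) ` parabolic_lie J" by (rule image_mono)
  then show "parabolic_lie (perm n ` J) \<subseteq> conj_by (ac_matrix n) ` parabolic_lie J"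
    by (simp only: conj_by_image_cancel[OF i])
qed (rule parabolic_lie_conj_by_subset[OF n J])

lemma standard_parabolic_conj_by:
  assumes n: "n \<in> NF" and J: "J \<subseteq> S" and P: "standard_parabolic J P"
  shows "standard_parabolic (perm n ` J) (conj_by (ac_matrix n) ` P)"
proof -
  have i: "invertible (ac_matrix n)" using NF_simps(2)[OF n] by (simp add: invertible_ac_matrix)
  have "P0 \<subseteq> P" using P by (simp add: standard_parabolic_def)
  then have "conj_by (ac_matrix n) ` P0 \<subseteq> conj_by (ac_matrix n) ` P" by (rule image_mono)
  then show ?thesis
    using P parabolic_conj_by[OF NF_simps(3)[OF n], of G P] lie_conj_by[OF i, of P]
    by (simp add: standard_parabolic_def NF_conj_G[OF n] NF_simps(6)[OF n] parabolic_lie_conj_by[OF n J])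
qed

text \<open>
  \<open>P\<^sub>J\<close> is an intersection of standard parabolic subgroups, and conjugating back by \<open>n\<close> carries each
  member of the family for the permuted set to a member of the family for \<open>J\<close>.
\<close>

lemma PJ_conj_by_subset:
  assumes n: "n \<in> NF" and J: "J \<subseteq> S"
  shows "conj_by (ac_matrix n) ` PJ J \<subseteq> PJ (perm n ` J)"
proof
  have n': "matrix_inv n \<in> NF" by (rule NF_inv[OF n])
  have i: "invertible (ac_matrix n)" using NF_simps(2)[OF n] by (simp add: invertible_ac_matrix)
  fix y assume "y \<in> conj_by (ac_matrix n) ` PJ J"
  then obtain x where x: "x \<in> PJ J" "y = conj_by (ac_matrix n) x" by blast
  have "y \<in> conj_by (ac_matrix n) ` G" using x PJ_subset by blast
  moreover have "y \<in> P" if K: "perm n ` J \<subseteq> K" "K \<subseteq> S" and P: "standard_parabolic K P" for K P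
  proof -
    have "perm (matrix_inv n) ` perm n ` J \<subseteq> perm (matrix_inv n) ` K" by (rule image_mono[OF K(1)])
    then have "J \<subseteq> perm (matrix_inv n) ` K" by (simp only: perm_perm_inv_image[OF n J])
    moreover have "perm (matrix_inv n) ` K \<subseteq> S" using K(2) perm_S[OF n'] by blast
    moreover have "standard_parabolic (perm (matrix_inv n) ` K) (conj_by (matrix_inv (ac_matrix n)) ` P)"
      using standard_parabolic_conj_by[OF n' K(2) P] NF_simps(2)[OF n] by (simp add: ac_matrix_inv)
    ultimately have "x \<in> conj_by (matrix_inv (ac_matrix n)) ` P" using x(1) unfolding PJ_def by blast
    then show "y \<in> P" unfolding x(2) by (auto simp: conj_by_cancel[OF i])
  qed
  ultimately show "y \<in> PJ (perm n ` J)" unfolding PJ_def NF_conj_G[OF n] by blast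
qed

lemma PJ_conj_by:
  assumes n: "n \<in> NF" and J: "J \<subseteq> S"
  shows "PJ (perm n ` J) = conj_by (ac_matrix n) ` PJ J"
proof
  have n': "matrix_inv n \<in> NF" by (rule NF_inv[OF n])
  have i: "invertible (ac_matrix n)" using NF_simps(2)[OF n] by (simp add: invertible_ac_matrix)
  have "perm n ` J \<subseteq> S" using J perm_S[OF n] by blast
  then have "conj_by (matrix_inv (ac_matrix n)) ` PJ (perm n ` J) \<subseteq> PJ J"
    using PJ_conj_by_subset[OF n', of "perm n ` J"] perm_perm_inv_image[OF n J] NF_simps(2)[OF n]
    by (simp add: ac_matrix_inv)
  then have "conj_by (ac_matrix n) ` conj_by (matrix_inv (ac_matrix n)) ` PJ (perm n ` J) \<subseteq>
      conj_by (ac_matrix n) ` PJ J" by (rule image_mono)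
  then show "PJ (perm n ` J) \<subseteq> conj_by (ac_matrix n) ` PJ J"
    by (simp only: conj_by_image_cancel[OF i])
qed (rule PJ_conj_by_subset[OF n J])

lemma rat_pts_NF_conj_by:
  assumes n: "n \<in> NF" and J: "J \<subseteq> S"
  shows "rat_pts (PJ (perm n ` J)) = conj_by n ` rat_pts (PJ J)"
    and "rat_pts (UJ (perm n ` J)) = conj_by n ` rat_pts (UJ J)"
    and "conj_by n ` GF = GF"
proof -
  have i: "invertible (ac_matrix n)" using NF_simps(2)[OF n] by (simp add: invertible_ac_matrix)
  note r = rat_pts_conj_by[OF NF_simps(2)[OF n], symmetric]
  show "rat_pts (PJ (perm n ` J)) = conj_by n ` rat_pts (PJ J)"
    "rat_pts (UJ (perm n ` J)) = conj_by n ` rat_pts (UJ J)" "conj_by n ` GF = GF"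
    by (simp_all add: r PJ_conj_by[OF n J] unip_radical_conj_by[OF i subgroup_PJ] NF_conj_G[OF n])
qed

text \<open>
  The default value of \<open>decomp\<close> also consists of elements of the two groups, so the conclusion holds
  for every \<open>g\<close>.
\<close>

lemma decomp_cases:
  obtains h n where "decomp g = (h, n)" "h \<in> GF" "n \<in> NF"
proof (cases "\<exists>h\<in>GF. \<exists>n\<in>NF. g = h ** n")
  case True
  then have "\<exists>x. case x of (h, n) \<Rightarrow> h \<in> GF \<and> n \<in> NF \<and> g = h ** n" by auto
  then have "case decomp g of (h, n) \<Rightarrow> h \<in> GF \<and> n \<in> NF \<and> g = h ** n"
    using True someI_ex[of "\<lambda>x. case x of (h, n) \<Rightarrow> h \<in> GF \<and> n \<in> NF \<and> g = h ** n"] by (simp add: decomp_def)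
  then show thesis using that by (cases "decomp g") auto
next
  case False
  then have "decomp g = (mat 1, mat 1)" by (simp add: decomp_def)
  then show thesis using that one_NF subgroup_GF by (auto simp: subgroup_GL_iff)
qed

end

section \<open>Induced representations\<close>

lemma ind_simps:
  "x \<oplus>\<^bsub>ind v H P E \<sigma>\<^esub> y = (\<lambda>g\<in>H. x g \<oplus>\<^bsub>E\<^esub> y g)"
  "c \<odot>\<^bsub>ind v H P E \<sigma>\<^esub> x = (\<lambda>g\<in>H. c \<odot>\<^bsub>E\<^esub> x g)"
  "\<zero>\<^bsub>ind v H P E \<sigma>\<^esub> = (\<lambda>g\<in>H. \<zero>\<^bsub>E\<^esub>)"
  by (simp_all add: ind_def)

lemma ind_memI:
  assumes "x \<in> extensional H" "\<And>g. g \<in> H \<Longrightarrow> x g \<in> carrier E"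
    and "\<And>p g. p \<in> P \<Longrightarrow> g \<in> H \<Longrightarrow> x (p ** g) = \<sigma> p (x g)"
    and "subgroup K GL" "openin (subtopology (mat_top v) H) K" "\<And>g k. g \<in> H \<Longrightarrow> k \<in> K \<Longrightarrow> x (g ** k) = x g"
  shows "x \<in> carrier (ind v H P E \<sigma>)"
  using assms by (auto simp: ind_def PiE_def Pi_def)

lemma ind_extensional: "x \<in> carrier (ind v H P E \<sigma>) \<Longrightarrow> x \<in> extensional H"
  and ind_closed: "x \<in> carrier (ind v H P E \<sigma>) \<Longrightarrow> g \<in> H \<Longrightarrow> x g \<in> carrier E"
  and ind_equivariant: "x \<in> carrier (ind v H P E \<sigma>) \<Longrightarrow> p \<in> P \<Longrightarrow> g \<in> H \<Longrightarrow> x (p ** g) = \<sigma> p (x g)"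
  and ind_smooth: "x \<in> carrier (ind v H P E \<sigma>) \<Longrightarrow>
    \<exists>K. subgroup K GL \<and> openin (subtopology (mat_top v) H) K \<and> (\<forall>g\<in>H. \<forall>k\<in>K. x (g ** k) = x g)"
  by (auto simp: ind_def PiE_def)

lemma ind_ext: "x \<in> carrier (ind v H P E \<sigma>) \<Longrightarrow> (\<lambda>g\<in>H. x g) = x"
  by (simp add: extensional_restrict ind_extensional)

lemma open_subset: "openin (subtopology T H) K \<Longrightarrow> K \<subseteq> H"
  using openin_subset by fastforce

lemma vspace_ind:
  fixes H :: "('f::field ^ 'n ^ 'n) set"
  assumes v: "nonarch_local_field v" and H: "subgroup H GL" "P \<subseteq> H" and E: "vspace E"
    and \<sigma>: "\<And>p. p \<in> P \<Longrightarrow> linear_map E E (\<sigma> p)"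
  shows "vspace (ind v H P E \<sigma>)"
proof -
  interpret E: vspace E by fact
  have m: "g ** h \<in> H" if "g \<in> H" "h \<in> H" for g h using H(1) that by (simp add: subgroup_GL_iff)
  have topH: "openin (subtopology (mat_top v) H) H"
  proof -
    interpret M: Metric_space UNIV "mat_dist v :: 'f ^ 'n ^ 'n \<Rightarrow> _" by (rule Metric_space_mat_dist[OF v])
    have "topspace (subtopology (mat_top v) H) = H" by (simp add: mat_top_eq[OF v])
    then show ?thesis using openin_topspace[of "subtopology (mat_top v) H"] by simp
  qed
  show ?thesis
  proof (rule vspaceI)
    show "\<zero>\<^bsub>ind v H P E \<sigma>\<^esub> \<in> carrier (ind v H P E \<sigma>)"
      unfolding ind_simps
    proof (rule ind_memI[OF _ _ _ H(1) topH])
      fix p g assume "p \<in> P" "g \<in> H"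
      then show "(\<lambda>g\<in>H. \<zero>\<^bsub>E\<^esub>) (p ** g) = \<sigma> p ((\<lambda>g\<in>H. \<zero>\<^bsub>E\<^esub>) g)"
        using m H(2) linear_map_zero[OF E E \<sigma>] by auto
    qed (use m in auto)
  next
    fix x y c assume x: "x \<in> carrier (ind v H P E \<sigma>)" and y: "y \<in> carrier (ind v H P E \<sigma>)"
    obtain K where K': "subgroup K GL" "openin (subtopology (mat_top v) H) K"
      "\<And>g k. g \<in> H \<Longrightarrow> k \<in> K \<Longrightarrow> x (g ** k) = x g"
      using ind_smooth[OF x] by blast
    note K = ind_closed[OF x] ind_equivariant[OF x] K'
    obtain L where L': "subgroup L GL" "openin (subtopology (mat_top v) H) L"
      "\<And>g k. g \<in> H \<Longrightarrow> k \<in> L \<Longrightarrow> y (g ** k) = y g"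
      using ind_smooth[OF y] by blast
    note L = ind_closed[OF y] ind_equivariant[OF y] L'
    have KH: "K \<subseteq> H" and LH: "L \<subseteq> H" using open_subset K(4) L(4) by blast+
    show "x \<oplus>\<^bsub>ind v H P E \<sigma>\<^esub> y \<in> carrier (ind v H P E \<sigma>)"
      unfolding ind_simps
    proof (rule ind_memI[where K = "K \<inter> L"])
      show "subgroup (K \<inter> L) GL" using K(3) L(3) by (simp add: subgroup_GL_iff)
      show "openin (subtopology (mat_top v) H) (K \<inter> L)" using K(4) L(4) by (rule openin_Int)
      fix p g assume "p \<in> P" "g \<in> H"
      moreover from this have "p ** g \<in> H" using H(2) m by blast
      ultimately show "(\<lambda>g\<in>H. x g \<oplus>\<^bsub>E\<^esub> y g) (p ** g) = \<sigma> p ((\<lambda>g\<in>H. x g \<oplus>\<^bsub>E\<^esub> y g) g)"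
        using K(1,2) L(1,2) linear_mapD(2)[OF \<sigma>] by simp
    next
      fix g k assume g: "g \<in> H" and k: "k \<in> K \<inter> L"
      then have "g ** k \<in> H" using KH m by blast
      then show "(\<lambda>g\<in>H. x g \<oplus>\<^bsub>E\<^esub> y g) (g ** k) = (\<lambda>g\<in>H. x g \<oplus>\<^bsub>E\<^esub> y g) g"
        using g k K(5) L(5) by simp
    qed (use K(1) L(1) in simp_all)
    show "c \<odot>\<^bsub>ind v H P E \<sigma>\<^esub> x \<in> carrier (ind v H P E \<sigma>)"
      unfolding ind_simps
    proof (rule ind_memI[OF _ _ _ K(3,4)])
      fix p g assume "p \<in> P" "g \<in> H"
      moreover from this have "p ** g \<in> H" using H(2) m by blast
      ultimately show "(\<lambda>g\<in>H. c \<odot>\<^bsub>E\<^esub> x g) (p ** g) = \<sigma> p ((\<lambda>g\<in>H. c \<odot>\<^bsub>E\<^esub> x g) g)"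
        using K(1,2) linear_mapD(3)[OF \<sigma>] by simp
    next
      fix g k assume g: "g \<in> H" and k: "k \<in> K"
      then have "g ** k \<in> H" using KH m by blast
      then show "(\<lambda>g\<in>H. c \<odot>\<^bsub>E\<^esub> x g) (g ** k) = (\<lambda>g\<in>H. c \<odot>\<^bsub>E\<^esub> x g) g" using g k K(5) by simp
    qed (use K(1) in simp_all)
    show "x \<oplus>\<^bsub>ind v H P E \<sigma>\<^esub> y = y \<oplus>\<^bsub>ind v H P E \<sigma>\<^esub> x"
      unfolding ind_simps using K(1) L(1) by (intro restrict_ext E.M.a_comm)
    show "c \<odot>\<^bsub>ind v H P E \<sigma>\<^esub> (x \<oplus>\<^bsub>ind v H P E \<sigma>\<^esub> y) = c \<odot>\<^bsub>ind v H P E \<sigma>\<^esub> x \<oplus>\<^bsub>ind v H P E \<sigma>\<^esub> c \<odot>\<^bsub>ind v H P E \<sigma>\<^esub> y"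
      unfolding ind_simps using K(1) L(1) by (intro restrict_ext) (simp add: E.scale_add_right)
    fix z assume "z \<in> carrier (ind v H P E \<sigma>)"
    then have "\<And>g. g \<in> H \<Longrightarrow> z g \<in> carrier E" by (rule ind_closed)
    then show "x \<oplus>\<^bsub>ind v H P E \<sigma>\<^esub> y \<oplus>\<^bsub>ind v H P E \<sigma>\<^esub> z = x \<oplus>\<^bsub>ind v H P E \<sigma>\<^esub> (y \<oplus>\<^bsub>ind v H P E \<sigma>\<^esub> z)"
      unfolding ind_simps using K(1) L(1) by (intro restrict_ext) (simp add: E.M.a_assoc)
  next
    fix x c d assume x: "x \<in> carrier (ind v H P E \<sigma>)"
    note cl = ind_closed[OF x]
    have "(\<lambda>g\<in>H. \<zero>\<^bsub>E\<^esub> \<oplus>\<^bsub>E\<^esub> x g) = (\<lambda>g\<in>H. x g)" "(\<lambda>g\<in>H. 1 \<odot>\<^bsub>E\<^esub> x g) = (\<lambda>g\<in>H. x g)"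
      using cl by (auto intro!: restrict_ext)
    moreover have "(\<lambda>g\<in>H. (\<lambda>g\<in>H. \<zero>\<^bsub>E\<^esub>) g \<oplus>\<^bsub>E\<^esub> x g) = (\<lambda>g\<in>H. \<zero>\<^bsub>E\<^esub> \<oplus>\<^bsub>E\<^esub> x g)" by (rule restrict_ext) simp
    ultimately show "\<zero>\<^bsub>ind v H P E \<sigma>\<^esub> \<oplus>\<^bsub>ind v H P E \<sigma>\<^esub> x = x" "1 \<odot>\<^bsub>ind v H P E \<sigma>\<^esub> x = x"
      unfolding ind_simps by (simp_all add: ind_ext[OF x])
    show "0 \<odot>\<^bsub>ind v H P E \<sigma>\<^esub> x = \<zero>\<^bsub>ind v H P E \<sigma>\<^esub>"
      unfolding ind_simps using cl by (intro restrict_ext) simp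
    show "(c + d) \<odot>\<^bsub>ind v H P E \<sigma>\<^esub> x = c \<odot>\<^bsub>ind v H P E \<sigma>\<^esub> x \<oplus>\<^bsub>ind v H P E \<sigma>\<^esub> d \<odot>\<^bsub>ind v H P E \<sigma>\<^esub> x"
      unfolding ind_simps using cl by (intro restrict_ext) (simp add: E.scale_add_left)
    show "(c * d) \<odot>\<^bsub>ind v H P E \<sigma>\<^esub> x = c \<odot>\<^bsub>ind v H P E \<sigma>\<^esub> (d \<odot>\<^bsub>ind v H P E \<sigma>\<^esub> x)"
      unfolding ind_simps using cl by (intro restrict_ext) (simp add: E.scale_scale)
  qed
qed

text \<open>
  A function invariant under an open subgroup \<open>K\<close> on the right is carried to one that is invariant under
  the conjugate \<open>n K n\<^sup>-\<^sup>1\<close>, which is open as conjugation is a homeomorphism.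
\<close>

lemma linear_map_ind_conj:
  fixes H :: "('f::field ^ 'n ^ 'n) set"
  assumes v: "nonarch_local_field v" and H: "subgroup H GL" "P \<subseteq> H" "P' \<subseteq> H"
    and n: "invertible n" "conj_by n ` H = H"
    and T: "linear_map E E' T"
    and eq: "\<And>p e. p \<in> P' \<Longrightarrow> e \<in> carrier E \<Longrightarrow> conj_by (matrix_inv n) p \<in> P \<and> T (\<sigma> (conj_by (matrix_inv n) p) e) = \<sigma>' p (T e)"
  shows "linear_map (ind v H P E \<sigma>) (ind v H P' E' \<sigma>') (\<lambda>x. \<lambda>h\<in>H. T (x (conj_by (matrix_inv n) h)))"
proof (rule linear_mapI)
  let ?c = "conj_by (matrix_inv n)"
  have cH: "?c h \<in> H" if "h \<in> H" for h
    using that n(2) in_conj_by_image_iff[OF n(1), of h H] by simp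
  fix x c assume x: "x \<in> carrier (ind v H P E \<sigma>)"
  obtain K where K': "subgroup K GL" "openin (subtopology (mat_top v) H) K"
      "\<And>g k. g \<in> H \<Longrightarrow> k \<in> K \<Longrightarrow> x (g ** k) = x g"
    using ind_smooth[OF x] by blast
  note K = ind_closed[OF x] ind_equivariant[OF x] K'
  show "(\<lambda>h\<in>H. T (x (?c h))) \<in> carrier (ind v H P' E' \<sigma>')"
  proof (rule ind_memI)
    show "subgroup (conj_by n ` K) GL" by (rule subgroup_conj_by[OF n(1) K(3)])
    show o: "openin (subtopology (mat_top v) H) (conj_by n ` K)"
      by (rule openin_subtopology_conj_by[OF v n K(4)])
    show "(\<lambda>h\<in>H. T (x (?c h))) g \<in> carrier E'" if "g \<in> H" for g
      using that K(1) cH linear_mapD(1)[OF T] by simp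
    fix p g assume p: "p \<in> P'" and g: "g \<in> H"
    have "p ** g \<in> H" using p g H by (auto simp: subgroup_GL_iff)
    moreover have "?c (p ** g) = ?c p ** ?c g" by (rule conj_by_mult[OF invertible_matrix_inv[OF n(1)]])
    ultimately show "(\<lambda>h\<in>H. T (x (?c h))) (p ** g) = \<sigma>' p ((\<lambda>h\<in>H. T (x (?c h))) g)"
      using g K(2)[of "?c p" "?c g"] K(1)[of "?c g"] eq[OF p] cH[OF g] by simp
  next
    fix g k assume g: "g \<in> H" and k: "k \<in> conj_by n ` K"
    then obtain k' where k': "k' \<in> K" "k = conj_by n k'" by blast
    have "k' \<in> H" using k'(1) open_subset[OF K(4)] by blast
    then have "k \<in> H" unfolding k'(2) using n(2) by blast
    then have "g ** k \<in> H" using g H(1) by (simp add: subgroup_GL_iff)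
    moreover have "?c (g ** k) = ?c g ** k'"
      by (simp add: conj_by_mult[OF invertible_matrix_inv[OF n(1)]] k'(2) conj_by_cancel[OF n(1)])
    ultimately show "(\<lambda>h\<in>H. T (x (?c h))) (g ** k) = (\<lambda>h\<in>H. T (x (?c h))) g"
      using g K(5)[OF cH[OF g] k'(1)] by simp
  qed simp
  show "(\<lambda>h\<in>H. T ((c \<odot>\<^bsub>ind v H P E \<sigma>\<^esub> x) (?c h))) = c \<odot>\<^bsub>ind v H P' E' \<sigma>'\<^esub> (\<lambda>h\<in>H. T (x (?c h)))"
    unfolding ind_simps using cH K(1) linear_mapD(3)[OF T] by (intro restrict_ext) simp
  fix y assume y: "y \<in> carrier (ind v H P E \<sigma>)"
  show "(\<lambda>h\<in>H. T ((x \<oplus>\<^bsub>ind v H P E \<sigma>\<^esub> y) (?c h))) =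
      (\<lambda>h\<in>H. T (x (?c h))) \<oplus>\<^bsub>ind v H P' E' \<sigma>'\<^esub> (\<lambda>h\<in>H. T (y (?c h)))"
    unfolding ind_simps using cH K(1) ind_closed[OF y] linear_mapD(2)[OF T] by (intro restrict_ext) simp
qed

lemma linear_map_ind:
  fixes H :: "('f::field ^ 'n ^ 'n) set"
  assumes v: "nonarch_local_field v" and H: "subgroup H GL" "P' \<subseteq> P" "P \<subseteq> H"
    and T: "linear_map E E' T"
    and eq: "\<And>p e. p \<in> P' \<Longrightarrow> e \<in> carrier E \<Longrightarrow> T (\<sigma> p e) = \<sigma>' p (T e)"
  shows "linear_map (ind v H P E \<sigma>) (ind v H P' E' \<sigma>') (\<lambda>x. \<lambda>h\<in>H. T (x h))"
proof -
  have c1: "conj_by (matrix_inv (mat 1)) p = p" for p :: "'f ^ 'n ^ 'n"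
    by (simp add: matrix_inv_one conj_by_def)
  then have "conj_by (mat 1) ` H = H" by (simp add: matrix_inv_one)
  then have "linear_map (ind v H P E \<sigma>) (ind v H P' E' \<sigma>') (\<lambda>x. \<lambda>h\<in>H. T (x (conj_by (matrix_inv (mat 1)) h)))"
    using H(2,3) by (intro linear_map_ind_conj[OF v H(1) _ _ invertible_one _ T]) (auto simp: c1 eq)
  then show ?thesis by (simp only: c1)
qed

text \<open>
  Translation by \<open>h\<close> conjugates the open subgroup that fixes a function by \<open>h\<close>.
\<close>

lemma linear_map_right_transl:
  fixes H :: "('f::field ^ 'n ^ 'n) set"
  assumes v: "nonarch_local_field v" and H: "subgroup H GL" "P \<subseteq> H" and h: "h \<in> H"
  shows "linear_map (ind v H P E \<sigma>) (ind v H P E \<sigma>) (right_transl H h)"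
  unfolding right_transl_def
proof (rule linear_mapI)
  have m: "g ** h \<in> H" if "g \<in> H" for g using H(1) h that by (simp add: subgroup_GL_iff)
  have hi: "invertible h" using H(1) h by (simp add: subgroup_GL_iff)
  have sub: "conj_by g ` H \<subseteq> H" if "g \<in> H" for g
    using that H(1) by (auto simp: conj_by_def subgroup_GL_iff)
  have "conj_by h ` conj_by (matrix_inv h) ` H \<subseteq> conj_by h ` H"
    by (intro image_mono sub) (use h H(1) in \<open>simp add: subgroup_GL_iff\<close>)
  then have ch: "conj_by h ` H = H" using sub[OF h] by (simp add: conj_by_image_cancel[OF hi])
  fix x c assume x: "x \<in> carrier (ind v H P E \<sigma>)"
  obtain K where K': "subgroup K GL" "openin (subtopology (mat_top v) H) K"
      "\<And>g k. g \<in> H \<Longrightarrow> k \<in> K \<Longrightarrow> x (g ** k) = x g"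
    using ind_smooth[OF x] by blast
  note K = ind_closed[OF x] ind_equivariant[OF x] K'
  show "(\<lambda>g\<in>H. x (g ** h)) \<in> carrier (ind v H P E \<sigma>)"
  proof (rule ind_memI)
    show "subgroup (conj_by h ` K) GL" by (rule subgroup_conj_by[OF hi K(3)])
    show o: "openin (subtopology (mat_top v) H) (conj_by h ` K)"
      by (rule openin_subtopology_conj_by[OF v hi ch K(4)])
    fix p g assume p: "p \<in> P" and g: "g \<in> H"
    have "p ** g \<in> H" using p g H by (auto simp: subgroup_GL_iff)
    then show "(\<lambda>g\<in>H. x (g ** h)) (p ** g) = \<sigma> p ((\<lambda>g\<in>H. x (g ** h)) g)"
      using g K(2)[OF p m[OF g]] by (simp add: matrix_mul_assoc)
  next
    fix g k assume g: "g \<in> H" and k: "k \<in> conj_by h ` K"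
    then obtain k' where k': "k' \<in> K" "k = conj_by h k'" by blast
    have "k' \<in> H" using k'(1) open_subset[OF K(4)] by blast
    then have "k \<in> H" unfolding k'(2) using ch by blast
    then have "g ** k \<in> H" using g H(1) by (simp add: subgroup_GL_iff)
    moreover have "g ** k ** h = g ** h ** k'"
      unfolding k'(2) conj_by_def by (simp add: matrix_mul_assoc mult_inv_cancel[OF hi])
    ultimately show "(\<lambda>g\<in>H. x (g ** h)) (g ** k) = (\<lambda>g\<in>H. x (g ** h)) g"
      using g K(5)[OF m[OF g] k'(1)] by simp
  qed (use K(1) m in simp_all)
  show "(\<lambda>g\<in>H. (c \<odot>\<^bsub>ind v H P E \<sigma>\<^esub> x) (g ** h)) = c \<odot>\<^bsub>ind v H P E \<sigma>\<^esub> (\<lambda>g\<in>H. x (g ** h))"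
    unfolding ind_simps using m by (intro restrict_ext) simp
  fix y
  show "(\<lambda>g\<in>H. (x \<oplus>\<^bsub>ind v H P E \<sigma>\<^esub> y) (g ** h)) =
      (\<lambda>g\<in>H. x (g ** h)) \<oplus>\<^bsub>ind v H P E \<sigma>\<^esub> (\<lambda>g\<in>H. y (g ** h))"
    unfolding ind_simps using m by (intro restrict_ext) simp
qed

section \<open>The spaces \<open>X\<^sub>J\<close> and the maps between them\<close>

lemma representationD:
  assumes "representation H V \<pi>"
  shows "vspace V" "\<And>g. g \<in> H \<Longrightarrow> linear_map V V (\<pi> g)"
    "\<And>x. x \<in> carrier V \<Longrightarrow> \<pi> (mat 1) x = x"
    "\<And>g h x. g \<in> H \<Longrightarrow> h \<in> H \<Longrightarrow> x \<in> carrier V \<Longrightarrow> \<pi> (g ** h) x = \<pi> g (\<pi> h x)"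
  using assms by (auto simp: representation_def vspace_def)

text \<open>
  A map that carries the operators from \<open>U\<close> to operators from \<open>U'\<close> carries the vectors \<open>u x - x\<close> to
  vectors of the same form.
\<close>

lemma coinv_ker_map:
  assumes V: "vspace V" and W: "vspace W" and f: "linear_map V W f" and U: "\<And>u. u \<in> U \<Longrightarrow> linear_map V V (\<pi> u)"
    and U': "\<And>u'. u' \<in> U' \<Longrightarrow> linear_map W W (\<rho> u')"
    and eq: "\<And>u x. u \<in> U \<Longrightarrow> x \<in> carrier V \<Longrightarrow> \<exists>u'\<in>U'. f (\<pi> u x) = \<rho> u' (f x)"
    and x: "x \<in> coinv_ker V \<pi> U"
  shows "f x \<in> coinv_ker W \<rho> U'"
proof -
  interpret V: vspace V by fact
  interpret W: vspace W by fact
  have Z: "subspace_of (coinv_ker W \<rho> U') W"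
    unfolding coinv_ker_def using linear_mapD(1)[OF U'] by (intro subspace_span_in[OF W]) auto
  show ?thesis
  proof (rule span_in_map[OF V W f _ Z _ x[unfolded coinv_ker_def]])
    show "{\<pi> u x \<ominus>\<^bsub>V\<^esub> x | u x. u \<in> U \<and> x \<in> carrier V} \<subseteq> carrier V"
      using linear_mapD(1)[OF U] by auto
    fix y assume "y \<in> {\<pi> u x \<ominus>\<^bsub>V\<^esub> x | u x. u \<in> U \<and> x \<in> carrier V}"
    then obtain u x where ux: "u \<in> U" "x \<in> carrier V" "y = \<pi> u x \<ominus>\<^bsub>V\<^esub> x" by blast
    obtain u' where u': "u' \<in> U'" "f (\<pi> u x) = \<rho> u' (f x)" using eq[OF ux(1,2)] by blast
    have "f y = \<rho> u' (f x) \<ominus>\<^bsub>W\<^esub> f x"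
      using linear_map_minus[OF V W f linear_mapD(1)[OF U[OF ux(1)] ux(2)] ux(2)] u' ux(3) by simp
    then show "f y \<in> coinv_ker W \<rho> U'"
      unfolding coinv_ker_def using u'(1) linear_mapD(1)[OF f ux(2)] by (intro span_in_superset[THEN subsetD]) blast
  qed
qed

context nonconnected_reductive
begin

context
  fixes V :: "(complex, 'v) module" and \<pi> :: "('f ^ 'n ^ 'n, 'v) action"
  assumes rep: "representation GtF V \<pi>"
begin

lemmas V_vspace = representationD(1)[OF rep]

lemma UJF_GtF: "u \<in> rat_pts (UJ J) \<Longrightarrow> u \<in> GtF"
  using UJF_subset PJF_subset GF_subset by blast

lemma PJF_GtF: "p \<in> rat_pts (PJ J) \<Longrightarrow> p \<in> GtF"
  using PJF_subset GF_subset by blast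

lemma subspace_ker_U: "subspace_of (ker_U V \<pi> J) V"
proof -
  interpret V: vspace V by (rule V_vspace)
  show ?thesis unfolding ker_U_def coinv_ker_def
    using linear_mapD(1)[OF representationD(2)[OF rep UJF_GtF]] by (intro subspace_span_in[OF V_vspace]) auto
qed

lemma ker_U_antimono: assumes "I \<subseteq> J" "x \<in> ker_U V \<pi> J" shows "x \<in> ker_U V \<pi> I"
proof -
  have "{\<pi> u x \<ominus>\<^bsub>V\<^esub> x | u x. u \<in> rat_pts (UJ J) \<and> x \<in> carrier V} \<subseteq> ker_U V \<pi> I"
    using rat_pts_mono[OF UJ_antimono[OF assms(1)]] unfolding ker_U_def coinv_ker_def
    by (intro order_trans[OF _ span_in_superset]) blast
  then have "ker_U V \<pi> J \<subseteq> ker_U V \<pi> I"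
    unfolding ker_U_def[of V \<pi> J] coinv_ker_def by (rule span_in_least[OF subspace_ker_U])
  then show ?thesis using assms(2) by blast
qed

lemma ker_U_conj:
  assumes g: "g \<in> GtF" and c: "\<And>u. u \<in> rat_pts (UJ K) \<Longrightarrow> conj_by g u \<in> rat_pts (UJ J)" and x: "x \<in> ker_U V \<pi> K"
  shows "\<pi> g x \<in> ker_U V \<pi> J"
  unfolding ker_U_def
proof (rule coinv_ker_map[OF V_vspace V_vspace representationD(2)[OF rep g]
      representationD(2)[OF rep UJF_GtF] representationD(2)[OF rep UJF_GtF] _ x[unfolded ker_U_def]])
  fix u x assume u: "u \<in> rat_pts (UJ K)" and x: "x \<in> carrier V"
  have gi: "invertible g" using g subgroup_rat_pts[OF subgroup_Gt] by (simp add: subgroup_GL_iff)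
  have "\<pi> g (\<pi> u x) = \<pi> (g ** u) x" by (rule representationD(4)[OF rep g UJF_GtF[OF u] x, symmetric])
  also have "g ** u = conj_by g u ** g" by (simp add: conj_by_def mult_inv_cancel[OF gi])
  also have "\<pi> (conj_by g u ** g) x = \<pi> (conj_by g u) (\<pi> g x)" by (rule representationD(4)[OF rep UJF_GtF[OF c[OF u]] g x])
  finally show "\<exists>u'\<in>rat_pts (UJ J). \<pi> g (\<pi> u x) = \<pi> u' (\<pi> g x)" using c[OF u] by blast
qed

lemma ker_U_PJ: "p \<in> rat_pts (PJ J) \<Longrightarrow> x \<in> ker_U V \<pi> J \<Longrightarrow> \<pi> p x \<in> ker_U V \<pi> J"
  by (rule ker_U_conj[OF PJF_GtF UJF_normal])

lemma vspace_coinv: "vspace (quot V (ker_U V \<pi> J))"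
  by (rule vspace_quot[OF V_vspace subspace_ker_U])

lemma linear_map_coinv_PJ:
  "p \<in> rat_pts (PJ J) \<Longrightarrow> linear_map (quot V (ker_U V \<pi> J)) (quot V (ker_U V \<pi> J)) (quot_map V (ker_U V \<pi> J) (\<pi> p))"
  by (rule linear_map_quot_map[OF V_vspace subspace_ker_U V_vspace subspace_ker_U representationD(2)[OF rep PJF_GtF] ker_U_PJ])

lemma vspace_XJ: "vspace (XJ V \<pi> J)"
  unfolding XJ_def by (rule vspace_ind[OF local_field subgroup_GF PJF_subset vspace_coinv linear_map_coinv_PJ])

lemma quot_map_PJ_cls:
  "p \<in> rat_pts (PJ J) \<Longrightarrow> x \<in> carrier V \<Longrightarrow>
    quot_map V (ker_U V \<pi> J) (\<pi> p) (cls V (ker_U V \<pi> J) x) = cls V (ker_U V \<pi> J) (\<pi> p x)"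
  by (rule quot_map_cls[OF V_vspace subspace_ker_U V_vspace subspace_ker_U representationD(2)[OF rep PJF_GtF] ker_U_PJ])

lemma linear_map_\<phi>:
  assumes "I \<subseteq> J"
  shows "linear_map (XJ V \<pi> J) (XJ V \<pi> I) (\<phi> V \<pi> I)"
  unfolding XJ_def \<phi>_def
proof (rule linear_map_ind[OF local_field subgroup_GF rat_pts_mono[OF PJ_mono[OF assms]] PJF_subset])
  have id: "linear_map V V id" by (rule linear_mapI) simp_all
  have k: "id x \<in> ker_U V \<pi> I" if "x \<in> ker_U V \<pi> J" for x using ker_U_antimono[OF assms that] by simp
  show "linear_map (quot V (ker_U V \<pi> J)) (quot V (ker_U V \<pi> I)) (quot_map V (ker_U V \<pi> I) id)"
    by (rule linear_map_quot_map[OF V_vspace subspace_ker_U V_vspace subspace_ker_U id k])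
  fix p e assume p: "p \<in> rat_pts (PJ I)" and "e \<in> carrier (quot V (ker_U V \<pi> J))"
  then obtain x where x: "x \<in> carrier V" "e = cls V (ker_U V \<pi> J) x" by (elim quot_cases)
  have p': "p \<in> rat_pts (PJ J)" using p rat_pts_mono[OF PJ_mono[OF assms]] by blast
  have c: "quot_map V (ker_U V \<pi> I) id (cls V (ker_U V \<pi> J) x) = cls V (ker_U V \<pi> I) x" if "x \<in> carrier V" for x
  proof -
    have "quot_map V (ker_U V \<pi> I) id (cls V (ker_U V \<pi> J) x) = cls V (ker_U V \<pi> I) (id x)"
      by (rule quot_map_cls[OF V_vspace subspace_ker_U V_vspace subspace_ker_U id k that])
    then show ?thesis by simp
  qed
  have "\<pi> p x \<in> carrier V" using linear_mapD(1)[OF representationD(2)[OF rep PJF_GtF[OF p]] x(1)] .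
  then show "quot_map V (ker_U V \<pi> I) id (quot_map V (ker_U V \<pi> J) (\<pi> p) e) =
      quot_map V (ker_U V \<pi> I) (\<pi> p) (quot_map V (ker_U V \<pi> I) id e)"
    unfolding x(2) by (simp add: quot_map_PJ_cls p p' c x(1))
qed

lemma linear_map_right_transl_XJ: "h \<in> GF \<Longrightarrow> linear_map (XJ V \<pi> J) (XJ V \<pi> J) (right_transl GF h)"
  unfolding XJ_def by (rule linear_map_right_transl[OF local_field subgroup_GF PJF_subset])

lemma linear_map_Xn:
  assumes n: "n \<in> NF" and J: "J \<subseteq> S"
  shows "linear_map (XJ V \<pi> (perm_preimage n J)) (XJ V \<pi> J) (Xn V \<pi> n J)"
  unfolding XJ_def Xn_def
proof (rule linear_map_ind_conj[OF local_field subgroup_GF PJF_subset PJF_subset NF_simps(2)[OF n]])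
  let ?K = "perm_preimage n J"
  note K = perm_preimage_image[OF n J]
  note r = rat_pts_NF_conj_by[OF n K(1), unfolded K(2)]
  show "conj_by n ` GF = GF" by (rule r(3))
  have "conj_by n u \<in> rat_pts (UJ J)" if "u \<in> rat_pts (UJ ?K)" for u
    unfolding r(2) using that by (rule imageI)
  then have k: "\<pi> n x \<in> ker_U V \<pi> J" if "x \<in> ker_U V \<pi> ?K" for x using ker_U_conj[OF NF_simps(1)[OF n] _ that] by blast
  note l = representationD(2)[OF rep NF_simps(1)[OF n]]
  show "linear_map (quot V (ker_U V \<pi> ?K)) (quot V (ker_U V \<pi> J)) (quot_map V (ker_U V \<pi> J) (\<pi> n))"
    by (rule linear_map_quot_map[OF V_vspace subspace_ker_U V_vspace subspace_ker_U l k])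
  note c = quot_map_cls[OF V_vspace subspace_ker_U V_vspace subspace_ker_U l k]
  fix p e assume p: "p \<in> rat_pts (PJ J)" and "e \<in> carrier (quot V (ker_U V \<pi> ?K))"
  then obtain x where x: "x \<in> carrier V" "e = cls V (ker_U V \<pi> ?K) x" by (elim quot_cases)
  let ?q = "conj_by (matrix_inv n) p"
  have q: "?q \<in> rat_pts (PJ ?K)" using p unfolding r(1) by (simp only: in_conj_by_image_iff[OF NF_simps(2)[OF n]])
  have cl: "\<pi> ?q x \<in> carrier V" "\<pi> n x \<in> carrier V"
    using linear_mapD(1)[OF representationD(2)[OF rep PJF_GtF[OF q]] x(1)] linear_mapD(1)[OF l x(1)] .
  have "n ** ?q = p ** n"
    unfolding conj_by_def using NF_simps(2)[OF n]
    by (simp add: matrix_inv_inv matrix_mul_assoc matrix_inv_both)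
  then have "\<pi> n (\<pi> ?q x) = \<pi> p (\<pi> n x)"
    using representationD(4)[OF rep NF_simps(1)[OF n] PJF_GtF[OF q] x(1)]
      representationD(4)[OF rep PJF_GtF[OF p] NF_simps(1)[OF n] x(1)] by simp
  then show "?q \<in> rat_pts (PJ ?K) \<and> quot_map V (ker_U V \<pi> J) (\<pi> n) (quot_map V (ker_U V \<pi> ?K) (\<pi> ?q) e) =
      quot_map V (ker_U V \<pi> J) (\<pi> p) (quot_map V (ker_U V \<pi> J) (\<pi> n) e)"
    unfolding x(2) using q by (simp add: quot_map_PJ_cls p c x(1) cl)
qed

end

lemma linear_map_Xf:
  assumes rep: "representation GtF V \<pi>" and rep': "representation GtF V' \<pi>'" and f: "rep_hom GtF V \<pi> V' \<pi>' f"
  shows "linear_map (XJ V \<pi> J) (XJ V' \<pi>' J) (Xf V' \<pi>' f J)"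
  unfolding XJ_def Xf_def
proof (rule linear_map_ind[OF local_field subgroup_GF order_refl PJF_subset])
  have lf: "linear_map V V' f" and eq: "\<And>g x. g \<in> GtF \<Longrightarrow> x \<in> carrier V \<Longrightarrow> f (\<pi> g x) = \<pi>' g (f x)"
    using f by (auto simp: rep_hom_def)
  note vs = V_vspace[OF rep] subspace_ker_U[OF rep] V_vspace[OF rep'] subspace_ker_U[OF rep']
  have ex: "\<exists>u'\<in>rat_pts (UJ J). f (\<pi> u x) = \<pi>' u' (f x)" if "u \<in> rat_pts (UJ J)" "x \<in> carrier V" for u x
    using eq[OF UJF_GtF[OF rep that(1)] that(2)] that(1) by blast
  have k: "f x \<in> ker_U V' \<pi>' J" if x: "x \<in> ker_U V \<pi> J" for x
    unfolding ker_U_def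
    by (rule coinv_ker_map[OF V_vspace[OF rep] V_vspace[OF rep'] lf representationD(2)[OF rep UJF_GtF[OF rep]]
          representationD(2)[OF rep' UJF_GtF[OF rep']] ex x[unfolded ker_U_def]])
  show "linear_map (quot V (ker_U V \<pi> J)) (quot V' (ker_U V' \<pi>' J)) (quot_map V' (ker_U V' \<pi>' J) f)"
    by (rule linear_map_quot_map[OF vs lf k])
  fix p e assume p: "p \<in> rat_pts (PJ J)" and "e \<in> carrier (quot V (ker_U V \<pi> J))"
  then obtain x where x: "x \<in> carrier V" "e = cls V (ker_U V \<pi> J) x" by (elim quot_cases)
  have "\<pi> p x \<in> carrier V" using linear_mapD(1)[OF representationD(2)[OF rep PJF_GtF[OF rep p]] x(1)] .
  then show "quot_map V' (ker_U V' \<pi>' J) f (quot_map V (ker_U V \<pi> J) (\<pi> p) e) =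
      quot_map V' (ker_U V' \<pi>' J) (\<pi>' p) (quot_map V' (ker_U V' \<pi>' J) f e)"
    unfolding x(2) using linear_mapD(1)[OF lf x(1)]
    by (simp add: quot_map_PJ_cls[OF rep p] quot_map_PJ_cls[OF rep' p] quot_map_cls[OF vs lf k] x(1)
        eq[OF PJF_GtF[OF rep p]])
qed

end

section \<open>Comparison of the two complexes\<close>

lemma bij_betw_PiE_map:
  assumes "\<And>i. i \<in> I \<Longrightarrow> bij_betw (f i) (A i) (B i)"
  shows "bij_betw (\<lambda>x. \<lambda>i\<in>I. f i (x i)) (\<Pi>\<^sub>E i\<in>I. A i) (\<Pi>\<^sub>E i\<in>I. B i)"
proof (rule bij_betw_byWitness[where f' = "\<lambda>y. \<lambda>i\<in>I. inv_into (A i) (f i) (y i)"])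
  have f: "f i a \<in> B i" "inv_into (A i) (f i) (f i a) = a" if "i \<in> I" "a \<in> A i" for i a
    using bij_betwE[OF assms[OF that(1)]] bij_betw_inv_into_left[OF assms[OF that(1)] that(2)] that(2) by blast+
  have g: "inv_into (A i) (f i) b \<in> A i" "f i (inv_into (A i) (f i) b) = b" if "i \<in> I" "b \<in> B i" for i b
    using bij_betwE[OF bij_betw_inv_into[OF assms[OF that(1)]]] bij_betw_inv_into_right[OF assms[OF that(1)] that(2)] that(2)
    by blast+
  show "\<forall>x\<in>\<Pi>\<^sub>E i\<in>I. A i. (\<lambda>i\<in>I. inv_into (A i) (f i) ((\<lambda>i\<in>I. f i (x i)) i)) = x"
  proof
    fix x assume x: "x \<in> (\<Pi>\<^sub>E i\<in>I. A i)"
    show "(\<lambda>i\<in>I. inv_into (A i) (f i) ((\<lambda>i\<in>I. f i (x i)) i)) = x"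
      by (rule PiE_ext[where k = I and s = A]) (use f PiE_mem[OF x] x in simp_all)
  qed
  show "\<forall>y\<in>\<Pi>\<^sub>E i\<in>I. B i. (\<lambda>i\<in>I. f i ((\<lambda>i\<in>I. inv_into (A i) (f i) (y i)) i)) = y"
  proof
    fix y assume y: "y \<in> (\<Pi>\<^sub>E i\<in>I. B i)"
    show "(\<lambda>i\<in>I. f i ((\<lambda>i\<in>I. inv_into (A i) (f i) (y i)) i)) = y"
      by (rule PiE_ext[where k = I and s = B]) (use g PiE_mem[OF y] y in simp_all)
  qed
  show "(\<lambda>x. \<lambda>i\<in>I. f i (x i)) ` (\<Pi>\<^sub>E i\<in>I. A i) \<subseteq> (\<Pi>\<^sub>E i\<in>I. B i)"
  proof (intro image_subsetI restrict_PiE_iff[THEN iffD2] ballI)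
    fix x i assume "x \<in> (\<Pi>\<^sub>E i\<in>I. A i)" "i \<in> I"
    then show "f i (x i) \<in> B i" using f(1) PiE_mem by metis
  qed
  show "(\<lambda>y. \<lambda>i\<in>I. inv_into (A i) (f i) (y i)) ` (\<Pi>\<^sub>E i\<in>I. B i) \<subseteq> (\<Pi>\<^sub>E i\<in>I. A i)"
  proof (intro image_subsetI restrict_PiE_iff[THEN iffD2] ballI)
    fix y i assume "y \<in> (\<Pi>\<^sub>E i\<in>I. B i)" "i \<in> I"
    then show "inv_into (A i) (f i) (y i) \<in> A i" using g(1) PiE_mem by metis
  qed
qed

text \<open>
  Applied to a coset, a linear map is just the direct image. This makes the image map the induced map
  on quotients, with no choice of representatives.
\<close>

lemma image_cls:
  assumes V: "vspace V" and f: "linear_map V V' f" and W: "subspace_of W V" and x: "x \<in> carrier V"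
  shows "f ` (cls V W x) = cls V' (f ` W) (f x)"
proof -
  have "f (w \<oplus>\<^bsub>V\<^esub> x) = f w \<oplus>\<^bsub>V'\<^esub> f x" if "w \<in> W" for w
    using linear_mapD(2)[OF f _ x] subspaceD(1)[OF V W] that by blast
  then have "f ` (\<Union>w\<in>W. {w \<oplus>\<^bsub>V\<^esub> x}) = (\<Union>w\<in>W. {f w \<oplus>\<^bsub>V'\<^esub> f x})"
    by (simp add: image_UN)
  then show ?thesis by (simp add: a_r_coset_def')
qed

lemma quot_subset:
  assumes "vspace V" "subspace_of W V" "C \<in> carrier (quot V W)"
  shows "C \<subseteq> carrier V" "C \<noteq> {}"
proof -
  from assms(3) obtain x where x: "x \<in> carrier V" "C = cls V W x" by (rule quot_cases)
  show "C \<subseteq> carrier V" unfolding x(2) by (rule subsetI) (simp add: cls_mem[OF assms(1,2) x(1)])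
  have "x \<in> C" unfolding x(2) by (rule cls_self[OF assms(1,2) x(1)])
  then show "C \<noteq> {}" by blast
qed

lemma image_quot_iso:
  assumes V: "vspace V" and V': "vspace V'" and f: "linear_map V V' f" and b: "bij_betw f (carrier V) (carrier V')"
    and W: "subspace_of W V"
  shows "linear_map (quot V W) (quot V' (f ` W)) ((`) f)"
    and "bij_betw ((`) f) (carrier (quot V W)) (carrier (quot V' (f ` W)))"
proof -
  interpret V: vspace V by fact
  have W': "subspace_of (f ` W) V'" by (rule subspace_image[OF V V' f W])
  note cl = linear_mapD(1)[OF f] and ic = image_cls[OF V f W]
  show "linear_map (quot V W) (quot V' (f ` W)) ((`) f)"
  proof (rule linear_mapI)
    fix C c assume "C \<in> carrier (quot V W)"
    then obtain x where x: "x \<in> carrier V" "C = cls V W x" by (rule quot_cases)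
    show "f ` C \<in> carrier (quot V' (f ` W))" using cls_in_quot[OF cl[OF x(1)]] by (simp only: x(2) ic[OF x(1)])
    have cx: "c \<odot>\<^bsub>V\<^esub> x \<in> carrier V" using x(1) by (rule V.scale_closed)
    show "f ` (c \<odot>\<^bsub>quot V W\<^esub> C) = c \<odot>\<^bsub>quot V' (f ` W)\<^esub> f ` C"
      by (simp only: x(2) quot_smult[OF V W x(1)] ic[OF x(1)] ic[OF cx] linear_mapD(3)[OF f x(1)] quot_smult[OF V' W' cl[OF x(1)]])
    fix D assume "D \<in> carrier (quot V W)"
    then obtain y where y: "y \<in> carrier V" "D = cls V W y" by (rule quot_cases)
    have xy: "x \<oplus>\<^bsub>V\<^esub> y \<in> carrier V" using x(1) y(1) by (rule V.M.a_closed)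
    show "f ` (C \<oplus>\<^bsub>quot V W\<^esub> D) = f ` C \<oplus>\<^bsub>quot V' (f ` W)\<^esub> f ` D"
      by (simp only: x(2) y(2) quot_add[OF V W x(1) y(1)] ic[OF x(1)] ic[OF y(1)] ic[OF xy] linear_mapD(2)[OF f x(1) y(1)]
        quot_add[OF V' W' cl[OF x(1)] cl[OF y(1)]])
  qed
  then have 1: "f ` C \<in> carrier (quot V' (f ` W))" if "C \<in> carrier (quot V W)" for C
    using that by (rule linear_mapD(1))
  have 2: "inj_on ((`) f) (carrier (quot V W))"
  proof (rule inj_onI)
    fix C D assume C: "C \<in> carrier (quot V W)" and D: "D \<in> carrier (quot V W)" and eq: "f ` C = f ` D"
    have "inj_on f (carrier V)" using b by (rule bij_betw_imp_inj_on)
    from inj_on_image_eq_iff[OF this quot_subset(1)[OF V W C] quot_subset(1)[OF V W D]] eq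
    show "C = D" by (rule iffD1)
  qed
  have 3: "D \<in> (`) f ` carrier (quot V W)" if D: "D \<in> carrier (quot V' (f ` W))" for D
  proof -
    from D obtain y where y: "y \<in> carrier V'" "D = cls V' (f ` W) y" by (rule quot_cases)
    have "y \<in> f ` carrier V" using y(1) by (simp only: bij_betw_imp_surj_on[OF b])
    then obtain x where x: "x \<in> carrier V" "y = f x" by blast
    show ?thesis unfolding y(2) x(2) ic[OF x(1), symmetric] by (rule imageI[OF cls_in_quot[OF x(1)]])
  qed
  show "bij_betw ((`) f) (carrier (quot V W)) (carrier (quot V' (f ` W)))"
    unfolding bij_betw_def by (intro conjI 2 equalityI image_subsetI 1 subsetI 3)
qed

context nonconnected_reductive
begin

lemma finite_compl: "finite (S - J)"
  by (rule finite_Diff[OF finite_S])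

lemma inj_ord_compl: "inj_on ord (S - J)"
  by (rule inj_on_diff[OF inj_ord])

lemma vspace_\<Lambda>: "vspace (\<Lambda> J)"
  unfolding \<Lambda>_def by (rule vspace_ext[OF vspace_free])

definition top_form where
  "top_form J = wdg (free (S - J)) (card (S - J)) (map delta (sorted_enum ord (S - J)))"

text \<open>
  The vector of \<open>\<Lambda>\<^sub>J\<close> along which \<open>X\<^sub>J\<close> is identified with \<open>Y\<^sub>J\<close>.
\<close>

definition orientation where
  "orientation J = of_int (shuffle_sign ord S J) \<odot>\<^bsub>\<Lambda> J\<^esub> top_form J"

lemma top_form_tuple: "map delta (sorted_enum ord (S - J)) \<in> tuples (free (S - J)) (card (S - J))"
  by (rule basis_tuple[OF finite_compl inj_ord_compl equalityD1[OF sorted_enum(1)[OF finite_compl inj_ord_compl]]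
      length_es[OF finite_compl inj_ord_compl]])

lemma top_form_closed: "top_form J \<in> carrier (\<Lambda> J)"
  unfolding top_form_def \<Lambda>_def by (rule wdg_closed[OF vspace_free top_form_tuple])

lemma orientation_closed: "orientation J \<in> carrier (\<Lambda> J)"
  unfolding orientation_def by (rule vspace.scale_closed[OF vspace_\<Lambda> top_form_closed])

lemma linear_map_ext_wedge_\<Lambda>:
  assumes I: "I \<subseteq> S" and i: "i \<in> S - I"
  shows "linear_map (\<Lambda> (insert i I)) (\<Lambda> I) (ext_wedge (free (S - I)) (card (S - insert i I)) (delta i))"
    and "ws \<in> tuples (free (S - insert i I)) (card (S - insert i I)) \<Longrightarrow>
      ext_wedge (free (S - I)) (card (S - insert i I)) (delta i) (wdg (free (S - insert i I)) (card (S - insert i I)) ws) =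
      wdg (free (S - I)) (card (S - I)) (ws @ [delta i])"
proof -
  have e: "insert i (S - insert i I) = S - I" using i by auto
  have "i \<notin> S - insert i I" by simp
  from card_insert_disjoint[OF finite_compl this] have c: "Suc (card (S - insert i I)) = card (S - I)"
    unfolding e by (rule sym)
  have sub: "carrier (free (S - insert i I)) \<subseteq> carrier (free (S - I))" by (rule subsetI, rule free_mono[of "S - insert i I"]) auto
  have e: "delta i \<in> carrier (free (S - I))" using i by (simp add: delta_in_free)
  show "linear_map (\<Lambda> (insert i I)) (\<Lambda> I) (ext_wedge (free (S - I)) (card (S - insert i I)) (delta i))"
    unfolding \<Lambda>_def c[symmetric] by (rule linear_map_ext_wedge[OF vspace_free vspace_free e sub]) (simp_all add: free_simps)
  show "ws \<in> tuples (free (S - insert i I)) (card (S - insert i I)) \<Longrightarrow>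
      ext_wedge (free (S - I)) (card (S - insert i I)) (delta i) (wdg (free (S - insert i I)) (card (S - insert i I)) ws) =
      wdg (free (S - I)) (card (S - I)) (ws @ [delta i])"
    unfolding c[symmetric] by (rule ext_wedge_wdg[OF vspace_free vspace_free e sub]) (simp_all add: free_simps)
qed

text \<open>
  Appending \<open>e\<^sub>i\<close> and sorting passes the \<open>k > i\<close> outside \<open>I \<union> {i}\<close>, and the change of the shuffle sign
  converts this count into the Borel--Serre sign.
\<close>

lemma ext_wedge_orientation:
  assumes I: "I \<subseteq> S" and i: "i \<in> S - I"
  shows "ext_wedge (free (S - I)) (card (S - insert i I)) (delta i) (orientation (insert i I)) =
    of_int (- \<epsilon> I i) \<odot>\<^bsub>\<Lambda> I\<^esub> orientation I"
proof -
  interpret L: vspace "\<Lambda> I" by (rule vspace_\<Lambda>)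
  let ?J = "insert i I" and ?w = "ext_wedge (free (S - I)) (card (S - insert i I)) (delta i)"
  let ?es = "sorted_enum ord (S - ?J)"
  note es = sorted_enum[OF finite_compl[of ?J] inj_ord_compl[of ?J]]
  have "?w (top_form ?J) = wdg (free (S - I)) (card (S - I)) (map delta (?es @ [i]))"
    unfolding top_form_def using linear_map_ext_wedge_\<Lambda>(2)[OF I i top_form_tuple] by simp
  also have "\<dots> = (- 1) ^ inversions ord (?es @ [i]) \<odot>\<^bsub>\<Lambda> I\<^esub> top_form I"
    unfolding \<Lambda>_def top_form_def
    by (rule wdg_basis_sort[OF finite_compl inj_ord_compl]) (use es i in auto)
  also have "inversions ord (?es @ [i]) = card {k \<in> S - ?J. ord i < ord k}"
    using inversions_snoc[OF es(3,2), of i] es(1) by simp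
  finally have w: "?w (top_form ?J) = (- 1) ^ card {k \<in> S - ?J. ord i < ord k} \<odot>\<^bsub>\<Lambda> I\<^esub> top_form I" .
  have "?w (orientation ?J) = of_int (shuffle_sign ord S ?J) \<odot>\<^bsub>\<Lambda> I\<^esub> ?w (top_form ?J)"
    unfolding orientation_def by (rule linear_mapD(3)[OF linear_map_ext_wedge_\<Lambda>(1)[OF I i] top_form_closed])
  also have "\<dots> = of_int (shuffle_sign ord S ?J * (- 1) ^ card {k \<in> S - ?J. ord i < ord k}) \<odot>\<^bsub>\<Lambda> I\<^esub> top_form I"
    unfolding w by (simp add: L.scale_scale top_form_closed)
  also have "\<dots> = of_int (- \<epsilon> I i * shuffle_sign ord S I) \<odot>\<^bsub>\<Lambda> I\<^esub> top_form I"
    unfolding shuffle_sign_insert[OF finite_S inj_ord i I] \<epsilon>_def ..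
  also have "\<dots> = of_int (- \<epsilon> I i) \<odot>\<^bsub>\<Lambda> I\<^esub> orientation I"
    unfolding orientation_def by (simp add: L.scale_scale top_form_closed)
  finally show ?thesis .
qed

lemma perm_compl:
  assumes n: "n \<in> NF" and J: "J \<subseteq> S"
  shows "perm n ` (S - perm_preimage n J) = S - J" "card (S - perm_preimage n J) = card (S - J)"
proof -
  have e: "S - perm_preimage n J = perm_preimage n (S - J)"
    using perm_S[OF n] by (auto simp: perm_preimage_def)
  have J': "S - J \<subseteq> S" by blast
  show "perm n ` (S - perm_preimage n J) = S - J" "card (S - perm_preimage n J) = card (S - J)"
    unfolding e by (rule perm_preimage_image[OF n J'])+
qed

lemma linear_map_ext_map_\<Lambda>:
  assumes n: "n \<in> NF" and J: "J \<subseteq> S"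
  shows "linear_map (\<Lambda> (perm_preimage n J)) (\<Lambda> J) (ext_map (free (S - J)) (card (S - J)) (push (perm n)))"
    and "ws \<in> tuples (free (S - perm_preimage n J)) (card (S - perm_preimage n J)) \<Longrightarrow>
      ext_map (free (S - J)) (card (S - J)) (push (perm n)) (wdg (free (S - perm_preimage n J)) (card (S - perm_preimage n J)) ws) =
      wdg (free (S - J)) (card (S - J)) (map (push (perm n)) ws)"
proof -
  have p: "linear_map (free (S - perm_preimage n J)) (free (S - J)) (push (perm n))"
    by (rule linear_map_push) (use perm_compl(1)[OF n J] in blast)
  show "linear_map (\<Lambda> (perm_preimage n J)) (\<Lambda> J) (ext_map (free (S - J)) (card (S - J)) (push (perm n)))"
    unfolding \<Lambda>_def perm_compl(2)[OF n J] by (rule linear_map_ext_map[OF vspace_free vspace_free p])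
  show "ws \<in> tuples (free (S - perm_preimage n J)) (card (S - perm_preimage n J)) \<Longrightarrow>
      ext_map (free (S - J)) (card (S - J)) (push (perm n)) (wdg (free (S - perm_preimage n J)) (card (S - perm_preimage n J)) ws) =
      wdg (free (S - J)) (card (S - J)) (map (push (perm n)) ws)"
    unfolding perm_compl(2)[OF n J] by (rule ext_map_wdg[OF vspace_free vspace_free p])
qed

text \<open>
  Sorting the permuted wedge product costs the inversions of \<open>a\<close> within the complement, and the shuffle
  signs convert these into the sign of \<open>a\<close> and the inversions within the set itself.
\<close>

lemma ext_map_orientation:
  assumes n: "n \<in> NF" and J: "J \<subseteq> S"
  shows "ext_map (free (S - J)) (card (S - J)) (push (perm n)) (orientation (perm_preimage n J)) =
    of_int (sign_on S (perm n) * \<epsilon>_perm (perm n) (perm_preimage n J)) \<odot>\<^bsub>\<Lambda> J\<^esub> orientation J"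
proof -
  interpret L: vspace "\<Lambda> J" by (rule vspace_\<Lambda>)
  let ?K = "perm_preimage n J" and ?m = "ext_map (free (S - J)) (card (S - J)) (push (perm n))"
  let ?es = "sorted_enum ord (S - ?K)"
  let ?Inv = "\<lambda>a A. {(i, i'). i \<in> A \<and> i' \<in> A \<and> ord i < ord i' \<and> ord (a i) > ord (a i')}"
  note es = sorted_enum[OF finite_compl[of ?K] inj_ord_compl[of ?K]]
  have K: "?K \<subseteq> S" by (rule perm_preimage_image(1)[OF n J])
  have inj: "inj_on (perm n) (S - ?K)" using bij_betw_imp_inj_on[OF bij_perm[OF n]] by (rule inj_on_subset) blast
  have "?m (top_form ?K) = wdg (free (S - J)) (card (S - J)) (map delta (map (perm n) ?es))"
    unfolding top_form_def linear_map_ext_map_\<Lambda>(2)[OF n J top_form_tuple] by (simp add: o_def)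
  also have "\<dots> = (- 1) ^ inversions ord (map (perm n) ?es) \<odot>\<^bsub>\<Lambda> J\<^esub> top_form J"
    unfolding \<Lambda>_def top_form_def
    by (rule wdg_basis_sort[OF finite_compl inj_ord_compl]) (use es inj perm_compl(1)[OF n J] in \<open>simp_all add: distinct_map\<close>)
  also have "inversions ord (map (perm n) ?es) = card (?Inv (perm n) (S - ?K))"
    using inversions_map[OF es(3), of "perm n"] es inj inj_ord_compl by (simp add: distinct_map)
  finally have m: "?m (top_form ?K) = (- 1) ^ card (?Inv (perm n) (S - ?K)) \<odot>\<^bsub>\<Lambda> J\<^esub> top_form J" .
  \<comment> \<open>The action on all functions is not a permutation of \<open>S\<close> in the strict sense; outside \<open>S\<close> it is replaced
    by the identity.\<close>
  define a where "a = restrict_id (perm n) S"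
  have a: "a permutes S"
    unfolding a_def using bij_perm[OF n] by (intro bij_imp_permutes) (auto simp: restrict_id_def cong: bij_betw_cong)
  have aS: "a i = perm n i" if "i \<in> S" for i using that by (simp add: a_def restrict_id_def)
  have s: "sign_on S (perm n) = sign a" by (simp add: sign_on_def a_def)
  have I: "?Inv a A = ?Inv (perm n) A" if A: "A \<subseteq> S" for A
  proof (rule Set.set_eqI)
    fix x
    show "x \<in> ?Inv a A \<longleftrightarrow> x \<in> ?Inv (perm n) A"
      using aS[OF subsetD[OF A], of "fst x"] aS[OF subsetD[OF A], of "snd x"] by (cases x) auto
  qed
  have "a ` ?K = perm n ` ?K" by (rule image_cong[OF refl]) (use aS K in blast)
  then have aK: "a ` ?K = J" by (simp only: perm_preimage_image(2)[OF n J])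
  have "shuffle_sign ord S ?K * (- 1) ^ card (?Inv a (S - ?K)) = sign a * (- 1) ^ card (?Inv a ?K) * shuffle_sign ord S (a ` ?K)"
    by (rule shuffle_sign_permutation[OF finite_S inj_ord a K])
  then have sg: "shuffle_sign ord S ?K * (- 1) ^ card (?Inv (perm n) (S - ?K)) =
      sign_on S (perm n) * \<epsilon>_perm (perm n) ?K * shuffle_sign ord S J"
    unfolding aK s \<epsilon>_perm_def I[OF K] I[OF Diff_subset] .
  have "?m (orientation ?K) = of_int (shuffle_sign ord S ?K) \<odot>\<^bsub>\<Lambda> J\<^esub> ?m (top_form ?K)"
    unfolding orientation_def by (rule linear_mapD(3)[OF linear_map_ext_map_\<Lambda>(1)[OF n J] top_form_closed])
  also have "\<dots> = of_int (shuffle_sign ord S ?K * (- 1) ^ card (?Inv (perm n) (S - ?K))) \<odot>\<^bsub>\<Lambda> J\<^esub> top_form J"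
    unfolding m by (simp add: L.scale_scale top_form_closed)
  also have "\<dots> = of_int (sign_on S (perm n) * \<epsilon>_perm (perm n) ?K) \<odot>\<^bsub>\<Lambda> J\<^esub> orientation J"
    unfolding sg orientation_def by (simp add: L.scale_scale top_form_closed)
  finally show ?thesis .
qed

text \<open>
  The comparison \<open>X\<^sub>t \<rightarrow> Y\<^sub>t\<close> before passing to cokernels.
\<close>

definition theta where
  "theta V \<pi> t x = (\<lambda>J\<in>subsets t. tens (XJ V \<pi> J) (\<Lambda> J) (x J) (orientation J))"

lemma subsets_insert: "I \<in> subsets t \<Longrightarrow> i \<in> S - I \<Longrightarrow> insert i I \<in> subsets (Suc t)"
  using finite_subset[OF _ finite_S, of I] by (auto simp: subsets_def)

lemma subsets_preimage: "n \<in> NF \<Longrightarrow> J \<in> subsets t \<Longrightarrow> perm_preimage n J \<in> subsets t"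
  using perm_preimage_image by (auto simp: subsets_def)

context
  fixes V :: "(complex, 'v) module" and \<pi> :: "('f ^ 'n ^ 'n, 'v) action"
  assumes rep: "representation GtF V \<pi>"
begin

lemmas XJ_vspace = vspace_XJ[OF rep]

lemma vspace_Xt: "vspace (Xt V \<pi> t)"
  unfolding Xt_def by (rule vspace_dsum[OF XJ_vspace])

lemma vspace_Yt: "vspace (Yt V \<pi> t)"
  unfolding Yt_def YJ_def by (rule vspace_dsum[OF vspace_tensor[OF XJ_vspace vspace_\<Lambda>]])

lemma Xt_component: "x \<in> carrier (Xt V \<pi> t) \<Longrightarrow> J \<in> subsets t \<Longrightarrow> x J \<in> carrier (XJ V \<pi> J)"
  unfolding Xt_def dsum_simps by (rule PiE_mem)

lemma linear_map_tens: "linear_map (XJ V \<pi> J) (YJ V \<pi> J) (\<lambda>x. tens (XJ V \<pi> J) (\<Lambda> J) x (orientation J))"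
  unfolding YJ_def
  by (rule linear_mapI)
     (simp_all add: tens_closed[OF XJ_vspace vspace_\<Lambda>] tens_add[OF XJ_vspace vspace_\<Lambda>] tens_scale[OF XJ_vspace vspace_\<Lambda>] orientation_closed)

lemma linear_map_theta: "linear_map (Xt V \<pi> t) (Yt V \<pi> t) (theta V \<pi> t)"
  unfolding Xt_def Yt_def theta_def[abs_def]
proof (rule linear_map_to_dsum)
  fix J assume J: "J \<in> subsets t"
  show "linear_map (dsum (subsets t) (XJ V \<pi>)) (YJ V \<pi> J) (\<lambda>x. tens (XJ V \<pi> J) (\<Lambda> J) (x J) (orientation J))"
    by (rule linear_map_comp[where f = "\<lambda>x. x J", OF linear_map_dsum_proj[OF J] linear_map_tens])
qed

lemma bij_theta: "bij_betw (theta V \<pi> t) (carrier (Xt V \<pi> t)) (carrier (Yt V \<pi> t))"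
  unfolding Xt_def Yt_def theta_def[abs_def] dsum_simps
proof (rule bij_betw_PiE_map)
  fix J assume "J \<in> subsets t"
  then have J: "J \<subseteq> S" by (simp add: subsets_def)
  have "of_int (shuffle_sign ord S J) \<noteq> (0 :: complex)" using shuffle_sign_neq_0[OF finite_S inj_ord J] by simp
  then show "bij_betw (\<lambda>x. tens (XJ V \<pi> J) (\<Lambda> J) x (orientation J)) (carrier (XJ V \<pi> J)) (carrier (YJ V \<pi> J))"
    unfolding YJ_def \<Lambda>_def orientation_def top_form_def
    by (rule bij_tens_top[OF finite_compl inj_ord_compl XJ_vspace])
qed

lemma linear_map_dX: "linear_map (Xt V \<pi> (Suc t)) (Xt V \<pi> t) (dX V \<pi> t)"
  unfolding Xt_def dX_def[abs_def]
proof (rule linear_map_to_dsum)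
  fix I assume I: "I \<in> subsets t"
  show "linear_map (dsum (subsets (Suc t)) (XJ V \<pi>)) (XJ V \<pi> I)
     (\<lambda>x. \<Oplus>\<^bsub>XJ V \<pi> I\<^esub>j\<in>S - I. of_int (\<epsilon> I j) \<odot>\<^bsub>XJ V \<pi> I\<^esub> \<phi> V \<pi> I (x (insert j I)))"
  proof (rule linear_map_sum[OF vspace_dsum[OF XJ_vspace] XJ_vspace finite_compl])
    fix j assume "j \<in> S - I"
    then have jI: "insert j I \<in> subsets (Suc t)" by (rule subsets_insert[OF I])
    show "linear_map (dsum (subsets (Suc t)) (XJ V \<pi>)) (XJ V \<pi> I)
        (\<lambda>x. of_int (\<epsilon> I j) \<odot>\<^bsub>XJ V \<pi> I\<^esub> \<phi> V \<pi> I (x (insert j I)))"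
      by (rule linear_map_smult[OF XJ_vspace], rule linear_map_comp[where f = "\<lambda>x. x (insert j I)"],
          rule linear_map_dsum_proj[OF jI], rule linear_map_\<phi>[OF rep subset_insertI])
  qed
qed

lemma subspace_imX: "subspace_of (imX V \<pi> t) (Xt V \<pi> t)"
proof -
  interpret vspace "Xt V \<pi> (Suc t)" by (rule vspace_Xt)
  show ?thesis unfolding imX_def by (rule subspace_image[OF vspace_Xt vspace_Xt linear_map_dX carrier_is_submodule])
qed

text \<open>
  Each summand of the differential contributes the factor by which wedging changes the orientations.
  It differs from the Borel--Serre sign by a minus sign common to all summands.
\<close>

lemma dY_theta:
  assumes x: "x \<in> carrier (Xt V \<pi> (Suc t))"
  shows "dY V \<pi> t (theta V \<pi> (Suc t) x) = theta V \<pi> t ((- 1) \<odot>\<^bsub>Xt V \<pi> t\<^esub> dX V \<pi> t x)"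
  unfolding dY_def theta_def[of V \<pi> t]
proof (rule restrict_ext)
  fix I assume I: "I \<in> subsets t"
  then have IS: "I \<subseteq> S" by (simp add: subsets_def)
  let ?X = "XJ V \<pi> I" and ?Y = "YJ V \<pi> I"
  interpret X: vspace ?X by (rule XJ_vspace)
  interpret Y: vspace ?Y unfolding YJ_def by (rule vspace_tensor[OF XJ_vspace vspace_\<Lambda>])
  let ?\<tau> = "\<lambda>x. tens ?X (\<Lambda> I) x (orientation I)"
  let ?p = "\<lambda>i. \<phi> V \<pi> I (x (insert i I))"
  have p: "?p i \<in> carrier ?X" if i: "i \<in> S - I" for i
    by (rule linear_mapD(1)[OF linear_map_\<phi>[OF rep] Xt_component[OF x subsets_insert[OF I i]]]) blast
  have "\<psi> V \<pi> I i (theta V \<pi> (Suc t) x (insert i I)) = ?\<tau> (of_int (- \<epsilon> I i) \<odot>\<^bsub>?X\<^esub> ?p i)"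
    if i: "i \<in> S - I" for i
  proof -
    have "\<psi> V \<pi> I i (theta V \<pi> (Suc t) x (insert i I)) =
        tens ?X (\<Lambda> I) (?p i) (ext_wedge (free (S - I)) (card (S - insert i I)) (delta i) (orientation (insert i I)))"
      unfolding \<psi>_def theta_def restrict_apply'[OF subsets_insert[OF I i]]
      by (rule tensor_map_tens[OF XJ_vspace vspace_\<Lambda> XJ_vspace vspace_\<Lambda> linear_map_\<phi>[OF rep] linear_map_ext_wedge_\<Lambda>(1)[OF IS i]
            Xt_component[OF x subsets_insert[OF I i]] orientation_closed]) blast
    also have "\<dots> = ?\<tau> (of_int (- \<epsilon> I i) \<odot>\<^bsub>?X\<^esub> ?p i)"
      unfolding ext_wedge_orientation[OF IS i]
      by (simp only: tens_scale[OF XJ_vspace vspace_\<Lambda> p[OF i] orientation_closed])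
    finally show ?thesis .
  qed
  then have "(\<Oplus>\<^bsub>?Y\<^esub>i\<in>S - I. \<psi> V \<pi> I i (theta V \<pi> (Suc t) x (insert i I))) =
      (\<Oplus>\<^bsub>?Y\<^esub>i\<in>S - I. ?\<tau> (of_int (- \<epsilon> I i) \<odot>\<^bsub>?X\<^esub> ?p i))"
    using p linear_mapD(1)[OF linear_map_tens] by (intro Y.M.finsum_cong') auto
  also have "\<dots> = ?\<tau> (\<Oplus>\<^bsub>?X\<^esub>i\<in>S - I. of_int (- \<epsilon> I i) \<odot>\<^bsub>?X\<^esub> ?p i)"
    using p by (intro linear_map_finsum[OF XJ_vspace Y.vspace_axioms linear_map_tens finite_compl, symmetric]) simp
  also have "(\<Oplus>\<^bsub>?X\<^esub>i\<in>S - I. of_int (- \<epsilon> I i) \<odot>\<^bsub>?X\<^esub> ?p i) =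
      (\<Oplus>\<^bsub>?X\<^esub>i\<in>S - I. (- 1) \<odot>\<^bsub>?X\<^esub> (of_int (\<epsilon> I i) \<odot>\<^bsub>?X\<^esub> ?p i))"
    using p by (intro X.M.finsum_cong') (auto simp: X.scale_scale)
  also have "\<dots> = (- 1) \<odot>\<^bsub>?X\<^esub> (\<Oplus>\<^bsub>?X\<^esub>i\<in>S - I. of_int (\<epsilon> I i) \<odot>\<^bsub>?X\<^esub> ?p i)"
    using p by (intro X.finsum_smult_ldistr[OF finite_compl, symmetric]) auto
  also have "\<dots> = ((- 1) \<odot>\<^bsub>Xt V \<pi> t\<^esub> dX V \<pi> t x) I"
    using I by (simp add: Xt_def dsum_simps dX_def)
  finally show "(\<Oplus>\<^bsub>?Y\<^esub>i\<in>S - I. \<psi> V \<pi> I i (theta V \<pi> (Suc t) x (insert i I))) =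
      ?\<tau> (((- 1) \<odot>\<^bsub>Xt V \<pi> t\<^esub> dX V \<pi> t x) I)" .
qed

text \<open>
  The differentials correspond up to sign, and a subspace is stable under negation.
\<close>

lemma imY_eq: "imY V \<pi> t = theta V \<pi> t ` imX V \<pi> t"
proof -
  interpret X: vspace "Xt V \<pi> t" by (rule vspace_Xt)
  note im = subspaceD[OF vspace_Xt subspace_imX]
  have "carrier (Yt V \<pi> (Suc t)) = theta V \<pi> (Suc t) ` carrier (Xt V \<pi> (Suc t))"
    using bij_theta by (simp add: bij_betw_def)
  then have "imY V \<pi> t = (\<lambda>x. theta V \<pi> t ((- 1) \<odot>\<^bsub>Xt V \<pi> t\<^esub> dX V \<pi> t x)) ` carrier (Xt V \<pi> (Suc t))"
    unfolding imY_def by (simp add: image_image dY_theta cong: image_cong)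
  also have "\<dots> = theta V \<pi> t ` ((\<lambda>y. (- 1) \<odot>\<^bsub>Xt V \<pi> t\<^esub> y) ` imX V \<pi> t)"
    by (simp add: imX_def image_image)
  also have "(\<lambda>y. (- 1) \<odot>\<^bsub>Xt V \<pi> t\<^esub> y) ` imX V \<pi> t = imX V \<pi> t"
  proof
    show "imX V \<pi> t \<subseteq> (\<lambda>y. (- 1) \<odot>\<^bsub>Xt V \<pi> t\<^esub> y) ` imX V \<pi> t"
    proof
      fix y assume y: "y \<in> imX V \<pi> t"
      then have "y \<in> carrier (Xt V \<pi> t)" using im(1) by blast
      then have "y = (- 1) \<odot>\<^bsub>Xt V \<pi> t\<^esub> ((- 1) \<odot>\<^bsub>Xt V \<pi> t\<^esub> y)" by (simp add: X.scale_scale)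
      then show "y \<in> (\<lambda>y. (- 1) \<odot>\<^bsub>Xt V \<pi> t\<^esub> y) ` imX V \<pi> t" using im(4)[OF y] by (rule image_eqI)
    qed
  qed (use im(4) in blast)
  finally show ?thesis .
qed

lemma actX_closed:
  assumes x: "x \<in> carrier (Xt V \<pi> t)"
  shows "actX V \<pi> t g x \<in> carrier (Xt V \<pi> t)"
proof -
  obtain h n where d: "decomp g = (h, n)" "h \<in> GF" "n \<in> NF" by (rule decomp_cases)
  have "right_transl GF h (c \<odot>\<^bsub>XJ V \<pi> J\<^esub> Xn V \<pi> n J (x (perm_preimage n J))) \<in> carrier (XJ V \<pi> J)"
    if J: "J \<in> subsets t" for J c
  proof -
    interpret X: vspace "XJ V \<pi> J" by (rule XJ_vspace)
    have JS: "J \<subseteq> S" using J by (simp add: subsets_def)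
    have "Xn V \<pi> n J (x (perm_preimage n J)) \<in> carrier (XJ V \<pi> J)"
      by (rule linear_mapD(1)[OF linear_map_Xn[OF rep d(3) JS] Xt_component[OF x subsets_preimage[OF d(3) J]]])
    then show ?thesis by (intro linear_mapD(1)[OF linear_map_right_transl_XJ[OF rep d(2)]]) simp
  qed
  then show ?thesis unfolding actX_def d(1) Xt_def dsum_simps by simp
qed

text \<open>
  Right translation does not touch the factor \<open>\<Lambda>\<^sub>J\<close>, so the whole discrepancy comes from the action of the
  normalizer on orientations.
\<close>

lemma actY_theta:
  assumes x: "x \<in> carrier (Xt V \<pi> t)"
  shows "actY V \<pi> t g (theta V \<pi> t x) = of_int (sgn_char g) \<odot>\<^bsub>Yt V \<pi> t\<^esub> theta V \<pi> t (actX V \<pi> t g x)"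
proof -
  obtain h n where d: "decomp g = (h, n)" "h \<in> GF" "n \<in> NF" by (rule decomp_cases)
  have s: "sgn_char g = sign_on S (perm n)" by (simp add: sgn_char_def d(1))
  show ?thesis
    unfolding actY_def d(1) prod.case Yt_def dsum_simps
  proof (rule restrict_ext)
    fix J assume J: "J \<in> subsets t"
    then have JS: "J \<subseteq> S" by (simp add: subsets_def)
    interpret X: vspace "XJ V \<pi> J" by (rule XJ_vspace)
    interpret Y: vspace "YJ V \<pi> J" unfolding YJ_def by (rule vspace_tensor[OF XJ_vspace vspace_\<Lambda>])
    let ?K = "perm_preimage n J" and ?s = "sign_on S (perm n)"
    let ?e = "\<epsilon>_perm (perm n) ?K"
    let ?T = "tens (XJ V \<pi> J) (\<Lambda> J)"
    have K: "?K \<in> subsets t" by (rule subsets_preimage[OF d(3) J])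
    have xK: "x ?K \<in> carrier (XJ V \<pi> ?K)" by (rule Xt_component[OF x K])
    define y where "y = Xn V \<pi> n J (x ?K)"
    have y: "y \<in> carrier (XJ V \<pi> J)"
      unfolding y_def by (rule linear_mapD(1)[OF linear_map_Xn[OF rep d(3) JS] xK])
    note rt = linear_map_right_transl_XJ[OF rep d(2), of J]
    have ry: "right_transl GF h y \<in> carrier (XJ V \<pi> J)" by (rule linear_mapD(1)[OF rt y])
    have idL: "linear_map (\<Lambda> J) (\<Lambda> J) id" by (rule linear_mapI) simp_all
    have o: "of_int (?s * ?e) \<odot>\<^bsub>\<Lambda> J\<^esub> orientation J \<in> carrier (\<Lambda> J)"
      by (rule vspace.scale_closed[OF vspace_\<Lambda> orientation_closed])
    have "tensor_map (XJ V \<pi> J) (\<Lambda> J) (Xn V \<pi> n J) (ext_map (free (S - J)) (card (S - J)) (push (perm n))) (theta V \<pi> t x ?K) =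
        ?T y (of_int (?s * ?e) \<odot>\<^bsub>\<Lambda> J\<^esub> orientation J)"
      unfolding theta_def restrict_apply'[OF K] y_def ext_map_orientation[OF d(3) JS, symmetric]
      by (rule tensor_map_tens[OF XJ_vspace vspace_\<Lambda> XJ_vspace vspace_\<Lambda> linear_map_Xn[OF rep d(3) JS]
            linear_map_ext_map_\<Lambda>(1)[OF d(3) JS] xK orientation_closed])
    then have "tensor_map (XJ V \<pi> J) (\<Lambda> J) (right_transl GF h) id
        (tensor_map (XJ V \<pi> J) (\<Lambda> J) (Xn V \<pi> n J) (ext_map (free (S - J)) (card (S - J)) (push (perm n))) (theta V \<pi> t x ?K)) =
        ?T (right_transl GF h y) (of_int (?s * ?e) \<odot>\<^bsub>\<Lambda> J\<^esub> orientation J)"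
      using tensor_map_tens[OF XJ_vspace vspace_\<Lambda> XJ_vspace vspace_\<Lambda> rt idL y o] by simp
    also have "\<dots> = of_int (?s * ?e) \<odot>\<^bsub>YJ V \<pi> J\<^esub> ?T (right_transl GF h y) (orientation J)"
      unfolding YJ_def by (rule tens_scale(2)[OF XJ_vspace vspace_\<Lambda> ry orientation_closed])
    also have "\<dots> = of_int ?s \<odot>\<^bsub>YJ V \<pi> J\<^esub> (of_int ?e \<odot>\<^bsub>YJ V \<pi> J\<^esub> ?T (right_transl GF h y) (orientation J))"
      using linear_mapD(1)[OF linear_map_tens ry] by (simp add: Y.scale_scale)
    also have "of_int ?e \<odot>\<^bsub>YJ V \<pi> J\<^esub> ?T (right_transl GF h y) (orientation J) =
        ?T (right_transl GF h (of_int ?e \<odot>\<^bsub>XJ V \<pi> J\<^esub> y)) (orientation J)"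
      unfolding linear_mapD(3)[OF rt y] by (rule linear_mapD(3)[OF linear_map_tens ry, symmetric])
    also have "\<dots> = theta V \<pi> t (actX V \<pi> t g x) J"
      using J by (simp add: theta_def actX_def d(1) y_def)
    finally show "tensor_map (XJ V \<pi> J) (\<Lambda> J) (right_transl GF h) id
        (tensor_map (XJ V \<pi> J) (\<Lambda> J) (Xn V \<pi> n J) (ext_map (free (S - J)) (card (S - J)) (push (perm n))) (theta V \<pi> t x ?K)) =
        of_int (sgn_char g) \<odot>\<^bsub>YJ V \<pi> J\<^esub> theta V \<pi> t (actX V \<pi> t g x) J"
      unfolding s .
  qed
qed

end

lemma mapX_closed:
  assumes rep: "representation GtF V \<pi>" and rep': "representation GtF V' \<pi>'" and f: "rep_hom GtF V \<pi> V' \<pi>' f"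
    and x: "x \<in> carrier (Xt V \<pi> t)"
  shows "mapX V' \<pi>' f t x \<in> carrier (Xt V' \<pi>' t)"
  using linear_mapD(1)[OF linear_map_Xf[OF rep rep' f] Xt_component[OF rep x]]
  unfolding mapX_def Xt_def dsum_simps by simp

lemma mapY_theta:
  assumes rep: "representation GtF V \<pi>" and rep': "representation GtF V' \<pi>'" and f: "rep_hom GtF V \<pi> V' \<pi>' f"
    and x: "x \<in> carrier (Xt V \<pi> t)"
  shows "mapY V' \<pi>' f t (theta V \<pi> t x) = theta V' \<pi>' t (mapX V' \<pi>' f t x)"
  unfolding mapY_def theta_def[of V' \<pi>']
proof (rule restrict_ext)
  fix J assume J: "J \<in> subsets t"
  have idL: "linear_map (\<Lambda> J) (\<Lambda> J) id" by (rule linear_mapI) simp_all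
  show "tensor_map (XJ V' \<pi>' J) (\<Lambda> J) (Xf V' \<pi>' f J) id (theta V \<pi> t x J) =
      tens (XJ V' \<pi>' J) (\<Lambda> J) (mapX V' \<pi>' f t x J) (orientation J)"
    using J tensor_map_tens[OF vspace_XJ[OF rep] vspace_\<Lambda> vspace_XJ[OF rep'] vspace_\<Lambda> linear_map_Xf[OF rep rep' f] idL
        Xt_component[OF rep x J] orientation_closed]
    by (simp add: theta_def mapX_def)
qed

end

section \<open>Functoriality of the components\<close>

lemma sub_mod_simps [simp]:
  "carrier (sub_mod V W) = W" "x \<oplus>\<^bsub>sub_mod V W\<^esub> y = x \<oplus>\<^bsub>V\<^esub> y" "c \<odot>\<^bsub>sub_mod V W\<^esub> x = c \<odot>\<^bsub>V\<^esub> x"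
  "\<zero>\<^bsub>sub_mod V W\<^esub> = \<zero>\<^bsub>V\<^esub>" "sub_mod (sub_mod V W) W' = sub_mod V W'"
  by (simp_all add: sub_mod_def)

lemma vspace_sub_mod: "vspace V \<Longrightarrow> subspace_of W V \<Longrightarrow> vspace (sub_mod V W)"
  unfolding vspace_def sub_mod_def by (rule submodule.submodule_is_module)

lemma subspace_sub_mod:
  assumes V: "vspace V" and W: "subspace_of W V"
  shows "subspace_of Z (sub_mod V W) \<longleftrightarrow> subspace_of Z V \<and> Z \<subseteq> W"
proof
  assume Z: "subspace_of Z (sub_mod V W)"
  note z = subspaceD[OF vspace_sub_mod[OF V W] Z, simplified]
  have ZV: "Z \<subseteq> carrier V" using z(1) subspaceD(1)[OF V W] by (rule order_trans)
  have "subspace_of Z V" by (rule subspaceI[OF V ZV z(2) z(3) z(4)])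
  then show "subspace_of Z V \<and> Z \<subseteq> W" using z(1) by blast
next
  assume Z: "subspace_of Z V \<and> Z \<subseteq> W"
  then have Z': "subspace_of Z V" by blast
  note z = subspaceD[OF V Z']
  show "subspace_of Z (sub_mod V W)"
    by (rule subspaceI[OF vspace_sub_mod[OF V W]]) (use Z z(2-4) in simp_all)
qed

lemma representation_sub_mod:
  assumes rep: "representation H V \<pi>" and W: "subrep H V \<pi> W"
  shows "representation H (sub_mod V W) \<pi>"
proof -
  note V = representationD[OF rep]
  have WV: "subspace_of W V" and st: "\<And>g x. g \<in> H \<Longrightarrow> x \<in> W \<Longrightarrow> \<pi> g x \<in> W"
    using W by (auto simp: subrep_def)
  have sub: "x \<in> carrier V" if "x \<in> W" for x using subspaceD(1)[OF V(1) WV] that by (rule subsetD)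
  have "module CC (sub_mod V W)" using vspace_sub_mod[OF V(1) WV] by (simp add: vspace_def)
  moreover have "linear_map (sub_mod V W) (sub_mod V W) (\<pi> g)" if g: "g \<in> H" for g
    by (rule linear_mapI) (use st[OF g] sub linear_mapD(2,3)[OF V(2)[OF g]] in simp_all)
  ultimately show ?thesis using V(3,4) sub by (simp add: representation_def)
qed

lemma rep_iso_inv:
  assumes V: "vspace V" and W: "vspace W" and \<pi>: "\<And>g. g \<in> H \<Longrightarrow> linear_map V V (\<pi> g)" and f: "rep_iso H V \<pi> W \<rho> f"
  shows "rep_iso H W \<rho> V \<pi> (inv_into (carrier V) f)"
proof -
  interpret V: vspace V by fact
  let ?g = "inv_into (carrier V) f"
  have l: "linear_map V W f" and eq: "\<And>g x. g \<in> H \<Longrightarrow> x \<in> carrier V \<Longrightarrow> f (\<pi> g x) = \<rho> g (f x)"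
    and b: "bij_betw f (carrier V) (carrier W)"
    using f by (auto simp: rep_iso_def rep_hom_def)
  note gc = bij_betwE[OF bij_betw_inv_into[OF b], rule_format] and fg = bij_betw_inv_into_right[OF b]
    and gf = bij_betw_inv_into_left[OF b]
  have "linear_map W V ?g"
  proof (rule linear_mapI)
    fix x y c assume x: "x \<in> carrier W"
    show "?g x \<in> carrier V" by (rule gc[OF x])
    have "c \<odot>\<^bsub>W\<^esub> x = f (c \<odot>\<^bsub>V\<^esub> ?g x)" using linear_mapD(3)[OF l gc[OF x]] fg[OF x] by simp
    then show "?g (c \<odot>\<^bsub>W\<^esub> x) = c \<odot>\<^bsub>V\<^esub> ?g x" using gf[of "c \<odot>\<^bsub>V\<^esub> ?g x"] gc[OF x] by simp
    assume y: "y \<in> carrier W"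
    have "x \<oplus>\<^bsub>W\<^esub> y = f (?g x \<oplus>\<^bsub>V\<^esub> ?g y)" using linear_mapD(2)[OF l gc[OF x] gc[OF y]] fg[OF x] fg[OF y] by simp
    then show "?g (x \<oplus>\<^bsub>W\<^esub> y) = ?g x \<oplus>\<^bsub>V\<^esub> ?g y" using gf[of "?g x \<oplus>\<^bsub>V\<^esub> ?g y"] gc[OF x] gc[OF y] by simp
  qed
  moreover have "?g (\<rho> h x) = \<pi> h (?g x)" if h: "h \<in> H" and x: "x \<in> carrier W" for h x
  proof -
    have "\<rho> h x = f (\<pi> h (?g x))" using eq[OF h gc[OF x]] fg[OF x] by simp
    then show ?thesis using gf[OF linear_mapD(1)[OF \<pi>[OF h] gc[OF x]]] by simp
  qed
  ultimately show ?thesis using bij_betw_inv_into[OF b] by (simp add: rep_iso_def rep_hom_def)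
qed

lemma rep_iso_trans:
  assumes f: "rep_iso H V \<pi> W \<rho> f" and g: "rep_iso H W \<rho> U \<sigma> g"
  shows "rep_iso H V \<pi> U \<sigma> (g \<circ> f)"
proof -
  have lf: "linear_map V W f" and lg: "linear_map W U g" using f g by (simp_all add: rep_iso_def rep_hom_def)
  have "linear_map V U (g \<circ> f)" using linear_map_comp[OF lf lg] by (simp add: o_def)
  moreover have "(g \<circ> f) (\<pi> h x) = \<sigma> h ((g \<circ> f) x)" if "h \<in> H" "x \<in> carrier V" for h x
    using f g that linear_mapD(1)[OF lf that(2)] by (simp add: rep_iso_def rep_hom_def)
  moreover have "bij_betw (g \<circ> f) (carrier V) (carrier U)"
    by (rule bij_betw_trans[of _ _ "carrier W"]) (use f g in \<open>simp_all add: rep_iso_def\<close>)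
  ultimately show ?thesis by (simp add: rep_iso_def rep_hom_def)
qed

lemma irreducible_rep_iso:
  assumes V: "vspace V" and W: "vspace W" and f: "rep_iso H V \<pi> W \<rho> f" and irr: "irreducible_rep H W \<rho>"
  shows "irreducible_rep H V \<pi>"
proof -
  interpret V: vspace V by fact
  have l: "linear_map V W f" and eq: "\<And>g x. g \<in> H \<Longrightarrow> x \<in> carrier V \<Longrightarrow> f (\<pi> g x) = \<rho> g (f x)"
    and b: "bij_betw f (carrier V) (carrier W)"
    using f by (auto simp: rep_iso_def rep_hom_def)
  have inj: "inj_on f (carrier V)" and im: "f ` carrier V = carrier W" using b by (simp_all add: bij_betw_def)
  have f0: "f \<zero>\<^bsub>V\<^esub> = \<zero>\<^bsub>W\<^esub>" by (rule linear_map_zero[OF V W l])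
  have "carrier V \<noteq> {\<zero>\<^bsub>V\<^esub>}"
  proof
    assume "carrier V = {\<zero>\<^bsub>V\<^esub>}"
    then have "f ` carrier V = {\<zero>\<^bsub>W\<^esub>}" by (simp only: image_insert image_empty f0)
    then show False using irr im by (simp add: irreducible_rep_def)
  qed
  moreover have "Z = {\<zero>\<^bsub>V\<^esub>} \<or> Z = carrier V" if Z: "subrep H V \<pi> Z" for Z
  proof -
    have ZV: "subspace_of Z V" and st: "\<And>g x. g \<in> H \<Longrightarrow> x \<in> Z \<Longrightarrow> \<pi> g x \<in> Z" using Z by (auto simp: subrep_def)
    have sub: "Z \<subseteq> carrier V" by (rule subspaceD(1)[OF V ZV])
    have "\<rho> g y \<in> f ` Z" if gy: "g \<in> H" "y \<in> f ` Z" for g y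
    proof -
      obtain x where x: "x \<in> Z" "y = f x" using gy(2) by (rule imageE)
      have "\<rho> g y = f (\<pi> g x)" using eq[OF gy(1) subsetD[OF sub x(1)]] x(2) by simp
      then show ?thesis using st[OF gy(1) x(1)] by (rule image_eqI)
    qed
    then have "subrep H W \<rho> (f ` Z)" using subspace_image[OF V W l ZV] by (simp add: subrep_def)
    then consider "f ` Z = {\<zero>\<^bsub>W\<^esub>}" | "f ` Z = carrier W" using irr by (auto simp: irreducible_rep_def)
    then show ?thesis
    proof cases
      case 1
      then have "f ` Z = f ` {\<zero>\<^bsub>V\<^esub>}" by (simp add: f0)
      then show ?thesis using inj_on_image_eq_iff[OF inj sub, of "{\<zero>\<^bsub>V\<^esub>}"] by simp
    next
      case 2
      then have "f ` Z = f ` carrier V" by (simp add: im)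
      then show ?thesis using inj_on_image_eq_iff[OF inj sub order_refl] by simp
    qed
  qed
  ultimately show ?thesis by (simp add: irreducible_rep_def)
qed

text \<open>
  Pulling back along a surjective morphism embeds the subrepresentations of the target into those of
  the source, compatibly with subquotients. Finite length and the conditions on irreducible
  subquotients pass to the target in this way.
\<close>

context
  fixes U :: "(complex, 'v) module" and U' :: "(complex, 'w) module"
    and H :: "('f::field ^ 'n ^ 'n) set" and \<pi> \<pi>' f
  assumes rep: "representation H U \<pi>" and rep': "representation H U' \<pi>'"
    and hom: "rep_hom H U \<pi> U' \<pi>' f" and surj: "f ` carrier U = carrier U'"
begin

private definition pb where "pb Z = {x \<in> carrier U. f x \<in> Z}"

lemma pb_image: "Z \<subseteq> carrier U' \<Longrightarrow> f ` pb Z = Z"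
  using surj by (auto simp: pb_def)

lemma hom_linear: "linear_map U U' f"
  and hom_eq: "g \<in> H \<Longrightarrow> x \<in> carrier U \<Longrightarrow> f (\<pi> g x) = \<pi>' g (f x)"
  using hom by (simp_all add: rep_hom_def)

lemmas U_vs = representationD(1)[OF rep] and U'_vs = representationD(1)[OF rep']

lemma subrep_pb:
  assumes Z: "subrep H U' \<pi>' Z"
  shows "subrep H U \<pi> (pb Z)"
proof -
  have Z': "subspace_of Z U'" and st: "\<And>g x. g \<in> H \<Longrightarrow> x \<in> Z \<Longrightarrow> \<pi>' g x \<in> Z" using Z by (auto simp: subrep_def)
  have "subspace_of (pb Z) U" unfolding pb_def by (rule subspace_vimage[OF U_vs U'_vs hom_linear Z'])
  moreover have "\<pi> g x \<in> pb Z" if "g \<in> H" "x \<in> pb Z" for g x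
    using that st hom_eq linear_mapD(1)[OF representationD(2)[OF rep]] by (simp add: pb_def)
  ultimately show ?thesis by (simp add: subrep_def)
qed

lemma subrep_subset: "subrep H U' \<pi>' Z \<Longrightarrow> Z \<subseteq> carrier U'"
  unfolding subrep_def using subspaceD(1)[OF U'_vs] by blast

lemma finite_length_image:
  assumes fl: "finite_length H U \<pi>"
  shows "finite_length H U' \<pi>'"
proof -
  obtain N where N: "\<And>\<C>. (\<forall>W\<in>\<C>. subrep H U \<pi> W) \<and> (\<forall>W\<in>\<C>. \<forall>W'\<in>\<C>. W \<subseteq> W' \<or> W' \<subseteq> W) \<Longrightarrow> finite \<C> \<and> card \<C> \<le> N"
    using fl unfolding finite_length_def by blast
  have "finite \<C> \<and> card \<C> \<le> N"
    if c: "\<forall>W\<in>\<C>. subrep H U' \<pi>' W" "\<forall>W\<in>\<C>. \<forall>W'\<in>\<C>. W \<subseteq> W' \<or> W' \<subseteq> W" for \<C>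
  proof -
    have inj: "inj_on pb \<C>"
    proof (rule inj_on_inverseI)
      fix W assume "W \<in> \<C>"
      with c(1) have "subrep H U' \<pi>' W" by (rule bspec)
      then show "f ` pb W = W" by (rule pb_image[OF subrep_subset])
    qed
    have "finite (pb ` \<C>) \<and> card (pb ` \<C>) \<le> N"
    proof (rule N, intro conjI ballI)
      fix W assume "W \<in> pb ` \<C>"
      then obtain Z where Z: "Z \<in> \<C>" "W = pb Z" by blast
      show "subrep H U \<pi> W" unfolding Z(2) by (rule subrep_pb[OF bspec[OF c(1) Z(1)]])
      fix W' assume "W' \<in> pb ` \<C>"
      then obtain Z' where Z': "Z' \<in> \<C>" "W' = pb Z'" by blast
      have "Z \<subseteq> Z' \<or> Z' \<subseteq> Z" using c(2) Z(1) Z'(1) by blast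
      then show "W \<subseteq> W' \<or> W' \<subseteq> W" unfolding Z(2) Z'(2) pb_def by blast
    qed
    then show ?thesis unfolding finite_image_iff[OF inj] card_image[OF inj] .
  qed
  then show ?thesis unfolding finite_length_def by (intro exI[of _ N] allI impI) (elim conjE)
qed

lemma subquotient_pb:
  assumes Z: "subrep H U' \<pi>' Z1" "subrep H U' \<pi>' Z2" "Z1 \<subseteq> Z2"
  shows "rep_iso H (quot (sub_mod U (pb Z2)) (pb Z1)) (\<lambda>g. quot_map (sub_mod U (pb Z2)) (pb Z1) (\<pi> g))
      (quot (sub_mod U' Z2) Z1) (\<lambda>g. quot_map (sub_mod U' Z2) Z1 (\<pi>' g)) (quot_map (sub_mod U' Z2) Z1 f)"
    and "vspace (quot (sub_mod U (pb Z2)) (pb Z1))" "vspace (quot (sub_mod U' Z2) Z1)"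
    and "g \<in> H \<Longrightarrow> linear_map (quot (sub_mod U (pb Z2)) (pb Z1)) (quot (sub_mod U (pb Z2)) (pb Z1))
      (quot_map (sub_mod U (pb Z2)) (pb Z1) (\<pi> g))"
proof -
  have P: "subrep H U \<pi> (pb Z1)" "subrep H U \<pi> (pb Z2)" "pb Z1 \<subseteq> pb Z2"
    using subrep_pb[OF Z(1)] subrep_pb[OF Z(2)] Z(3) by (auto simp: pb_def)
  have sP: "subspace_of (pb Z2) U" "subspace_of Z2 U'" using P(2) Z(2) by (simp_all add: subrep_def)
  let ?A = "sub_mod U (pb Z2)" and ?B = "sub_mod U' Z2"
  have A: "representation H ?A \<pi>" "subspace_of (pb Z1) ?A" and B: "representation H ?B \<pi>'" "subspace_of Z1 ?B"
    using representation_sub_mod[OF rep P(2)] representation_sub_mod[OF rep' Z(2)] P Z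
      subspace_sub_mod[OF U_vs sP(1), of "pb Z1"] subspace_sub_mod[OF U'_vs sP(2), of Z1] by (simp_all add: subrep_def)
  note vA = representationD(1)[OF A(1)] and vB = representationD(1)[OF B(1)]
  interpret vA: vspace ?A by (rule vA)
  have stA: "\<pi> g x \<in> pb Z1" if "g \<in> H" "x \<in> pb Z1" for g x using P(1) that by (simp add: subrep_def)
  have stB: "\<pi>' g x \<in> Z1" if "g \<in> H" "x \<in> Z1" for g x using Z(1) that by (simp add: subrep_def)
  have l: "linear_map ?A ?B f"
    by (rule linear_mapI) (use linear_mapD(2,3)[OF hom_linear] in \<open>simp_all add: pb_def\<close>)
  have fZ: "f x \<in> Z1" if "x \<in> pb Z1" for x using that by (simp add: pb_def)
  show vQ: "vspace (quot ?A (pb Z1))" and vQ': "vspace (quot ?B Z1)"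
    by (rule vspace_quot[OF vA A(2)], rule vspace_quot[OF vB B(2)])
  show lin: "g \<in> H \<Longrightarrow> linear_map (quot ?A (pb Z1)) (quot ?A (pb Z1)) (quot_map ?A (pb Z1) (\<pi> g))" for g
    by (rule linear_map_quot_map[OF vA A(2) vA A(2) representationD(2)[OF A(1)] stA])
  have qf: "quot_map ?B Z1 f (cls ?A (pb Z1) x) = cls ?B Z1 (f x)" if "x \<in> carrier ?A" for x
    by (rule quot_map_cls[OF vA A(2) vB B(2) l fZ that])
  have q\<pi>: "quot_map ?A (pb Z1) (\<pi> g) (cls ?A (pb Z1) x) = cls ?A (pb Z1) (\<pi> g x)" if "g \<in> H" "x \<in> carrier ?A" for g x
    by (rule quot_map_cls[OF vA A(2) vA A(2) representationD(2)[OF A(1) that(1)] stA[OF that(1)] that(2)])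
  have q\<pi>': "quot_map ?B Z1 (\<pi>' g) (cls ?B Z1 x) = cls ?B Z1 (\<pi>' g x)" if "g \<in> H" "x \<in> carrier ?B" for g x
    by (rule quot_map_cls[OF vB B(2) vB B(2) representationD(2)[OF B(1) that(1)] stB[OF that(1)] that(2)])
  have lf: "linear_map (quot ?A (pb Z1)) (quot ?B Z1) (quot_map ?B Z1 f)"
    by (rule linear_map_quot_map[OF vA A(2) vB B(2) l fZ])
  have eq: "quot_map ?B Z1 f (quot_map ?A (pb Z1) (\<pi> g) C) = quot_map ?B Z1 (\<pi>' g) (quot_map ?B Z1 f C)"
    if g: "g \<in> H" and C: "C \<in> carrier (quot ?A (pb Z1))" for g C
  proof -
    from C obtain x where x: "x \<in> carrier ?A" "C = cls ?A (pb Z1) x" by (rule quot_cases)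
    have xU: "x \<in> carrier U" using x(1) by (simp add: pb_def)
    show ?thesis
      unfolding x(2) q\<pi>[OF g x(1)] qf[OF x(1)] q\<pi>'[OF g linear_mapD(1)[OF l x(1)]]
        qf[OF linear_mapD(1)[OF representationD(2)[OF A(1) g] x(1)]] hom_eq[OF g xU] ..
  qed
  have "bij_betw (quot_map ?B Z1 f) (carrier (quot ?A (pb Z1))) (carrier (quot ?B Z1))"
  proof (rule bij_betwI')
    fix C D assume C: "C \<in> carrier (quot ?A (pb Z1))" and D: "D \<in> carrier (quot ?A (pb Z1))"
    from C obtain x where x: "x \<in> carrier ?A" "C = cls ?A (pb Z1) x" by (rule quot_cases)
    from D obtain y where y: "y \<in> carrier ?A" "D = cls ?A (pb Z1) y" by (rule quot_cases)
    have xy: "x \<ominus>\<^bsub>?A\<^esub> y \<in> carrier ?A" using x(1) y(1) by (rule vA.M.minus_closed)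
    have "cls ?B Z1 (f x) = cls ?B Z1 (f y) \<longleftrightarrow> f (x \<ominus>\<^bsub>?A\<^esub> y) \<in> Z1"
      unfolding cls_eq_iff[OF vB B(2) linear_mapD(1)[OF l x(1)] linear_mapD(1)[OF l y(1)]]
        linear_map_minus[OF vA vB l x(1) y(1)] ..
    also have "\<dots> \<longleftrightarrow> x \<ominus>\<^bsub>?A\<^esub> y \<in> pb Z1" using xy by (simp add: pb_def)
    also have "\<dots> \<longleftrightarrow> cls ?A (pb Z1) x = cls ?A (pb Z1) y" by (rule cls_eq_iff[OF vA A(2) x(1) y(1), symmetric])
    finally show "quot_map ?B Z1 f C = quot_map ?B Z1 f D \<longleftrightarrow> C = D" unfolding x(2) y(2) qf[OF x(1)] qf[OF y(1)] .
  next
    fix C assume "C \<in> carrier (quot ?A (pb Z1))"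
    then show "quot_map ?B Z1 f C \<in> carrier (quot ?B Z1)" by (rule linear_mapD(1)[OF lf])
  next
    fix D assume "D \<in> carrier (quot ?B Z1)"
    then obtain y where y: "y \<in> carrier ?B" "D = cls ?B Z1 y" by (rule quot_cases)
    have "y \<in> f ` pb Z2" using y(1) pb_image[OF subrep_subset[OF Z(2)]] by simp
    then obtain x where x: "x \<in> pb Z2" "y = f x" by blast
    then have x': "x \<in> carrier ?A" by simp
    show "\<exists>C\<in>carrier (quot ?A (pb Z1)). D = quot_map ?B Z1 f C"
      by (rule bexI[OF _ cls_in_quot[OF x']]) (simp only: qf[OF x'] y(2) x(2))
  qed
  then show "rep_iso H (quot ?A (pb Z1)) (\<lambda>g. quot_map ?A (pb Z1) (\<pi> g)) (quot ?B Z1) (\<lambda>g. quot_map ?B Z1 (\<pi>' g)) (quot_map ?B Z1 f)"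
    using lf eq by (simp add: rep_iso_def rep_hom_def)
qed

lemma pb_mono: "Z1 \<subseteq> Z2 \<Longrightarrow> pb Z1 \<subseteq> pb Z2"
  by (auto simp: pb_def)

lemma irreducible_subquotient_pullback:
  assumes Z: "subrep H U' \<pi>' Z1" "subrep H U' \<pi>' Z2" "Z1 \<subseteq> Z2"
    and irr: "irreducible_rep H (quot (sub_mod U' Z2) Z1) (\<lambda>g. quot_map (sub_mod U' Z2) Z1 (\<pi>' g))"
  obtains W1 W2 h where "subrep H U \<pi> W1" "subrep H U \<pi> W2" "W1 \<subseteq> W2"
    "irreducible_rep H (quot (sub_mod U W2) W1) (\<lambda>g. quot_map (sub_mod U W2) W1 (\<pi> g))"
    "rep_iso H (quot (sub_mod U' Z2) Z1) (\<lambda>g. quot_map (sub_mod U' Z2) Z1 (\<pi>' g))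
       (quot (sub_mod U W2) W1) (\<lambda>g. quot_map (sub_mod U W2) W1 (\<pi> g)) h"
proof -
  let ?Q = "quot (sub_mod U (pb Z2)) (pb Z1)" and ?\<sigma> = "\<lambda>g. quot_map (sub_mod U (pb Z2)) (pb Z1) (\<pi> g)"
  let ?Q' = "quot (sub_mod U' Z2) Z1" and ?\<sigma>' = "\<lambda>g. quot_map (sub_mod U' Z2) Z1 (\<pi>' g)"
  note q = subquotient_pb[OF Z]
  have irr': "irreducible_rep H ?Q ?\<sigma>" by (rule irreducible_rep_iso[OF q(2,3,1) irr])
  have "rep_iso H ?Q' ?\<sigma>' ?Q ?\<sigma> (inv_into (carrier ?Q) (quot_map (sub_mod U' Z2) Z1 f))"
  proof (rule rep_iso_inv)
    show "linear_map ?Q ?Q (?\<sigma> g)" if "g \<in> H" for g by (rule q(4)[OF that])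
  qed (rule q(2), rule q(3), rule q(1))
  then show thesis
    by (rule that[OF subrep_pb[OF Z(1)] subrep_pb[OF Z(2)] pb_mono[OF Z(3)] irr'])
qed

end

lemma representation_subgroup: "representation H V \<pi> \<Longrightarrow> H' \<subseteq> H \<Longrightarrow> representation H' V \<pi>"
  by (simp add: representation_def subset_iff)

lemma smooth_sub_mod:
  assumes s: "smooth v H V \<pi>" and H': "H' \<subseteq> H" and W: "W \<subseteq> carrier V"
  shows "smooth v H' (sub_mod V W) \<pi>"
  unfolding smooth_def
proof
  fix x assume "x \<in> carrier (sub_mod V W)"
  then have "x \<in> carrier V" using W by auto
  then have "openin (subtopology (mat_top v) H) {g \<in> H. \<pi> g x = x}" using s by (simp add: smooth_def)
  then obtain T where T: "openin (mat_top v) T" "{g \<in> H. \<pi> g x = x} = T \<inter> H" by (auto simp: openin_subtopology)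
  have "{g \<in> H'. \<pi> g x = x} = T \<inter> H'" using T(2) H' by blast
  then show "openin (subtopology (mat_top v) H') {g \<in> H'. \<pi> g x = x}" using T(1) by (auto simp: openin_subtopology)
qed

context nonconnected_reductive
begin

lemma subrep_component:
  assumes rep: "representation GtF V \<pi>"
  shows "subrep GtF V \<pi> (span_in V (\<Union>{W. subrep GtF V \<pi> W \<and> in_Rt t (sub_mod V W) \<pi>}))"
proof -
  note V = representationD[OF rep]
  let ?B = "\<Union>{W. subrep GtF V \<pi> W \<and> in_Rt t (sub_mod V W) \<pi>}"
  have B: "?B \<subseteq> carrier V"
  proof (rule Union_least)
    fix W assume "W \<in> {W. subrep GtF V \<pi> W \<and> in_Rt t (sub_mod V W) \<pi>}"
    then have "subspace_of W V" by (simp add: subrep_def)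
    then show "W \<subseteq> carrier V" by (rule subspaceD(1)[OF V(1)])
  qed
  have S: "subspace_of (span_in V ?B) V" by (rule subspace_span_in[OF V(1) B])
  have "\<pi> g x \<in> span_in V ?B" if g: "g \<in> GtF" and x: "x \<in> span_in V ?B" for g x
  proof (rule span_in_map[OF V(1) V(1) V(2)[OF g] B S _ x])
    fix x assume "x \<in> ?B"
    then obtain W where W: "subrep GtF V \<pi> W" "in_Rt t (sub_mod V W) \<pi>" "x \<in> W" by blast
    then have "\<pi> g x \<in> W" using g by (simp add: subrep_def)
    then have "\<pi> g x \<in> ?B" using W(1,2) by blast
    then show "\<pi> g x \<in> span_in V ?B" by (rule subsetD[OF span_in_superset])
  qed
  then show ?thesis using S by (simp add: subrep_def)
qed

lemma representation_component:
  "representation GtF V \<pi> \<Longrightarrow> representation GtF (component V \<pi> t) \<pi>"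
  unfolding component_def by (rule representation_sub_mod[OF _ subrep_component])

text \<open>
  An irreducible subquotient of the image is one of the source, by pulling back, so it satisfies the
  condition that defines the category.
\<close>

lemma in_Rt_image:
  assumes V: "representation GtF V \<pi>" and V': "fl_smooth_rep v GtF V' \<pi>'" and f: "rep_hom GtF V \<pi> V' \<pi>' f"
    and W: "subrep GtF V \<pi> W" and WR: "in_Rt t (sub_mod V W) \<pi>"
  shows "subrep GtF V' \<pi>' (f ` W)" "in_Rt t (sub_mod V' (f ` W)) \<pi>'"
proof -
  have rep': "representation GtF V' \<pi>'" and sm': "smooth v GtF V' \<pi>'" using V' by (simp_all add: fl_smooth_rep_def)
  note vV = representationD(1)[OF V] and vV' = representationD(1)[OF rep']
  have lf: "linear_map V V' f" and eq: "\<And>g x. g \<in> GtF \<Longrightarrow> x \<in> carrier V \<Longrightarrow> f (\<pi> g x) = \<pi>' g (f x)"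
    using f by (simp_all add: rep_hom_def)
  have sW: "subspace_of W V" and stW: "\<And>g x. g \<in> GtF \<Longrightarrow> x \<in> W \<Longrightarrow> \<pi> g x \<in> W" using W by (auto simp: subrep_def)
  have WV: "W \<subseteq> carrier V" by (rule subspaceD(1)[OF vV sW])
  have sW': "subspace_of (f ` W) V'" by (rule subspace_image[OF vV vV' lf sW])
  have "\<pi>' g y \<in> f ` W" if gy: "g \<in> GtF" "y \<in> f ` W" for g y
  proof -
    obtain x where x: "x \<in> W" "y = f x" using gy(2) by (rule imageE)
    have "\<pi>' g y = f (\<pi> g x)" using eq[OF gy(1) subsetD[OF WV x(1)]] x(2) by simp
    then show ?thesis using stW[OF gy(1) x(1)] by (rule image_eqI)
  qed
  then show s: "subrep GtF V' \<pi>' (f ` W)" using sW' by (simp add: subrep_def)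
  let ?U = "sub_mod V W" and ?U' = "sub_mod V' (f ` W)"
  have U: "representation GtF ?U \<pi>" "representation GtF ?U' \<pi>'"
    by (rule representation_sub_mod[OF V W], rule representation_sub_mod[OF rep' s])
  have hom: "rep_hom GtF ?U \<pi> ?U' \<pi>' f"
    unfolding rep_hom_def
  proof (intro conjI ballI linear_mapI)
    fix g x assume "g \<in> GtF" "x \<in> carrier ?U"
    then show "f (\<pi> g x) = \<pi>' g (f x)" using eq WV by auto
  qed (use linear_mapD(2,3)[OF lf] subsetD[OF WV] in simp_all)
  have UG: "representation GF ?U \<pi>" "representation GF ?U' \<pi>'"
    by (rule representation_subgroup[OF U(1) GF_subset], rule representation_subgroup[OF U(2) GF_subset])
  have homG: "rep_hom GF ?U \<pi> ?U' \<pi>' f" using hom GF_subset by (auto simp: rep_hom_def)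
  have surj: "f ` carrier ?U = carrier ?U'" by simp
  have R: "fl_smooth_rep v GtF ?U \<pi>" "in_RtG t ?U \<pi>" using WR by (simp_all add: in_Rt_def)
  have RG: "fl_smooth_rep v GF ?U \<pi>" using R(2) by (simp add: in_RtG_def)
  have W'V': "f ` W \<subseteq> carrier V'" by (rule subspaceD(1)[OF vV' sW'])
  have "fl_smooth_rep v GtF ?U' \<pi>'"
    using U(2) smooth_sub_mod[OF sm' order_refl W'V'] finite_length_image[OF U hom surj] R(1)
    by (simp add: fl_smooth_rep_def)
  moreover have "fl_smooth_rep v GF ?U' \<pi>'"
    using UG(2) smooth_sub_mod[OF sm' GF_subset W'V'] finite_length_image[OF UG homG surj] RG
    by (simp add: fl_smooth_rep_def)
  moreover have "\<exists>I M (E :: (complex, nat \<Rightarrow> complex) module) \<tau> N1 N2 f.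
           I \<subseteq> S \<and> card I = t \<and> levi (PJ I) M \<and> M0 \<subseteq> M \<and> irreducible_supercuspidal v M E \<tau> \<and>
           subrep GF (parabolic_ind v G (PJ I) M E \<tau>) (right_transl GF) N1 \<and>
           subrep GF (parabolic_ind v G (PJ I) M E \<tau>) (right_transl GF) N2 \<and> N1 \<subseteq> N2 \<and>
           rep_iso GF (quot (sub_mod ?U' W2) W1) (\<lambda>g. quot_map (sub_mod ?U' W2) W1 (\<pi>' g))
             (quot (sub_mod (parabolic_ind v G (PJ I) M E \<tau>) N2) N1)
             (\<lambda>g. quot_map (sub_mod (parabolic_ind v G (PJ I) M E \<tau>) N2) N1 (right_transl GF g)) f"
    if Z: "subrep GF ?U' \<pi>' W1" "subrep GF ?U' \<pi>' W2" "W1 \<subseteq> W2"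
      "irreducible_rep GF (quot (sub_mod ?U' W2) W1) (\<lambda>g. quot_map (sub_mod ?U' W2) W1 (\<pi>' g))" for W1 W2
  proof -
    obtain P1 P2 h where P: "subrep GF ?U \<pi> P1" "subrep GF ?U \<pi> P2" "P1 \<subseteq> P2"
      "irreducible_rep GF (quot (sub_mod ?U P2) P1) (\<lambda>g. quot_map (sub_mod ?U P2) P1 (\<pi> g))"
      and h: "rep_iso GF (quot (sub_mod ?U' W2) W1) (\<lambda>g. quot_map (sub_mod ?U' W2) W1 (\<pi>' g))
       (quot (sub_mod ?U P2) P1) (\<lambda>g. quot_map (sub_mod ?U P2) P1 (\<pi> g)) h"
      by (rule irreducible_subquotient_pullback[OF UG homG surj Z])
    from R(2)[unfolded in_RtG_def, THEN conjunct2, rule_format, OF conjI[OF P(1) conjI[OF P(2) conjI[OF P(3,4)]]]]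
    obtain I M \<tau> N1 N2 f0 and E :: "(complex, nat \<Rightarrow> complex) module" where
      1: "I \<subseteq> S" "card I = t" "levi (PJ I) M" "M0 \<subseteq> M" "irreducible_supercuspidal v M E \<tau>"
           "subrep GF (parabolic_ind v G (PJ I) M E \<tau>) (right_transl GF) N1"
           "subrep GF (parabolic_ind v G (PJ I) M E \<tau>) (right_transl GF) N2" "N1 \<subseteq> N2"
      and 2: "rep_iso GF (quot (sub_mod ?U P2) P1) (\<lambda>g. quot_map (sub_mod ?U P2) P1 (\<pi> g))
             (quot (sub_mod (parabolic_ind v G (PJ I) M E \<tau>) N2) N1)
             (\<lambda>g. quot_map (sub_mod (parabolic_ind v G (PJ I) M E \<tau>) N2) N1 (right_transl GF g)) f0"
      by (elim exE conjE)
    show ?thesis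
      by (rule exI[of _ I], rule exI[of _ M], rule exI[of _ E], rule exI[of _ \<tau>], rule exI[of _ N1], rule exI[of _ N2],
          rule exI[of _ "f0 \<circ> h"]) (intro conjI 1 rep_iso_trans[OF h 2])
  qed
  ultimately show "in_Rt t ?U' \<pi>'" unfolding in_Rt_def in_RtG_def by (intro conjI allI impI) (assumption | elim conjE)+
qed

text \<open>
  The component is spanned by the subrepresentations in the category of index \<open>t\<close>, and their images are
  again such subrepresentations of the target.
\<close>

lemma rep_hom_component:
  assumes V: "representation GtF V \<pi>" and V': "fl_smooth_rep v GtF V' \<pi>'" and f: "rep_hom GtF V \<pi> V' \<pi>' f"
  shows "rep_hom GtF (component V \<pi> t) \<pi> (component V' \<pi>' t) \<pi>' f"
proof -
  have rep': "representation GtF V' \<pi>'" using V' by (simp add: fl_smooth_rep_def)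
  note vV = representationD(1)[OF V] and vV' = representationD(1)[OF rep']
  have lf: "linear_map V V' f" and eq: "\<And>g x. g \<in> GtF \<Longrightarrow> x \<in> carrier V \<Longrightarrow> f (\<pi> g x) = \<pi>' g (f x)"
    using f by (simp_all add: rep_hom_def)
  let ?B = "\<Union>{W. subrep GtF V \<pi> W \<and> in_Rt t (sub_mod V W) \<pi>}"
  let ?B' = "\<Union>{W. subrep GtF V' \<pi>' W \<and> in_Rt t (sub_mod V' W) \<pi>'}"
  have s: "subspace_of (span_in V ?B) V" "subspace_of (span_in V' ?B') V'"
    using subrep_component[OF V, of t] subrep_component[OF rep', of t] by (simp_all add: subrep_def)
  have sub: "span_in V ?B \<subseteq> carrier V" by (rule subspaceD(1)[OF vV s(1)])
  have B: "?B \<subseteq> carrier V" using span_in_superset sub by (rule order_trans)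
  have cl: "f x \<in> span_in V' ?B'" if x: "x \<in> span_in V ?B" for x
  proof (rule span_in_map[OF vV vV' lf B s(2) _ x])
    fix x assume "x \<in> ?B"
    then obtain W where W: "subrep GtF V \<pi> W" "in_Rt t (sub_mod V W) \<pi>" "x \<in> W" by blast
    have "f ` W \<subseteq> ?B'" using in_Rt_image[OF V V' f W(1,2)] by blast
    then have "f x \<in> ?B'" using W(3) by blast
    then show "f x \<in> span_in V' ?B'" by (rule subsetD[OF span_in_superset])
  qed
  show ?thesis
    unfolding rep_hom_def component_def
  proof (intro conjI ballI linear_mapI)
    fix g x assume "g \<in> GtF" "x \<in> carrier (sub_mod V (span_in V ?B))"
    then show "f (\<pi> g x) = \<pi>' g (f x)" using eq sub by auto
  qed (use cl linear_mapD(2,3)[OF lf] subsetD[OF sub] in simp_all)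
qed

section \<open>The isomorphism\<close>

text \<open>
  An element of a cokernel is a coset, which is mapped to its direct image.
\<close>

definition comparison where
  "comparison V \<pi> z = (\<lambda>t\<in>{..r}. theta (component V \<pi> t) \<pi> t ` z t)"

end

lemma image_quot_map:
  assumes V: "vspace V" and f: "linear_map V V' f" and W: "subspace_of W V"
    and a: "\<And>x. x \<in> C \<Longrightarrow> a x \<in> carrier V"
  shows "f ` quot_map V W a C = (\<Union>x\<in>C. cls V' (f ` W) (f (a x)))"
  unfolding quot_map_def image_UN by (rule SUP_cong[OF refl]) (rule image_cls[OF V f W a])

text \<open>
  If \<open>f\<close> intertwines \<open>a\<close> with \<open>b\<close> up to the sign \<open>s\<close>, then so it does on quotients. All maps are unions
  over cosets, so the sign is moved through these unions before they are compared. The sign appears on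
  the other side than in the hypothesis, as \<open>s\<close> is its own inverse.
\<close>

lemma image_quot_map_sign:
  assumes V: "vspace V" and V': "vspace V'" and f: "linear_map V V' f" and W: "subspace_of W V"
    and C: "C \<subseteq> carrier V" and a: "\<And>x. x \<in> carrier V \<Longrightarrow> a x \<in> carrier V"
    and b: "\<And>x. x \<in> carrier V \<Longrightarrow> b (f x) = s \<odot>\<^bsub>V'\<^esub> f (a x)" and s: "s * s = 1"
  shows "f ` quot_map V W a C = s \<odot>\<^bsub>quot V' (f ` W)\<^esub> quot_map V' (f ` W) b (f ` C)"
proof -
  interpret V': vspace V' by fact
  have W': "subspace_of (f ` W) V'" by (rule subspace_image[OF V V' f W])
  have *: "(\<Union>w\<in>cls V' (f ` W) (b (f x)). cls V' (f ` W) (s \<odot>\<^bsub>V'\<^esub> w)) = cls V' (f ` W) (f (a x))" if x: "x \<in> C" for x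
  proof -
    have xV: "x \<in> carrier V" using C x by (rule subsetD)
    have z: "f (a x) \<in> carrier V'" by (rule linear_mapD(1)[OF f a[OF xV]])
    have sz: "s \<odot>\<^bsub>V'\<^esub> f (a x) \<in> carrier V'" using z by simp
    have "s \<odot>\<^bsub>quot V' (f ` W)\<^esub> cls V' (f ` W) (s \<odot>\<^bsub>V'\<^esub> f (a x)) = cls V' (f ` W) (f (a x))"
      unfolding quot_smult[OF V' W' sz] using z s by (simp add: V'.scale_scale)
    then show ?thesis unfolding b[OF xV] by (simp add: quot_def)
  qed
  have "s \<odot>\<^bsub>quot V' (f ` W)\<^esub> quot_map V' (f ` W) b (f ` C) =
      (\<Union>x\<in>C. \<Union>w\<in>cls V' (f ` W) (b (f x)). cls V' (f ` W) (s \<odot>\<^bsub>V'\<^esub> w))"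
    by (simp add: quot_def quot_map_def)
  also have "\<dots> = (\<Union>x\<in>C. cls V' (f ` W) (f (a x)))" by (rule SUP_cong[OF refl *])
  also have "\<dots> = f ` quot_map V W a C" using a C by (intro image_quot_map[OF V f W, symmetric]) blast
  finally show ?thesis by (rule sym)
qed

context nonconnected_reductive
begin

lemma rep_iso_comparison:
  assumes rep: "representation GtF V \<pi>"
  shows "rep_iso GtF (BS V \<pi>) (BS_act V \<pi>) (DA V \<pi>) (twist (DA V \<pi>) (DA_act V \<pi>) sgn_char) (comparison V \<pi>)"
proof -
  let ?V = "component V \<pi>"
  note c = representation_component[OF rep]
  let ?Q = "\<lambda>t. quot (Xt (?V t) \<pi> t) (imX (?V t) \<pi> t)" and ?Q' = "\<lambda>t. quot (Yt (?V t) \<pi> t) (imY (?V t) \<pi> t)"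
  have iso: "linear_map (?Q t) (?Q' t) ((`) (theta (?V t) \<pi> t))"
    "bij_betw ((`) (theta (?V t) \<pi> t)) (carrier (?Q t)) (carrier (?Q' t))" for t
    unfolding imY_eq[OF c]
    by (rule image_quot_iso[OF vspace_Xt[OF c] vspace_Yt[OF c] linear_map_theta[OF c] bij_theta[OF c] subspace_imX[OF c]])+
  have cmp: "comparison V \<pi> = (\<lambda>z. \<lambda>t\<in>{..r}. theta (?V t) \<pi> t ` z t)"
    by (rule ext) (rule comparison_def)
  have l: "linear_map (BS V \<pi>) (DA V \<pi>) (comparison V \<pi>)"
    unfolding BS_def DA_def cmp
  proof (rule linear_map_to_dsum)
    fix t assume t: "t \<in> {..r}"
    show "linear_map (dsum {..r} ?Q) (?Q' t) (\<lambda>z. theta (?V t) \<pi> t ` z t)"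
      by (rule linear_map_comp[where f = "\<lambda>z. z t" and g = "(`) (theta (?V t) \<pi> t)"])
         (rule linear_map_dsum_proj[OF t], rule iso(1))
  qed
  have b: "bij_betw (comparison V \<pi>) (carrier (BS V \<pi>)) (carrier (DA V \<pi>))"
    unfolding BS_def DA_def cmp dsum_simps
    by (rule bij_betw_PiE_map[where f = "\<lambda>t. (`) (theta (?V t) \<pi> t)"]) (rule iso(2))
  have eq: "comparison V \<pi> (BS_act V \<pi> g z) = twist (DA V \<pi>) (DA_act V \<pi>) sgn_char g (comparison V \<pi> z)"
    if z: "z \<in> carrier (BS V \<pi>)" for g z
    unfolding comparison_def[of V \<pi> "BS_act V \<pi> g z"] twist_def DA_def dsum_simps
  proof (rule restrict_ext)
    fix t assume t: "t \<in> {..r}"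
    have C: "z t \<in> carrier (quot (Xt (?V t) \<pi> t) (imX (?V t) \<pi> t))" using z t unfolding BS_def dsum_simps by (rule PiE_mem)
    have "sign p * sign p = 1" for p :: "('f alg_closure ^ 'n ^ 'n \<Rightarrow> 'f alg_closure) \<Rightarrow> _" by (simp add: sign_def)
    then have "sgn_char g * sgn_char g = 1" by (simp add: sgn_char_def sign_on_def)
    then have s: "of_int (sgn_char g) * of_int (sgn_char g) = (1 :: complex)" by (metis of_int_1 of_int_mult)
    have "theta (?V t) \<pi> t ` quot_map (Xt (?V t) \<pi> t) (imX (?V t) \<pi> t) (actX (?V t) \<pi> t g) (z t) =
        of_int (sgn_char g) \<odot>\<^bsub>quot (Yt (?V t) \<pi> t) (imY (?V t) \<pi> t)\<^esub>
        quot_map (Yt (?V t) \<pi> t) (imY (?V t) \<pi> t) (actY (?V t) \<pi> t g) (theta (?V t) \<pi> t ` z t)"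
      unfolding imY_eq[OF c]
    proof (rule image_quot_map_sign[where f = "theta (?V t) \<pi> t" and a = "actX (?V t) \<pi> t g" and b = "actY (?V t) \<pi> t g"
          and V = "Xt (?V t) \<pi> t" and V' = "Yt (?V t) \<pi> t" and W = "imX (?V t) \<pi> t" and s = "of_int (sgn_char g)" and C = "z t"])
      show "vspace (Xt (?V t) \<pi> t)" "vspace (Yt (?V t) \<pi> t)" by (rule vspace_Xt[OF c], rule vspace_Yt[OF c])
      show "linear_map (Xt (?V t) \<pi> t) (Yt (?V t) \<pi> t) (theta (?V t) \<pi> t)" by (rule linear_map_theta[OF c])
      show "subspace_of (imX (?V t) \<pi> t) (Xt (?V t) \<pi> t)" by (rule subspace_imX[OF c])
      show "z t \<subseteq> carrier (Xt (?V t) \<pi> t)" by (rule quot_subset(1)[OF vspace_Xt[OF c] subspace_imX[OF c] C])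
      show "actX (?V t) \<pi> t g x \<in> carrier (Xt (?V t) \<pi> t)" if x: "x \<in> carrier (Xt (?V t) \<pi> t)" for x
        by (rule actX_closed[OF c x])
      show "actY (?V t) \<pi> t g (theta (?V t) \<pi> t x) =
          of_int (sgn_char g) \<odot>\<^bsub>Yt (?V t) \<pi> t\<^esub> theta (?V t) \<pi> t (actX (?V t) \<pi> t g x)"
        if x: "x \<in> carrier (Xt (?V t) \<pi> t)" for x
        by (rule actY_theta[OF c x])
      show "of_int (sgn_char g) * of_int (sgn_char g) = (1 :: complex)" by (rule s)
    qed
    then show "theta (?V t) \<pi> t ` BS_act V \<pi> g z t =
        of_int (sgn_char g) \<odot>\<^bsub>quot (Yt (?V t) \<pi> t) (imY (?V t) \<pi> t)\<^esub> DA_act V \<pi> g (comparison V \<pi> z) t"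
      using t by (simp add: BS_act_def DA_act_def comparison_def)
  qed
  show ?thesis using l b eq by (simp add: rep_iso_def rep_hom_def)
qed

lemma comparison_natural:
  assumes V: "representation GtF V \<pi>" and V': "fl_smooth_rep v GtF V' \<pi>'" and f: "rep_hom GtF V \<pi> V' \<pi>' f"
    and z: "z \<in> carrier (BS V \<pi>)"
  shows "comparison V' \<pi>' (BS_map V' \<pi>' f z) = DA_map V' \<pi>' f (comparison V \<pi> z)"
proof -
  let ?V = "component V \<pi>" and ?V' = "component V' \<pi>'"
  have rep': "representation GtF V' \<pi>'" using V' by (simp add: fl_smooth_rep_def)
  note c = representation_component[OF V] and c' = representation_component[OF rep'] and fc = rep_hom_component[OF V V' f]
  show ?thesis
    unfolding comparison_def[of V'] DA_map_def
  proof (rule restrict_ext)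
    fix t assume t: "t \<in> {..r}"
    have C: "z t \<in> carrier (quot (Xt (?V t) \<pi> t) (imX (?V t) \<pi> t))" using z t unfolding BS_def dsum_simps by (rule PiE_mem)
    note sub = subsetD[OF quot_subset(1)[OF vspace_Xt[OF c] subspace_imX[OF c] C]]
    have "theta (?V' t) \<pi>' t ` quot_map (Xt (?V' t) \<pi>' t) (imX (?V' t) \<pi>' t) (mapX (?V' t) \<pi>' f t) (z t) =
        (\<Union>x\<in>z t. cls (Yt (?V' t) \<pi>' t) (theta (?V' t) \<pi>' t ` imX (?V' t) \<pi>' t) (theta (?V' t) \<pi>' t (mapX (?V' t) \<pi>' f t x)))"
      by (rule image_quot_map[OF vspace_Xt[OF c'] linear_map_theta[OF c'] subspace_imX[OF c'] mapX_closed[OF c c' fc sub]])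
    also have "\<dots> = (\<Union>x\<in>z t. cls (Yt (?V' t) \<pi>' t) (imY (?V' t) \<pi>' t) (mapY (?V' t) \<pi>' f t (theta (?V t) \<pi> t x)))"
      unfolding imY_eq[OF c'] by (rule SUP_cong[OF refl]) (simp only: mapY_theta[OF c c' fc sub])
    also have "\<dots> = quot_map (Yt (?V' t) \<pi>' t) (imY (?V' t) \<pi>' t) (mapY (?V' t) \<pi>' f t) (theta (?V t) \<pi> t ` z t)"
      by (simp add: quot_map_def)
    finally show "theta (?V' t) \<pi>' t ` BS_map V' \<pi>' f z t =
        quot_map (Yt (?V' t) \<pi>' t) (imY (?V' t) \<pi>' t) (mapY (?V' t) \<pi>' f t) (comparison V \<pi> z t)"
      using t by (simp add: BS_map_def comparison_def)
  qed
qed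

end

theorem corollary3p3p2:
  fixes v :: "'f::field \<Rightarrow> real"
    and Gt M0 P0 :: "('f alg_closure ^ 'n ^ 'n) set"
    and ord :: "('f alg_closure ^ 'n ^ 'n \<Rightarrow> 'f alg_closure) \<Rightarrow> nat"
  assumes "nonarch_local_field v"
    and "algebraic_group Gt"
    and "reductive (identity_component Gt)"
    and "minimal_parabolic_pair (identity_component Gt) M0 P0"
    and "bij_betw ord (nonconnected_group.S M0 P0) {1..card (nonconnected_group.S M0 P0)}"
  defines "BS \<equiv> nonconnected_group.BS v Gt M0 P0 ord"
    and "BS_act \<equiv> nonconnected_group.BS_act v Gt M0 P0 ord"
    and "BS_map \<equiv> nonconnected_group.BS_map v Gt M0 P0 ord"
    and "DA \<equiv> nonconnected_group.DA v Gt M0 P0"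
    and "DA_act \<equiv> nonconnected_group.DA_act v Gt M0 P0"
    and "DA_map \<equiv> nonconnected_group.DA_map v Gt M0 P0"
    and "sgn_char \<equiv> nonconnected_group.sgn_char Gt M0 P0"
  shows "\<exists>\<Phi>.
    (\<forall>(V :: (complex, 'v) module) \<pi>. fl_smooth_rep v (rat_pts Gt) V \<pi> \<longrightarrow>
       rep_iso (rat_pts Gt) (BS V \<pi>) (BS_act V \<pi>) (DA V \<pi>) (twist (DA V \<pi>) (DA_act V \<pi>) sgn_char) (\<Phi> V \<pi>)) \<and>
    (\<forall>(V :: (complex, 'v) module) \<pi> (V' :: (complex, 'v) module) \<pi>' f.
       fl_smooth_rep v (rat_pts Gt) V \<pi> \<and> fl_smooth_rep v (rat_pts Gt) V' \<pi>' \<and>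
       rep_hom (rat_pts Gt) V \<pi> V' \<pi>' f \<longrightarrow>
       (\<forall>z \<in> carrier (BS V \<pi>). \<Phi> V' \<pi>' (BS_map V' \<pi>' f z) = DA_map V' \<pi>' f (\<Phi> V \<pi> z)))"
proof -
  \<comment> \<open>The interpretation below introduces facts of the same names.\<close>
  note defs = BS_def BS_act_def BS_map_def DA_def DA_act_def DA_map_def sgn_char_def
  interpret nonconnected_reductive v Gt M0 P0 ord
    using assms(1-5) by (rule nonconnected_reductive.intro)
  have rep: "representation (rat_pts Gt) V \<pi>" if "fl_smooth_rep v (rat_pts Gt) V \<pi>"
    for V :: "(complex, 'v) module" and \<pi> using that by (simp add: fl_smooth_rep_def)
  show ?thesis
    unfolding defs
  proof (rule exI[of _ comparison], intro conjI allI impI ballI, goal_cases)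
    case (1 V \<pi>)
    show ?case by (rule rep_iso_comparison[OF rep[OF 1]])
  next
    case (2 V \<pi> V' \<pi>' f z)
    note * = 2(1)[THEN conjunct1] 2(1)[THEN conjunct2, THEN conjunct1] 2(1)[THEN conjunct2, THEN conjunct2]
    show ?case by (rule comparison_natural[OF rep[OF *(1)] *(2,3) 2(2)])
  qed
qed

end
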